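(* Let $\Omega\subset\mathbb{R}^n$ be a bounded, smooth, uniformly (strictly) convex domain with diameter $d$, let $V:\bar\Omega\to\mathbb{R}$ be a smooth convex function, and let $\tilde V\in C^1([-\tfrac d2,\tfrac d2])$ be an even function satisfying $$\big[\nabla V(y)-\nabla V(x)\big]\cdot\frac{y-x}{|y-x|}\ \ge\ 2\tilde V'\Big(\frac{|y-x|}{2}\Big)\qquad\text{for all }x\neq y\in\Omega.$$ Then $\lambda_2-\lambda_1\ \ge\ \tilde\lambda_2-\tilde\lambda_1$.
   Context: $\lambda_1<\lambda_2$ are the first two Dirichlet eigenvalues of $-\Delta+V$ on $\Omega$ (i.e. of $-\Delta u+Vu=\lambda u$ in $\Omega$, $u=0$ on $\partial\Omega$). $\tilde\lambda_1<\tilde\lambda_2$ are the first two eigenvalues of the one-dimensional problem $-\tilde u''+\tilde V\tilde u=\tilde\lambda\tilde u$ on $(-\tfrac d2,\tfrac d2)$, $\tilde u(\pm\tfrac d2)=0$. *)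

theory Defs
  imports "HOL-Analysis.Analysis"
begin

fun iter_dd :: "'a::real_normed_vector list \<Rightarrow> ('a \<Rightarrow> real) \<Rightarrow> 'a \<Rightarrow> real" where
  "iter_dd [] f = f"
| "iter_dd (v # vs) f = (\<lambda>x. deriv (\<lambda>t. iter_dd vs f (x + t *\<^sub>R v)) 0)"

definition Ck_on :: "nat \<Rightarrow> 'a::real_normed_vector set \<Rightarrow> ('a \<Rightarrow> real) \<Rightarrow> bool" where
  "Ck_on k S f \<longleftrightarrow> open S \<and>
     (\<forall>vs. length vs \<le> k \<longrightarrow> continuous_on S (iter_dd vs f) \<and>
        (length vs < k \<longrightarrow> (\<forall>v. \<forall>x\<in>S. (\<lambda>t. iter_dd vs f (x + t *\<^sub>R v)) differentiable (at 0))))"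

definition C_inf_on :: "'a::real_normed_vector set \<Rightarrow> ('a \<Rightarrow> real) \<Rightarrow> bool" where
  "C_inf_on S f \<longleftrightarrow> (\<forall>k. Ck_on k S f)"

definition smooth_on_closed :: "'a::real_normed_vector set \<Rightarrow> ('a \<Rightarrow> real) \<Rightarrow> bool" where
  "smooth_on_closed K f \<longleftrightarrow> (\<exists>U. open U \<and> K \<subseteq> U \<and> C_inf_on U f)"

definition grad :: "('a::euclidean_space \<Rightarrow> real) \<Rightarrow> 'a \<Rightarrow> 'a" where
  "grad f x = (\<Sum>b\<in>Basis. iter_dd [b] f x *\<^sub>R b)"

definition laplacian :: "('a::euclidean_space \<Rightarrow> real) \<Rightarrow> 'a \<Rightarrow> real" where
  "laplacian u x = (\<Sum>b\<in>Basis. iter_dd [b, b] u x)"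

text \<open>Bounded smooth uniformly (strictly) convex domain: given by a smooth defining function
  rho with nonvanishing gradient on the boundary whose Hessian is positive definite on the
  tangent space at every boundary point (boundary compact, hence uniformly).\<close>
definition smooth_uniformly_convex_domain :: "'a::euclidean_space set \<Rightarrow> bool" where
  "smooth_uniformly_convex_domain \<Omega> \<longleftrightarrow>
     open \<Omega> \<and> bounded \<Omega> \<and> \<Omega> \<noteq> {} \<and> convex \<Omega> \<and>
     (\<exists>\<rho> U. open U \<and> closure \<Omega> \<subseteq> U \<and> C_inf_on U \<rho> \<and>
        \<Omega> = {x\<in>U. \<rho> x < 0} \<and> frontier \<Omega> = {x\<in>U. \<rho> x = 0} \<and>
        (\<forall>x\<in>frontier \<Omega>. grad \<rho> x \<noteq> 0 \<and>
           (\<forall>\<xi>. \<xi> \<noteq> 0 \<and> grad \<rho> x \<bullet> \<xi> = 0 \<longrightarrow> iter_dd [\<xi>, \<xi>] \<rho> x > 0)))"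

definition dirichlet_eigenvalue :: "'a::euclidean_space set \<Rightarrow> ('a \<Rightarrow> real) \<Rightarrow> real \<Rightarrow> bool" where
  "dirichlet_eigenvalue \<Omega> V lam \<longleftrightarrow>
     (\<exists>u. Ck_on 2 \<Omega> u \<and> continuous_on (closure \<Omega>) u \<and>
          (\<forall>x\<in>frontier \<Omega>. u x = 0) \<and> (\<exists>x\<in>\<Omega>. u x \<noteq> 0) \<and>
          (\<forall>x\<in>\<Omega>. - laplacian u x + V x * u x = lam * u x))"

definition first_two_dirichlet_eigenvalues ::
  "'a::euclidean_space set \<Rightarrow> ('a \<Rightarrow> real) \<Rightarrow> real \<Rightarrow> real \<Rightarrow> bool" where
  "first_two_dirichlet_eigenvalues \<Omega> V l1 l2 \<longleftrightarrow>
     dirichlet_eigenvalue \<Omega> V l1 \<and> (\<forall>\<mu>. dirichlet_eigenvalue \<Omega> V \<mu> \<longrightarrow> l1 \<le> \<mu>) \<and>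
     l1 < l2 \<and> dirichlet_eigenvalue \<Omega> V l2 \<and>
     (\<forall>\<mu>. dirichlet_eigenvalue \<Omega> V \<mu> \<and> l1 < \<mu> \<longrightarrow> l2 \<le> \<mu>)"

end

theory Submission
  imports Defs
begin

text \<open>
  The argument follows Andrews and Clutterbuck, with elliptic maximum principles in place of
  parabolic ones. Perturb \<open>V\<close> to \<open>V + \<delta> |x|\<^sup>2\<close>, let \<open>u\<close> be the positive ground state and \<open>f = ln u\<close>.
  Korevaar's argument shows that \<open>f\<close> is concave, and a four-point maximum principle sharpens this to
  \<open>(\<nabla>f(y) - \<nabla>f(x)) \<bullet> (y - x) \<le> 2 (ln \<phi>)'(|y - x|/2) |y - x|\<close>, where \<open>\<phi>\<close> is the even solution of
  the one-dimensional equation at an energy slightly below its first eigenvalue. If \<open>u\<^sub>2\<close> is an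
  eigenfunction for the second eigenvalue, then \<open>v = u\<^sub>2 / u\<close> satisfies
  \<open>\<Delta>v + 2 \<nabla>f \<bullet> \<nabla>v = - \<gamma> v\<close> with \<open>\<gamma>\<close> tending to the gap as \<open>\<delta> \<rightarrow> 0\<close>; comparing \<open>v(y) - v(x)\<close> with
  \<open>C w(|y - x|/2)\<close>, where \<open>w\<close> is a quotient of one-dimensional solutions, bounds \<open>\<gamma>\<close> from below.

  Regularity up to the boundary is never used. Maxima are kept inside by the penalty \<open>\<epsilon> ln u\<close>, and
  \<open>v\<close> is bounded by barriers built from the defining function. The ground state itself is a
  limit of ground states of finite-difference operators, compactness coming from a
  discrete gradient estimate of Brandt.
\<close>

section \<open>Second-order calculus and maxima\<close>

declare iter_dd.simps(2) [simp del]

lemma eventually_on_line: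
  fixes x v :: "'a::real_normed_vector"
  assumes "\<forall>\<^sub>F z in nhds x. P z"
  shows "\<forall>\<^sub>F t in nhds (0::real). P (x + t *\<^sub>R v)"
proof -
  have "((\<lambda>t. x + t *\<^sub>R v) \<longlongrightarrow> x + 0 *\<^sub>R v) (nhds (0::real))"
    by (intro tendsto_intros filterlim_ident)
  then show ?thesis using assms by (auto simp: filterlim_iff)
qed

lemma eventually_on_line_in_open:
  fixes x v :: "'a::real_normed_vector"
  shows "open S \<Longrightarrow> x \<in> S \<Longrightarrow> \<forall>\<^sub>F t in nhds (0::real). x + t *\<^sub>R v \<in> S"
  by (intro eventually_on_line eventually_nhds_in_open)

lemma has_derivative_line:
  fixes u :: "'a::euclidean_space \<Rightarrow> real"
  assumes "(u has_derivative (\<lambda>v. g \<bullet> v)) (at (x + t *\<^sub>R a))"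
  shows "((\<lambda>t. u (x + t *\<^sub>R a)) has_real_derivative g \<bullet> a) (at t)"
proof -
  have "((\<lambda>t. x + t *\<^sub>R a) has_derivative (\<lambda>s. s *\<^sub>R a)) (at t)"
    by (auto intro!: derivative_eq_intros)
  from has_derivative_compose[OF this assms] show ?thesis
    by (simp add: has_field_derivative_def mult_commute_abs)
qed

lemma has_derivative_line_inner:
  fixes g :: "'a::euclidean_space \<Rightarrow> 'a"
  assumes "(g has_derivative H) (at (x + t *\<^sub>R a))"
  shows "((\<lambda>t. g (x + t *\<^sub>R a) \<bullet> w) has_real_derivative H a \<bullet> w) (at t)"
proof -
  have "((\<lambda>t. x + t *\<^sub>R a) has_derivative (\<lambda>s. s *\<^sub>R a)) (at t)"
    by (auto intro!: derivative_eq_intros)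
  from has_derivative_inner_left[OF has_derivative_compose[OF this assms], of w]
  have "((\<lambda>t. g (x + t *\<^sub>R a) \<bullet> w) has_derivative (\<lambda>s. H (s *\<^sub>R a) \<bullet> w)) (at t)" .
  moreover have "(\<lambda>s. H (s *\<^sub>R a) \<bullet> w) = (*) (H a \<bullet> w)"
    using linear_scale[OF has_derivative_linear[OF assms]] by (simp add: fun_eq_iff)
  ultimately show ?thesis by (simp add: has_field_derivative_def)
qed

lemma has_derivative_of_last_partial:
  fixes F :: "'a::real_normed_vector \<times> real \<Rightarrow> real"
  assumes W: "open W" "(x, t) \<in> W" and A: "((\<lambda>v. F (v, t)) has_derivative A) (at x)"
    and partial: "\<And>v s. (v, s) \<in> W \<Longrightarrow> ((\<lambda>s. F (v, s)) has_real_derivative P (v, s)) (at s)"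
    and cont: "isCont P (x, t)"
  shows "(F has_derivative (\<lambda>(v, s). A v + P (x, t) * s)) (at (x, t))"
proof -
  obtain X Y where XY: "open X" "open Y" "(x, t) \<in> X \<times> Y" "X \<times> Y \<subseteq> W"
    using open_prod_elim[OF W] by metis
  obtain r where r: "r > 0" "ball t r \<subseteq> Y" using XY(2,3) open_contains_ball by blast
  have "((\<lambda>(v, s). F (v, s)) has_derivative (\<lambda>(v, s). A v + blinfun_scaleR_right (P (x, t)) s))
    (at (x, t) within X \<times> ball t r)"
  proof (rule has_derivative_partialsI)
    show "((\<lambda>v. F (v, t)) has_derivative A) (at x within X)" by (rule has_derivative_at_withinI[OF A])
    show "((\<lambda>s. F (v, s)) has_derivative blinfun_scaleR_right (P (v, s))) (at s within ball t r)"
      if "v \<in> X" "s \<in> ball t r" for v s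
    proof (rule has_derivative_at_withinI)
      have "(v, s) \<in> W" using that XY(4) r(2) by blast
      from partial[OF this] show "((\<lambda>s. F (v, s)) has_derivative blinfun_scaleR_right (P (v, s))) (at s)"
        by (simp add: has_field_derivative_def real_scaleR_def[abs_def])
    qed
    show "continuous (at (x, t) within X \<times> ball t r) (\<lambda>(v, s). blinfun_scaleR_right (P (v, s)))"
      unfolding split_beta using cont by (auto intro!: continuous_at_imp_continuous_at_within
        bounded_linear.isCont[OF bounded_linear_blinfun_scaleR_right])
  qed (use r in auto)
  moreover have "at (x, t) within X \<times> ball t r = at (x, t)"
    by (rule at_within_open) (use XY(1,3) r(1) in \<open>auto simp: open_Times\<close>)
  ultimately show ?thesis by (simp add: split_beta')
qed

lemma has_derivative_of_continuous_partials:
  fixes f :: "'a::euclidean_space \<Rightarrow> real"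
  assumes S: "open S" "x \<in> S"
    and partial: "\<And>b y. b \<in> Basis \<Longrightarrow> y \<in> S \<Longrightarrow>
      ((\<lambda>t. f (y + t *\<^sub>R b)) has_real_derivative p b y) (at 0)"
    and cont: "\<And>b. b \<in> Basis \<Longrightarrow> isCont (p b) x"
  shows "(f has_derivative (\<lambda>v. \<Sum>b\<in>Basis. p b x * (v \<bullet> b))) (at x)"
proof -
  define P where "P B v = x + (\<Sum>b\<in>B. (v \<bullet> b) *\<^sub>R b)" for B v
  have "((\<lambda>v. f (P B v)) has_derivative (\<lambda>v. \<Sum>b\<in>B. p b x * (v \<bullet> b))) (at 0)"
    if "B \<subseteq> Basis" for B
    using finite_subset[OF that finite_Basis] that
  proof (induction B rule: finite_induct)
    case empty
    show ?case by (simp add: P_def)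
  next
    case (insert a B)
    then have a: "a \<in> Basis" by simp
    define Q where "Q z = P B (fst z) + snd z *\<^sub>R a" for z :: "'a \<times> real"
    have continuous_Q: "continuous_on UNIV Q" unfolding Q_def P_def by (intro continuous_intros)
    have Q_at_0: "Q (0, 0) = x" by (simp add: Q_def P_def)
    define D where "D = (\<lambda>(v, t). (\<Sum>b\<in>B. p b x * (v \<bullet> b)) + p a (Q (0, 0)) * t)"
    have "((\<lambda>z. f (Q z)) has_derivative D) (at (0, 0))"
      unfolding D_def
    proof (rule has_derivative_of_last_partial)
      show "open (Q -` S)" "(0, 0) \<in> Q -` S"
        using open_vimage[OF S(1) continuous_Q] S(2) by (simp_all add: Q_at_0)
      show "((\<lambda>v. f (Q (v, 0))) has_derivative (\<lambda>v. \<Sum>b\<in>B. p b x * (v \<bullet> b))) (at 0)"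
        using insert by (simp add: Q_def)
      show "((\<lambda>s. f (Q (v, s))) has_real_derivative p a (Q (v, t))) (at t)" if "(v, t) \<in> Q -` S" for v t
        using partial[OF a, of "Q (v, t)"] that DERIV_shift[of "\<lambda>s. f (Q (v, s))" "p a (Q (v, t))" 0 t]
        by (simp add: Q_def algebra_simps)
      have "isCont Q (0, 0)" using continuous_Q by (simp add: continuous_on_eq_continuous_at)
      then show "isCont (\<lambda>z. p a (Q z)) (0, 0)" by (rule isCont_o2) (simp add: Q_at_0 cont[OF a])
    qed
    moreover have "((\<lambda>v. (v, v \<bullet> a)) has_derivative (\<lambda>v. (v, v \<bullet> a))) (at 0)"
      by (auto intro!: derivative_eq_intros)
    ultimately have "((\<lambda>v. f (Q (v, v \<bullet> a))) has_derivative (\<lambda>v. D (v, v \<bullet> a))) (at 0)"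
      using has_derivative_compose[of "\<lambda>v. (v, v \<bullet> a)" _ 0 UNIV "\<lambda>z. f (Q z)" D] by simp
    then show ?case
      using insert.hyps by (simp add: Q_at_0 D_def) (simp add: Q_def P_def algebra_simps)
  qed
  from this[of Basis] have "((\<lambda>v. f (x + v)) has_derivative (\<lambda>v. \<Sum>b\<in>Basis. p b x * (v \<bullet> b))) (at 0)"
    by (simp add: P_def euclidean_representation)
  then show ?thesis by (simp add: has_derivative_at)
qed

definition has_hessian_on ::
  "'a::euclidean_space set \<Rightarrow> ('a \<Rightarrow> real) \<Rightarrow> ('a \<Rightarrow> 'a) \<Rightarrow> ('a \<Rightarrow> 'a \<Rightarrow> 'a) \<Rightarrow> bool" where
  "has_hessian_on S u g H \<longleftrightarrow>
    (\<forall>x\<in>S. (u has_derivative (\<lambda>v. g x \<bullet> v)) (at x) \<and> (g has_derivative H x) (at x))"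

definition hess :: "('a::euclidean_space \<Rightarrow> real) \<Rightarrow> 'a \<Rightarrow> 'a \<Rightarrow> 'a" where
  "hess u x v = (\<Sum>b\<in>Basis. iter_dd [v, b] u x *\<^sub>R b)"

definition trace_op :: "('a::euclidean_space \<Rightarrow> 'a) \<Rightarrow> real" where
  "trace_op A = (\<Sum>b\<in>Basis. A b \<bullet> b)"

lemma has_hessian_onD:
  assumes "has_hessian_on S u g H" "x \<in> S"
  shows "(u has_derivative (\<lambda>v. g x \<bullet> v)) (at x)" "(g has_derivative H x) (at x)"
    "linear (H x)"
  using assms by (auto simp: has_hessian_on_def intro: has_derivative_linear)

lemma has_hessian_on_continuous_on:
  assumes "has_hessian_on S u g H"
  shows "continuous_on S u" "continuous_on S g"
  using assms by (auto simp: has_hessian_on_def intro!: continuous_at_imp_continuous_on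
    intro: has_derivative_continuous)

lemma has_hessian_on_subset:
  "has_hessian_on S u g H \<Longrightarrow> T \<subseteq> S \<Longrightarrow> has_hessian_on T u g H"
  by (auto simp: has_hessian_on_def)

context
  fixes S :: "'a::euclidean_space set" and u g H
  assumes S: "open S" and hessian: "has_hessian_on S u g H"
begin

lemma has_derivative_iter_dd_has_hessian_on:
  assumes x: "x \<in> S"
  shows "((\<lambda>t. u (x + t *\<^sub>R v)) has_real_derivative g x \<bullet> v) (at 0)"
    and "((\<lambda>t. iter_dd [w] u (x + t *\<^sub>R v)) has_real_derivative H x v \<bullet> w) (at 0)"
proof -
  have first: "((\<lambda>t. u (y + t *\<^sub>R w)) has_real_derivative g y \<bullet> w) (at 0)" if "y \<in> S" for y w
    using has_derivative_line[of u "g y" y 0 w] has_hessian_onD(1)[OF hessian that] by simp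
  show "((\<lambda>t. u (x + t *\<^sub>R v)) has_real_derivative g x \<bullet> v) (at 0)" by (rule first[OF x])
  have "\<forall>\<^sub>F t in nhds 0. iter_dd [w] u (x + t *\<^sub>R v) = g (x + t *\<^sub>R v) \<bullet> w"
    using eventually_on_line_in_open[OF S x, of v]
    by eventually_elim (simp add: iter_dd.simps(2) DERIV_imp_deriv[OF first])
  moreover have "((\<lambda>t. g (x + t *\<^sub>R v) \<bullet> w) has_real_derivative H x v \<bullet> w) (at 0)"
    using has_derivative_line_inner[of g "H x" x 0 v w] has_hessian_onD(2)[OF hessian x] by simp
  ultimately show "((\<lambda>t. iter_dd [w] u (x + t *\<^sub>R v)) has_real_derivative H x v \<bullet> w) (at 0)"
    by (rule DERIV_cong_ev[OF refl _ refl, THEN iffD2])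
qed

lemma iter_dd_has_hessian_on:
  assumes "x \<in> S"
  shows "iter_dd [v] u x = g x \<bullet> v" "iter_dd [v, w] u x = H x v \<bullet> w"
  using DERIV_imp_deriv[OF has_derivative_iter_dd_has_hessian_on(1)[OF assms]]
    DERIV_imp_deriv[OF has_derivative_iter_dd_has_hessian_on(2)[OF assms]] by (simp_all add: iter_dd.simps(2))

lemma laplacian_has_hessian_on: "x \<in> S \<Longrightarrow> laplacian u x = trace_op (H x)"
  by (simp add: laplacian_def trace_op_def iter_dd_has_hessian_on)

lemma Ck2_of_has_hessian_on:
  assumes cont: "\<And>b c. continuous_on S (\<lambda>x. H x b \<bullet> c)"
  shows "Ck_on 2 S u"
  unfolding Ck_on_def
proof (intro conjI allI impI ballI)
  show "open S" by (rule S)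
  fix vs :: "'a list"
  assume "length vs \<le> 2"
  then consider "vs = []" | v where "vs = [v]" | v w where "vs = [v, w]"
    by (cases vs; cases "tl vs") auto
  then show "continuous_on S (iter_dd vs u)"
  proof cases
    case 1
    then show ?thesis using has_hessian_on_continuous_on(1)[OF hessian] by (simp only: iter_dd.simps)
  next
    case (2 v)
    have "continuous_on S (\<lambda>x. g x \<bullet> v)"
      by (intro continuous_intros has_hessian_on_continuous_on(2)[OF hessian])
    then show ?thesis unfolding 2
      by (rule continuous_on_eq) (simp add: iter_dd_has_hessian_on)
  next
    case (3 v w)
    show ?thesis unfolding 3
      by (rule continuous_on_eq[OF cont[of v w]]) (simp add: iter_dd_has_hessian_on)
  qed
  fix v x
  assume "length vs < 2" and x: "x \<in> S"
  then consider "vs = []" | w where "vs = [w]"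
    by (cases vs; cases "tl vs") auto
  then show "(\<lambda>t. iter_dd vs u (x + t *\<^sub>R v)) differentiable (at 0)"
  proof cases
    case 1
    then show ?thesis
      using has_derivative_iter_dd_has_hessian_on(1)[OF x, of v] by (auto simp: real_differentiable_def)
  next
    case (2 w)
    show ?thesis
      using has_derivative_iter_dd_has_hessian_on(2)[OF x, of w v]
      unfolding 2 real_differentiable_def by blast
  qed
qed

end

lemma Ck2_has_derivative_iter_dd:
  assumes Ck2: "Ck_on 2 S u" and vs: "length vs < 2" and x: "x \<in> S"
  shows "(iter_dd vs u has_derivative (\<lambda>v. \<Sum>b\<in>Basis. iter_dd (b # vs) u x * (v \<bullet> b))) (at x)"
proof (rule has_derivative_of_continuous_partials)
  show "open S" "x \<in> S" using Ck2 x by (simp_all add: Ck_on_def)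
  show "isCont (iter_dd (b # vs) u) x" for b
  proof -
    have "length (b # vs) \<le> 2" using vs by simp
    then have "continuous_on S (iter_dd (b # vs) u)" using Ck2 unfolding Ck_on_def by blast
    then show ?thesis using \<open>open S\<close> x by (simp only: continuous_on_eq_continuous_at)
  qed
  show "((\<lambda>t. iter_dd vs u (y + t *\<^sub>R b)) has_real_derivative iter_dd (b # vs) u y) (at 0)"
    if "y \<in> S" for b y
    using Ck2 vs that by (simp add: Ck_on_def iter_dd.simps(2) DERIV_deriv_iff_real_differentiable)
qed

lemma inner_sum_scaleR_left: "(\<bullet>) (\<Sum>b\<in>B. c b *\<^sub>R b) = (\<lambda>v. \<Sum>b\<in>B. c b * (v \<bullet> b))"
  unfolding inner_sum_left by (intro ext sum.cong refl) (simp add: inner_commute)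

lemma Ck2_has_hessian_on:
  assumes Ck2: "Ck_on 2 S u"
  shows "has_hessian_on S u (grad u) (hess u)"
proof -
  note deriv = Ck2_has_derivative_iter_dd[OF Ck2]
  have linear: "iter_dd [v, b] u x = (\<Sum>c\<in>Basis. iter_dd [c, b] u x * (v \<bullet> c))"
    if "x \<in> S" for v b x
  proof -
    have "(iter_dd [b] u has_derivative (\<bullet>) (\<Sum>c\<in>Basis. iter_dd [c, b] u x *\<^sub>R c)) (at (x + 0 *\<^sub>R v))"
      using deriv[of "[b]" x] that by (simp add: inner_sum_scaleR_left)
    from DERIV_imp_deriv[OF has_derivative_line[OF this]] show ?thesis
      unfolding iter_dd.simps(2)[of v] inner_sum_scaleR_left .
  qed
  show ?thesis
    unfolding has_hessian_on_def
  proof (intro ballI conjI)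
    fix x
    assume x: "x \<in> S"
    show "(u has_derivative (\<lambda>v. grad u x \<bullet> v)) (at x)"
      using deriv[of "[]" x] x unfolding grad_def inner_sum_scaleR_left iter_dd.simps(1) by simp
    have hess: "hess u x = (\<lambda>v. \<Sum>b\<in>Basis. (\<Sum>c\<in>Basis. iter_dd [c, b] u x * (v \<bullet> c)) *\<^sub>R b)"
      unfolding hess_def by (intro ext sum.cong refl arg_cong2[where f = "(*\<^sub>R)"] linear x)
    show "(grad u has_derivative hess u x) (at x)"
      unfolding hess grad_def
      by (intro has_derivative_sum has_derivative_scaleR_left deriv) (use x in auto)
  qed
qed

lemma Ck2_continuous_on_hess:
  assumes "Ck_on 2 S u"
  shows "continuous_on S (\<lambda>x. hess u x b \<bullet> c)"
proof (rule continuous_on_eq)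
  have "length [b, c] \<le> 2" by simp
  then show "continuous_on S (iter_dd [b, c] u)" using assms unfolding Ck_on_def by blast
  show "iter_dd [b, c] u x = hess u x b \<bullet> c" if "x \<in> S" for x
    using assms iter_dd_has_hessian_on(2)[OF _ Ck2_has_hessian_on[OF assms] that]
    by (simp add: Ck_on_def)
qed

definition jet2 :: "(real \<Rightarrow> real) \<Rightarrow> real \<Rightarrow> real \<Rightarrow> bool" where
  "jet2 F a c \<longleftrightarrow> (\<exists>F'. (\<forall>\<^sub>F t in nhds 0. (F has_real_derivative F' t) (at t)) \<and> F' 0 = a \<and>
    (F' has_real_derivative c) (at 0))"

lemma jet2_add:
  assumes "jet2 F a c" "jet2 G b d"
  shows "jet2 (\<lambda>t. F t + G t) (a + b) (c + d)"
proof -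
  from assms obtain F' G' where
    "\<forall>\<^sub>F t in nhds 0. (F has_real_derivative F' t) (at t)" "F' 0 = a" "(F' has_real_derivative c) (at 0)"
    "\<forall>\<^sub>F t in nhds 0. (G has_real_derivative G' t) (at t)" "G' 0 = b" "(G' has_real_derivative d) (at 0)"
    unfolding jet2_def by blast
  then show ?thesis unfolding jet2_def
    by (intro exI[of _ "\<lambda>t. F' t + G' t"]) (auto intro!: derivative_eq_intros elim: eventually_elim2)
qed

lemma jet2_cmult:
  assumes "jet2 F a c"
  shows "jet2 (\<lambda>t. k * F t) (k * a) (k * c)"
proof -
  from assms obtain F' where "\<forall>\<^sub>F t in nhds 0. (F has_real_derivative F' t) (at t)" "F' 0 = a"
    "(F' has_real_derivative c) (at 0)" unfolding jet2_def by blast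
  then show ?thesis unfolding jet2_def
    by (intro exI[of _ "\<lambda>t. k * F' t"]) (auto intro!: derivative_eq_intros elim: eventually_mono)
qed

lemma jet2_minus: "jet2 F a c \<Longrightarrow> jet2 (\<lambda>t. - F t) (- a) (- c)"
  using jet2_cmult[of F a c "-1"] by simp

lemma jet2_diff:
  assumes "jet2 F a c" "jet2 G b d"
  shows "jet2 (\<lambda>t. F t - G t) (a - b) (c - d)"
  using jet2_add[OF assms(1) jet2_minus[OF assms(2)]] by simp

lemma jet2_shift:
  assumes I: "open I" "s \<in> I" and F: "\<And>t. t \<in> I \<Longrightarrow> (F has_real_derivative F' t) (at t)"
    and F': "(F' has_real_derivative c) (at s)"
  shows "jet2 (\<lambda>t. F (s + t)) (F' s) c"
  unfolding jet2_def
proof (intro exI[of _ "\<lambda>t. F' (s + t)"] conjI)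
  show "\<forall>\<^sub>F t in nhds 0. ((\<lambda>t. F (s + t)) has_real_derivative F' (s + t)) (at t)"
    using eventually_on_line_in_open[OF I, of 1]
  proof eventually_elim
    case (elim t)
    then have "(F has_real_derivative F' (t + s)) (at (t + s))" using F by (simp add: add.commute)
    then show ?case unfolding DERIV_shift add.commute[of s] .
  qed
  show "((\<lambda>t. F' (s + t)) has_real_derivative c) (at 0)"
    using F' DERIV_shift[of F' c 0 s] by (simp add: add.commute)
qed simp

lemma jet2_line:
  fixes u :: "'a::euclidean_space \<Rightarrow> real"
  assumes hessian: "has_hessian_on S u g H" and S: "open S" "x \<in> S"
  shows "jet2 (\<lambda>t. u (x + t *\<^sub>R v)) (g x \<bullet> v) (H x v \<bullet> v)"
  unfolding jet2_def
proof (intro exI[of _ "\<lambda>t. g (x + t *\<^sub>R v) \<bullet> v"] conjI)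
  show "\<forall>\<^sub>F t in nhds 0. ((\<lambda>t. u (x + t *\<^sub>R v)) has_real_derivative g (x + t *\<^sub>R v) \<bullet> v) (at t)"
    using eventually_on_line_in_open[OF S]
    by eventually_elim (intro has_derivative_line has_hessian_onD(1)[OF hessian])
  show "((\<lambda>t. g (x + t *\<^sub>R v) \<bullet> v) has_real_derivative H x v \<bullet> v) (at 0)"
    using has_derivative_line_inner[of g "H x" x 0 v v] has_hessian_onD(2)[OF hessian S(2)] by simp
qed simp

lemma jet2_local_max:
  assumes jet: "jet2 F a c" and max: "\<forall>\<^sub>F t in nhds 0. F t \<le> F 0"
  shows "a = 0" "c \<le> 0"
proof -
  obtain F' where F': "\<forall>\<^sub>F t in nhds 0. (F has_real_derivative F' t) (at t)" "F' 0 = a"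
    "(F' has_real_derivative c) (at 0)"
    using jet unfolding jet2_def by blast
  obtain r where r: "r > 0" "\<And>t. \<bar>t\<bar> < r \<Longrightarrow> (F has_real_derivative F' t) (at t)"
    "\<And>t. \<bar>t\<bar> < r \<Longrightarrow> F t \<le> F 0"
    using eventually_conj[OF F'(1) max] unfolding eventually_nhds_metric
    by (auto simp: dist_real_def)
  show a: "a = 0"
    using DERIV_local_max[of F "F' 0" 0 r] r(1) r(2)[of 0] r(3) F'(2)
    by (simp add: abs_minus_commute)
  show "c \<le> 0"
  proof (rule ccontr)
    assume "\<not> c \<le> 0"
    then obtain d where d: "d > 0" "\<And>h. 0 < h \<Longrightarrow> h < d \<Longrightarrow> F' 0 < F' (0 + h)"
      using DERIV_pos_inc_right[OF F'(3)] by force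
    define h where "h = min d r / 2"
    have h: "0 < h" "h < d" "h < r" using d r by (auto simp: h_def)
    have "F 0 < F h"
    proof (rule DERIV_pos_imp_increasing_open[OF h(1)])
      show "\<exists>y. DERIV F x :> y \<and> 0 < y" if "0 < x" "x < h" for x
        using that r(2) d(2) h a F'(2) by (metis abs_of_pos add_0 less_trans)
      show "continuous_on {0..h} F"
        by (rule continuous_at_imp_continuous_on) (use r(2) h in \<open>auto intro!: DERIV_isCont[of F "F' x" x for x]\<close>)
    qed
    moreover have "F h \<le> F 0" using r(3)[of h] h by simp
    ultimately show False by simp
  qed
qed

lemma has_hessian_on_add:
  "has_hessian_on S u g H \<Longrightarrow> has_hessian_on S v k K \<Longrightarrow>
    has_hessian_on S (\<lambda>x. u x + v x) (\<lambda>x. g x + k x) (\<lambda>x a. H x a + K x a)"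
  unfolding has_hessian_on_def by (auto intro!: derivative_eq_intros simp: inner_add_left)

lemma has_hessian_on_cmult:
  "has_hessian_on S u g H \<Longrightarrow>
    has_hessian_on S (\<lambda>x. c * u x) (\<lambda>x. c *\<^sub>R g x) (\<lambda>x a. c *\<^sub>R H x a)"
  unfolding has_hessian_on_def by (auto intro!: derivative_eq_intros)

lemma has_hessian_on_const: "has_hessian_on S (\<lambda>x. c) (\<lambda>x. 0) (\<lambda>x a. 0)"
proof -
  have "(\<bullet>) (0::'a) = (\<lambda>v. 0)" by auto
  then show ?thesis unfolding has_hessian_on_def by auto
qed

lemma has_hessian_on_mult:
  "has_hessian_on S u g H \<Longrightarrow> has_hessian_on S v k K \<Longrightarrow>
    has_hessian_on S (\<lambda>x. u x * v x) (\<lambda>x. u x *\<^sub>R k x + v x *\<^sub>R g x)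
      (\<lambda>x a. u x *\<^sub>R K x a + (g x \<bullet> a) *\<^sub>R k x + (v x *\<^sub>R H x a + (k x \<bullet> a) *\<^sub>R g x))"
  unfolding has_hessian_on_def
  by (auto intro!: derivative_eq_intros ext simp: inner_add_left algebra_simps)

lemma has_hessian_on_compose:
  assumes hessian: "has_hessian_on S u g H"
    and F: "\<And>x. x \<in> S \<Longrightarrow> (F has_real_derivative F' (u x)) (at (u x))"
    and F': "\<And>x. x \<in> S \<Longrightarrow> (F' has_real_derivative F'' (u x)) (at (u x))"
  shows "has_hessian_on S (\<lambda>x. F (u x)) (\<lambda>x. F' (u x) *\<^sub>R g x)
    (\<lambda>x a. F' (u x) *\<^sub>R H x a + (F'' (u x) * (g x \<bullet> a)) *\<^sub>R g x)"
  unfolding has_hessian_on_def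
proof (intro ballI conjI)
  fix x
  assume x: "x \<in> S"
  note u = has_hessian_onD(1)[OF hessian x] and g = has_hessian_onD(2)[OF hessian x]
  have "((\<lambda>x. F (u x)) has_derivative (\<lambda>v. F' (u x) * (g x \<bullet> v))) (at x)"
    using has_derivative_compose[OF u] F[OF x] by (simp add: has_field_derivative_def)
  then show "((\<lambda>x. F (u x)) has_derivative (\<lambda>v. (F' (u x) *\<^sub>R g x) \<bullet> v)) (at x)" by simp
  have "((\<lambda>x. F' (u x)) has_derivative (\<lambda>v. F'' (u x) * (g x \<bullet> v))) (at x)"
    using has_derivative_compose[OF u] F'[OF x] by (simp add: has_field_derivative_def)
  from has_derivative_scaleR[OF this g] show "((\<lambda>x. F' (u x) *\<^sub>R g x) has_derivative
    (\<lambda>a. F' (u x) *\<^sub>R H x a + (F'' (u x) * (g x \<bullet> a)) *\<^sub>R g x)) (at x)" .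
qed

lemma trace_op_simps:
  "trace_op (\<lambda>a. A a + B a) = trace_op A + trace_op B"
  "trace_op (\<lambda>a. c *\<^sub>R A a) = c * trace_op A"
  "trace_op (\<lambda>a. (p \<bullet> a) *\<^sub>R q) = p \<bullet> q"
  "trace_op (\<lambda>a. (k * (p \<bullet> a)) *\<^sub>R q) = k * (p \<bullet> q)"
  "trace_op (\<lambda>a. 0) = 0"
  by (simp_all add: trace_op_def inner_add_left sum.distrib sum_distrib_left
    euclidean_inner[of p q] mult.assoc)

lemma trace_op_orthonormal:
  fixes e :: "'a::euclidean_space"
  assumes e: "norm e = 1"
  obtains B where "finite B" "e \<in> B" "\<And>A. linear A \<Longrightarrow> trace_op A = (\<Sum>b\<in>B. A b \<bullet> b)"
proof -
  obtain B where B: "e \<in> B" "pairwise orthogonal B" "\<And>x. x \<in> B \<Longrightarrow> norm x = 1"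
    "independent B" "card B = DIM('a)" "span B = UNIV"
    using vector_in_orthonormal_basis[OF e] by metis
  have fin: "finite B" using B(4) independent_imp_finite by blast
  have expand: "v = (\<Sum>b\<in>B. (v \<bullet> b) *\<^sub>R b)" for v
    using orthonormal_basis_expand[OF B(2) B(3), of v] fin B(6) by simp
  show ?thesis
  proof (rule that[OF fin B(1)])
    fix A :: "'a \<Rightarrow> 'a"
    assume A: "linear A"
    have "A c \<bullet> c = (\<Sum>b\<in>B. (A c \<bullet> b) * (b \<bullet> c))" for c
      using arg_cong[OF expand[of "A c"], of "\<lambda>v. v \<bullet> c"] by (simp add: inner_sum_left)
    then have "trace_op A = (\<Sum>c\<in>Basis. \<Sum>b\<in>B. (A c \<bullet> b) * (b \<bullet> c))"
      by (simp add: trace_op_def)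
    also have "\<dots> = (\<Sum>b\<in>B. \<Sum>c\<in>Basis. (A c \<bullet> b) * (b \<bullet> c))" by (rule sum.swap)
    also have "\<dots> = (\<Sum>b\<in>B. A b \<bullet> b)"
    proof (rule sum.cong[OF refl])
      fix b
      have "A b = A (\<Sum>c\<in>Basis. (b \<bullet> c) *\<^sub>R c)" by (simp add: euclidean_representation)
      also have "\<dots> = (\<Sum>c\<in>Basis. (b \<bullet> c) *\<^sub>R A c)" using A by (simp add: linear_sum linear_scale)
      finally show "(\<Sum>c\<in>Basis. (A c \<bullet> b) * (b \<bullet> c)) = A b \<bullet> b"
        by (simp add: inner_sum_left mult.commute)
    qed
    finally show "trace_op A = (\<Sum>b\<in>B. A b \<bullet> b)" .
  qed
qed

lemma has_hessian_on_local_max: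
  fixes u :: "'a::euclidean_space \<Rightarrow> real"
  assumes hessian: "has_hessian_on S u g H" and S: "open S" "x \<in> S"
    and max: "\<forall>\<^sub>F y in nhds x. u y \<le> u x"
  shows "g x = 0" "trace_op (H x) \<le> 0"
proof -
  have "\<forall>\<^sub>F t in nhds 0. u (x + t *\<^sub>R v) \<le> u (x + 0 *\<^sub>R v)" for v
    using eventually_on_line[OF max] by simp
  note jet = jet2_local_max[OF jet2_line[OF hessian S] this]
  show "g x = 0" using jet(1)[of "g x"] by simp
  show "trace_op (H x) \<le> 0" unfolding trace_op_def using jet(2) by (intro sum_nonpos) auto
qed

lemma has_hessian_on_local_min:
  fixes u :: "'a::euclidean_space \<Rightarrow> real"
  assumes hessian: "has_hessian_on S u g H" and S: "open S" "x \<in> S"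
    and min: "\<forall>\<^sub>F y in nhds x. u x \<le> u y"
  shows "trace_op (H x) \<ge> 0"
proof -
  have "\<forall>\<^sub>F y in nhds x. (-1) * u y \<le> (-1) * u x" using min by (rule eventually_mono) simp
  from has_hessian_on_local_max(2)[OF has_hessian_on_cmult[OF hessian] S this]
  show ?thesis unfolding trace_op_simps(2) by simp
qed

lemma has_hessian_on_exp:
  assumes "has_hessian_on S u g H"
  shows "has_hessian_on S (\<lambda>x. exp (p * u x)) (\<lambda>x. (p * exp (p * u x)) *\<^sub>R g x)
    (\<lambda>x a. (p * exp (p * u x)) *\<^sub>R H x a + ((p * p * exp (p * u x)) * (g x \<bullet> a)) *\<^sub>R g x)"
  by (rule has_hessian_on_compose[OF assms, of "\<lambda>s. exp (p * s)" "\<lambda>s. p * exp (p * s)"])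
    (auto intro!: derivative_eq_intros)

lemma trace_op_hessian_exp:
  "trace_op (\<lambda>a. (p * E) *\<^sub>R H a + ((p * p * E) * (g \<bullet> a)) *\<^sub>R g) =
    E * (p\<^sup>2 * (g \<bullet> g) + p * trace_op H)"
  unfolding trace_op_simps(1) trace_op_simps(2) trace_op_simps(4)
  by (simp add: power2_eq_square algebra_simps)

lemma has_hessian_on_ln:
  assumes hessian: "has_hessian_on S u g H" and pos: "\<And>x. x \<in> S \<Longrightarrow> u x > 0"
  shows "has_hessian_on S (\<lambda>x. ln (u x)) (\<lambda>x. inverse (u x) *\<^sub>R g x)
    (\<lambda>x a. inverse (u x) *\<^sub>R H x a + (- (inverse (u x) * inverse (u x)) * (g x \<bullet> a)) *\<^sub>R g x)"
  by (rule has_hessian_on_compose[OF hessian, of ln inverse "\<lambda>s. - (inverse s * inverse s)"])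
    (use pos in \<open>auto intro!: derivative_eq_intros
      simp: less_imp_neq[symmetric] power2_eq_square inverse_eq_divide\<close>)

lemma trace_op_hessian_ln:
  "trace_op (\<lambda>a. inverse s *\<^sub>R H a + (- (inverse s * inverse s) * (g \<bullet> a)) *\<^sub>R g) +
    (inverse s *\<^sub>R g) \<bullet> (inverse s *\<^sub>R g) = trace_op H / s"
  unfolding trace_op_simps(1) trace_op_simps(2) trace_op_simps(4) by (simp add: divide_inverse)

lemma has_real_derivative_norm_line:
  fixes z a :: "'a::real_inner"
  assumes "z \<noteq> 0"
  shows "((\<lambda>t. norm (z + t *\<^sub>R a)) has_real_derivative (a \<bullet> sgn z)) (at 0)"
proof -
  have "((\<lambda>t. z + t *\<^sub>R a) has_derivative (\<lambda>t. t *\<^sub>R a)) (at 0)"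
    by (auto intro!: derivative_eq_intros)
  moreover have "(norm has_derivative (\<lambda>v. v \<bullet> sgn z)) (at (z + 0 *\<^sub>R a))"
    using has_derivative_norm[of z] assms by simp
  ultimately have "((\<lambda>t. norm (z + t *\<^sub>R a)) has_derivative (\<lambda>t. (t *\<^sub>R a) \<bullet> sgn z)) (at 0)"
    by (rule has_derivative_compose)
  moreover have "(\<lambda>t. (t *\<^sub>R a) \<bullet> sgn z) = (*) (a \<bullet> sgn z)" by (simp add: fun_eq_iff)
  ultimately show ?thesis by (simp add: has_field_derivative_def)
qed

lemma norm_le_DIM_mult:
  fixes x :: "'a::euclidean_space"
  assumes "\<And>b. b \<in> Basis \<Longrightarrow> \<bar>x \<bullet> b\<bar> \<le> r"
  shows "norm x \<le> real DIM('a) * r"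
proof -
  have "norm x \<le> (\<Sum>b\<in>Basis. \<bar>x \<bullet> b\<bar>)" by (rule norm_le_l1)
  also have "\<dots> \<le> (\<Sum>b\<in>(Basis::'a set). r)" using assms by (rule sum_mono)
  finally show ?thesis by simp
qed

lemma compact_sublevel:
  fixes q :: "'a::t2_space \<Rightarrow> real"
  assumes "compact A" "continuous_on A q"
  shows "compact {x \<in> A. q x \<le> c}"
proof -
  have "closed {x \<in> A. q x \<le> c}"
    by (rule continuous_on_closed_Collect_le[OF assms(2) continuous_on_const compact_imp_closed[OF assms(1)]])
  then have "compact (A \<inter> {x \<in> A. q x \<le> c})" by (rule compact_Int_closed[OF assms(1)])
  moreover have "A \<inter> {x \<in> A. q x \<le> c} = {x \<in> A. q x \<le> c}" by blast
  ultimately show ?thesis by simp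
qed

lemma compact_superlevel:
  fixes q :: "'a::t2_space \<Rightarrow> real"
  assumes "compact A" "continuous_on A q"
  shows "compact {x \<in> A. c \<le> q x}"
  using compact_sublevel[OF assms(1) continuous_on_minus[OF assms(2)], of "- c"] by simp

section \<open>Finite differences\<close>

lemma quadratic_nonneg_imp_linear_zero:
  fixes p q :: real
  assumes "\<And>t. 0 \<le> 2 * t * p + t\<^sup>2 * q"
  shows "p = 0"
proof (rule ccontr)
  assume p: "p \<noteq> 0"
  define k where "k = \<bar>q\<bar> + 1"
  have k: "k > 0" "q < k" by (auto simp: k_def)
  have "2 * (- p / k) * p + (- p / k)\<^sup>2 * q = (p\<^sup>2 / k\<^sup>2) * (q - 2 * k)"
    using k by (simp add: field_simps power2_eq_square)
  moreover have "\<dots> < 0" using p k by (intro mult_pos_neg) auto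
  ultimately show False using assms[of "- p / k"] by simp
qed

context
  fixes A :: "'i set" and a :: "'i \<Rightarrow> 'i \<Rightarrow> real"
  assumes finite_A: "finite A"
begin

definition bilinear_form :: "('i \<Rightarrow> real) \<Rightarrow> ('i \<Rightarrow> real) \<Rightarrow> real" where
  "bilinear_form f g = (\<Sum>x\<in>A. f x * (\<Sum>y\<in>A. a x y * g y))"

lemma bilinear_form_add_cmult:
  "bilinear_form (\<lambda>x. f x + t * k x) g = bilinear_form f g + t * bilinear_form k g"
  "bilinear_form g (\<lambda>x. f x + t * k x) = bilinear_form g f + t * bilinear_form g k"
  by (simp_all add: bilinear_form_def algebra_simps sum.distrib sum_distrib_left)

lemma bilinear_form_cmult:
  "bilinear_form (\<lambda>x. c * f x) (\<lambda>x. c * f x) = c\<^sup>2 * bilinear_form f f"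
  by (simp add: bilinear_form_def sum_distrib_left power2_eq_square mult_ac)

lemma bilinear_form_sym:
  assumes "\<And>x y. x \<in> A \<Longrightarrow> y \<in> A \<Longrightarrow> a x y = a y x"
  shows "bilinear_form f g = bilinear_form g f"
proof -
  have "bilinear_form f g = (\<Sum>y\<in>A. \<Sum>x\<in>A. f x * (a x y * g y))"
    unfolding bilinear_form_def sum_distrib_left by (rule sum.swap)
  also have "\<dots> = (\<Sum>y\<in>A. \<Sum>x\<in>A. g y * (a y x * f x))"
    by (intro sum.cong refl) (auto simp: assms)
  finally show ?thesis by (simp add: bilinear_form_def sum_distrib_left)
qed

lemma bilinear_form_abs_le:
  assumes off_diagonal: "\<And>x y. x \<in> A \<Longrightarrow> y \<in> A \<Longrightarrow> x \<noteq> y \<Longrightarrow> a x y \<le> 0"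
  shows "bilinear_form (\<lambda>x. \<bar>f x\<bar>) (\<lambda>x. \<bar>f x\<bar>) \<le> bilinear_form f f"
  unfolding bilinear_form_def sum_distrib_left
proof (intro sum_mono)
  fix x y
  assume xy: "x \<in> A" "y \<in> A"
  show "\<bar>f x\<bar> * (a x y * \<bar>f y\<bar>) \<le> f x * (a x y * f y)"
  proof (cases "x = y")
    case True
    have "\<bar>p\<bar> * (k * \<bar>p\<bar>) = p * (k * p)" for p k :: real by (cases "p \<ge> 0") auto
    then show ?thesis using True by simp
  next
    case False
    have "f x * f y \<le> \<bar>f x\<bar> * \<bar>f y\<bar>" by (simp add: abs_mult[symmetric])
    then have "a x y * (\<bar>f x\<bar> * \<bar>f y\<bar>) \<le> a x y * (f x * f y)"
      using off_diagonal[OF xy False] by (intro mult_left_mono_neg)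
    then show ?thesis by (simp add: mult.left_commute)
  qed
qed

lemma bilinear_form_ge_of_unit:
  assumes unit: "\<And>w. (\<And>x. x \<notin> A \<Longrightarrow> w x = 0) \<Longrightarrow> (\<Sum>x\<in>A. (w x)\<^sup>2) = 1 \<Longrightarrow> c \<le> bilinear_form w w"
  shows "c * (\<Sum>x\<in>A. (w x)\<^sup>2) \<le> bilinear_form w w"
proof -
  define N where "N = (\<Sum>x\<in>A. (w x)\<^sup>2)"
  have "c * N \<le> bilinear_form w w"
  proof (cases "N = 0")
    case True
    then have "w x = 0" if "x \<in> A" for x
      using that finite_A by (simp add: N_def sum_nonneg_eq_0_iff)
    then show ?thesis using True by (simp add: bilinear_form_def)
  next
    case False
    then have N: "N > 0" by (simp add: N_def less_le sum_nonneg)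
    define w' where "w' = (\<lambda>x. if x \<in> A then 1 / sqrt N * w x else 0)"
    have "(\<Sum>x\<in>A. (w' x)\<^sup>2) = (\<Sum>x\<in>A. 1 / N * (w x)\<^sup>2)"
      using N by (intro sum.cong) (auto simp: w'_def power_divide)
    also have "\<dots> = 1" using N unfolding sum_distrib_left[symmetric] by (simp add: N_def)
    finally have "c \<le> bilinear_form w' w'" by (intro unit) (auto simp: w'_def)
    also have "bilinear_form w' w' = bilinear_form (\<lambda>x. 1 / sqrt N * w x) (\<lambda>x. 1 / sqrt N * w x)"
      by (simp add: bilinear_form_def w'_def cong: sum.cong)
    also have "\<dots> = bilinear_form w w / N"
      unfolding bilinear_form_cmult using N by (simp add: power_divide)
    finally show ?thesis using N by (simp add: field_simps)
  qed
  then show ?thesis by (simp add: N_def)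
qed

lemma bilinear_form_attains_min:
  assumes "A \<noteq> {}"
  obtains u where "\<And>x. x \<notin> A \<Longrightarrow> u x = 0" "(\<Sum>x\<in>A. (u x)\<^sup>2) = 1"
    "\<And>w. bilinear_form u u * (\<Sum>x\<in>A. (w x)\<^sup>2) \<le> bilinear_form w w"
proof -
  define F where "F = (\<lambda>x. if x \<in> A then {-1..1::real} else {0})"
  define S where "S = PiE UNIV F \<inter> {f. (\<Sum>x\<in>A. (f x)\<^sup>2) = 1}"
  have eval: "continuous_on T (\<lambda>f. f x)" for x :: 'i and T :: "('i \<Rightarrow> real) set"
    by (rule continuous_on_subset[OF continuous_on_product_coordinates]) simp
  have "compactin (product_topology (\<lambda>_. euclidean) UNIV) (PiE UNIV F)"
    unfolding compactin_PiE by (auto simp: F_def)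
  then have "compact (PiE UNIV F)" by (simp add: euclidean_product_topology)
  moreover have "closed {f :: 'i \<Rightarrow> real. (\<Sum>x\<in>A. (f x)\<^sup>2) = 1}"
    by (intro closed_Collect_eq continuous_on_sum continuous_on_power continuous_on_const eval)
  ultimately have "compact S" unfolding S_def by (rule compact_Int_closed)
  have in_S: "w \<in> S" if "\<And>x. x \<notin> A \<Longrightarrow> w x = 0" "(\<Sum>x\<in>A. (w x)\<^sup>2) = 1" for w
  proof -
    have "\<bar>w x\<bar> \<le> 1" if "x \<in> A" for x
    proof -
      have "(w x)\<^sup>2 \<le> (\<Sum>x\<in>A. (w x)\<^sup>2)" using finite_A that by (intro member_le_sum) auto
      then show ?thesis using \<open>(\<Sum>x\<in>A. (w x)\<^sup>2) = 1\<close> abs_le_square_iff[of "w x" 1] by simp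
    qed
    then show ?thesis using that by (auto simp: S_def F_def abs_le_iff)
  qed
  obtain x0 where "x0 \<in> A" using assms by auto
  then have "(\<lambda>x. if x = x0 then 1 else 0) \<in> S"
    using finite_A by (intro in_S) (auto simp: if_distrib[where f = "\<lambda>z. z\<^sup>2"] cong: if_cong)
  then have "S \<noteq> {}" by blast
  moreover have "continuous_on S (\<lambda>f. bilinear_form f f)"
    unfolding bilinear_form_def
    by (intro continuous_on_sum continuous_on_mult continuous_on_const eval)
  ultimately obtain u where u: "u \<in> S" "\<And>w. w \<in> S \<Longrightarrow> bilinear_form u u \<le> bilinear_form w w"
    using continuous_attains_inf[OF \<open>compact S\<close>] by blast
  show ?thesis
  proof (rule that[of u])
    show "u x = 0" if "x \<notin> A" for x
      using u(1) that unfolding S_def F_def by (auto simp: PiE_iff split: if_splits)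
    show "(\<Sum>x\<in>A. (u x)\<^sup>2) = 1" using u(1) by (simp add: S_def)
    fix w :: "'i \<Rightarrow> real"
    show "bilinear_form u u * (\<Sum>x\<in>A. (w x)\<^sup>2) \<le> bilinear_form w w"
      by (rule bilinear_form_ge_of_unit) (intro u(2) in_S)
  qed
qed

lemma bilinear_form_minimizer_eigenvector:
  assumes sym: "\<And>x y. x \<in> A \<Longrightarrow> y \<in> A \<Longrightarrow> a x y = a y x"
    and min: "\<And>w. l * (\<Sum>x\<in>A. (w x)\<^sup>2) \<le> bilinear_form w w"
    and u: "bilinear_form u u = l * (\<Sum>x\<in>A. (u x)\<^sup>2)" and x: "x \<in> A"
  shows "(\<Sum>y\<in>A. a x y * u y) = l * u x"
proof -
  define d where "d = (\<lambda>y. if y = x then 1 else 0 :: real)"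
  have bilinear_d: "bilinear_form d g = (\<Sum>y\<in>A. a x y * g y)" for g
    using x finite_A
    by (simp add: bilinear_form_def d_def if_distrib[where f = "\<lambda>c. c * _"] cong: if_cong)
  have "0 \<le> 2 * t * ((\<Sum>y\<in>A. a x y * u y) - l * u x) + t\<^sup>2 * (a x x - l)" for t
  proof -
    let ?w = "\<lambda>y. u y + t * d y"
    have "bilinear_form ?w ?w = bilinear_form u u + 2 * t * bilinear_form d u + t\<^sup>2 * bilinear_form d d"
      using bilinear_form_sym[OF sym, of u d]
      by (simp add: bilinear_form_add_cmult algebra_simps power2_eq_square)
    moreover have "bilinear_form d d = a x x"
      using x finite_A by (simp add: bilinear_d) (simp add: d_def if_distrib cong: if_cong)
    moreover have "(\<Sum>y\<in>A. (?w y)\<^sup>2) = (\<Sum>y\<in>A. (u y)\<^sup>2) + (2 * t * u x + t\<^sup>2)"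
    proof -
      have "(\<Sum>y\<in>A. (?w y)\<^sup>2) = (\<Sum>y\<in>A. (u y)\<^sup>2 + (if y = x then 2 * t * u x + t\<^sup>2 else 0))"
        unfolding d_def by (intro sum.cong) (auto simp: power2_eq_square algebra_simps)
      also have "\<dots> = (\<Sum>y\<in>A. (u y)\<^sup>2) + (2 * t * u x + t\<^sup>2)"
        using x finite_A by (simp add: sum.distrib)
      finally show ?thesis .
    qed
    ultimately show ?thesis using min[of ?w] u bilinear_d[of u] by (simp add: algebra_simps)
  qed
  from quadratic_nonneg_imp_linear_zero[OF this] show ?thesis by simp
qed

lemma nonneg_ground_state_of_symmetric_matrix:
  assumes "A \<noteq> {}" and sym: "\<And>x y. x \<in> A \<Longrightarrow> y \<in> A \<Longrightarrow> a x y = a y x"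
    and off_diagonal: "\<And>x y. x \<in> A \<Longrightarrow> y \<in> A \<Longrightarrow> x \<noteq> y \<Longrightarrow> a x y \<le> 0"
  obtains u l where "\<And>x. 0 \<le> u x" "\<And>x. x \<notin> A \<Longrightarrow> u x = 0" "\<exists>x\<in>A. u x \<noteq> 0"
    "\<And>x. x \<in> A \<Longrightarrow> (\<Sum>y\<in>A. a x y * u y) = l * u x"
    "\<And>w. l * (\<Sum>x\<in>A. (w x)\<^sup>2) \<le> bilinear_form w w"
proof (rule bilinear_form_attains_min[OF assms(1)])
  fix u
  assume u: "\<And>x. x \<notin> A \<Longrightarrow> u x = 0" "(\<Sum>x\<in>A. (u x)\<^sup>2) = 1"
    and min: "\<And>w. bilinear_form u u * (\<Sum>x\<in>A. (w x)\<^sup>2) \<le> bilinear_form w w"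
  define v where "v x = \<bar>u x\<bar>" for x
  have v: "(\<Sum>x\<in>A. (v x)\<^sup>2) = 1" using u(2) by (simp add: v_def)
  have v_min: "bilinear_form v v = bilinear_form u u * (\<Sum>x\<in>A. (v x)\<^sup>2)"
  proof (rule antisym)
    have "bilinear_form v v \<le> bilinear_form u u"
      unfolding v_def by (rule bilinear_form_abs_le[OF off_diagonal])
    then show "bilinear_form v v \<le> bilinear_form u u * (\<Sum>x\<in>A. (v x)\<^sup>2)" by (simp add: v)
  qed (rule min)
  have eigen: "(\<Sum>y\<in>A. a x y * v y) = bilinear_form u u * v x" if "x \<in> A" for x
    by (rule bilinear_form_minimizer_eigenvector[OF sym min v_min that])
  have nonzero: "\<exists>x\<in>A. v x \<noteq> 0"
  proof (rule ccontr)
    assume "\<not> ?thesis"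
    then have "(\<Sum>x\<in>A. (v x)\<^sup>2) = 0" by simp
    then show False using v by simp
  qed
  show ?thesis
    by (rule that[of v "bilinear_form u u", OF _ _ nonzero eigen min]) (simp_all add: v_def u(1))
qed

end

lemma finite_max_obtain:
  fixes f :: "'i \<Rightarrow> real"
  assumes "finite A" "A \<noteq> {}"
  obtains x where "x \<in> A" "\<And>y. y \<in> A \<Longrightarrow> f y \<le> f x"
  using obtains_MAX[OF assms, of f] Max_ge[of "f ` A"] assms(1) by (metis finite_imageI imageI)

definition grid :: "real \<Rightarrow> 'a::euclidean_space set" where
  "grid h = {x. \<forall>b\<in>Basis. \<exists>j::int. x \<bullet> b = h * of_int j}"

definition cube :: "'a::euclidean_space \<Rightarrow> real \<Rightarrow> 'a set" where
  "cube p r = {x. \<forall>b\<in>Basis. \<bar>(x - p) \<bullet> b\<bar> \<le> r}"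

definition dlap :: "real \<Rightarrow> ('a::euclidean_space \<Rightarrow> real) \<Rightarrow> 'a \<Rightarrow> real" where
  "dlap h u x = (\<Sum>b\<in>Basis. (u (x + h *\<^sub>R b) + u (x - h *\<^sub>R b) - 2 * u x) / h\<^sup>2)"

definition fdiff :: "real \<Rightarrow> 'a::euclidean_space \<Rightarrow> ('a \<Rightarrow> real) \<Rightarrow> 'a \<Rightarrow> real" where
  "fdiff h b u x = (u (x + h *\<^sub>R b) - u x) / h"

lemma grid_add: "x \<in> grid h \<Longrightarrow> y \<in> grid h \<Longrightarrow> x + y \<in> grid h"
  unfolding grid_def by (auto simp: inner_add_left) (metis distrib_left of_int_add)

lemma grid_diff: "x \<in> grid h \<Longrightarrow> y \<in> grid h \<Longrightarrow> x - y \<in> grid h"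
  unfolding grid_def by (auto simp: inner_diff_left) (metis right_diff_distrib of_int_diff)

lemma grid_scaleR_Basis: "b \<in> Basis \<Longrightarrow> (h * of_int j) *\<^sub>R b \<in> grid h"
  unfolding grid_def by (auto simp: inner_Basis intro: exI[of _ 0])

lemma grid_step:
  assumes "b \<in> Basis" "x \<in> grid h"
  shows "x + h *\<^sub>R b \<in> grid h" "x - h *\<^sub>R b \<in> grid h"
  using grid_scaleR_Basis[OF assms(1), of h 1] assms(2) by (auto intro: grid_add grid_diff)

lemma grid_inner_less_iff:
  assumes "h > 0" "x \<in> grid h" "b \<in> Basis"
  shows "x \<bullet> b < h * of_int k \<longleftrightarrow> x \<bullet> b + h \<le> h * of_int k"
proof -
  obtain j :: int where j: "x \<bullet> b = h * of_int j" using assms by (auto simp: grid_def)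
  have "h * (of_int j + 1) \<le> h * of_int k \<longleftrightarrow> of_int j + 1 \<le> (of_int k :: real)"
    using assms(1) by simp
  also have "\<dots> \<longleftrightarrow> j < k" by linarith
  finally show ?thesis using assms(1) by (simp add: j algebra_simps)
qed

lemma grid_abs_inner_less_imp_le:
  assumes "h > 0" "x \<in> grid h" "b \<in> Basis" "\<bar>x \<bullet> b\<bar> < h * of_int k"
  shows "\<bar>x \<bullet> b\<bar> + h \<le> h * of_int k"
proof -
  have "0 - x \<in> grid h" by (rule grid_diff[OF _ assms(2)]) (auto simp: grid_def)
  then show ?thesis
    using grid_inner_less_iff[OF assms(1,2,3), of k] grid_inner_less_iff[OF assms(1) _ assms(3), of "- x" k] assms(4)
    by (auto simp: abs_if split: if_splits)
qed

lemma bounded_cube: "bounded (cube (p::'a::euclidean_space) r)"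
proof (rule bounded_subset[OF bounded_cball])
  show "cube p r \<subseteq> cball p (real DIM('a) * r)"
    unfolding cube_def by (auto simp: dist_norm norm_minus_commute[of p] intro!: norm_le_DIM_mult)
qed

lemma open_contains_cube:
  fixes p :: "'a::euclidean_space"
  assumes "open S" "p \<in> S"
  obtains r where "r > 0" "cube p r \<subseteq> S"
proof -
  obtain e where e: "e > 0" "cball p e \<subseteq> S" using assms open_contains_cball by blast
  have "norm (x - p) \<le> e" if "x \<in> cube p (e / real DIM('a))" for x
    using norm_le_DIM_mult[of "x - p" "e / real DIM('a)"] that by (simp add: cube_def)
  then have "cube p (e / real DIM('a)) \<subseteq> S"
    using e(2) by (auto simp: dist_norm norm_minus_commute subset_iff)
  then show ?thesis using that[of "e / real DIM('a)"] e(1) by simp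
qed

lemma finite_bounded_Int_grid:
  fixes B :: "'a::euclidean_space set"
  assumes h: "h > 0" and B: "bounded B"
  shows "finite (B \<inter> grid h)"
proof -
  obtain R where R: "\<And>x. x \<in> B \<Longrightarrow> norm x \<le> R" using B bounded_iff by blast
  define J where "J = {- \<lceil>R / h\<rceil> .. \<lceil>R / h\<rceil>}"
  define G where "G = (\<lambda>j::'a \<Rightarrow> int. \<Sum>b\<in>Basis. (h * of_int (j b)) *\<^sub>R b)"
  have "B \<inter> grid h \<subseteq> G ` (PiE Basis (\<lambda>_. J))"
  proof
    fix x
    assume x: "x \<in> B \<inter> grid h"
    then obtain j where j: "\<And>b. b \<in> Basis \<Longrightarrow> x \<bullet> b = h * of_int (j b)"
      unfolding grid_def by (auto, metis)
    have "j b \<in> J" if b: "b \<in> Basis" for b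
    proof -
      have "\<bar>h * of_int (j b)\<bar> \<le> R" using j[OF b] R[of x] x Basis_le_norm[OF b, of x] by auto
      then have "\<bar>of_int (j b)\<bar> \<le> R / h" using h by (simp add: abs_mult field_simps)
      then have "\<bar>real_of_int (j b)\<bar> \<le> of_int \<lceil>R / h\<rceil>" by linarith
      then have "\<bar>j b\<bar> \<le> \<lceil>R / h\<rceil>" by linarith
      then show ?thesis by (auto simp: J_def)
    qed
    then have "restrict j Basis \<in> PiE Basis (\<lambda>_. J)" by auto
    moreover have "x = G (restrict j Basis)"
      unfolding G_def using j euclidean_representation[of x] by (simp cong: sum.cong)
    ultimately show "x \<in> G ` (PiE Basis (\<lambda>_. J))" by blast
  qed
  moreover have "finite (PiE (Basis::'a set) (\<lambda>_. J))" by (intro finite_PiE) (auto simp: J_def)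
  ultimately show ?thesis using finite_surj by blast
qed

lemma dlap_diff: "dlap h (\<lambda>x. p x - q x) y = dlap h p y - dlap h q y"
  unfolding dlap_def sum_subtractf[symmetric]
  by (rule sum.cong) (simp_all add: diff_divide_distrib add_divide_distrib)

lemma dlap_cmult: "dlap h (\<lambda>x. c * p x) y = c * dlap h p y"
  unfolding dlap_def sum_distrib_left by (rule sum.cong) (simp_all add: algebra_simps)

lemma dlap_nonpos_at_max:
  assumes "\<And>b. b \<in> Basis \<Longrightarrow> u (x + h *\<^sub>R b) \<le> u x" "\<And>b. b \<in> Basis \<Longrightarrow> u (x - h *\<^sub>R b) \<le> u x"
  shows "dlap h u x \<le> 0"
  unfolding dlap_def
proof (rule sum_nonpos)
  fix b :: 'a
  assume "b \<in> Basis"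
  then show "(u (x + h *\<^sub>R b) + u (x - h *\<^sub>R b) - 2 * u x) / h\<^sup>2 \<le> 0"
    using assms[of b] by (intro divide_nonpos_nonneg) auto
qed

lemma dlap_separable:
  fixes q :: "'a::euclidean_space \<Rightarrow> real \<Rightarrow> real" and x0 :: 'a
  shows "dlap h (\<lambda>y. \<Sum>d\<in>Basis. q d ((y - x0) \<bullet> d)) y = (\<Sum>c\<in>Basis.
    (q c ((y - x0) \<bullet> c + h) + q c ((y - x0) \<bullet> c - h) - 2 * q c ((y - x0) \<bullet> c)) / h\<^sup>2)"
  unfolding dlap_def
proof (rule sum.cong[OF refl])
  fix c :: 'a
  assume c: "c \<in> Basis"
  have split: "(\<Sum>d\<in>Basis. q d ((y + t *\<^sub>R c - x0) \<bullet> d)) =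
    q c ((y - x0) \<bullet> c + t) + (\<Sum>d\<in>Basis - {c}. q d ((y - x0) \<bullet> d))" for t
  proof -
    have "(\<Sum>d\<in>Basis - {c}. q d ((y + t *\<^sub>R c - x0) \<bullet> d)) = (\<Sum>d\<in>Basis - {c}. q d ((y - x0) \<bullet> d))"
      using c by (intro sum.cong) (auto simp: algebra_simps inner_Basis)
    then show ?thesis using c by (subst sum.remove[of _ c]) (auto simp: algebra_simps)
  qed
  show "((\<Sum>d\<in>Basis. q d ((y + h *\<^sub>R c - x0) \<bullet> d)) + (\<Sum>d\<in>Basis. q d ((y - h *\<^sub>R c - x0) \<bullet> d)) -
      2 * (\<Sum>d\<in>Basis. q d ((y - x0) \<bullet> d))) / h\<^sup>2 =
    (q c ((y - x0) \<bullet> c + h) + q c ((y - x0) \<bullet> c - h) - 2 * q c ((y - x0) \<bullet> c)) / h\<^sup>2"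
    using split[of h] split[of "- h"] split[of 0] by simp
qed

text \<open>Brandt's interior gradient estimate: the odd part of \<open>u\<close> in direction \<open>b\<close> is compared with a
  quadratic function on a half box, on which the discrete Laplacian acts exactly.\<close>

context
  fixes h r M F :: real and N :: nat and b x0 :: "'a::euclidean_space" and u :: "'a \<Rightarrow> real"
  assumes h: "h > 0" and N: "N \<ge> 1" and r: "r = h * real N" and b: "b \<in> Basis"
    and x0: "x0 \<in> grid h" and M: "M > 0" and F: "F \<ge> 0"
    and u_bound: "\<And>y. y \<in> grid h \<Longrightarrow> y \<in> cube x0 (r + h) \<Longrightarrow> \<bar>u y\<bar> \<le> M"
    and dlap_bound: "\<And>y. y \<in> grid h \<Longrightarrow> y \<in> cube x0 (r + h) \<Longrightarrow> \<bar>dlap h u y\<bar> \<le> F"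
begin

definition half_box :: "'a set" where
  "half_box = {y \<in> grid h. (\<forall>c\<in>Basis - {b}. \<bar>(y - x0) \<bullet> c\<bar> \<le> r) \<and>
    h \<le> (y - x0) \<bullet> b \<and> (y - x0) \<bullet> b \<le> r + h}"

definition reflection :: "'a \<Rightarrow> 'a" where
  "reflection y = y - (2 * ((y - x0) \<bullet> b) - h) *\<^sub>R b"

definition odd_part :: "'a \<Rightarrow> real" where
  "odd_part y = (u y - u (reflection y)) / 2"

definition brandt_curvature :: real where
  "brandt_curvature = F / 2 + real DIM('a) * M / r\<^sup>2"

definition brandt_profile :: "'a \<Rightarrow> real \<Rightarrow> real" where
  "brandt_profile c t = (if c = b
    then (M / r + 3/2 * brandt_curvature * r) * (t - h/2) - brandt_curvature * (t - h/2)\<^sup>2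
      + brandt_curvature * h\<^sup>2 / 4
    else M / r\<^sup>2 * t\<^sup>2)"

definition brandt_barrier :: "'a \<Rightarrow> real" where
  "brandt_barrier y = (\<Sum>c\<in>Basis. brandt_profile c ((y - x0) \<bullet> c))"

lemma r_pos: "r > 0" and h_le_r: "h \<le> r"
  using h N by (auto simp: r)

lemma brandt_curvature_pos: "brandt_curvature > 0"
  using F M r_pos unfolding brandt_curvature_def by (intro add_nonneg_pos divide_pos_pos mult_pos_pos) auto

lemma inner_translate:
  "c \<in> Basis \<Longrightarrow> d \<in> Basis \<Longrightarrow> (y + t *\<^sub>R c - x0) \<bullet> d = (y - x0) \<bullet> d + (if c = d then t else 0)"
  by (simp add: algebra_simps inner_Basis)

lemma reflection_inner:
  assumes "c \<in> Basis"
  shows "(reflection y - x0) \<bullet> c = (if c = b then h - (y - x0) \<bullet> b else (y - x0) \<bullet> c)"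
proof -
  have "reflection y = y + (h - 2 * ((y - x0) \<bullet> b)) *\<^sub>R b" by (simp add: reflection_def algebra_simps)
  then show ?thesis using inner_translate[OF b assms, of y] by auto
qed

lemma reflection_translate:
  assumes "c \<in> Basis"
  shows "reflection (y + t *\<^sub>R c) = reflection y + (if c = b then - t else t) *\<^sub>R c"
  using inner_translate[OF assms b, of y t]
  by (auto simp: reflection_def algebra_simps) (simp flip: scaleR_add_left)

lemma reflection_grid:
  assumes y: "y \<in> grid h"
  shows "reflection y \<in> grid h"
proof -
  obtain j :: int where j: "(y - x0) \<bullet> b = h * of_int j"
    using grid_diff[OF y x0] b by (auto simp: grid_def)
  have "reflection y = y - (h * of_int (2 * j - 1)) *\<^sub>R b"
    unfolding reflection_def j by (simp add: algebra_simps)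
  then show ?thesis using grid_diff[OF y grid_scaleR_Basis[OF b, of h "2 * j - 1"]] by simp
qed

lemma half_box_subset_cube:
  assumes "y \<in> half_box"
  shows "y \<in> cube x0 (r + h)" "reflection y \<in> cube x0 (r + h)"
proof -
  have "\<bar>(y - x0) \<bullet> c\<bar> \<le> r + h \<and> \<bar>(reflection y - x0) \<bullet> c\<bar> \<le> r + h" if c: "c \<in> Basis" for c
  proof (cases "c = b")
    case False
    then have "\<bar>(y - x0) \<bullet> c\<bar> \<le> r" using assms c by (simp add: half_box_def)
    then show ?thesis using h False by (simp add: reflection_inner[OF c])
  qed (use assms h r_pos in \<open>simp add: half_box_def reflection_inner[OF b]\<close>)
  then show "y \<in> cube x0 (r + h)" "reflection y \<in> cube x0 (r + h)" by (simp_all add: cube_def)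
qed

lemma odd_part_le:
  assumes "y \<in> half_box"
  shows "odd_part y \<le> M"
  using u_bound[of y] u_bound[of "reflection y"] half_box_subset_cube[OF assms] reflection_grid[of y] assms
  by (simp add: odd_part_def half_box_def abs_le_iff)

lemma dlap_odd_part_ge:
  assumes "y \<in> half_box"
  shows "dlap h odd_part y \<ge> - F"
proof -
  have "dlap h (\<lambda>y. u (reflection y)) y = dlap h u (reflection y)"
    unfolding dlap_def
  proof (rule sum.cong[OF refl])
    fix c :: 'a
    assume c: "c \<in> Basis"
    show "(u (reflection (y + h *\<^sub>R c)) + u (reflection (y - h *\<^sub>R c)) - 2 * u (reflection y)) / h\<^sup>2 =
      (u (reflection y + h *\<^sub>R c) + u (reflection y - h *\<^sub>R c) - 2 * u (reflection y)) / h\<^sup>2"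
      using reflection_translate[OF c, of y h] reflection_translate[OF c, of y "-h"]
      by (cases "c = b") auto
  qed
  moreover have "odd_part = (\<lambda>y. 1/2 * (u y - u (reflection y)))" by (auto simp: odd_part_def)
  ultimately have "dlap h odd_part y = (dlap h u y - dlap h u (reflection y)) / 2"
    by (simp only: dlap_cmult dlap_diff)
  moreover have "\<bar>dlap h u y\<bar> \<le> F" "\<bar>dlap h u (reflection y)\<bar> \<le> F"
    using assms half_box_subset_cube[OF assms] reflection_grid
    by (auto intro!: dlap_bound simp: half_box_def)
  ultimately show ?thesis by simp
qed

lemma dlap_brandt_barrier: "dlap h brandt_barrier y = - F - 2 * M / r\<^sup>2"
proof -
  have "dlap h brandt_barrier y = (\<Sum>c\<in>Basis. if c = b then - 2 * brandt_curvature else 2 * M / r\<^sup>2)"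
    unfolding brandt_barrier_def dlap_separable
    by (rule sum.cong) (use h r_pos in \<open>simp_all add: brandt_profile_def power2_eq_square field_simps\<close>)
  also have "\<dots> = - 2 * brandt_curvature + (\<Sum>c\<in>Basis - {b}. 2 * M / r\<^sup>2)"
    using b by (subst sum.remove[of _ b]) (auto intro!: sum.cong)
  also have "\<dots> = - 2 * brandt_curvature + (real DIM('a) - 1) * (2 * M / r\<^sup>2)"
    using b by (simp add: card_Diff_singleton of_nat_diff DIM_positive Suc_leI)
  also have "\<dots> = - F - 2 * M / r\<^sup>2"
    by (simp add: brandt_curvature_def algebra_simps add_divide_distrib diff_divide_distrib)
  finally show ?thesis .
qed

lemma brandt_barrier_eq:
  "brandt_barrier y = brandt_profile b ((y - x0) \<bullet> b) + (\<Sum>c\<in>Basis - {b}. M / r\<^sup>2 * ((y - x0) \<bullet> c)\<^sup>2)"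
  unfolding brandt_barrier_def using b by (subst sum.remove[of _ b]) (auto simp: brandt_profile_def)

lemma tangential_nonneg: "0 \<le> (\<Sum>c\<in>Basis - {b}. M / r\<^sup>2 * ((y - x0) \<bullet> c)\<^sup>2)"
  using M by (intro sum_nonneg) auto

lemma brandt_profile_ge:
  assumes "h \<le> t" "t \<le> r + h"
  shows "M / r * (t - h/2) \<le> brandt_profile b t"
proof -
  have T: "0 \<le> t - h/2" "t - h/2 \<le> 3/2 * r" using assms h h_le_r by auto
  have "brandt_curvature * (t - h/2) * (t - h/2) \<le> brandt_curvature * (3/2 * r) * (t - h/2)"
    using T brandt_curvature_pos by (intro mult_right_mono mult_left_mono) auto
  moreover have "0 \<le> brandt_curvature * h\<^sup>2 / 4" using brandt_curvature_pos by simp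
  ultimately show ?thesis unfolding brandt_profile_def by (simp add: power2_eq_square distrib_right)
qed

lemma brandt_barrier_ge_on_faces:
  assumes y: "y \<in> half_box"
    and face: "(y - x0) \<bullet> b = r + h \<or> (\<exists>c\<in>Basis - {b}. \<bar>(y - x0) \<bullet> c\<bar> = r)"
  shows "brandt_barrier y \<ge> M"
proof -
  have profile: "M / r * ((y - x0) \<bullet> b - h/2) \<le> brandt_profile b ((y - x0) \<bullet> b)"
    using y by (intro brandt_profile_ge) (auto simp: half_box_def)
  show ?thesis
    using face
  proof
    assume "(y - x0) \<bullet> b = r + h"
    then have "M / r * r \<le> M / r * ((y - x0) \<bullet> b - h/2)"
      using M r_pos h by (intro mult_left_mono) auto
    then show ?thesis using profile tangential_nonneg[of y] r_pos by (simp add: brandt_barrier_eq)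
  next
    assume "\<exists>c\<in>Basis - {b}. \<bar>(y - x0) \<bullet> c\<bar> = r"
    then obtain c where c: "c \<in> Basis - {b}" "\<bar>(y - x0) \<bullet> c\<bar> = r" by blast
    have "((y - x0) \<bullet> c)\<^sup>2 = r\<^sup>2" using c(2) by (metis power2_abs)
    then have "M = M / r\<^sup>2 * ((y - x0) \<bullet> c)\<^sup>2" using r_pos by simp
    also have "\<dots> \<le> (\<Sum>c\<in>Basis - {b}. M / r\<^sup>2 * ((y - x0) \<bullet> c)\<^sup>2)"
      using c(1) M by (intro member_le_sum) auto
    finally have "M \<le> (\<Sum>c\<in>Basis - {b}. M / r\<^sup>2 * ((y - x0) \<bullet> c)\<^sup>2)" .
    moreover have "0 \<le> M / r * ((y - x0) \<bullet> b - h/2)"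
      using y M r_pos h by (intro mult_nonneg_nonneg) (auto simp: half_box_def)
    ultimately show ?thesis using profile by (simp add: brandt_barrier_eq)
  qed
qed

lemma reflection_of_lowest_layer:
  assumes "(y - x0) \<bullet> b = h"
  shows "odd_part (y - h *\<^sub>R b) = - odd_part y" "0 \<le> brandt_barrier (y - h *\<^sub>R b) + brandt_barrier y"
proof -
  have "reflection y = y - h *\<^sub>R b" "reflection (y - h *\<^sub>R b) = y"
    using assms reflection_translate[OF b, of y "-h"] by (auto simp: reflection_def)
  then show "odd_part (y - h *\<^sub>R b) = - odd_part y" unfolding odd_part_def by (simp only:) argo
  have "(y - h *\<^sub>R b - x0) \<bullet> b = 0" using assms inner_translate[OF b b, of y "-h"] by simp
  then have "brandt_profile b ((y - h *\<^sub>R b - x0) \<bullet> b) + brandt_profile b ((y - x0) \<bullet> b) = 0"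
    using assms by (simp add: brandt_profile_def power2_eq_square field_simps)
  then show "0 \<le> brandt_barrier (y - h *\<^sub>R b) + brandt_barrier y"
    using tangential_nonneg[of y] tangential_nonneg[of "y - h *\<^sub>R b"] unfolding brandt_barrier_eq by linarith
qed

lemma half_box_neighbour:
  assumes y: "y \<in> half_box" and off_faces: "(y - x0) \<bullet> b \<noteq> r + h" "\<And>c. c \<in> Basis - {b} \<Longrightarrow> \<bar>(y - x0) \<bullet> c\<bar> \<noteq> r"
    and c: "c \<in> Basis"
  shows "y + h *\<^sub>R c \<in> half_box" "c \<noteq> b \<or> (y - x0) \<bullet> b \<noteq> h \<Longrightarrow> y - h *\<^sub>R c \<in> half_box"
proof -
  have y': "y \<in> grid h" "h \<le> (y - x0) \<bullet> b" "(y - x0) \<bullet> b < r + h"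
    "\<And>d. d \<in> Basis - {b} \<Longrightarrow> \<bar>(y - x0) \<bullet> d\<bar> < r"
    using y off_faces by (auto simp: half_box_def less_le)
  note grid = grid_diff[OF y'(1) x0]
  have below_top: "(y - x0) \<bullet> b + h \<le> r + h"
    using grid_inner_less_iff[OF h grid b, of "int N + 1"] y'(3) by (simp add: r distrib_left)
  have inside: "\<bar>(y - x0) \<bullet> d\<bar> + h \<le> r" if "d \<in> Basis - {b}" for d
    using grid_abs_inner_less_imp_le[OF h grid, of d "int N"] y'(4)[OF that] that by (simp add: r)
  have step: "y + t *\<^sub>R c \<in> half_box"
    if t: "\<bar>t\<bar> = h" "y + t *\<^sub>R c \<in> grid h" "c = b \<Longrightarrow> h \<le> (y - x0) \<bullet> b + t" for t
    using t inside y'(2,3) below_top c b unfolding half_box_def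
    by (fastforce simp: inner_translate split: if_splits)
  show "y + h *\<^sub>R c \<in> half_box" using step[of h] grid_step(1)[OF c y'(1)] h y'(2) by simp
  assume "c \<noteq> b \<or> (y - x0) \<bullet> b \<noteq> h"
  then have "c = b \<Longrightarrow> 2 * h \<le> (y - x0) \<bullet> b"
    using grid_inner_less_iff[OF h grid b, of 2] y'(2) grid_inner_less_iff[OF h grid b, of 1]
    by (force simp: not_less)
  then show "y - h *\<^sub>R c \<in> half_box" using step[of "- h"] grid_step(2)[OF c y'(1)] h by simp
qed

lemma odd_part_le_brandt_barrier:
  assumes "z \<in> half_box"
  shows "odd_part z \<le> brandt_barrier z"
proof (rule ccontr)
  assume pos_z: "\<not> ?thesis"
  define w where "w y = odd_part y - brandt_barrier y" for y
  have "half_box \<subseteq> cube x0 (r + h) \<inter> grid h" using half_box_subset_cube(1) by (auto simp: half_box_def)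
  then have "finite half_box" using finite_bounded_Int_grid[OF h bounded_cube] finite_subset by blast
  then obtain y where y: "y \<in> half_box" "\<And>z. z \<in> half_box \<Longrightarrow> w z \<le> w y"
    using finite_max_obtain[of half_box w] assms by blast
  have pos: "w y > 0" using y(2)[OF assms] pos_z by (simp add: w_def)
  then have "\<not> brandt_barrier y \<ge> M" using odd_part_le[OF y(1)] by (simp add: w_def)
  then have off_faces: "(y - x0) \<bullet> b \<noteq> r + h" "\<And>c. c \<in> Basis - {b} \<Longrightarrow> \<bar>(y - x0) \<bullet> c\<bar> \<noteq> r"
    using brandt_barrier_ge_on_faces[OF y(1)] by blast+
  note neighbour = half_box_neighbour[OF y(1) off_faces]
  have "dlap h w y \<le> 0"
  proof (rule dlap_nonpos_at_max)
    fix c :: 'a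
    assume c: "c \<in> Basis"
    show "w (y + h *\<^sub>R c) \<le> w y" by (rule y(2)[OF neighbour(1)[OF _ c]])
    show "w (y - h *\<^sub>R c) \<le> w y"
    proof (cases "c \<noteq> b \<or> (y - x0) \<bullet> b \<noteq> h")
      case True
      then show ?thesis by (intro y(2) neighbour(2)[OF _ c])
    next
      case False
      then show ?thesis using reflection_of_lowest_layer[of y] pos by (simp add: w_def)
    qed
  qed
  then have "2 * M / r\<^sup>2 \<le> 0"
    using dlap_odd_part_ge[OF y(1)] unfolding w_def dlap_diff dlap_brandt_barrier by simp
  then show False using M r_pos by (simp add: field_simps)
qed

lemma discrete_gradient_upper:
  "u (x0 + h *\<^sub>R b) - u x0 \<le> h * (M / r * (1 + 3/2 * real DIM('a)) + 3/4 * F * r)"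
proof -
  let ?y = "x0 + h *\<^sub>R b"
  have "(\<Sum>c\<in>Basis - {b}. M / r\<^sup>2 * ((?y - x0) \<bullet> c)\<^sup>2) = 0"
    using b by (intro sum.neutral) (auto simp: inner_Basis)
  then have barrier_y: "brandt_barrier ?y = (M / r + 3/2 * brandt_curvature * r) * h / 2"
    unfolding brandt_barrier_eq using b by (simp add: brandt_profile_def power2_eq_square field_simps)
  have "?y \<in> half_box"
    using grid_step(1)[OF b x0] b h r_pos by (auto simp: half_box_def inner_Basis)
  then have "odd_part ?y \<le> brandt_barrier ?y" by (rule odd_part_le_brandt_barrier)
  then have "u ?y - u (reflection ?y) \<le> (M / r + 3/2 * brandt_curvature * r) * h"
    unfolding odd_part_def barrier_y by argo
  moreover have "reflection ?y = x0" using b by (simp add: reflection_def)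
  moreover have "M / r + 3/2 * brandt_curvature * r = M / r * (1 + 3/2 * real DIM('a)) + 3/4 * F * r"
    using r_pos by (simp add: brandt_curvature_def field_simps power2_eq_square)
  ultimately show ?thesis by (simp add: mult.commute)
qed

end

lemma discrete_gradient_estimate:
  fixes u :: "'a::euclidean_space \<Rightarrow> real"
  assumes h: "h > 0" and N: "N \<ge> (1::nat)" and r: "r = h * real N" and b: "b \<in> Basis"
    and x0: "x0 \<in> grid h" and M: "M > 0" and F: "F \<ge> 0"
    and u_bound: "\<And>y. y \<in> grid h \<Longrightarrow> y \<in> cube x0 (r + h) \<Longrightarrow> \<bar>u y\<bar> \<le> M"
    and dlap_bound: "\<And>y. y \<in> grid h \<Longrightarrow> y \<in> cube x0 (r + h) \<Longrightarrow> \<bar>dlap h u y\<bar> \<le> F"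
  shows "\<bar>fdiff h b u x0\<bar> \<le> M / r * (1 + 3/2 * real DIM('a)) + 3/4 * F * r"
proof -
  define K where "K = M / r * (1 + 3/2 * real DIM('a)) + 3/4 * F * r"
  have upper: "u (x0 + h *\<^sub>R b) - u x0 \<le> h * K"
    unfolding K_def by (rule discrete_gradient_upper[OF h N r b x0 M F u_bound dlap_bound])
  have "(-1) * u (x0 + h *\<^sub>R b) - (-1) * u x0 \<le> h * K"
    unfolding K_def by (rule discrete_gradient_upper[OF h N r b x0 M F])
      (use u_bound dlap_bound in \<open>auto simp: dlap_cmult[of _ "-1", simplified]\<close>)
  then have "\<bar>u (x0 + h *\<^sub>R b) - u x0\<bar> \<le> h * K" using upper by simp
  then show ?thesis
    unfolding fdiff_def K_def[symmetric] abs_divide using h by (simp add: pos_divide_le_eq mult.commute)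
qed

lemma dlap_eq_sum_fdiff:
  assumes "h \<noteq> 0"
  shows "dlap h u x = (\<Sum>b\<in>Basis. fdiff h b (fdiff h b u) (x - h *\<^sub>R b))"
  unfolding dlap_def fdiff_def using assms
  by (intro sum.cong) (auto simp: power2_eq_square diff_divide_distrib add_divide_distrib)

lemma dlap_fdiff: "dlap h (fdiff h b u) = fdiff h b (dlap h u)"
proof
  fix x
  show "dlap h (fdiff h b u) x = fdiff h b (dlap h u) x"
    unfolding fdiff_def[of h b "dlap h u"] dlap_def fdiff_def sum_subtractf[symmetric] sum_divide_distrib
    by (rule sum.cong) (simp_all add: diff_divide_distrib add_divide_distrib algebra_simps)
qed

lemma fdiff_mult:
  "fdiff h b (\<lambda>x. p x * q x) = (\<lambda>x. p (x + h *\<^sub>R b) * fdiff h b q x + fdiff h b p x * q x)"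
  by (rule ext) (simp add: fdiff_def diff_divide_distrib algebra_simps)

lemma fdiff_add: "fdiff h b (\<lambda>x. p x + q x) = (\<lambda>x. fdiff h b p x + fdiff h b q x)"
  by (rule ext) (simp add: fdiff_def diff_divide_distrib add_divide_distrib)

lemma fdiff_translate: "fdiff h b (\<lambda>x. p (x + h *\<^sub>R c)) = (\<lambda>x. fdiff h b p (x + h *\<^sub>R c))"
  by (rule ext) (simp add: fdiff_def algebra_simps)

locale schroedinger_domain =
  fixes Om :: "'a::euclidean_space set" and V :: "'a \<Rightarrow> real" and gV :: "'a \<Rightarrow> 'a" and M :: real
  assumes open_Om: "open Om" and convex_Om: "convex Om" and bounded_Om: "bounded Om" and Om_ne: "Om \<noteq> {}"
    and V_deriv: "\<And>x. x \<in> Om \<Longrightarrow> (V has_derivative (\<lambda>v. gV x \<bullet> v)) (at x)"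
    and V_bound: "\<And>x. x \<in> Om \<Longrightarrow> \<bar>V x\<bar> \<le> M"
    and gV_bound: "\<And>x. x \<in> Om \<Longrightarrow> norm (gV x) \<le> M"
    and gV_lipschitz: "\<And>x y. x \<in> Om \<Longrightarrow> y \<in> Om \<Longrightarrow> norm (gV x - gV y) \<le> M * norm (x - y)"
begin

lemma M_nonneg: "M \<ge> 0"
  using V_bound Om_ne by force

lemma finite_Om_Int_grid: "h > 0 \<Longrightarrow> finite (Om \<inter> grid h)"
  by (rule finite_bounded_Int_grid[OF _ bounded_Om])

definition rayleigh_bound :: "real \<Rightarrow> real \<Rightarrow> bool" where
  "rayleigh_bound h l \<longleftrightarrow> (\<forall>w. (\<forall>x. x \<notin> Om \<inter> grid h \<longrightarrow> w x = 0) \<longrightarrow>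
    l * (\<Sum>x\<in>Om \<inter> grid h. (w x)\<^sup>2) \<le> (\<Sum>x\<in>Om \<inter> grid h. w x * (V x * w x - dlap h w x)))"

definition schroedinger_matrix :: "real \<Rightarrow> 'a \<Rightarrow> 'a \<Rightarrow> real" where
  "schroedinger_matrix h x y = (if y = x then V x else 0) + (\<Sum>b\<in>Basis.
    (2 * of_bool (y = x) - of_bool (y = x + h *\<^sub>R b) - of_bool (y = x - h *\<^sub>R b)) / h\<^sup>2)"

lemma schroedinger_matrix_sym: "schroedinger_matrix h x y = schroedinger_matrix h y x"
proof -
  have "(y = x + h *\<^sub>R b) = (x = y - h *\<^sub>R b)" "(y = x - h *\<^sub>R b) = (x = y + h *\<^sub>R b)" for b
    by (auto simp: algebra_simps)
  then show ?thesis unfolding schroedinger_matrix_def by (auto intro!: sum.cong)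
qed

lemma schroedinger_matrix_off_diagonal: "x \<noteq> y \<Longrightarrow> schroedinger_matrix h x y \<le> 0"
  unfolding schroedinger_matrix_def by (auto intro!: sum_nonpos divide_nonpos_nonneg)

lemma sum_schroedinger_matrix:
  assumes h: "h > 0" and x: "x \<in> Om \<inter> grid h" and w: "\<And>y. y \<notin> Om \<inter> grid h \<Longrightarrow> w y = 0"
  shows "(\<Sum>y\<in>Om \<inter> grid h. schroedinger_matrix h x y * w y) = V x * w x - dlap h w x"
proof -
  define A where "A = Om \<inter> grid h"
  have fin: "finite A" unfolding A_def by (rule finite_Om_Int_grid[OF h])
  have delta: "(\<Sum>y\<in>A. of_bool (y = z) * w y) = w z" for z
    using fin w[of z] by (simp add: A_def of_bool_def if_distrib[where f = "\<lambda>t. t * _"] cong: if_cong)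
  have "(\<Sum>y\<in>A. schroedinger_matrix h x y * w y) = (\<Sum>y\<in>A. V x * (of_bool (y = x) * w y) +
    (\<Sum>b\<in>Basis. (2 * (of_bool (y = x) * w y) - of_bool (y = x + h *\<^sub>R b) * w y
      - of_bool (y = x - h *\<^sub>R b) * w y) / h\<^sup>2))"
    unfolding schroedinger_matrix_def distrib_right sum_distrib_right
    by (intro arg_cong2[where f = "(+)"] sum.cong refl) (auto simp: algebra_simps diff_divide_distrib)
  also have "\<dots> = V x * w x + (\<Sum>b\<in>Basis. \<Sum>y\<in>A. (2 * (of_bool (y = x) * w y) -
      of_bool (y = x + h *\<^sub>R b) * w y - of_bool (y = x - h *\<^sub>R b) * w y) / h\<^sup>2)"
    unfolding sum.distrib sum_distrib_left[symmetric] delta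
    by (rule arg_cong2[where f = "(+)", OF refl sum.swap])
  also have "\<dots> = V x * w x + (\<Sum>b\<in>Basis. (2 * w x - w (x + h *\<^sub>R b) - w (x - h *\<^sub>R b)) / h\<^sup>2)"
    unfolding sum_divide_distrib[symmetric] sum_subtractf sum_distrib_left[symmetric] delta ..
  also have "(\<Sum>b\<in>Basis. (2 * w x - w (x + h *\<^sub>R b) - w (x - h *\<^sub>R b)) / h\<^sup>2) = - dlap h w x"
    unfolding dlap_def sum_negf[symmetric] using h by (intro sum.cong) (auto simp: field_simps)
  finally show ?thesis by (simp add: A_def)
qed

lemma discrete_ground_state:
  assumes h: "h > 0" and meets_grid: "Om \<inter> grid h \<noteq> {}"
  obtains u l where "\<And>x. 0 \<le> u x" "\<And>x. u x \<le> 1" "\<And>x. x \<notin> Om \<inter> grid h \<Longrightarrow> u x = 0"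
    "\<exists>x\<in>Om \<inter> grid h. u x = 1"
    "\<And>x. x \<in> Om \<inter> grid h \<Longrightarrow> dlap h u x = (V x - l) * u x"
    "rayleigh_bound h l"
proof -
  define A where "A = Om \<inter> grid h"
  have fin: "finite A" unfolding A_def by (rule finite_Om_Int_grid[OF h])
  let ?a = "schroedinger_matrix h"
  obtain u l where u: "\<And>x. 0 \<le> u x" "\<And>x. x \<notin> A \<Longrightarrow> u x = 0" "\<exists>x\<in>A. u x \<noteq> 0"
    and eigen: "\<And>x. x \<in> A \<Longrightarrow> (\<Sum>y\<in>A. ?a x y * u y) = l * u x"
    and min: "\<And>w. l * (\<Sum>x\<in>A. (w x)\<^sup>2) \<le> bilinear_form A ?a w w"
    by (rule nonneg_ground_state_of_symmetric_matrix[OF fin meets_grid[folded A_def], of ?a])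
      (use schroedinger_matrix_sym schroedinger_matrix_off_diagonal in \<open>blast+\<close>)
  obtain m where m: "m \<in> A" "\<And>x. x \<in> A \<Longrightarrow> u x \<le> u m"
    using finite_max_obtain[OF fin, of u] meets_grid unfolding A_def by blast
  have u_m_pos: "u m > 0" using u(1,3) m(2) by (metis less_eq_real_def less_le_trans)
  define v where "v = (\<lambda>x. 1 / u m * u x)"
  note matrix = sum_schroedinger_matrix[OF h, folded A_def]
  show ?thesis
  proof (rule that[of v l])
    show "0 \<le> v x" for x using u(1) u_m_pos by (simp add: v_def)
    show "v x \<le> 1" for x using u(2)[of x] m(2)[of x] u_m_pos by (cases "x \<in> A") (auto simp: v_def)
    show "v x = 0" if "x \<notin> Om \<inter> grid h" for x using u(2) that by (simp add: v_def A_def)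
    show "\<exists>x\<in>Om \<inter> grid h. v x = 1" using m(1) u_m_pos by (auto simp: v_def A_def)
    show "dlap h v x = (V x - l) * v x" if "x \<in> Om \<inter> grid h" for x
      using eigen[of x] matrix[of x u] u(2) that unfolding v_def dlap_cmult
      by (simp add: A_def algebra_simps flip: add_divide_distrib)
    show "rayleigh_bound h l"
      unfolding rayleigh_bound_def A_def[symmetric]
    proof (intro allI impI)
      fix w :: "'a \<Rightarrow> real"
      assume "\<forall>x. x \<notin> A \<longrightarrow> w x = 0"
      then have "bilinear_form A ?a w w = (\<Sum>x\<in>A. w x * (V x * w x - dlap h w x))"
        unfolding bilinear_form_def[OF fin] by (intro sum.cong) (simp_all add: matrix)
      then show "l * (\<Sum>x\<in>A. (w x)\<^sup>2) \<le> (\<Sum>x\<in>A. w x * (V x * w x - dlap h w x))"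
        using min[of w] by simp
    qed
  qed
qed

end

definition cos_bump :: "real \<Rightarrow> real \<Rightarrow> real" where
  "cos_bump L t = (if \<bar>t\<bar> < L then cos (pi * t / (2 * L)) else 0)"

lemma cos_bump_second_difference:
  assumes t: "\<bar>t\<bar> + h \<le> L" and h: "h > 0"
  shows "cos_bump L (t + h) + cos_bump L (t - h) = 2 * cos (pi * h / (2 * L)) * cos_bump L t"
proof -
  have L: "L > 0" "\<bar>t\<bar> < L" using t h by auto
  have shifted: "cos_bump L (t + e) = cos (pi * (t + e) / (2 * L))" if "\<bar>e\<bar> = h" for e
  proof (cases "\<bar>t + e\<bar> < L")
    case False
    then consider "t + e = L" | "t + e = - L" using t \<open>\<bar>e\<bar> = h\<close> by linarith
    then have "cos (pi * (t + e) / (2 * L)) = 0" using L(1) by cases simp_all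
    then show ?thesis using False by (simp add: cos_bump_def)
  qed (simp add: cos_bump_def)
  have "pi * (t + h) / (2 * L) = pi * t / (2 * L) + pi * h / (2 * L)"
    "pi * (t + - h) / (2 * L) = pi * t / (2 * L) - pi * h / (2 * L)"
    by (simp_all add: add_divide_distrib diff_divide_distrib algebra_simps)
  then show ?thesis
    using shifted[of h] shifted[of "- h"] h L by (simp add: cos_add cos_diff cos_bump_def)
qed

text \<open>Test function for the Rayleigh quotient: inside its support it is an exact eigenfunction of the
  discrete Laplacian.\<close>

definition cos_product :: "real \<Rightarrow> real \<Rightarrow> 'a::euclidean_space \<Rightarrow> 'a \<Rightarrow> real" where
  "cos_product h L c x = (if x \<in> grid h then \<Prod>b\<in>Basis. cos_bump L ((x - c) \<bullet> b) else 0)"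

lemma cos_product_nonzero:
  "cos_product h L c x \<noteq> 0 \<Longrightarrow> x \<in> grid h \<and> (\<forall>b\<in>Basis. \<bar>(x - c) \<bullet> b\<bar> < L)"
  by (auto simp: cos_product_def cos_bump_def split: if_splits)

lemma dlap_cos_product:
  fixes c x :: "'a::euclidean_space"
  assumes h: "h > 0" and L: "L = h * real N" and c: "c \<in> grid h" and x: "cos_product h L c x \<noteq> 0"
  shows "dlap h (cos_product h L c) x =
    - (real DIM('a) * ((2 - 2 * cos (pi * h / (2 * L))) / h\<^sup>2)) * cos_product h L c x"
proof -
  let ?w = "cos_product h L c"
  have grid_x: "x \<in> grid h" and inside: "\<And>b. b \<in> Basis \<Longrightarrow> \<bar>(x - c) \<bullet> b\<bar> < L"
    using cos_product_nonzero[OF x] by blast+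
  have "?w (x + h *\<^sub>R b) + ?w (x - h *\<^sub>R b) = 2 * cos (pi * h / (2 * L)) * ?w x" if b: "b \<in> Basis" for b
  proof -
    define t where "t = (x - c) \<bullet> b"
    define P where "P = (\<Prod>d\<in>Basis - {b}. cos_bump L ((x - c) \<bullet> d))"
    have factor: "?w (x + e *\<^sub>R b) = cos_bump L (t + e) * P" if "x + e *\<^sub>R b \<in> grid h" for e
    proof -
      have "(\<Prod>d\<in>Basis - {b}. cos_bump L ((x + e *\<^sub>R b - c) \<bullet> d)) = P"
        unfolding P_def using b by (intro prod.cong) (auto simp: algebra_simps inner_Basis)
      moreover have "(x + e *\<^sub>R b - c) \<bullet> b = t + e" using b by (simp add: t_def algebra_simps)
      ultimately show ?thesis using that b by (simp add: cos_product_def prod.remove)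
    qed
    have "\<bar>t\<bar> + h \<le> L"
      using grid_abs_inner_less_imp_le[OF h grid_diff[OF grid_x c] b, of "int N"] inside[OF b]
      by (simp add: t_def L)
    from cos_bump_second_difference[OF this h]
    show ?thesis using factor[of h] factor[of "- h"] factor[of 0] grid_step[OF b grid_x] grid_x
      by (simp add: distrib_right[symmetric])
  qed
  then have "dlap h ?w x = (\<Sum>b\<in>(Basis::'a set). (2 * cos (pi * h / (2 * L)) - 2) * ?w x / h\<^sup>2)"
    unfolding dlap_def by (intro sum.cong) (simp_all only: left_diff_distrib)
  then show ?thesis by (simp add: algebra_simps diff_divide_distrib)
qed

lemma one_minus_cos_le: "2 - 2 * cos t \<le> (t::real)\<^sup>2"
proof -
  have "(sin (t / 2))\<^sup>2 \<le> (t / 2)\<^sup>2" using abs_sin_x_le_abs_x[of "t / 2"] abs_le_square_iff by blast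
  then show ?thesis using cos_double_sin[of "t / 2"] by (simp add: power_divide)
qed

definition gfloor :: "real \<Rightarrow> 'a::euclidean_space \<Rightarrow> 'a" where
  "gfloor h x = (\<Sum>b\<in>Basis. (h * of_int \<lfloor>(x \<bullet> b) / h\<rfloor>) *\<^sub>R b)"

lemma gfloor_inner: "b \<in> Basis \<Longrightarrow> gfloor h x \<bullet> b = h * of_int \<lfloor>(x \<bullet> b) / h\<rfloor>"
  unfolding gfloor_def by (simp add: inner_sum_left inner_Basis if_distrib cong: if_cong)

lemma gfloor_grid: "gfloor h x \<in> grid h"
  unfolding grid_def by (auto simp: gfloor_inner)

lemma gfloor_close:
  assumes "h > 0" "b \<in> Basis"
  shows "\<bar>(gfloor h x - x) \<bullet> b\<bar> \<le> h"
proof -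
  have "of_int \<lfloor>(x \<bullet> b) / h\<rfloor> \<le> (x \<bullet> b) / h" "(x \<bullet> b) / h \<le> of_int \<lfloor>(x \<bullet> b) / h\<rfloor> + 1" by linarith+
  from mult_left_mono[OF this(1), of h] mult_left_mono[OF this(2), of h] show ?thesis
    using assms by (simp add: gfloor_inner inner_diff_left distrib_left abs_le_iff)
qed

lemma norm_gfloor_diff:
  fixes x :: "'a::euclidean_space"
  shows "h > 0 \<Longrightarrow> norm (gfloor h x - x) \<le> real DIM('a) * h"
  by (rule norm_le_DIM_mult[OF gfloor_close])

context schroedinger_domain
begin

lemma rayleigh_bound_le_of_test_function:
  assumes h: "h > 0" and l: "rayleigh_bound h l" and c: "c \<in> Om \<inter> grid h" "w c \<noteq> 0"
    and support: "\<And>x. x \<notin> Om \<inter> grid h \<Longrightarrow> w x = 0"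
    and bound: "\<And>x. x \<in> Om \<inter> grid h \<Longrightarrow> w x * (V x * w x - dlap h w x) \<le> C * (w x)\<^sup>2"
  shows "l \<le> C"
proof -
  have "l * (\<Sum>x\<in>Om \<inter> grid h. (w x)\<^sup>2) \<le> (\<Sum>x\<in>Om \<inter> grid h. w x * (V x * w x - dlap h w x))"
    using l support unfolding rayleigh_bound_def by blast
  also have "\<dots> \<le> C * (\<Sum>x\<in>Om \<inter> grid h. (w x)\<^sup>2)"
    unfolding sum_distrib_left by (intro sum_mono bound)
  finally show ?thesis
    using sum_pos2[OF finite_Om_Int_grid[OF h] c(1), of "\<lambda>x. (w x)\<^sup>2"] c(2) by simp
qed

lemma rayleigh_bound_le:
  fixes p :: 'a
  assumes cube: "cube p r \<subseteq> Om" and h: "0 < h" "h \<le> r / 4" and l: "rayleigh_bound h l"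
  shows "l \<le> real DIM('a) * (2 * pi / r)\<^sup>2 + M"
proof -
  define c where "c = gfloor h p"
  define N where "N = nat \<lfloor>r / (2 * h)\<rfloor>"
  define L where "L = h * real N"
  define w where "w = cos_product h L c"
  have r: "r > 0" using h by simp
  have "2 \<le> r / (2 * h)" using h by (simp add: field_simps)
  then have N: "real N \<le> r / (2 * h)" "r / (2 * h) - 1 \<le> real N" unfolding N_def by linarith+
  have L: "L \<le> r / 2" "r / 4 \<le> L"
    using mult_left_mono[OF N(1), of h] mult_left_mono[OF N(2), of h] h
    by (simp_all add: L_def right_diff_distrib)
  have L_pos: "L > 0" using L(2) r by simp
  have c: "c \<in> grid h" unfolding c_def by (rule gfloor_grid)
  show ?thesis
  proof (rule rayleigh_bound_le_of_test_function[OF h(1) l])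
    show support: "w x = 0" if "x \<notin> Om \<inter> grid h" for x
    proof (rule ccontr)
      assume "w x \<noteq> 0"
      then have x: "x \<in> grid h" "\<And>b. b \<in> Basis \<Longrightarrow> \<bar>(x - c) \<bullet> b\<bar> < L"
        using cos_product_nonzero[of h L c x] by (auto simp: w_def)
      have "\<bar>(x - p) \<bullet> b\<bar> \<le> r" if b: "b \<in> Basis" for b
        using x(2)[OF b] gfloor_close[OF h(1) b, of p] L h by (simp add: c_def inner_diff_left)
      then show False using cube x(1) that by (auto simp: cube_def)
    qed
    show w_center_nonzero: "w c \<noteq> 0" using c L_pos by (simp add: w_def cos_product_def cos_bump_def)
    show "c \<in> Om \<inter> grid h" using support w_center_nonzero by blast
    fix x
    assume x: "x \<in> Om \<inter> grid h"
    define K where "K = real DIM('a) * ((2 - 2 * cos (pi * h / (2 * L))) / h\<^sup>2)"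
    have "(2 - 2 * cos (pi * h / (2 * L))) / h\<^sup>2 \<le> (pi * h / (2 * L))\<^sup>2 / h\<^sup>2"
      by (intro divide_right_mono one_minus_cos_le) simp
    also have "\<dots> = (pi / (2 * L))\<^sup>2" using h by (simp add: power_divide power_mult_distrib)
    also have "\<dots> \<le> (2 * pi / r)\<^sup>2" using L L_pos r by (intro power_mono) (auto simp: field_simps)
    finally have "K \<le> real DIM('a) * (2 * pi / r)\<^sup>2" unfolding K_def by (rule mult_left_mono) simp
    then have "V x + K \<le> real DIM('a) * (2 * pi / r)\<^sup>2 + M" using V_bound[of x] x by simp
    moreover have "w x * (V x * w x - dlap h w x) = (V x + K) * (w x)\<^sup>2"
    proof (cases "w x = 0")
      case False
      then have "dlap h w x = - K * w x"
        unfolding w_def K_def by (rule dlap_cos_product[OF h(1) L_def c])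
      then show ?thesis by (simp add: power2_eq_square algebra_simps)
    qed simp
    ultimately show "w x * (V x * w x - dlap h w x) \<le> (real DIM('a) * (2 * pi / r)\<^sup>2 + M) * (w x)\<^sup>2"
      by (simp add: mult_right_mono)
  qed
qed

lemma discrete_eigenvalue_ge:
  assumes h: "h > 0" and u: "\<And>x. u x \<le> 1" "x \<in> Om" "u x = 1" "dlap h u x = (V x - l) * u x"
  shows "- M \<le> l"
proof -
  have "dlap h u x \<le> 0" by (rule dlap_nonpos_at_max) (simp_all add: u(1,3))
  then show ?thesis using u V_bound[of x] by simp
qed

context
  fixes h D t l C :: real and nu :: 'a and u :: "'a \<Rightarrow> real"
  assumes h: "h > 0" "h \<le> D" and nu: "norm nu = 1"
    and slab: "\<And>x. x \<in> Om \<Longrightarrow> 0 < t - x \<bullet> nu \<and> t - x \<bullet> nu \<le> D"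
    and u01: "\<And>x. u x \<le> 1" "\<And>x. 0 \<le> u x" and u_zero: "\<And>x. x \<notin> Om \<inter> grid h \<Longrightarrow> u x = 0"
    and u_eq: "\<And>x. x \<in> Om \<inter> grid h \<Longrightarrow> dlap h u x = (V x - l) * u x" and l: "l \<le> C" and C: "C \<ge> 0"
begin

definition slab_barrier :: "'a \<Rightarrow> real" where
  "slab_barrier x = (C + M + 1) * (2 * D * (t - x \<bullet> nu) - (t - x \<bullet> nu)\<^sup>2)"

lemma dlap_slab_barrier: "dlap h slab_barrier y = - 2 * (C + M + 1)"
proof -
  have "slab_barrier (y + h *\<^sub>R b) + slab_barrier (y - h *\<^sub>R b) - 2 * slab_barrier y =
    - 2 * (C + M + 1) * h\<^sup>2 * (nu \<bullet> b)\<^sup>2" for b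
    by (simp add: slab_barrier_def power2_eq_square algebra_simps inner_commute)
  then have "dlap h slab_barrier y = (\<Sum>b\<in>Basis. - 2 * (C + M + 1) * (nu \<bullet> b)\<^sup>2)"
    unfolding dlap_def using h by (intro sum.cong) auto
  also have "\<dots> = - 2 * (C + M + 1) * (nu \<bullet> nu)"
    by (simp add: sum_distrib_left euclidean_inner[of nu nu] power2_eq_square)
  finally show ?thesis using nu by (simp add: norm_eq_1)
qed

lemma slab_barrier_le:
  assumes "x \<in> Om"
  shows "slab_barrier x \<le> 3 * (C + M + 1) * D * (t - x \<bullet> nu)"
proof -
  have "(t - x \<bullet> nu) * (2 * D - (t - x \<bullet> nu)) \<le> (t - x \<bullet> nu) * (3 * D)"
    using slab[OF assms] h by (intro mult_left_mono) auto
  then have "(C + M + 1) * ((t - x \<bullet> nu) * (2 * D - (t - x \<bullet> nu))) \<le> (C + M + 1) * ((t - x \<bullet> nu) * (3 * D))"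
    by (rule mult_left_mono) (use C M_nonneg in simp)
  then show ?thesis by (simp add: slab_barrier_def power2_eq_square algebra_simps)
qed

lemma slab_barrier_neighbour_ge:
  assumes y: "y \<in> Om" and b: "b \<in> Basis" and e: "\<bar>e\<bar> = h"
  shows "- slab_barrier (y + e *\<^sub>R b) \<le> 3 * (C + M + 1) * D * h"
proof -
  define s where "s = t - (y + e *\<^sub>R b) \<bullet> nu"
  have "\<bar>b \<bullet> nu\<bar> \<le> 1" using Basis_le_norm[OF b, of nu] nu by (simp add: inner_commute)
  then have "\<bar>e * (b \<bullet> nu)\<bar> \<le> h" using h e by (simp add: abs_mult mult_left_le)
  then have s: "\<bar>s - (t - y \<bullet> nu)\<bar> \<le> h" by (simp add: s_def inner_add_left)
  have "- (s * (2 * D - s)) \<le> 3 * D * h"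
  proof (cases "s \<ge> 0")
    case True
    then have "0 \<le> s * (2 * D - s)" using s slab[OF y] h by (intro mult_nonneg_nonneg) auto
    moreover have "0 \<le> 3 * D * h" using h by simp
    ultimately show ?thesis by linarith
  next
    case False
    have "(- s) * (2 * D - s) \<le> h * (3 * D)" using False s slab[OF y] h by (intro mult_mono) auto
    then show ?thesis by (simp add: mult.commute)
  qed
  then have "(C + M + 1) * (- (s * (2 * D - s))) \<le> (C + M + 1) * (3 * D * h)"
    using C M_nonneg by (intro mult_left_mono) auto
  then show ?thesis unfolding slab_barrier_def s_def[symmetric] by (simp add: power2_eq_square algebra_simps)
qed

lemma dlap_u_ge:
  assumes y: "y \<in> Om \<inter> grid h"
  shows "dlap h u y \<ge> - (C + M)"
proof -
  define K where "K = C + M"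
  have "- K \<le> V y - l" using V_bound[of y] y l by (auto simp: K_def abs_le_iff)
  from mult_right_mono[OF this u01(2)[of y]] have "- (K * u y) \<le> (V y - l) * u y" by simp
  moreover have "K * u y \<le> K * 1" using C M_nonneg u01(1) by (intro mult_left_mono) (auto simp: K_def)
  ultimately show ?thesis unfolding u_eq[OF y] K_def[symmetric] by simp
qed

lemma discrete_slab_estimate:
  assumes x: "x \<in> Om"
  shows "u x \<le> 3 * (C + M + 1) * D * (t - x \<bullet> nu + h)"
proof (cases "x \<in> Om \<inter> grid h")
  case False
  moreover have "0 \<le> 3 * (C + M + 1) * D * (t - x \<bullet> nu + h)" using slab[OF x] C M_nonneg h by simp
  ultimately show ?thesis using u_zero by simp
next
  case True
  define w where "w z = u z - slab_barrier z" for z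
  obtain y where y: "y \<in> Om \<inter> grid h" "\<And>z. z \<in> Om \<inter> grid h \<Longrightarrow> w z \<le> w y"
    using finite_max_obtain[OF finite_Om_Int_grid[OF h(1)], of w] True by blast
  have "\<exists>b\<in>Basis. \<exists>e. \<bar>e\<bar> = h \<and> w y < w (y + e *\<^sub>R b)"
  proof (rule ccontr)
    assume "\<not> ?thesis"
    then have neighbour: "w (y + e *\<^sub>R b) \<le> w y" if "b \<in> Basis" "\<bar>e\<bar> = h" for b e using that by force
    have "dlap h w y \<le> 0"
      by (rule dlap_nonpos_at_max) (use neighbour[of _ h] neighbour[of _ "- h"] h in auto)
    then show False
      using dlap_u_ge[OF y(1)] C M_nonneg unfolding w_def dlap_diff dlap_slab_barrier by simp
  qed
  then obtain b e where neighbour: "b \<in> Basis" "\<bar>e\<bar> = h" "w y < w (y + e *\<^sub>R b)" by blast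
  have "y + e *\<^sub>R b \<notin> Om \<inter> grid h" using y(2) neighbour(3) by force
  then have "w (y + e *\<^sub>R b) = - slab_barrier (y + e *\<^sub>R b)" using u_zero by (simp add: w_def)
  then have "w x \<le> 3 * (C + M + 1) * D * h"
    using y(2)[OF True] neighbour(3) slab_barrier_neighbour_ge[OF _ neighbour(1,2)] y(1) by fastforce
  then show ?thesis using slab_barrier_le[OF x] by (simp add: w_def algebra_simps)
qed

end

end

section \<open>The ground state of a Schroedinger operator\<close>

text \<open>Grid functions \<open>w h\<close> on the grids of mesh \<open>h\<close> converge continuously to \<open>U\<close> at \<open>p\<close> if
  \<open>w h x\<close> tends to \<open>U p\<close> along this filter, i.e. as \<open>h\<close> runs through \<open>G\<close> and the grid points \<open>x\<close> tend to \<open>p\<close>.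
  Working with a filter \<open>G\<close> in place of a sequence of meshes makes compactness an instance of Tychonoff's theorem.\<close>

definition grid_filter :: "real filter \<Rightarrow> 'a::euclidean_space \<Rightarrow> (real \<times> 'a) filter" where
  "grid_filter G p = inf (G \<times>\<^sub>F nhds p) (principal {(h, x). x \<in> grid h})"

lemma eventually_grid_filter:
  "(\<forall>\<^sub>F (h, x) in grid_filter G p. P h x) \<longleftrightarrow>
    (\<exists>r>0. \<forall>\<^sub>F h in G. \<forall>x\<in>grid h. dist x p < r \<longrightarrow> P h x)" (is "?lhs \<longleftrightarrow> ?rhs")
proof
  assume ?lhs
  then obtain Q R where "eventually Q G" "eventually R (nhds p)"
    "\<And>h x. Q h \<Longrightarrow> R x \<Longrightarrow> x \<in> grid h \<longrightarrow> P h x"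
    unfolding grid_filter_def eventually_inf_principal eventually_prod_filter by auto
  moreover from this(2) obtain r where "r > 0" "\<And>x. dist x p < r \<Longrightarrow> R x"
    unfolding eventually_nhds_metric by blast
  ultimately show ?rhs by (intro exI[of _ r]) (auto elim: eventually_mono)
next
  assume ?rhs
  then obtain r where r: "r > 0" "\<forall>\<^sub>F h in G. \<forall>x\<in>grid h. dist x p < r \<longrightarrow> P h x" by blast
  moreover have "\<forall>\<^sub>F x in nhds p. dist x p < r" using r(1) eventually_nhds_metric by blast
  ultimately show ?lhs
    unfolding grid_filter_def eventually_inf_principal eventually_prod_filter by (intro exI conjI) auto
qed

lemma grid_filter_mono: "G \<le> G' \<Longrightarrow> grid_filter G p \<le> grid_filter G' p"
  unfolding grid_filter_def by (intro inf_mono prod_filter_mono order_refl)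

lemma eventually_grid_filter_in_grid: "\<forall>\<^sub>F z in grid_filter G p. snd z \<in> grid (fst z)"
  unfolding grid_filter_def eventually_inf_principal by (simp add: case_prod_unfold)

lemma filterlim_grid_filter_fst_snd:
  "filterlim fst G (grid_filter G p)" "(snd \<longlongrightarrow> p) (grid_filter G p)"
  unfolding grid_filter_def
  by (rule filterlim_mono[OF filterlim_fst order_refl inf_le1], rule filterlim_mono[OF filterlim_snd order_refl inf_le1])

lemma filterlim_into_grid_filter:
  assumes "filterlim k G F" "(f \<longlongrightarrow> p) F" "\<forall>\<^sub>F i in F. f i \<in> grid (k i)"
  shows "filterlim (\<lambda>i. (k i, f i)) (grid_filter G p) F"
  unfolding grid_filter_def filterlim_inf filterlim_principal
  using filterlim_Pair[OF assms(1,2)] assms(3) by simp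

lemma filterlim_at_right_0D:
  assumes "filterlim k G F" "G \<le> at_right (0::real)"
  shows "(k \<longlongrightarrow> 0) F" "\<forall>\<^sub>F i in F. k i > 0"
proof -
  have "filterlim k (at_right 0) F" using filterlim_mono[OF assms(1,2)] by simp
  then show "(k \<longlongrightarrow> 0) F" "\<forall>\<^sub>F i in F. k i > 0"
    by (simp_all add: filterlim_at eventually_conj_iff)
qed

lemma eventually_at_right_0_le:
  assumes "G \<le> at_right (0::real)" "e > 0"
  shows "\<forall>\<^sub>F h in G. 0 < h \<and> h \<le> e"
proof (rule filter_leD[OF assms(1)])
  show "\<forall>\<^sub>F h in at_right 0. 0 < h \<and> h \<le> e"
    unfolding eventually_at_right_field by (rule exI[of _ e]) (use assms(2) in auto)
qed

lemma tendsto_gfloor: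
  fixes f :: "'i \<Rightarrow> 'a::euclidean_space"
  assumes k: "filterlim k G F" "G \<le> at_right 0" and f: "(f \<longlongrightarrow> p) F"
  shows "((\<lambda>i. gfloor (k i) (f i)) \<longlongrightarrow> p) F"
proof -
  have "((\<lambda>i. gfloor (k i) (f i) - f i) \<longlongrightarrow> 0) F"
  proof (rule Lim_null_comparison)
    show "\<forall>\<^sub>F i in F. norm (gfloor (k i) (f i) - f i) \<le> real DIM('a) * k i"
      using filterlim_at_right_0D(2)[OF k] by eventually_elim (rule norm_gfloor_diff)
    show "((\<lambda>i. real DIM('a) * k i) \<longlongrightarrow> 0) F"
      using tendsto_mult_right_zero[OF filterlim_at_right_0D(1)[OF k]] .
  qed
  from tendsto_add[OF this f] show ?thesis by simp
qed

lemma filterlim_gfloor_grid_filter: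
  "G \<le> at_right 0 \<Longrightarrow> filterlim (\<lambda>h. (h, gfloor h x)) (grid_filter G x) G"
  by (intro filterlim_into_grid_filter tendsto_gfloor[of _ G] filterlim_ident tendsto_const
    always_eventually allI gfloor_grid)

lemma grid_filter_nontrivial: "G \<le> at_right 0 \<Longrightarrow> G \<noteq> bot \<Longrightarrow> grid_filter G x \<noteq> bot"
  using filterlim_gfloor_grid_filter[of G x] by (auto simp: filterlim_def filtermap_bot_iff bot_unique)

lemma filterlim_grid_step:
  assumes G: "G \<le> at_right 0" and b: "b \<in> Basis"
  shows "filterlim (\<lambda>(h, x). (h, x + h *\<^sub>R b)) (grid_filter G p) (grid_filter G p)"
    "filterlim (\<lambda>(h, x). (h, x - h *\<^sub>R b)) (grid_filter G p) (grid_filter G p)"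
proof -
  let ?F = "grid_filter G p"
  note lim = filterlim_grid_filter_fst_snd[where G = G and p = p]
  have "((\<lambda>z. snd z + fst z *\<^sub>R b) \<longlongrightarrow> p + 0 *\<^sub>R b) ?F" "((\<lambda>z. snd z - fst z *\<^sub>R b) \<longlongrightarrow> p - 0 *\<^sub>R b) ?F"
    by (intro tendsto_intros lim filterlim_at_right_0D(1)[OF lim(1) G])+
  then have tendsto: "((\<lambda>z. snd z + fst z *\<^sub>R b) \<longlongrightarrow> p) ?F" "((\<lambda>z. snd z - fst z *\<^sub>R b) \<longlongrightarrow> p) ?F"
    by simp_all
  have grid: "\<forall>\<^sub>F z in ?F. snd z + fst z *\<^sub>R b \<in> grid (fst z)" "\<forall>\<^sub>F z in ?F. snd z - fst z *\<^sub>R b \<in> grid (fst z)"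
    by (rule eventually_mono[OF eventually_grid_filter_in_grid], erule grid_step[OF b])+
  show "filterlim (\<lambda>(h, x). (h, x + h *\<^sub>R b)) ?F ?F" "filterlim (\<lambda>(h, x). (h, x - h *\<^sub>R b)) ?F ?F"
    unfolding case_prod_unfold
    by (rule filterlim_into_grid_filter[OF lim(1) tendsto(1) grid(1)],
        rule filterlim_into_grid_filter[OF lim(1) tendsto(2) grid(2)])
qed

lemma Bfun_add:
  fixes f g :: "'i \<Rightarrow> 'a::real_normed_vector"
  assumes "Bfun f F" "Bfun g F"
  shows "Bfun (\<lambda>x. f x + g x) F"
proof -
  obtain B C where "\<forall>\<^sub>F x in F. norm (f x) \<le> B" "\<forall>\<^sub>F x in F. norm (g x) \<le> C"
    using assms by (auto elim!: BfunE)
  then have "\<forall>\<^sub>F x in F. norm (f x + g x) \<le> B + C" by eventually_elim (rule norm_triangle_mono)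
  then show ?thesis by (rule BfunI)
qed

lemma Bfun_mult:
  fixes f g :: "'i \<Rightarrow> 'a::real_normed_algebra"
  assumes "Bfun f F" "Bfun g F"
  shows "Bfun (\<lambda>x. f x * g x) F"
proof -
  obtain B C where "B > 0" "\<forall>\<^sub>F x in F. norm (f x) \<le> B" "\<forall>\<^sub>F x in F. norm (g x) \<le> C"
    using assms by (auto elim!: BfunE)
  from this(2,3) have "\<forall>\<^sub>F x in F. norm (f x * g x) \<le> B * C"
    by eventually_elim (use \<open>B > 0\<close> in \<open>auto intro!: order_trans[OF norm_mult_ineq] mult_mono\<close>)
  then show ?thesis by (rule BfunI)
qed

lemma Bfun_compose:
  fixes f :: "'i \<Rightarrow> 'a::real_normed_vector"
  assumes "Bfun f F" "filterlim g F G"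
  shows "Bfun (\<lambda>x. f (g x)) G"
proof -
  obtain C where "\<forall>\<^sub>F x in F. norm (f x) \<le> C" using assms(1) by (elim BfunE)
  from eventually_compose_filterlim[OF this assms(2)] show ?thesis by (rule BfunI)
qed

lemma Bfun_cong_eventually:
  fixes f g :: "'i \<Rightarrow> 'a::real_normed_vector"
  assumes "Bfun g F" "\<forall>\<^sub>F x in F. f x = g x"
  shows "Bfun f F"
proof -
  obtain C where "\<forall>\<^sub>F x in F. norm (g x) \<le> C" using assms(1) by (elim BfunE)
  with assms(2) have "\<forall>\<^sub>F x in F. norm (f x) \<le> C" by eventually_elim simp
  then show ?thesis by (rule BfunI)
qed

abbreviation bounded_near :: "'a::euclidean_space \<Rightarrow> (real \<Rightarrow> 'a \<Rightarrow> real) \<Rightarrow> bool" where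
  "bounded_near p w \<equiv> Bfun (\<lambda>(h, x). w h x) (grid_filter (at_right 0) p)"

lemma bounded_nearE:
  assumes "bounded_near p w"
  obtains C where "C > 0" "\<forall>\<^sub>F (h, x) in grid_filter (at_right 0) p. \<bar>w h x\<bar> \<le> C"
  using assms by (elim BfunE) (simp add: case_prod_unfold)

lemma bounded_near_add: "bounded_near p w \<Longrightarrow> bounded_near p v \<Longrightarrow> bounded_near p (\<lambda>h x. w h x + v h x)"
  unfolding case_prod_unfold by (rule Bfun_add)

lemma bounded_near_mult: "bounded_near p w \<Longrightarrow> bounded_near p v \<Longrightarrow> bounded_near p (\<lambda>h x. w h x * v h x)"
  unfolding case_prod_unfold by (rule Bfun_mult)

lemma bounded_near_translate:
  assumes "bounded_near p w" "b \<in> Basis"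
  shows "bounded_near p (\<lambda>h x. w h (x + h *\<^sub>R b))"
  using Bfun_compose[OF assms(1) filterlim_grid_step(1)[OF order_refl assms(2)]]
  by (simp add: case_prod_unfold)

lemma bounded_near_fdiff:
  fixes w :: "real \<Rightarrow> 'a::euclidean_space \<Rightarrow> real"
  assumes w: "bounded_near p w" "bounded_near p (\<lambda>h. dlap h (w h))" and b: "b \<in> Basis"
  shows "bounded_near p (\<lambda>h. fdiff h b (w h))"
proof -
  define n where "n = real DIM('a)"
  have n: "n \<ge> 1" by (simp add: n_def DIM_positive Suc_leI)
  obtain C where C: "C > 0" "\<forall>\<^sub>F (h, x) in grid_filter (at_right 0) p. \<bar>w h x\<bar> \<le> C"
    by (rule bounded_nearE[OF w(1)])
  obtain D where D: "D > 0" "\<forall>\<^sub>F (h, x) in grid_filter (at_right 0) p. \<bar>dlap h (w h) x\<bar> \<le> D"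
    by (rule bounded_nearE[OF w(2)])
  have "\<forall>\<^sub>F (h, x) in grid_filter (at_right 0) p. \<bar>w h x\<bar> \<le> C \<and> \<bar>dlap h (w h) x\<bar> \<le> D"
    using eventually_conj[OF C(2) D(2)] by (simp add: case_prod_unfold)
  then obtain r where r: "r > 0" "\<forall>\<^sub>F h in at_right 0. \<forall>x\<in>grid h. dist x p < r \<longrightarrow> \<bar>w h x\<bar> \<le> C \<and> \<bar>dlap h (w h) x\<bar> \<le> D"
    unfolding eventually_grid_filter by blast
  define R where "R = r / (4 * n)"
  have R: "R > 0" "n * R = r / 4" using r n by (simp_all add: R_def)
  define E where "E = C / (R / 2) * (1 + 3/2 * n) + 3/4 * D * R"
  have "\<forall>\<^sub>F h in at_right 0. \<forall>x\<in>grid h. dist x p < r / 4 \<longrightarrow> \<bar>fdiff h b (w h) x\<bar> \<le> E"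
    using r(2) eventually_at_right_0_le[OF order_refl half_gt_zero[OF R(1)]]
  proof eventually_elim
    case (elim h)
    show ?case
    proof (intro ballI impI)
      fix x
      assume x: "x \<in> grid h" "dist x p < r / 4"
      define N where "N = nat \<lfloor>R / h\<rfloor>"
      define q where "q = h * real N"
      have "2 \<le> R / h" using elim by (simp add: field_simps)
      then have N: "real N \<le> R / h" "R / h - 1 \<le> real N" "N \<ge> 1" unfolding N_def by linarith+
      have q: "R / 2 \<le> q" "q \<le> R"
        using mult_left_mono[OF N(1), of h] mult_left_mono[OF N(2), of h] elim(2)
        by (simp_all add: q_def right_diff_distrib)
      have bounds: "\<bar>w h y\<bar> \<le> C \<and> \<bar>dlap h (w h) y\<bar> \<le> D" if y: "y \<in> grid h" "y \<in> cube x (q + h)" for y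
      proof -
        have "norm (y - x) \<le> n * (q + h)"
          unfolding n_def by (rule norm_le_DIM_mult) (use y(2) in \<open>simp add: cube_def\<close>)
        also have "\<dots> \<le> n * (R + R / 2)" using q elim(2) n by (intro mult_left_mono) auto
        also have "\<dots> = r * (3/8)" using R(2) by (simp add: algebra_simps)
        finally have "dist y p < r" using dist_triangle[of y p x] x(2) r(1) by (simp add: dist_norm)
        then show ?thesis using elim(1) y(1) by blast
      qed
      have "\<bar>fdiff h b (w h) x\<bar> \<le> C / q * (1 + 3/2 * n) + 3/4 * D * q"
        unfolding n_def
        by (rule discrete_gradient_estimate[OF _ N(3) q_def b]) (use elim x C(1) D(1) bounds in auto)
      also have "\<dots> \<le> E"
        unfolding E_def
        using q R C(1) D(1) n by (intro add_mono mult_right_mono mult_left_mono divide_left_mono) auto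
      finally show "\<bar>fdiff h b (w h) x\<bar> \<le> E" .
    qed
  qed
  then have "\<forall>\<^sub>F (h, x) in grid_filter (at_right 0) p. \<bar>fdiff h b (w h) x\<bar> \<le> E"
    unfolding eventually_grid_filter using r(1) by (intro exI[of _ "r / 4"]) simp
  then show ?thesis by (intro BfunI[of _ E]) (simp add: case_prod_unfold)
qed

lemma eventually_fdiff_cong:
  assumes "\<forall>\<^sub>F (h, x) in grid_filter (at_right 0) p. w h x = v h x" "b \<in> Basis"
  shows "\<forall>\<^sub>F (h, x) in grid_filter (at_right 0) p. fdiff h b (w h) x = fdiff h b (v h) x"
proof -
  have "\<forall>\<^sub>F (h, x) in grid_filter (at_right 0) p. w h (x + h *\<^sub>R b) = v h (x + h *\<^sub>R b)"
    using eventually_compose_filterlim[OF assms(1) filterlim_grid_step(1)[OF order_refl assms(2)]]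
    by (simp add: case_prod_unfold)
  with assms(1) show ?thesis by eventually_elim (auto simp: fdiff_def)
qed

lemma grid_line_increment:
  assumes h: "h > 0" and "\<And>i. i < j \<Longrightarrow> \<bar>fdiff h b w (x + (real i * h) *\<^sub>R b) - d\<bar> \<le> C"
  shows "\<bar>w (x + (real j * h) *\<^sub>R b) - w x - real j * h * d\<bar> \<le> C * (real j * h)"
  using assms(2)
proof (induction j)
  case (Suc j)
  let ?y = "x + (real j * h) *\<^sub>R b"
  have "x + (real (Suc j) * h) *\<^sub>R b = ?y + h *\<^sub>R b" by (simp add: algebra_simps)
  moreover have "w (?y + h *\<^sub>R b) = w ?y + fdiff h b w ?y * h" using h by (simp add: fdiff_def)
  ultimately have "w (x + (real (Suc j) * h) *\<^sub>R b) - w x - real (Suc j) * h * d =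
    (w ?y - w x - real j * h * d) + (fdiff h b w ?y - d) * h"
    by (simp only:) (simp add: algebra_simps)
  also have "\<bar>\<dots>\<bar> \<le> C * (real j * h) + C * h"
  proof (intro order_trans[OF abs_triangle_ineq] add_mono)
    show "\<bar>w ?y - w x - real j * h * d\<bar> \<le> C * (real j * h)" using Suc by auto
    show "\<bar>(fdiff h b w ?y - d) * h\<bar> \<le> C * h"
      unfolding abs_mult using Suc.prems[of j] h by (simp add: mult_right_mono)
  qed
  finally show ?case by (simp add: algebra_simps)
qed simp

lemma grid_line_lipschitz:
  fixes z :: "'a::euclidean_space"
  assumes h: "h > 0" and C: "\<And>z. z \<in> grid h \<Longrightarrow> z \<in> cube p r \<Longrightarrow> \<bar>fdiff h b w z\<bar> \<le> C" and b: "b \<in> Basis"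
    and z: "z \<in> grid h" "z \<in> cube p r" and z': "z + (h * of_int j) *\<^sub>R b \<in> cube p r"
  shows "\<bar>w (z + (h * of_int j) *\<^sub>R b) - w z\<bar> \<le> C * \<bar>h * of_int j\<bar>"
proof -
  have forward: "\<bar>w (y + (h * real n) *\<^sub>R b) - w y\<bar> \<le> C * \<bar>h * real n\<bar>"
    if y: "y \<in> grid h" "y \<in> cube p r" "y + (h * real n) *\<^sub>R b \<in> cube p r" for y n
  proof -
    have "\<bar>fdiff h b w (y + (real i * h) *\<^sub>R b) - 0\<bar> \<le> C" if i: "i < n" for i
    proof -
      have "y + (real i * h) *\<^sub>R b \<in> grid h"
        using grid_add[OF y(1) grid_scaleR_Basis[OF b, of h "int i"]] by (simp add: mult.commute)
      moreover have "0 \<le> real i * h" "real i * h \<le> real n * h" using i h by (auto intro: mult_right_mono)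
      then have "\<bar>(y + (real i * h) *\<^sub>R b - p) \<bullet> c\<bar> \<le> r" if "c \<in> Basis" for c
        using y(2,3) b that
        by (cases "b = c") (force simp: cube_def mult.commute inner_diff_left inner_add_left inner_Basis)+
      then have "y + (real i * h) *\<^sub>R b \<in> cube p r" by (simp add: cube_def)
      ultimately show ?thesis using C by simp
    qed
    from grid_line_increment[OF h this] show ?thesis using h by (simp add: mult.commute)
  qed
  show ?thesis
  proof (cases "j \<ge> 0")
    case True
    then show ?thesis using forward[OF z, of "nat j"] z' by simp
  next
    case False
    then show ?thesis
      using forward[of "z + (h * of_int j) *\<^sub>R b" "nat (- j)"] z z' grid_add[OF z(1) grid_scaleR_Basis[OF b]]
      by (simp add: abs_minus_commute)
  qed
qed

lemma grid_cube_lipschitz: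
  fixes x y :: "'a::euclidean_space"
  assumes h: "h > 0"
    and C: "\<And>z b. b \<in> Basis \<Longrightarrow> z \<in> grid h \<Longrightarrow> z \<in> cube p r \<Longrightarrow> \<bar>fdiff h b w z\<bar> \<le> C"
    and x: "x \<in> grid h" "x \<in> cube p r" and y: "y \<in> grid h" "y \<in> cube p r"
  shows "\<bar>w y - w x\<bar> \<le> C * (\<Sum>b\<in>Basis. \<bar>(y - x) \<bullet> b\<bar>)"
proof -
  define Z where "Z = (\<lambda>B. x + (\<Sum>b\<in>B. ((y - x) \<bullet> b) *\<^sub>R b))"
  have Z_inner: "Z B \<bullet> c = (if c \<in> B then y \<bullet> c else x \<bullet> c)" if "B \<subseteq> Basis" "c \<in> Basis" for B c
  proof -
    have "(\<Sum>b\<in>B. ((y - x) \<bullet> b) *\<^sub>R b) \<bullet> c = (\<Sum>b\<in>B. if b = c then (y - x) \<bullet> b else 0)"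
      unfolding inner_sum_left using that by (intro sum.cong) (auto simp: inner_Basis)
    also have "\<dots> = (if c \<in> B then (y - x) \<bullet> c else 0)"
      using finite_subset[OF that(1) finite_Basis] by simp
    finally show ?thesis by (simp add: Z_def inner_add_left inner_diff_left)
  qed
  have Z_grid: "Z B \<in> grid h" and Z_cube: "Z B \<in> cube p r" if "B \<subseteq> Basis" for B
    using x y by (auto simp: grid_def cube_def inner_diff_left Z_inner[OF that])
  have "\<bar>w (Z B) - w x\<bar> \<le> C * (\<Sum>b\<in>B. \<bar>(y - x) \<bullet> b\<bar>)" if "B \<subseteq> Basis" for B
    using finite_subset[OF that finite_Basis] that
  proof (induction B rule: finite_induct)
    case empty
    then show ?case by (simp add: Z_def)
  next
    case (insert a B)
    have a: "a \<in> Basis" "B \<subseteq> Basis" using insert.prems by auto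
    obtain j :: int where j: "(y - x) \<bullet> a = h * of_int j"
      using grid_diff[OF y(1) x(1)] a by (auto simp: grid_def)
    have step: "Z (insert a B) = Z B + (h * of_int j) *\<^sub>R a"
      using insert.hyps by (simp add: Z_def j[symmetric] algebra_simps)
    have "\<bar>w (Z (insert a B)) - w (Z B)\<bar> \<le> C * \<bar>h * of_int j\<bar>"
      unfolding step by (rule grid_line_lipschitz[OF h C[OF a(1)] a(1) Z_grid[OF a(2)] Z_cube[OF a(2)]])
        (use Z_cube[OF insert.prems] step in simp_all)
    then show ?case using insert.IH[OF a(2)] insert.hyps by (simp add: j distrib_left)
  qed
  from this[of Basis] show ?thesis by (simp add: Z_def euclidean_representation)
qed

lemma tendsto_diff_gfloor_of_bounded_fdiff:
  fixes w :: "real \<Rightarrow> 'a::euclidean_space \<Rightarrow> real"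
  assumes w: "\<And>b. b \<in> Basis \<Longrightarrow> bounded_near p (\<lambda>h. fdiff h b (w h))"
  shows "((\<lambda>(h, x). w h x - w h (gfloor h p)) \<longlongrightarrow> 0) (grid_filter (at_right 0) p)"
proof -
  let ?F = "grid_filter (at_right 0) p"
  have "\<forall>b\<in>Basis. \<exists>C. \<forall>\<^sub>F (h, x) in ?F. \<bar>fdiff h b (w h) x\<bar> \<le> C"
    by (intro ballI, rule bounded_nearE[OF w]) (assumption, rule exI)
  from bchoice[OF this] obtain C
    where C: "\<forall>b\<in>Basis. \<forall>\<^sub>F (h, x) in ?F. \<bar>fdiff h b (w h) x\<bar> \<le> C b" ..
  define K where "K = (\<Sum>b\<in>Basis. \<bar>C b\<bar>)"
  have K: "C b \<le> K" if "b \<in> Basis" for b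
    using member_le_sum[OF that, of "\<lambda>b. \<bar>C b\<bar>"] by (simp add: K_def)
  have "\<forall>\<^sub>F (h, x) in ?F. \<forall>b\<in>Basis. \<bar>fdiff h b (w h) x\<bar> \<le> K"
    unfolding case_prod_unfold
  proof (rule eventually_ball_finite[OF finite_Basis], rule ballI)
    fix b :: 'a
    assume "b \<in> Basis"
    from bspec[OF C this] K[OF this] show "\<forall>\<^sub>F z in ?F. \<bar>fdiff (fst z) b (w (fst z)) (snd z)\<bar> \<le> K"
      unfolding case_prod_unfold by (auto elim: eventually_mono)
  qed
  then obtain r where r: "r > 0" "\<forall>\<^sub>F h in at_right 0. \<forall>x\<in>grid h. dist x p < r \<longrightarrow> (\<forall>b\<in>Basis. \<bar>fdiff h b (w h) x\<bar> \<le> K)"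
    unfolding eventually_grid_filter by blast
  obtain q where q: "q > 0" "cube p q \<subseteq> ball p r" using open_contains_cube[of "ball p r" p] r(1) by auto
  have ball_cube: "x \<in> cube p q" if "dist x p < q" for x
    using that Basis_le_norm[of _ "x - p"] by (force simp: cube_def dist_norm)
  have gfloor_lim: "((\<lambda>z. gfloor (fst z) p) \<longlongrightarrow> p) ?F"
    by (rule tendsto_gfloor[OF filterlim_grid_filter_fst_snd(1) order_refl tendsto_const])
  have "\<forall>\<^sub>F z in ?F. norm (w (fst z) (snd z) - w (fst z) (gfloor (fst z) p)) \<le>
    K * (\<Sum>b\<in>Basis. \<bar>(snd z - gfloor (fst z) p) \<bullet> b\<bar>)"
    using filterlim_at_right_0D(2)[OF filterlim_grid_filter_fst_snd(1) order_refl]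
      eventually_compose_filterlim[OF r(2) filterlim_grid_filter_fst_snd(1)]
      tendstoD[OF gfloor_lim q(1)] tendstoD[OF filterlim_grid_filter_fst_snd(2) q(1)]
      eventually_grid_filter_in_grid
  proof eventually_elim
    case (elim z)
    show ?case
      unfolding real_norm_def
    proof (rule grid_cube_lipschitz[OF elim(1), of p q])
      fix y b :: 'a
      assume "b \<in> Basis" "y \<in> grid (fst z)" "y \<in> cube p q"
      then show "\<bar>fdiff (fst z) b (w (fst z)) y\<bar> \<le> K"
        using elim(2) q(2) by (auto simp: dist_commute subset_iff)
    qed (use elim ball_cube gfloor_grid in auto)
  qed
  moreover have "((\<lambda>z. K * (\<Sum>b\<in>Basis. \<bar>(snd z - gfloor (fst z) p) \<bullet> b\<bar>)) \<longlongrightarrow>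
    K * (\<Sum>b\<in>Basis. \<bar>(p - p) \<bullet> b\<bar>)) ?F"
    by (intro tendsto_intros gfloor_lim filterlim_grid_filter_fst_snd)
  then have "((\<lambda>z. K * (\<Sum>b\<in>Basis. \<bar>(snd z - gfloor (fst z) p) \<bullet> b\<bar>)) \<longlongrightarrow> 0) ?F" by simp
  ultimately show ?thesis unfolding case_prod_unfold by (rule Lim_null_comparison)
qed

lemma eventually_grid_filter_in_open:
  assumes "open S" "p \<in> S"
  shows "\<forall>\<^sub>F z in grid_filter G p. snd z \<in> S"
  using filterlim_grid_filter_fst_snd(2) assms by (rule topological_tendstoD)

primrec bounded_fdiffs :: "nat \<Rightarrow> 'a::euclidean_space \<Rightarrow> (real \<Rightarrow> 'a \<Rightarrow> real) \<Rightarrow> bool" where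
  "bounded_fdiffs 0 p w = bounded_near p w"
| "bounded_fdiffs (Suc m) p w = (bounded_near p w \<and> (\<forall>b\<in>Basis. bounded_fdiffs m p (\<lambda>h. fdiff h b (w h))))"

lemma bounded_fdiffs_Suc_imp: "bounded_fdiffs (Suc m) p w \<Longrightarrow> bounded_fdiffs m p w"
  by (induction m arbitrary: w) auto

lemma bounded_fdiffs_mono: "m \<le> n \<Longrightarrow> bounded_fdiffs n p w \<Longrightarrow> bounded_fdiffs m p w"
  by (induction rule: dec_induct) (blast dest: bounded_fdiffs_Suc_imp)+

lemma bounded_fdiffs_foldr:
  "bounded_fdiffs m p w \<Longrightarrow> set vs \<subseteq> Basis \<Longrightarrow> length vs \<le> m \<Longrightarrow> bounded_near p (\<lambda>h. foldr (fdiff h) vs (w h))"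
proof (induction vs arbitrary: m w rule: rev_induct)
  case Nil
  then show ?case by (cases m) simp_all
next
  case (snoc b vs)
  then obtain n where "m = Suc n" by (cases m) auto
  with snoc.prems snoc.IH[of n "\<lambda>h. fdiff h b (w h)"] show ?case by simp
qed

lemma bounded_fdiffs_const:
  assumes "\<And>h. \<bar>c h\<bar> \<le> C"
  shows "bounded_fdiffs m p (\<lambda>h x. c h)"
  using assms
proof (induction m arbitrary: c C)
  case 0
  then show ?case by (auto simp: case_prod_unfold intro: BfunI[of _ C] always_eventually)
next
  case (Suc m)
  have "fdiff h b (\<lambda>x. c h) = (\<lambda>x. 0)" for h and b :: 'a by (simp add: fdiff_def fun_eq_iff)
  moreover have "bounded_near p (\<lambda>h x. c h)"
    using Suc.prems by (auto simp: case_prod_unfold intro: BfunI[of _ C] always_eventually)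
  ultimately show ?case using Suc.IH[of "\<lambda>h. 0" 0] by simp
qed

lemma bounded_fdiffs_add:
  "bounded_fdiffs m p w \<Longrightarrow> bounded_fdiffs m p v \<Longrightarrow> bounded_fdiffs m p (\<lambda>h x. w h x + v h x)"
  by (induction m arbitrary: w v) (simp_all add: fdiff_add bounded_near_add)

lemma bounded_fdiffs_translate:
  "bounded_fdiffs m p w \<Longrightarrow> c \<in> Basis \<Longrightarrow> bounded_fdiffs m p (\<lambda>h x. w h (x + h *\<^sub>R c))"
proof (induction m arbitrary: w)
  case (Suc m)
  have "bounded_fdiffs m p (\<lambda>h. fdiff h b (\<lambda>x. w h (x + h *\<^sub>R c)))" if "b \<in> Basis" for b
    unfolding fdiff_translate by (rule Suc.IH) (use Suc.prems that in simp_all)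
  with Suc.prems show ?case by (simp add: bounded_near_translate)
qed (simp add: bounded_near_translate)

lemma bounded_fdiffs_mult:
  "bounded_fdiffs m p w \<Longrightarrow> bounded_fdiffs m p v \<Longrightarrow> bounded_fdiffs m p (\<lambda>h x. w h x * v h x)"
proof (induction m arbitrary: w v)
  case (Suc m)
  have "bounded_fdiffs m p (\<lambda>h. fdiff h b (\<lambda>x. w h x * v h x))" if "b \<in> Basis" for b
    unfolding fdiff_mult using Suc.prems Suc.prems[THEN bounded_fdiffs_Suc_imp] that
    by (intro bounded_fdiffs_add Suc.IH bounded_fdiffs_translate) simp_all
  with Suc.prems show ?case by (simp add: bounded_near_mult)
qed (simp add: bounded_near_mult)

lemma bounded_fdiffs_cong:
  assumes "bounded_fdiffs m p v" "\<forall>\<^sub>F (h, x) in grid_filter (at_right 0) p. w h x = v h x"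
  shows "bounded_fdiffs m p w"
  using assms
proof (induction m arbitrary: w v)
  case 0
  then show ?case by (auto intro: Bfun_cong_eventually simp: case_prod_unfold)
next
  case (Suc m)
  have "bounded_fdiffs m p (\<lambda>h. fdiff h b (w h))" if b: "b \<in> Basis" for b
    by (rule Suc.IH[OF _ eventually_fdiff_cong[OF Suc.prems(2) b]]) (use Suc.prems(1) b in simp)
  moreover have "bounded_near p w"
    using Suc.prems by (auto intro: Bfun_cong_eventually simp: case_prod_unfold)
  ultimately show ?case by simp
qed

lemma bounded_fdiffs_Suc_of_dlap:
  "bounded_fdiffs m p w \<Longrightarrow> bounded_fdiffs m p (\<lambda>h. dlap h (w h)) \<Longrightarrow> bounded_fdiffs (Suc m) p w"
proof (induction m arbitrary: w)
  case 0
  then show ?case by (simp add: bounded_near_fdiff)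
next
  case (Suc m)
  have "bounded_fdiffs (Suc m) p (\<lambda>h. fdiff h b (w h))" if "b \<in> Basis" for b
    by (rule Suc.IH) (use Suc.prems that in \<open>simp_all add: dlap_fdiff\<close>)
  with Suc.prems show ?case by simp
qed

lemma bounded_fdiffs_of_equation:
  assumes P: "bounded_fdiffs n p P" and u: "bounded_near p u"
    and eq: "\<forall>\<^sub>F (h, x) in grid_filter (at_right 0) p. dlap h (u h) x = P h x * u h x"
  shows "m \<le> Suc n \<Longrightarrow> bounded_fdiffs m p u"
proof (induction m)
  case (Suc m)
  have "bounded_fdiffs m p (\<lambda>h x. P h x * u h x)"
    using Suc bounded_fdiffs_mono[OF _ P, of m] by (intro bounded_fdiffs_mult) auto
  with Suc show ?case by (intro bounded_fdiffs_Suc_of_dlap bounded_fdiffs_cong[OF _ eq]) auto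
qed (simp add: u)

lemma compact_imp_convergent_finer_filter:
  fixes f :: "'i \<Rightarrow> 'a::topological_space"
  assumes "compact S" "G \<noteq> bot" "\<forall>\<^sub>F i in G. f i \<in> S"
  obtains z G' where "z \<in> S" "G' \<le> G" "G' \<noteq> bot" "(f \<longlongrightarrow> z) G'"
proof -
  obtain z where z: "z \<in> S" "inf (nhds z) (filtermap f G) \<noteq> bot"
    using compact_filter[THEN iffD1, OF assms(1), rule_format, of "filtermap f G"] assms(2,3)
    by (auto simp: eventually_filtermap filtermap_bot_iff)
  let ?G' = "inf G (filtercomap f (nhds z))"
  have "?G' \<noteq> bot"
  proof
    assume "?G' = bot"
    then have "\<forall>\<^sub>F i in ?G'. False" by simp
    then obtain P Q where "eventually P G" "eventually Q (nhds z)" and disjoint: "\<And>i. P i \<Longrightarrow> \<not> Q (f i)"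
      unfolding eventually_inf eventually_filtercomap by blast
    moreover have "\<forall>\<^sub>F i in G. \<not> Q (f i)" using \<open>eventually P G\<close> by (rule eventually_mono) (rule disjoint)
    ultimately have "\<forall>\<^sub>F y in inf (nhds z) (filtermap f G). False"
      unfolding eventually_inf eventually_filtermap
      by (intro exI[of _ Q] exI[of _ "\<lambda>y. \<not> Q y"]) auto
    with z(2) show False by (simp add: trivial_limit_def)
  qed
  moreover have "(f \<longlongrightarrow> z) ?G'"
    by (rule filterlim_mono[OF filterlim_filtercomap order_refl inf_le2])
  ultimately show ?thesis using that[of z ?G'] z(1) by simp
qed

lemma bounded_family_convergent_finer_filter:
  fixes f :: "'i \<Rightarrow> 'h \<Rightarrow> real"
  assumes "G \<noteq> bot" and bounded: "\<And>i. i \<in> I \<Longrightarrow> Bfun (f i) G"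
  obtains L G' where "G' \<le> G" "G' \<noteq> bot" "\<And>i. i \<in> I \<Longrightarrow> (f i \<longlongrightarrow> L i) G'"
proof -
  have "\<forall>i\<in>I. \<exists>C. \<forall>\<^sub>F h in G. norm (f i h) \<le> C"
    by (intro ballI, rule BfunE[OF bounded]) (assumption, rule exI)
  from bchoice[OF this] obtain C where C: "\<forall>i\<in>I. \<forall>\<^sub>F h in G. norm (f i h) \<le> C i" ..
  define F where "F = (\<lambda>h i. if i \<in> I \<and> \<bar>f i h\<bar> \<le> C i then f i h else 0)"
  let ?K = "PiE UNIV (\<lambda>i. {- \<bar>C i\<bar>..\<bar>C i\<bar>})"
  have K: "compact ?K"
    using compactin_PiE[of "\<lambda>i. euclidean" UNIV "\<lambda>i. {- \<bar>C i\<bar>..\<bar>C i\<bar>}"]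
    by (simp add: euclidean_product_topology)
  have "F h \<in> ?K" for h
  proof (rule PiE_I)
    show "F h i \<in> {- \<bar>C i\<bar>..\<bar>C i\<bar>}" for i unfolding F_def by (cases "\<bar>f i h\<bar> \<le> C i") auto
  qed simp
  then have F: "\<forall>\<^sub>F h in G. F h \<in> ?K" by simp
  obtain L G' where L: "G' \<le> G" "G' \<noteq> bot" "(F \<longlongrightarrow> L) G'"
    by (rule compact_imp_convergent_finer_filter[OF K \<open>G \<noteq> bot\<close> F])
  have "(f i \<longlongrightarrow> L i) G'" if i: "i \<in> I" for i
  proof (rule Lim_transform_eventually)
    show "((\<lambda>h. F h i) \<longlongrightarrow> L i) G'"
      using continuous_on_tendsto_compose[OF continuous_on_product_coordinates L(3)] by simp
    show "\<forall>\<^sub>F h in G'. F h i = f i h"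
      using filter_leD[OF L(1) bspec[OF C i]] by eventually_elim (simp add: F_def i)
  qed
  with L(1,2) show ?thesis by (rule that)
qed

abbreviation converges_near :: "real filter \<Rightarrow> (real \<Rightarrow> 'a::euclidean_space \<Rightarrow> real) \<Rightarrow> 'a \<Rightarrow> real \<Rightarrow> bool" where
  "converges_near G w p c \<equiv> ((\<lambda>(h, x). w h x) \<longlongrightarrow> c) (grid_filter G p)"

lemma converges_near_compose:
  assumes "converges_near G w p c" "filterlim k G F" "(f \<longlongrightarrow> p) F" "\<forall>\<^sub>F i in F. f i \<in> grid (k i)"
  shows "((\<lambda>i. w (k i) (f i)) \<longlongrightarrow> c) F"
  using filterlim_compose[OF assms(1) filterlim_into_grid_filter[OF assms(2-4)]] by simp

lemma converges_near_gfloor: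
  assumes "G \<le> at_right 0" "converges_near G w p c"
  shows "((\<lambda>h. w h (gfloor h p)) \<longlongrightarrow> c) G"
  using filterlim_compose[OF assms(2) filterlim_gfloor_grid_filter[OF assms(1)]] by simp

lemma converges_near_of_gfloor:
  assumes G: "G \<le> at_right 0" and bounded: "bounded_fdiffs 1 p w" and lim: "((\<lambda>h. w h (gfloor h p)) \<longlongrightarrow> c) G"
  shows "converges_near G w p c"
proof -
  have "((\<lambda>(h, x). w h x - w h (gfloor h p)) \<longlongrightarrow> 0) (grid_filter G p)"
    using tendsto_diff_gfloor_of_bounded_fdiff[where p = p and w = w] bounded
    by (intro filterlim_mono[OF _ order_refl grid_filter_mono[OF G]]) simp
  moreover have "((\<lambda>(h, x). w h (gfloor h p)) \<longlongrightarrow> c) (grid_filter G p)"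
    using filterlim_compose[OF lim filterlim_grid_filter_fst_snd(1)] by (simp add: case_prod_unfold)
  ultimately show ?thesis using tendsto_add by (fastforce simp: case_prod_unfold)
qed

lemma converges_nearD:
  assumes "converges_near G w p c" "e > 0"
  obtains r where "r > 0" "\<forall>\<^sub>F h in G. \<forall>x\<in>grid h. dist x p < r \<longrightarrow> \<bar>w h x - c\<bar> \<le> e"
proof -
  have "\<forall>\<^sub>F (h, x) in grid_filter G p. \<bar>w h x - c\<bar> \<le> e"
    using tendstoD[OF assms] by (auto simp: dist_real_def case_prod_unfold elim: eventually_mono)
  then show ?thesis using that unfolding eventually_grid_filter by blast
qed

context
  fixes G :: "real filter" and S :: "'a::euclidean_space set" and w :: "real \<Rightarrow> 'a \<Rightarrow> real" and U
  assumes G: "G \<le> at_right 0" "G \<noteq> bot" and S: "open S"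
    and w: "\<And>y. y \<in> S \<Longrightarrow> converges_near G w y (U y)"
begin

lemma isCont_of_converges_near:
  assumes p: "p \<in> S"
  shows "isCont U p"
  unfolding continuous_at_eps_delta
proof (intro allI impI)
  fix e :: real
  assume "e > 0"
  then obtain r where r: "r > 0" "\<forall>\<^sub>F h in G. \<forall>x\<in>grid h. dist x p < r \<longrightarrow> \<bar>w h x - U p\<bar> \<le> e / 2"
    using converges_nearD[OF w[OF p], of "e / 2"] by auto
  obtain s where s: "s > 0" "ball p s \<subseteq> S" using S p open_contains_ball by blast
  have "\<bar>U y - U p\<bar> \<le> e / 2" if y: "dist y p < min r s" for y
  proof (rule tendsto_upperbound[OF _ _ G(2)])
    have "y \<in> S" using s(2) y by (auto simp: subset_iff dist_commute)
    then show "((\<lambda>h. \<bar>w h (gfloor h y) - U p\<bar>) \<longlongrightarrow> \<bar>U y - U p\<bar>) G"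
      by (intro tendsto_intros converges_near_gfloor[OF G(1) w])
    have "\<forall>\<^sub>F h in G. dist (gfloor h y) p < r"
      using order_tendstoD(2)[OF tendsto_dist[OF tendsto_gfloor[OF filterlim_ident G(1) tendsto_const] tendsto_const], of y p r] y
      by simp
    with r(2) show "\<forall>\<^sub>F h in G. \<bar>w h (gfloor h y) - U p\<bar> \<le> e / 2"
      by eventually_elim (simp add: gfloor_grid)
  qed
  then show "\<exists>d>0. \<forall>y. dist y p < d \<longrightarrow> dist (U y) (U p) < e"
    using r(1) s(1) \<open>e > 0\<close> by (intro exI[of _ "min r s"]) (force simp: dist_real_def)
qed

lemma increment_le_of_converges_near_fdiff:
  assumes b: "b \<in> Basis" and r: "ball p r \<subseteq> S"
    and fdiff: "\<forall>\<^sub>F h in G. \<forall>x\<in>grid h. dist x p < r \<longrightarrow> \<bar>fdiff h b (w h) x - d\<bar> \<le> e"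
    and t: "t \<ge> 0" and y: "y \<in> ball p r" "y + t *\<^sub>R b \<in> ball p r"
  shows "\<bar>U (y + t *\<^sub>R b) - U y - t * d\<bar> \<le> e * t"
proof -
  let ?j = "\<lambda>h. nat \<lfloor>t / h\<rfloor>"
  define x where "x = (\<lambda>h. gfloor h y)"
  have pos: "\<forall>\<^sub>F h in G. 0 < h" using filterlim_at_right_0D(2)[OF filterlim_ident G(1)] .
  have j_le: "real (?j h) * h \<le> t" and j_ge: "t - h \<le> real (?j h) * h" if h: "h > 0" for h
  proof -
    have "0 \<le> t / h" using t h by simp
    then have "real (?j h) \<le> t / h" "t / h - 1 \<le> real (?j h)" by linarith+
    from mult_right_mono[OF this(1), of h] mult_right_mono[OF this(2), of h] h
    show "real (?j h) * h \<le> t" "t - h \<le> real (?j h) * h" by (simp_all add: left_diff_distrib)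
  qed
  have j_lim: "((\<lambda>h. real (?j h) * h) \<longlongrightarrow> t) G"
  proof (rule tendsto_sandwich)
    show "((\<lambda>h. t - h) \<longlongrightarrow> t) G"
      using tendsto_diff[OF tendsto_const filterlim_at_right_0D(1)[OF filterlim_ident G(1)], of t] by simp
    show "\<forall>\<^sub>F h in G. t - h \<le> real (?j h) * h" "\<forall>\<^sub>F h in G. real (?j h) * h \<le> t"
      using pos by (eventually_elim, simp add: j_ge, eventually_elim, simp add: j_le)
  qed simp
  have x_lim: "(x \<longlongrightarrow> y) G" unfolding x_def by (rule tendsto_gfloor[OF filterlim_ident G(1) tendsto_const])
  have endpoint: "((\<lambda>h. x h + (real (?j h) * h) *\<^sub>R b) \<longlongrightarrow> y + t *\<^sub>R b) G"
    by (intro tendsto_intros x_lim j_lim)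
  have grid: "x h + (real i * h) *\<^sub>R b \<in> grid h" for h i
    unfolding x_def
    using grid_add[OF gfloor_grid grid_scaleR_Basis[OF b, of h "int i"]] by (simp add: mult.commute)
  have between: "z + (real i * h) *\<^sub>R b \<in> ball p r"
    if "z \<in> ball p r" "z + (real j * h) *\<^sub>R b \<in> ball p r" "i < j" for z h i j
  proof -
    have "z + (real i * h) *\<^sub>R b = (1 - real i / real j) *\<^sub>R z + (real i / real j) *\<^sub>R (z + (real j * h) *\<^sub>R b)"
      using that(3) by (simp add: algebra_simps)
    also have "\<dots> \<in> ball p r" by (rule convexD[OF convex_ball that(1,2)]) (use that(3) in auto)
    finally show ?thesis .
  qed
  have near: "\<forall>\<^sub>F h in G. \<forall>i<?j h. dist (x h + (real i * h) *\<^sub>R b) p < r"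
    using pos order_tendstoD(2)[OF tendsto_dist[OF x_lim tendsto_const] y(1)[unfolded mem_ball dist_commute[of p]]]
      order_tendstoD(2)[OF tendsto_dist[OF endpoint tendsto_const] y(2)[unfolded mem_ball dist_commute[of p]]]
  proof eventually_elim
    case (elim h)
    then show ?case using between[of "x h" _ h] by (simp add: dist_commute)
  qed
  have "\<forall>\<^sub>F h in G. \<bar>w h (x h + (real (?j h) * h) *\<^sub>R b) - w h (x h) - real (?j h) * h * d\<bar> \<le> e * (real (?j h) * h)"
    using pos fdiff near
    by eventually_elim (rule grid_line_increment, use grid in auto)
  moreover have "((\<lambda>h. w h (x h + (real (?j h) * h) *\<^sub>R b)) \<longlongrightarrow> U (y + t *\<^sub>R b)) G" "((\<lambda>h. w h (x h)) \<longlongrightarrow> U y) G"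
    using y r grid[of _ "?j _"] grid[of _ 0]
    by (auto intro!: converges_near_compose[OF w] filterlim_ident endpoint x_lim always_eventually)
  ultimately show ?thesis
    by (intro tendsto_le[OF G(2)]) (auto intro!: tendsto_intros j_lim)
qed

lemma has_real_derivative_of_converges_near:
  assumes b: "b \<in> Basis" and p: "p \<in> S" and fdiff: "converges_near G (\<lambda>h. fdiff h b (w h)) p d"
  shows "((\<lambda>t. U (p + t *\<^sub>R b)) has_real_derivative d) (at 0)"
  unfolding DERIV_def LIM_eq
proof (intro allI impI)
  fix e :: real
  assume e: "e > 0"
  obtain r where r: "r > 0" "\<forall>\<^sub>F h in G. \<forall>x\<in>grid h. dist x p < r \<longrightarrow> \<bar>fdiff h b (w h) x - d\<bar> \<le> e / 2"
    using converges_nearD[OF fdiff, of "e / 2"] e by auto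
  obtain s where s: "s > 0" "ball p s \<subseteq> S" using S p open_contains_ball by blast
  define q where "q = min r s"
  have q: "q > 0" "ball p q \<subseteq> S" using r(1) s by (auto simp: q_def)
  have "\<forall>\<^sub>F h in G. \<forall>x\<in>grid h. dist x p < q \<longrightarrow> \<bar>fdiff h b (w h) x - d\<bar> \<le> e / 2"
    using r(2) by eventually_elim (simp add: q_def)
  note increment = increment_le_of_converges_near_fdiff[OF b q(2) this]
  have "\<bar>(U (p + t *\<^sub>R b) - U p) / t - d\<bar> < e" if t: "t \<noteq> 0" "\<bar>t\<bar> < q" for t
  proof -
    have "p + t *\<^sub>R b \<in> ball p q" using t b by (simp add: dist_norm)
    then have "\<bar>U (p + t *\<^sub>R b) - U p - t * d\<bar> \<le> e / 2 * \<bar>t\<bar>"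
      using increment[of t p] increment[of "- t" "p + t *\<^sub>R b"] q(1)
      by (cases "t \<ge> 0") (auto simp: abs_le_iff)
    moreover have "(U (p + t *\<^sub>R b) - U p) / t - d = (U (p + t *\<^sub>R b) - U p - t * d) / t"
      using t by (simp add: diff_divide_distrib)
    ultimately have "\<bar>(U (p + t *\<^sub>R b) - U p) / t - d\<bar> \<le> e / 2"
      using t by (simp add: abs_divide pos_divide_le_eq)
    then show ?thesis using e by simp
  qed
  then show "\<exists>s>0. \<forall>t. t \<noteq> 0 \<and> norm (t - 0) < s \<longrightarrow> norm ((U (p + (0 + t) *\<^sub>R b) - U (p + 0 *\<^sub>R b)) / t - d) < e"
    using q(1) by (intro exI[of _ q]) simp
qed

end

lemma onorm_inner_le: "onorm (\<lambda>v. a \<bullet> v) \<le> norm a"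
  by (rule onorm_bound) (simp_all add: Cauchy_Schwarz_ineq2)

lemma supporting_direction:
  fixes S :: "'a::euclidean_space set"
  assumes S: "open S" "convex S" "S \<noteq> {}" and p: "p \<notin> S"
  obtains nu where "norm nu = 1" "\<And>x. x \<in> S \<Longrightarrow> 0 < (p - x) \<bullet> nu"
proof -
  obtain a b where a: "a \<noteq> 0" "\<forall>x\<in>S. a \<bullet> x \<le> b" "b \<le> a \<bullet> p"
    using separating_hyperplane_sets[of S "{p}"] assms by auto
  have "0 < (p - x) \<bullet> (a /\<^sub>R norm a)" if x: "x \<in> S" for x
  proof -
    obtain e where e: "e > 0" "ball x e \<subseteq> S" using S(1) x open_contains_ball by blast
    define d where "d = e / (2 * norm a)"
    have d: "d > 0" "dist x (x + d *\<^sub>R a) < e" using e a by (simp_all add: d_def dist_norm)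
    then have "a \<bullet> (x + d *\<^sub>R a) \<le> b" using a(2) e(2) by (auto simp: subset_iff)
    moreover have "d * (a \<bullet> a) > 0" using d a by simp
    ultimately have "a \<bullet> x < a \<bullet> p" using a(3) by (simp add: inner_add_right)
    then have "0 < inverse (norm a) * ((p - x) \<bullet> a)"
      using a(1) by (simp add: inner_commute[of "p - x"] inner_diff_right)
    then show ?thesis by simp
  qed
  then show ?thesis using that[of "a /\<^sub>R norm a"] a by simp
qed

context schroedinger_domain
begin

lemma V_lipschitz:
  assumes "x \<in> Om" "y \<in> Om"
  shows "\<bar>V x - V y\<bar> \<le> M * norm (x - y)"
proof -
  have "norm (V x - V y) \<le> M * norm (x - y)"
  proof (rule differentiable_bound[OF convex_Om])
    fix z
    assume z: "z \<in> Om"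
    show "(V has_derivative (\<lambda>v. gV z \<bullet> v)) (at z within Om)"
      by (rule has_derivative_at_withinI[OF V_deriv[OF z]])
    show "onorm (\<lambda>v. gV z \<bullet> v) \<le> M" by (rule order_trans[OF onorm_inner_le gV_bound[OF z]])
  qed (use assms in auto)
  then show ?thesis by simp
qed

lemma V_increment_lipschitz:
  assumes "x \<in> Om" "x + c \<in> Om" "y \<in> Om" "y + c \<in> Om"
  shows "\<bar>(V (x + c) - V x) - (V (y + c) - V y)\<bar> \<le> M * norm c * norm (x - y)"
proof -
  let ?T = "Om \<inter> (\<lambda>z. z - c) ` Om"
  have "convex ?T" by (intro convex_Int convex_Om convex_translation_subtract)
  then have "norm ((V (x + c) - V x) - (V (y + c) - V y)) \<le> M * norm c * norm (x - y)"
  proof (rule differentiable_bound[where f = "\<lambda>z. V (z + c) - V z" and f' = "\<lambda>z v. (gV (z + c) - gV z) \<bullet> v"])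
    fix z
    assume "z \<in> ?T"
    then have in_Om: "z + c \<in> Om" "z \<in> Om" by auto
    have "((\<lambda>z. V (z + c)) has_derivative (\<lambda>v. gV (z + c) \<bullet> v)) (at z)"
      by (rule has_derivative_compose[where f = "\<lambda>z. z + c" and f' = "\<lambda>v. v", OF _ V_deriv[OF in_Om(1)]])
        (auto intro!: derivative_eq_intros)
    then have "((\<lambda>z. V (z + c) - V z) has_derivative (\<lambda>v. (gV (z + c) - gV z) \<bullet> v)) (at z)"
      unfolding inner_diff_left by (rule has_derivative_diff[OF _ V_deriv[OF in_Om(2)]])
    then show "((\<lambda>z. V (z + c) - V z) has_derivative (\<lambda>v. (gV (z + c) - gV z) \<bullet> v)) (at z within ?T)"
      by (rule has_derivative_at_withinI)
    show "onorm (\<lambda>v. (gV (z + c) - gV z) \<bullet> v) \<le> M * norm c"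
      using order_trans[OF onorm_inner_le gV_lipschitz[OF in_Om]] by simp
  qed (use assms in \<open>auto intro: image_eqI[of _ _ "_ + c"]\<close>)
  then show ?thesis by simp
qed

lemma bounded_near_on_Om:
  assumes p: "p \<in> Om" and bound: "\<And>h x. h > 0 \<Longrightarrow> x \<in> Om \<Longrightarrow> \<bar>w h x\<bar> \<le> C"
  shows "bounded_near p w"
proof (rule BfunI)
  show "\<forall>\<^sub>F z in grid_filter (at_right 0) p. norm (case z of (h, x) \<Rightarrow> w h x) \<le> C"
    using eventually_grid_filter_in_open[OF open_Om p]
      filterlim_at_right_0D(2)[OF filterlim_grid_filter_fst_snd(1) order_refl]
    by eventually_elim (auto simp: case_prod_unfold bound)
qed

lemma bounded_fdiffs_V:
  assumes p: "p \<in> Om"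
  shows "bounded_fdiffs 2 p (\<lambda>h. V)"
proof -
  let ?F = "grid_filter (at_right 0) p"
  have pos: "\<forall>\<^sub>F z in ?F. fst z > 0"
    by (rule filterlim_at_right_0D(2)[OF filterlim_grid_filter_fst_snd(1) order_refl])
  have in_Om: "\<forall>\<^sub>F z in ?F. snd z \<in> Om" by (rule eventually_grid_filter_in_open[OF open_Om p])
  note step = eventually_compose_filterlim[OF _ filterlim_grid_step(1)[OF order_refl], unfolded case_prod_unfold]
  have "\<forall>\<^sub>F z in ?F. \<bar>fdiff (fst z) b V (snd z)\<bar> \<le> M" if b: "b \<in> Basis" for b
    using pos in_Om step[OF in_Om b]
  proof eventually_elim
    case (elim z)
    then show ?case
      using V_lipschitz[of "snd z + fst z *\<^sub>R b" "snd z"] b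
      by (simp add: fdiff_def abs_divide pos_divide_le_eq)
  qed
  moreover have "\<forall>\<^sub>F z in ?F. \<bar>fdiff (fst z) c (fdiff (fst z) b V) (snd z)\<bar> \<le> M" if b: "b \<in> Basis"
    and c: "c \<in> Basis" for b c
    using pos in_Om step[OF in_Om b] step[OF in_Om c] step[OF step[OF in_Om b] c]
  proof eventually_elim
    case (elim z)
    define h x where "h = fst z" and "x = snd z"
    have "\<bar>(V (x + h *\<^sub>R c + h *\<^sub>R b) - V (x + h *\<^sub>R c)) - (V (x + h *\<^sub>R b) - V x)\<bar> \<le> M * h * h"
      using V_increment_lipschitz[of "x + h *\<^sub>R c" "h *\<^sub>R b" x] elim b c by (simp add: h_def x_def)
    moreover have "fdiff h c (fdiff h b V) x =
      ((V (x + h *\<^sub>R c + h *\<^sub>R b) - V (x + h *\<^sub>R c)) - (V (x + h *\<^sub>R b) - V x)) / (h * h)"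
      by (simp add: fdiff_def diff_divide_distrib)
    ultimately show ?case
      using elim(1) unfolding h_def[symmetric] x_def[symmetric] by (simp add: abs_divide pos_divide_le_eq)
  qed
  moreover have "\<forall>\<^sub>F z in ?F. \<bar>V (snd z)\<bar> \<le> M" using in_Om by eventually_elim (rule V_bound)
  ultimately show ?thesis
    unfolding numeral_2_eq_2 bounded_fdiffs.simps case_prod_unfold
    by (intro conjI ballI BfunI[of _ M]) simp_all
qed

lemma discrete_ground_states:
  obtains h0 C u l where "h0 > 0" "\<And>h x. 0 \<le> u h x" "\<And>h x. u h x \<le> 1" "\<And>h. \<bar>l h\<bar> \<le> C"
    "\<And>h x. 0 < h \<Longrightarrow> h \<le> h0 \<Longrightarrow> x \<notin> Om \<inter> grid h \<Longrightarrow> u h x = 0"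
    "\<And>h. 0 < h \<Longrightarrow> h \<le> h0 \<Longrightarrow> \<exists>x\<in>Om \<inter> grid h. u h x = 1"
    "\<And>h x. 0 < h \<Longrightarrow> h \<le> h0 \<Longrightarrow> x \<in> Om \<inter> grid h \<Longrightarrow> dlap h (u h) x = (V x - l h) * u h x"
proof -
  obtain p where p: "p \<in> Om" using Om_ne by blast
  obtain r where r: "r > 0" "cube p r \<subseteq> Om" using open_contains_cube[OF open_Om p] by blast
  define C where "C = real DIM('a) * (2 * pi / r)\<^sup>2 + M"
  have C: "M \<le> C" by (simp add: C_def)
  define P where "P = (\<lambda>h u l. (\<forall>x. 0 \<le> u x \<and> u x \<le> 1) \<and> \<bar>l\<bar> \<le> C \<and> (0 < h \<and> h \<le> r / 4 \<longrightarrow>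
    (\<forall>x. x \<notin> Om \<inter> grid h \<longrightarrow> u x = 0) \<and> (\<exists>x\<in>Om \<inter> grid h. u x = 1) \<and>
    (\<forall>x\<in>Om \<inter> grid h. dlap h u x = (V x - l) * u x)))"
  have "\<exists>u l. P h u l" for h
  proof (cases "0 < h \<and> h \<le> r / 4")
    case True
    have "gfloor h p \<in> cube p r" using gfloor_close[of h _ p] True by (force simp: cube_def)
    then have meets_grid: "Om \<inter> grid h \<noteq> {}" using r(2) gfloor_grid[of h p] by blast
    obtain u l where u: "\<And>x. 0 \<le> u x" "\<And>x. u x \<le> 1" "\<And>x. x \<notin> Om \<inter> grid h \<Longrightarrow> u x = 0"
      "\<exists>x\<in>Om \<inter> grid h. u x = 1" "\<And>x. x \<in> Om \<inter> grid h \<Longrightarrow> dlap h u x = (V x - l) * u x" "rayleigh_bound h l"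
      by (rule discrete_ground_state[OF conjunct1[OF True] meets_grid]) (rule that)
    have "l \<le> C" unfolding C_def using rayleigh_bound_le[OF r(2) _ _ u(6)] True by simp
    moreover obtain x where "x \<in> Om \<inter> grid h" "u x = 1" using u(4) by blast
    then have "- M \<le> l" using discrete_eigenvalue_ge[of h u x l] True u(2,5) by blast
    ultimately have "P h u l" unfolding P_def using u(1-5) C by (auto simp: abs_le_iff)
    then show ?thesis by blast
  next
    case False
    then have "P h (\<lambda>x. 0) 0" unfolding P_def using C M_nonneg by auto
    then show ?thesis by blast
  qed
  then have "\<forall>h. \<exists>u l. P h u l" by blast
  from choice[OF this] obtain u where "\<forall>h. \<exists>l. P h (u h) l" ..
  from choice[OF this] obtain l where "\<forall>h. P h (u h) (l h)" ..
  then have P: "P h (u h) (l h)" for h ..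
  show ?thesis by (rule that[of "r / 4" u l C]) (use P[unfolded P_def] r(1) in auto)
qed

end

locale discrete_ground_state_family = schroedinger_domain +
  fixes h0 C :: real and u :: "real \<Rightarrow> 'a \<Rightarrow> real" and l :: "real \<Rightarrow> real"
  assumes h0: "h0 > 0" and u_nonneg: "\<And>h x. 0 \<le> u h x" and u_le_1: "\<And>h x. u h x \<le> 1"
    and l_bound: "\<And>h. \<bar>l h\<bar> \<le> C"
    and u_zero: "\<And>h x. 0 < h \<Longrightarrow> h \<le> h0 \<Longrightarrow> x \<notin> Om \<inter> grid h \<Longrightarrow> u h x = 0"
    and u_attains_1: "\<And>h. 0 < h \<Longrightarrow> h \<le> h0 \<Longrightarrow> \<exists>x\<in>Om \<inter> grid h. u h x = 1"
    and u_equation: "\<And>h x. 0 < h \<Longrightarrow> h \<le> h0 \<Longrightarrow> x \<in> Om \<inter> grid h \<Longrightarrow> dlap h (u h) x = (V x - l h) * u h x"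
begin

lemma eventually_u_equation:
  assumes G: "G \<le> at_right 0" and p: "p \<in> Om"
  shows "\<forall>\<^sub>F (h, x) in grid_filter G p. dlap h (u h) x = (V x - l h) * u h x"
  using eventually_compose_filterlim[OF eventually_at_right_0_le[OF G h0] filterlim_grid_filter_fst_snd(1)]
    eventually_grid_filter_in_open[OF open_Om p] eventually_grid_filter_in_grid[of G p]
  by eventually_elim (simp add: case_prod_unfold u_equation)

lemma bounded_fdiffs_u:
  assumes p: "p \<in> Om"
  shows "bounded_fdiffs 3 p u"
proof (rule bounded_fdiffs_of_equation[OF _ _ eventually_u_equation[OF order_refl p]])
  show "bounded_fdiffs 2 p (\<lambda>h x. V x - l h)"
    using bounded_fdiffs_add[OF bounded_fdiffs_V[OF p] bounded_fdiffs_const[of "\<lambda>h. - l h" C]] l_bound by simp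
  show "bounded_near p u"
    using u_nonneg u_le_1 by (intro bounded_near_on_Om[OF p, of _ 1]) (simp add: abs_of_nonneg)
qed simp

definition boundary_slope :: real where
  "boundary_slope = 3 * (C + M + 1) * (diameter (closure Om) + 1)"

lemma C_nonneg: "C \<ge> 0"
  using l_bound[of 0] by linarith

lemma boundary_slope_nonneg: "boundary_slope \<ge> 0"
  using C_nonneg M_nonneg diameter_ge_0[of "closure Om"] bounded_Om
  by (simp add: boundary_slope_def bounded_closure)

lemma discrete_boundary_estimate:
  assumes p: "p \<in> frontier Om" and nu: "norm nu = 1" "\<And>y. y \<in> Om \<Longrightarrow> 0 < (p - y) \<bullet> nu"
    and x: "x \<in> Om" and h: "0 < h" "h \<le> min h0 1"
  shows "u h x \<le> boundary_slope * ((p - x) \<bullet> nu + h)"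
proof -
  define D where "D = diameter (closure Om) + 1"
  have bounded: "bounded (closure Om)" using bounded_Om by (rule bounded_closure)
  have slab: "0 < p \<bullet> nu - y \<bullet> nu \<and> p \<bullet> nu - y \<bullet> nu \<le> D" if y: "y \<in> Om" for y
  proof -
    have "(p - y) \<bullet> nu \<le> norm (p - y)" using norm_cauchy_schwarz[of "p - y" nu] nu(1) by simp
    also have "\<dots> \<le> D"
      using diameter_bounded_bound[OF bounded, of p y] p y closure_subset[of Om]
      by (auto simp: D_def dist_norm frontier_def)
    finally show ?thesis using nu(2)[OF y] by (simp add: inner_diff_left)
  qed
  have "h \<le> D" using h diameter_ge_0[OF bounded] by (simp add: D_def)
  moreover have "l h \<le> C" using l_bound[of h] by simp
  ultimately have "u h x \<le> 3 * (C + M + 1) * D * (p \<bullet> nu - x \<bullet> nu + h)"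
    using h by (intro discrete_slab_estimate[OF h(1) _ nu(1) slab u_le_1 u_nonneg u_zero u_equation _ C_nonneg x]) simp_all
  then show ?thesis by (simp add: boundary_slope_def D_def inner_diff_left)
qed

end

locale ground_state_limit = discrete_ground_state_family +
  fixes G :: "real filter" and U :: "'a list \<Rightarrow> 'a \<Rightarrow> real" and lam :: real
  assumes G: "G \<le> at_right 0" "G \<noteq> bot" and l_tendsto: "(l \<longlongrightarrow> lam) G"
    and U: "\<And>vs x. set vs \<subseteq> Basis \<Longrightarrow> length vs \<le> 2 \<Longrightarrow> x \<in> Om \<Longrightarrow>
      ((\<lambda>h. foldr (fdiff h) vs (u h) (gfloor h x)) \<longlongrightarrow> U vs x) G"
begin

lemma U_converges_near:
  assumes vs: "set vs \<subseteq> Basis" "length vs \<le> 2" and p: "p \<in> Om"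
  shows "converges_near G (\<lambda>h. foldr (fdiff h) vs (u h)) p (U vs p)"
proof (rule converges_near_of_gfloor[where w = "\<lambda>h. foldr (fdiff h) vs (u h)"
  and p = p, OF G(1) _ U[OF vs p]])
  have "bounded_near p (\<lambda>h. foldr (fdiff h) (b # vs) (u h))" if "b \<in> Basis" for b
    by (rule bounded_fdiffs_foldr[OF bounded_fdiffs_u[OF p]]) (use vs that in auto)
  moreover have "bounded_near p (\<lambda>h. foldr (fdiff h) vs (u h))"
    by (rule bounded_fdiffs_foldr[OF bounded_fdiffs_u[OF p]]) (use vs in auto)
  ultimately show "bounded_fdiffs 1 p (\<lambda>h. foldr (fdiff h) vs (u h))" by simp
qed

lemma isCont_U:
  assumes "set vs \<subseteq> Basis" "length vs \<le> 2" "x \<in> Om"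
  shows "isCont (U vs) x"
  by (rule isCont_of_converges_near[OF G open_Om U_converges_near]) (use assms in auto)

lemma U_has_derivative:
  assumes vs: "set vs \<subseteq> Basis" "length vs \<le> 1" and x: "x \<in> Om"
  shows "(U vs has_derivative (\<lambda>a. \<Sum>b\<in>Basis. U (b # vs) x * (a \<bullet> b))) (at x)"
proof (rule has_derivative_of_continuous_partials[OF open_Om x])
  show "isCont (U (b # vs)) x" if "b \<in> Basis" for b
    by (rule isCont_U) (use that vs x in auto)
  show "((\<lambda>t. U vs (y + t *\<^sub>R b)) has_real_derivative U (b # vs) y) (at 0)" if "b \<in> Basis" "y \<in> Om" for b y
    using U_converges_near[of "b # vs" y] vs that
    by (intro has_real_derivative_of_converges_near[OF G open_Om U_converges_near]) auto
qed

lemma U_equation: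
  assumes x: "x \<in> Om"
  shows "(\<Sum>b\<in>Basis. U [b, b] x) = (V x - lam) * U [] x"
proof (rule tendsto_unique[OF grid_filter_nontrivial[OF G]])
  let ?F = "grid_filter G x"
  have pos: "\<forall>\<^sub>F z in ?F. fst z > 0"
    by (rule filterlim_at_right_0D(2)[OF filterlim_grid_filter_fst_snd(1) G(1)])
  have "((\<lambda>z. fdiff (fst z) b (fdiff (fst z) b (u (fst z))) (snd z - fst z *\<^sub>R b)) \<longlongrightarrow> U [b, b] x) ?F"
    if b: "b \<in> Basis" for b
    using filterlim_compose[OF U_converges_near[of "[b, b]" x] filterlim_grid_step(2)[OF G(1) b]] b x
    by (simp add: case_prod_unfold)
  then have "((\<lambda>z. \<Sum>b\<in>Basis. fdiff (fst z) b (fdiff (fst z) b (u (fst z))) (snd z - fst z *\<^sub>R b)) \<longlongrightarrow>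
    (\<Sum>b\<in>Basis. U [b, b] x)) ?F"
    by (intro tendsto_sum)
  then show "((\<lambda>z. dlap (fst z) (u (fst z)) (snd z)) \<longlongrightarrow> (\<Sum>b\<in>Basis. U [b, b] x)) ?F"
    by (rule Lim_transform_eventually) (use pos in eventually_elim, simp add: dlap_eq_sum_fdiff)
  have "((\<lambda>z. V (snd z)) \<longlongrightarrow> V x) ?F"
    by (rule isCont_tendsto_compose[OF has_derivative_continuous[OF V_deriv[OF x]] filterlim_grid_filter_fst_snd(2)])
  moreover have "((\<lambda>z. l (fst z)) \<longlongrightarrow> lam) ?F"
    by (rule filterlim_compose[OF l_tendsto filterlim_grid_filter_fst_snd(1)])
  moreover have "((\<lambda>z. u (fst z) (snd z)) \<longlongrightarrow> U [] x) ?F"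
    using U_converges_near[of "[]" x] x by (simp add: case_prod_unfold)
  ultimately have "((\<lambda>z. (V (snd z) - l (fst z)) * u (fst z) (snd z)) \<longlongrightarrow> (V x - lam) * U [] x) ?F"
    by (intro tendsto_intros)
  then show "((\<lambda>z. dlap (fst z) (u (fst z)) (snd z)) \<longlongrightarrow> (V x - lam) * U [] x) ?F"
    by (rule Lim_transform_eventually)
      (use eventually_u_equation[OF G(1) x] in eventually_elim, simp add: case_prod_unfold)
qed

lemma min_h0_1_pos: "0 < min h0 1"
  using h0 by simp

lemma u_gfloor_tendsto: "x \<in> Om \<Longrightarrow> ((\<lambda>h. u h (gfloor h x)) \<longlongrightarrow> U [] x) G"
  using U[of "[]" x] by simp

lemma U_bounds:
  assumes "x \<in> Om"
  shows "0 \<le> U [] x" "U [] x \<le> 1"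
  using tendsto_lowerbound[OF u_gfloor_tendsto[OF assms] _ G(2)] tendsto_upperbound[OF u_gfloor_tendsto[OF assms] _ G(2)]
  by (simp_all add: u_nonneg u_le_1)

lemma U_boundary_estimate:
  assumes p: "p \<in> frontier Om" and nu: "norm nu = 1" "\<And>y. y \<in> Om \<Longrightarrow> 0 < (p - y) \<bullet> nu" and x: "x \<in> Om"
  shows "U [] x \<le> boundary_slope * ((p - x) \<bullet> nu)"
proof (rule tendsto_le[OF G(2) _ u_gfloor_tendsto[OF x]])
  have gfloor: "((\<lambda>h. gfloor h x) \<longlongrightarrow> x) G" by (rule tendsto_gfloor[OF filterlim_ident G(1) tendsto_const])
  have "((\<lambda>h. boundary_slope * ((p - gfloor h x) \<bullet> nu + h)) \<longlongrightarrow> boundary_slope * ((p - x) \<bullet> nu + 0)) G"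
    by (intro tendsto_intros gfloor filterlim_at_right_0D(1)[OF filterlim_ident G(1)])
  then show "((\<lambda>h. boundary_slope * ((p - gfloor h x) \<bullet> nu + h)) \<longlongrightarrow> boundary_slope * ((p - x) \<bullet> nu)) G" by simp
  show "\<forall>\<^sub>F h in G. u h (gfloor h x) \<le> boundary_slope * ((p - gfloor h x) \<bullet> nu + h)"
    using topological_tendstoD[OF gfloor open_Om x] eventually_at_right_0_le[OF G(1) min_h0_1_pos]
    by eventually_elim (simp add: discrete_boundary_estimate[OF p nu])
qed

lemma U_attains_1: "\<exists>x\<in>Om. U [] x = 1"
proof -
  have small: "\<forall>\<^sub>F h in G. 0 < h \<and> h \<le> min h0 1" by (rule eventually_at_right_0_le[OF G(1) min_h0_1_pos])
  obtain m where m: "\<And>h. 0 < h \<Longrightarrow> h \<le> h0 \<Longrightarrow> m h \<in> Om \<and> m h \<in> grid h \<and> u h (m h) = 1"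
    using u_attains_1 by (metis IntD1 IntD2)
  have "\<forall>\<^sub>F h in G. m h \<in> closure Om"
    using small by eventually_elim (use m closure_subset in fastforce)
  with bounded_Om G(2) obtain z G' where z: "z \<in> closure Om" and G': "G' \<le> G" "G' \<noteq> bot"
    and m_lim: "(m \<longlongrightarrow> z) G'"
    by (auto intro: compact_imp_convergent_finer_filter[of "closure Om" G m])
  note G'_le = order_trans[OF G'(1) G(1)]
  have small': "\<forall>\<^sub>F h in G'. 0 < h \<and> h \<le> min h0 1" by (rule filter_leD[OF G'(1) small])
  have z_Om: "z \<in> Om"
  proof (rule ccontr)
    assume "z \<notin> Om"
    then have front: "z \<in> frontier Om" using z open_Om by (simp add: frontier_def interior_open)
    obtain nu where nu: "norm nu = 1" "\<And>x. x \<in> Om \<Longrightarrow> 0 < (z - x) \<bullet> nu"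
      using supporting_direction[OF open_Om convex_Om Om_ne \<open>z \<notin> Om\<close>] by blast
    have "((\<lambda>h. boundary_slope * ((z - m h) \<bullet> nu + h)) \<longlongrightarrow> boundary_slope * ((z - z) \<bullet> nu + 0)) G'"
      by (intro tendsto_intros m_lim filterlim_at_right_0D(1)[OF filterlim_ident G'_le])
    moreover have "\<forall>\<^sub>F h in G'. 1 \<le> boundary_slope * ((z - m h) \<bullet> nu + h)"
      using small'
    proof eventually_elim
      case (elim h)
      then show ?case using discrete_boundary_estimate[OF front nu, of "m h" h] m[of h] by simp
    qed
    ultimately have "1 \<le> boundary_slope * ((z - z) \<bullet> nu + 0)" using G'(2) by (rule tendsto_lowerbound)
    then show False by simp
  qed
  have "converges_near G' u z (U [] z)"
    using filterlim_mono[OF U_converges_near[of "[]" z] order_refl grid_filter_mono[OF G'(1)]] z_Om by simp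
  then have "((\<lambda>h. u h (m h)) \<longlongrightarrow> U [] z) G'"
    by (rule converges_near_compose[OF _ filterlim_ident m_lim]) (use small' in eventually_elim, simp add: m)
  moreover have "((\<lambda>h. u h (m h)) \<longlongrightarrow> 1) G'"
    by (rule tendsto_eventually) (use small' in eventually_elim, simp add: m)
  ultimately have "U [] z = 1" using tendsto_unique G'(2) by blast
  with z_Om show ?thesis by blast
qed

definition ground :: "'a \<Rightarrow> real" where
  "ground x = (if x \<in> Om then U [] x else 0)"

definition ground_grad :: "'a \<Rightarrow> 'a" where
  "ground_grad x = (\<Sum>b\<in>Basis. U [b] x *\<^sub>R b)"

definition ground_hess :: "'a \<Rightarrow> 'a \<Rightarrow> 'a" where
  "ground_hess x a = (\<Sum>b\<in>Basis. (\<Sum>c\<in>Basis. U [c, b] x * (a \<bullet> c)) *\<^sub>R b)"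

lemma has_hessian_on_ground: "has_hessian_on Om ground ground_grad ground_hess"
  unfolding has_hessian_on_def
proof (intro ballI conjI)
  fix x
  assume x: "x \<in> Om"
  have "ground_grad x \<bullet> a = (\<Sum>b\<in>Basis. U [b] x * (a \<bullet> b))" for a
    unfolding ground_grad_def inner_sum_left by (intro sum.cong) (simp_all add: inner_commute)
  then have "(U [] has_derivative (\<lambda>a. ground_grad x \<bullet> a)) (at x)"
    using U_has_derivative[of "[]" x] x by simp
  then show "(ground has_derivative (\<lambda>a. ground_grad x \<bullet> a)) (at x)"
    by (rule has_derivative_transform_within_open[OF _ open_Om x]) (simp add: ground_def)
  show "(ground_grad has_derivative ground_hess x) (at x)"
    unfolding ground_grad_def ground_hess_def
    by (intro has_derivative_sum has_derivative_scaleR_left U_has_derivative) (use x in simp_all)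
qed

lemma ground_hess_inner:
  assumes "b \<in> Basis"
  shows "ground_hess x a \<bullet> b = (\<Sum>c\<in>Basis. U [c, b] x * (a \<bullet> c))"
  unfolding ground_hess_def using assms by (simp add: inner_sum_left inner_Basis if_distrib cong: if_cong)

lemma continuous_on_ground_hess: "continuous_on Om (\<lambda>x. ground_hess x a \<bullet> e)"
proof -
  have "ground_hess x a \<bullet> e = (\<Sum>b\<in>Basis. (\<Sum>c\<in>Basis. U [c, b] x * (a \<bullet> c)) * (b \<bullet> e))" for x
    by (simp add: ground_hess_def inner_sum_left)
  moreover have "continuous_on Om (U [c, b])" if "b \<in> Basis" "c \<in> Basis" for b c
    using that by (intro continuous_at_imp_continuous_on ballI isCont_U) simp_all
  ultimately show ?thesis by (auto intro!: continuous_intros)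
qed

lemma trace_ground_hess:
  assumes "x \<in> Om"
  shows "trace_op (ground_hess x) = (V x - lam) * ground x"
proof -
  have "trace_op (ground_hess x) = (\<Sum>b\<in>Basis. U [b, b] x)"
    unfolding trace_op_def
    by (rule sum.cong) (simp_all add: ground_hess_inner inner_Basis if_distrib cong: if_cong)
  then show ?thesis using U_equation assms by (simp add: ground_def)
qed

lemma ground_bounds: "0 \<le> ground x" "ground x \<le> 1"
  using U_bounds by (simp_all add: ground_def)

lemma ground_le_boundary_distance:
  assumes p: "p \<in> frontier Om"
  shows "ground x \<le> boundary_slope * norm (x - p)"
proof (cases "x \<in> Om")
  case True
  have "p \<notin> Om" using p open_Om by (simp add: frontier_def interior_open)
  then obtain nu where nu: "norm nu = 1" "\<And>y. y \<in> Om \<Longrightarrow> 0 < (p - y) \<bullet> nu"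
    using supporting_direction[OF open_Om convex_Om Om_ne] by blast
  have "ground x \<le> boundary_slope * ((p - x) \<bullet> nu)"
    using U_boundary_estimate[OF p nu True] True by (simp add: ground_def)
  also have "\<dots> \<le> boundary_slope * (norm (p - x) * norm nu)"
    by (intro mult_left_mono norm_cauchy_schwarz boundary_slope_nonneg)
  finally show ?thesis by (simp add: nu norm_minus_commute)
qed (simp add: ground_def boundary_slope_nonneg)

lemma continuous_on_closure_ground: "continuous_on (closure Om) ground"
  unfolding continuous_on_eq_continuous_within
proof
  fix p
  assume p: "p \<in> closure Om"
  show "continuous (at p within closure Om) ground"
  proof (cases "p \<in> Om")
    case True
    from has_derivative_continuous[OF has_hessian_onD(1)[OF has_hessian_on_ground this]]
    show ?thesis by (rule continuous_at_imp_continuous_at_within)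
  next
    case False
    then have front: "p \<in> frontier Om" using p open_Om by (simp add: frontier_def interior_open)
    have "(ground \<longlongrightarrow> 0) (at p within closure Om)"
    proof (rule Lim_null_comparison)
      show "\<forall>\<^sub>F x in at p within closure Om. norm (ground x) \<le> boundary_slope * norm (x - p)"
        using ground_le_boundary_distance[OF front] ground_bounds by simp
      have "((\<lambda>x. boundary_slope * norm (x - p)) \<longlongrightarrow> boundary_slope * norm (p - p)) (at p within closure Om)"
        by (intro tendsto_intros)
      then show "((\<lambda>x. boundary_slope * norm (x - p)) \<longlongrightarrow> 0) (at p within closure Om)" by simp
    qed
    then show ?thesis using False by (simp add: continuous_within ground_def)
  qed
qed

end

lemma (in discrete_ground_state_family) ground_state_limit_exists:
  obtains G U lam where "ground_state_limit Om V gV M h0 C u l G U lam"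
proof -
  define quotient where "quotient = (\<lambda>i h. case i of None \<Rightarrow> l h | Some (vs, x) \<Rightarrow> foldr (fdiff h) vs (u h) (gfloor h x))"
  define I where "I = insert None (Some ` ({vs :: 'a list. set vs \<subseteq> Basis \<and> length vs \<le> 2} \<times> Om))"
  have "Bfun (quotient i) (at_right 0)" if i: "i \<in> I" for i
  proof (cases i)
    case None
    then show ?thesis using l_bound by (auto simp: quotient_def intro: BfunI[of _ C])
  next
    case (Some j)
    then obtain vs x where j: "i = Some (vs, x)" "set vs \<subseteq> Basis" "length vs \<le> 2" "x \<in> Om"
      using i by (auto simp: I_def)
    have "bounded_near x (\<lambda>h. foldr (fdiff h) vs (u h))"
      by (rule bounded_fdiffs_foldr[OF bounded_fdiffs_u]) (use j in auto)
    from Bfun_compose[OF this filterlim_gfloor_grid_filter[OF order_refl]] show ?thesis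
      by (simp add: j quotient_def)
  qed
  then obtain L G where L: "G \<le> at_right 0" "G \<noteq> bot" "\<And>i. i \<in> I \<Longrightarrow> (quotient i \<longlongrightarrow> L i) G"
    by (rule bounded_family_convergent_finer_filter[OF trivial_limit_at_right_real]) blast+
  have "ground_state_limit Om V gV M h0 C u l G (\<lambda>vs x. L (Some (vs, x))) (L None)"
  proof unfold_locales
    show "(l \<longlongrightarrow> L None) G" using L(3)[of None] by (simp add: I_def quotient_def)
    show "((\<lambda>h. foldr (fdiff h) vs (u h) (gfloor h x)) \<longlongrightarrow> L (Some (vs, x))) G"
      if "set vs \<subseteq> Basis" "length vs \<le> 2" "x \<in> Om" for vs x
      using L(3)[of "Some (vs, x)"] that by (simp add: I_def quotient_def)
  qed (rule L(1), rule L(2))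
  then show ?thesis by (rule that)
qed

theorem (in schroedinger_domain) ground_state_exists:
  obtains u g H lam where "has_hessian_on Om u g H" "\<And>b c. continuous_on Om (\<lambda>x. H x b \<bullet> c)"
    "\<And>x. x \<in> Om \<Longrightarrow> trace_op (H x) = (V x - lam) * u x"
    "\<And>x. x \<in> Om \<Longrightarrow> 0 \<le> u x" "\<And>x. x \<in> Om \<Longrightarrow> u x \<le> 1" "\<exists>x\<in>Om. u x = 1"
    "continuous_on (closure Om) u" "\<And>x. x \<in> frontier Om \<Longrightarrow> u x = 0"
proof -
  obtain h0 C u l where "h0 > 0" "\<And>h x. 0 \<le> u h x" "\<And>h x. u h x \<le> 1" "\<And>h. \<bar>l h\<bar> \<le> C"
    "\<And>h x. 0 < h \<Longrightarrow> h \<le> h0 \<Longrightarrow> x \<notin> Om \<inter> grid h \<Longrightarrow> u h x = 0"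
    "\<And>h. 0 < h \<Longrightarrow> h \<le> h0 \<Longrightarrow> \<exists>x\<in>Om \<inter> grid h. u h x = 1"
    "\<And>h x. 0 < h \<Longrightarrow> h \<le> h0 \<Longrightarrow> x \<in> Om \<inter> grid h \<Longrightarrow> dlap h (u h) x = (V x - l h) * u h x"
    by (rule discrete_ground_states) (rule that)
  then interpret discrete_ground_state_family Om V gV M h0 C u l by unfold_locales
  obtain G U lam where "ground_state_limit Om V gV M h0 C u l G U lam" by (rule ground_state_limit_exists)
  then interpret ground_state_limit Om V gV M h0 C u l G U lam .
  show ?thesis
  proof (rule that[OF has_hessian_on_ground continuous_on_ground_hess trace_ground_hess])
    show "\<exists>x\<in>Om. ground x = 1" using U_attains_1 by (auto simp: ground_def)
    show "x \<in> frontier Om \<Longrightarrow> ground x = 0" for x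
      using open_Om by (simp add: ground_def frontier_def interior_open)
  qed (use ground_bounds continuous_on_closure_ground in auto)
qed

section \<open>Boundary barriers and quotients by the ground state\<close>

text \<open>The barrier of Hopf's lemma.\<close>

lemma gaussian_subsolution:
  fixes c :: "'a::euclidean_space"
  assumes r: "r > 0" and C: "C \<ge> 0"
  obtains a g H where "a > 0" "has_hessian_on UNIV (\<lambda>x. exp (- a * (dist c x)\<^sup>2)) g H"
    "\<And>x. r \<le> dist c x \<Longrightarrow> (C + 1) * exp (- a * (dist c x)\<^sup>2) \<le> trace_op (H x)"
proof -
  define n where "n = real DIM('a)"
  define a where "a = max 1 ((n + C + 1) / r\<^sup>2)"
  have a: "a \<ge> 1" "n + C + 1 \<le> a * r\<^sup>2"
    using r by (auto simp: a_def max_def field_simps)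
  have "has_hessian_on UNIV (\<lambda>x. (x - c) \<bullet> (x - c)) (\<lambda>x. 2 *\<^sub>R (x - c)) (\<lambda>x a. 2 *\<^sub>R a)"
    unfolding has_hessian_on_def by (auto intro!: derivative_eq_intros simp: inner_commute algebra_simps)
  moreover have "(\<lambda>x. (x - c) \<bullet> (x - c)) = (\<lambda>x. (dist c x)\<^sup>2)"
    by (simp add: fun_eq_iff dist_norm norm_minus_commute[of c] power2_norm_eq_inner)
  ultimately have hessian: "has_hessian_on UNIV (\<lambda>x. (dist c x)\<^sup>2) (\<lambda>x. 2 *\<^sub>R (x - c)) (\<lambda>x a. 2 *\<^sub>R a)"
    by simp
  show ?thesis
  proof (rule that[OF _ has_hessian_on_exp[OF hessian, of "- a"]])
    fix x
    assume "r \<le> dist c x"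
    then have "a * r\<^sup>2 \<le> a * (dist c x)\<^sup>2" using r a by (intro mult_left_mono power_mono) auto
    moreover have "0 \<le> n" by (simp add: n_def)
    ultimately have "C + 1 \<le> 4 * (a * (dist c x)\<^sup>2) - 2 * n" using a(2) C by linarith
    then have "1 * (C + 1) \<le> a * (4 * (a * (dist c x)\<^sup>2) - 2 * n)" using a C by (intro mult_mono) auto
    then have "C + 1 \<le> (- a)\<^sup>2 * ((2 *\<^sub>R (x - c)) \<bullet> (2 *\<^sub>R (x - c))) + (- a) * trace_op (\<lambda>a::'a. 2 *\<^sub>R a)"
      by (simp add: trace_op_def n_def dist_norm norm_minus_commute[of c] power2_norm_eq_inner
        power2_eq_square[of a] algebra_simps)
    then show "(C + 1) * exp (- a * (dist c x)\<^sup>2) \<le> trace_op (\<lambda>b. (- a * exp (- a * (dist c x)\<^sup>2)) *\<^sub>R (2 *\<^sub>R b) +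
      (- a * - a * exp (- a * (dist c x)\<^sup>2) * ((2 *\<^sub>R (x - c)) \<bullet> b)) *\<^sub>R (2 *\<^sub>R (x - c)))"
      unfolding trace_op_hessian_exp by (simp add: mult.commute)
  qed (use a in simp)
qed

context
  fixes S :: "'a::euclidean_space set" and u :: "'a \<Rightarrow> real" and g :: "'a \<Rightarrow> 'a" and H :: "'a \<Rightarrow> 'a \<Rightarrow> 'a"
    and C :: real
  assumes S: "open S" and u: "has_hessian_on S u g H" and C: "C \<ge> 0"
    and supersolution: "\<And>x. x \<in> S \<Longrightarrow> trace_op (H x) \<le> C * u x" and nonneg: "\<And>x. x \<in> S \<Longrightarrow> 0 \<le> u x"
begin

lemma supersolution_ge_on_annulus:
  assumes q: "has_hessian_on UNIV q gq Hq" and subsolution: "\<And>x. r \<le> dist c x \<Longrightarrow> C * q x < trace_op (Hq x)"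
    and annulus: "cball c R \<subseteq> S" and inner: "\<And>x. dist c x = r \<Longrightarrow> q x \<le> u x"
    and outer: "\<And>x. dist c x = R \<Longrightarrow> q x \<le> 0"
    and x: "r \<le> dist c x" "dist c x \<le> R"
  shows "q x \<le> u x"
proof (rule ccontr)
  assume less: "\<not> q x \<le> u x"
  define w where "w = (\<lambda>x. u x + (-1) * q x)"
  note w = has_hessian_on_add[OF u has_hessian_on_cmult[OF has_hessian_on_subset[OF q subset_UNIV], where c = "-1"], folded w_def]
  define A where "A = {y \<in> cball c R. r \<le> dist c y}"
  have A: "A \<subseteq> S" using annulus by (auto simp: A_def)
  have "compact A" unfolding A_def by (intro compact_superlevel compact_cball continuous_intros)
  moreover have "x \<in> A" using x by (simp add: A_def)
  moreover have "continuous_on A w"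
    using has_hessian_on_continuous_on(1)[OF w] A continuous_on_subset by blast
  ultimately obtain y where y: "y \<in> A" "\<And>x. x \<in> A \<Longrightarrow> w y \<le> w x" using continuous_attains_inf[of A w] by blast
  have w_neg: "u y < q y" using y(2)[OF \<open>x \<in> A\<close>] less by (simp add: w_def)
  have "y \<in> S" using y(1) A by blast
  then have "dist c y \<noteq> r" "dist c y \<noteq> R" using inner[of y] outer[of y] nonneg[of y] w_neg by auto
  then have interior: "r < dist c y" "dist c y < R" using y(1) by (auto simp: A_def)
  have "open ({x. r < dist c x} \<inter> ball c R)"
    by (intro open_Int open_ball open_Collect_less continuous_intros)
  then have "\<forall>\<^sub>F x in nhds y. x \<in> {x. r < dist c x} \<inter> ball c R"
    by (rule eventually_nhds_in_open) (use interior in simp)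
  then have "\<forall>\<^sub>F x in nhds y. w y \<le> w x"
    by (rule eventually_mono) (use y(2) in \<open>simp add: A_def\<close>)
  from has_hessian_on_local_min[OF w S \<open>y \<in> S\<close> this]
  have "trace_op (Hq y) \<le> trace_op (H y)" unfolding trace_op_simps(1) trace_op_simps(2) by simp
  also have "\<dots> \<le> C * u y" by (rule supersolution[OF \<open>y \<in> S\<close>])
  also have "\<dots> \<le> C * q y" using w_neg C by (intro mult_left_mono) auto
  finally show False using subsolution[of y] interior by simp
qed

lemma supersolution_pos_on_annulus:
  assumes m: "m > 0" and u_ge: "\<And>y. dist c y \<le> r \<Longrightarrow> m \<le> u y" and r: "r > 0"
    and R: "cball c R \<subseteq> S" and z: "r \<le> dist c z" "dist c z < R"
  shows "u z > 0"
proof -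
  obtain a gq Hq where a: "a > 0" and hessian: "has_hessian_on UNIV (\<lambda>x. exp (- a * (dist c x)\<^sup>2)) gq Hq"
    and trace: "\<And>x. r \<le> dist c x \<Longrightarrow> (C + 1) * exp (- a * (dist c x)\<^sup>2) \<le> trace_op (Hq x)"
    using gaussian_subsolution[OF r C, of c] by blast
  define E where "E = (\<lambda>x. exp (- a * (dist c x)\<^sup>2))"
  define b where "b = exp (- a * R\<^sup>2)"
  have b: "b > 0" by (simp add: b_def)
  have "m * E z + m * (- b) \<le> u z"
  proof (rule supersolution_ge_on_annulus[where r = r and c = c and R = R])
    show "has_hessian_on UNIV (\<lambda>x. m * E x + m * (- b)) (\<lambda>x. m *\<^sub>R gq x + 0) (\<lambda>x v. m *\<^sub>R Hq x v + 0)"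
      unfolding E_def by (intro has_hessian_on_add has_hessian_on_cmult hessian has_hessian_on_const)
    fix x
    show "C * (m * E x + m * (- b)) < trace_op (\<lambda>v. m *\<^sub>R Hq x v + 0)" if "r \<le> dist c x"
    proof -
      have "C * (m * E x + m * (- b)) \<le> m * (C * E x)" using C m b by (simp add: algebra_simps)
      also have "\<dots> < m * ((C + 1) * E x)" using m by (simp add: E_def)
      also have "\<dots> \<le> m * trace_op (Hq x)" using trace[OF that] m by (simp add: E_def)
      finally show ?thesis unfolding trace_op_simps(1) trace_op_simps(2) trace_op_simps(5) by simp
    qed
    show "m * E x + m * (- b) \<le> u x" if "dist c x = r"
    proof -
      have "E x \<le> 1" using a by (simp add: E_def)
      then have "m * E x + m * (- b) \<le> m"
        using m b by (smt (verit) mult_left_le mult_nonneg_nonneg mult_minus_right)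
      then show ?thesis using u_ge[of x] that by simp
    qed
    show "m * E x + m * (- b) \<le> 0" if "dist c x = R" using that by (simp add: E_def b_def)
  qed (use R z in auto)
  moreover have "(dist c z)\<^sup>2 < R\<^sup>2" using z(2) by (intro power_strict_mono) auto
  then have "b < E z" using a by (simp add: E_def b_def)
  then have "m * b < m * E z" using m by simp
  ultimately show ?thesis by simp
qed

lemma supersolution_pos_on_ball:
  assumes c: "c \<in> S" "u c > 0" and R: "cball c R \<subseteq> S" and z: "dist c z < R"
  shows "u z > 0"
proof -
  have R_pos: "R > 0" using z zero_le_dist[of c z] by linarith
  have "isCont u c"
    using has_hessian_on_continuous_on(1)[OF u] S c(1) by (simp add: continuous_on_eq_continuous_at)
  then obtain r0 where r0: "r0 > 0" "\<And>y. dist y c < r0 \<Longrightarrow> dist (u y) (u c) < u c / 2"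
    unfolding continuous_at_eps_delta using c(2) half_gt_zero by blast
  define r where "r = min r0 R / 2"
  have r: "0 < r" "r < R" "r < r0" using r0 R_pos by (auto simp: r_def)
  define m where "m = u c / 2"
  have m: "m > 0" using c(2) by (simp add: m_def)
  have u_ge: "m \<le> u y" if "dist c y \<le> r" for y
  proof -
    have "dist (u y) (u c) < u c / 2" using r0(2)[of y] that r(3) by (simp add: dist_commute)
    then show ?thesis unfolding m_def dist_real_def by linarith
  qed
  show ?thesis
  proof (cases "dist c z \<le> r")
    case True
    then show ?thesis using m u_ge by (meson less_le_trans)
  next
    case False
    show ?thesis by (rule supersolution_pos_on_annulus[OF m u_ge r(1) R]) (use False z in auto)
  qed
qed

lemma positive_of_nonneg_supersolution:
  assumes "connected S" and "\<exists>x\<in>S. u x > 0" and "x \<in> S"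
  shows "u x > 0"
proof -
  define P where "P = {x \<in> S. u x > 0}"
  define N where "N = {x \<in> S. u x \<le> 0}"
  have "open P"
    unfolding P_def
    using continuous_on_open_vimage[OF S, of u, THEN iffD1, OF has_hessian_on_continuous_on(1)[OF u],
      rule_format, OF open_greaterThan[of "0::real"]]
    by (simp add: vimage_def Int_def conj_commute)
  moreover have "open N"
    unfolding open_contains_ball
  proof
    fix z
    assume z: "z \<in> N"
    then obtain e where e: "e > 0" "cball z e \<subseteq> S" using S[unfolded open_contains_cball] by (auto simp: N_def)
    have "y \<in> N" if y: "y \<in> ball z (e / 3)" for y
    proof -
      have "cball y (e / 2) \<subseteq> cball z e"
      proof
        show "v \<in> cball z e" if "v \<in> cball y (e / 2)" for v
          using that y dist_triangle[of z v y] e(1) by simp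
      qed
      then have "cball y (e / 2) \<subseteq> S" "y \<in> S" using e y by (auto simp: subset_iff)
      moreover have "dist y z < e / 2" "u z \<le> 0" using y z e(1) by (auto simp: N_def dist_commute)
      ultimately have "\<not> u y > 0" using supersolution_pos_on_ball[of y "e / 2" z] by auto
      then show ?thesis using \<open>y \<in> S\<close> by (simp add: N_def not_less)
    qed
    then show "\<exists>e>0. ball z e \<subseteq> N" using e by (intro exI[of _ "e / 3"]) auto
  qed
  ultimately have "P \<inter> S = {} \<or> N \<inter> S = {}"
    using assms(1) by (intro connectedD) (auto simp: P_def N_def)
  then show ?thesis using assms(2,3) by (auto simp: P_def N_def)
qed

end

locale smooth_convex_domain =
  fixes Om :: "'a::euclidean_space set" and rho :: "'a \<Rightarrow> real" and gr :: "'a \<Rightarrow> 'a" and Hr :: "'a \<Rightarrow> 'a \<Rightarrow> 'a"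
    and U :: "'a set"
  assumes open_Om: "open Om" and convex_Om: "convex Om" and bounded_Om: "bounded Om" and Om_ne: "Om \<noteq> {}"
    and open_U: "open U" and closure_Om_subset_U: "closure Om \<subseteq> U"
    and has_hessian_on_rho: "has_hessian_on U rho gr Hr"
    and continuous_on_Hr: "\<And>b c. continuous_on U (\<lambda>x. Hr x b \<bullet> c)"
    and rho_neg: "\<And>x. x \<in> Om \<Longrightarrow> rho x < 0" and rho_zero: "\<And>x. x \<in> frontier Om \<Longrightarrow> rho x = 0"
    and gr_nonzero: "\<And>x. x \<in> frontier Om \<Longrightarrow> gr x \<noteq> 0"
    and positive_curvature: "\<And>x v. x \<in> frontier Om \<Longrightarrow> v \<noteq> 0 \<Longrightarrow> gr x \<bullet> v = 0 \<Longrightarrow> Hr x v \<bullet> v > 0"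

lemma smooth_convex_domain_of_smooth_uniformly_convex_domain:
  assumes "smooth_uniformly_convex_domain Om"
  obtains rho U where "smooth_convex_domain Om rho (grad rho) (hess rho) U"
proof -
  obtain rho U where U: "open U" "closure Om \<subseteq> U" "C_inf_on U rho" "Om = {x\<in>U. rho x < 0}" "frontier Om = {x\<in>U. rho x = 0}"
    and boundary: "\<forall>x\<in>frontier Om. grad rho x \<noteq> 0 \<and> (\<forall>v. v \<noteq> 0 \<and> grad rho x \<bullet> v = 0 \<longrightarrow> iter_dd [v, v] rho x > 0)"
    and Om: "open Om" "bounded Om" "Om \<noteq> {}" "convex Om"
    using assms unfolding smooth_uniformly_convex_domain_def by blast
  have rho_C2: "Ck_on 2 U rho" using U(3) by (simp add: C_inf_on_def)
  note hessian = Ck2_has_hessian_on[OF rho_C2]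
  have "smooth_convex_domain Om rho (grad rho) (hess rho) U"
  proof
    fix x v
    assume x: "x \<in> frontier Om"
    then have "x \<in> U" using U(5) by blast
    show "grad rho x \<noteq> 0" "rho x = 0" using x boundary U(5) by auto
    assume "v \<noteq> 0" "grad rho x \<bullet> v = 0"
    then have "iter_dd [v, v] rho x > 0" using x boundary by blast
    then show "hess rho x v \<bullet> v > 0" unfolding iter_dd_has_hessian_on(2)[OF U(1) hessian \<open>x \<in> U\<close>] .
  next
    show "rho x < 0" if "x \<in> Om" for x using that U(4) by blast
  qed (rule Om U hessian Ck2_continuous_on_hess[OF rho_C2])+
  then show ?thesis by (rule that)
qed

context smooth_convex_domain
begin

lemma compact_closure_Om: "compact (closure Om)"
  using bounded_Om by simp

lemma Om_closure: "x \<in> Om \<Longrightarrow> x \<in> closure Om"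
  using closure_subset by blast

lemma Om_U: "x \<in> Om \<Longrightarrow> x \<in> U"
  using closure_Om_subset_U Om_closure by blast

lemma closure_cases: "x \<in> closure Om \<Longrightarrow> x \<in> Om \<or> x \<in> frontier Om"
  using open_Om by (simp add: frontier_def interior_open)

lemma continuous_on_rho: "continuous_on (closure Om) rho"
  using has_hessian_on_continuous_on(1)[OF has_hessian_on_rho] closure_Om_subset_U
  by (rule continuous_on_subset)

lemma continuous_on_gr: "continuous_on (closure Om) gr"
  using has_hessian_on_continuous_on(2)[OF has_hessian_on_rho] closure_Om_subset_U
  by (rule continuous_on_subset)

definition exp_rho_laplacian :: "real \<Rightarrow> 'a \<Rightarrow> real" where
  "exp_rho_laplacian p x = exp (p * rho x) * (p\<^sup>2 * (gr x \<bullet> gr x) + p * trace_op (Hr x))"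

lemma has_hessian_on_exp_rho:
  obtains gE HE where "has_hessian_on Om (\<lambda>x. exp (p * rho x)) gE HE" "\<And>x. trace_op (HE x) = exp_rho_laplacian p x"
proof (rule that[OF has_hessian_on_exp])
  show "has_hessian_on Om rho gr Hr"
    by (rule has_hessian_on_subset[OF has_hessian_on_rho]) (use Om_U in blast)
qed (simp add: trace_op_hessian_exp exp_rho_laplacian_def)

lemma gr_bounded_below_near_frontier:
  obtains b d where "b > 0" "d > 0" "\<And>x. x \<in> closure Om \<Longrightarrow> - d < rho x \<Longrightarrow> b \<le> gr x \<bullet> gr x"
proof -
  have cont: "continuous_on (closure Om) (\<lambda>x. gr x \<bullet> gr x)" by (intro continuous_on_inner continuous_on_gr)
  have "Om \<noteq> UNIV" using bounded_Om not_bounded_UNIV by blast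
  then have frontier: "frontier Om \<noteq> {}" "compact (frontier Om)" "frontier Om \<subseteq> closure Om"
    using Om_ne frontier_eq_empty[of Om] compact_frontier_bounded[OF bounded_Om] by (auto simp: frontier_def)
  obtain x0 where x0: "x0 \<in> frontier Om" "\<And>x. x \<in> frontier Om \<Longrightarrow> gr x0 \<bullet> gr x0 \<le> gr x \<bullet> gr x"
    using continuous_attains_inf[OF frontier(2,1) continuous_on_subset[OF cont frontier(3)]] by blast
  define b where "b = (gr x0 \<bullet> gr x0) / 2"
  have b: "b > 0" "gr x0 \<bullet> gr x0 = 2 * b" using gr_nonzero[OF x0(1)] by (simp_all add: b_def)
  define Z where "Z = {x \<in> closure Om. gr x \<bullet> gr x \<le> b}"
  have compact: "compact Z" unfolding Z_def by (rule compact_sublevel[OF compact_closure_Om cont])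
  have neg: "rho x < 0" if "x \<in> Z" for x
    using that closure_cases[of x] x0(2)[of x] b rho_neg[of x] by (force simp: Z_def)
  show ?thesis
  proof (cases "Z = {}")
    case True
    then show ?thesis by (intro that[OF b(1) zero_less_one]) (auto simp: Z_def not_le)
  next
    case False
    have "continuous_on Z rho" by (rule continuous_on_subset[OF continuous_on_rho]) (auto simp: Z_def)
    then obtain z where z: "z \<in> Z" "\<And>x. x \<in> Z \<Longrightarrow> rho x \<le> rho z"
      using continuous_attains_sup[OF compact False] by blast
    show ?thesis
    proof (rule that[OF b(1), of "- rho z"])
      show "b \<le> gr x \<bullet> gr x" if "x \<in> closure Om" "- (- rho z) < rho x" for x
        using z(2)[of x] that by (cases "gr x \<bullet> gr x \<le> b") (auto simp: Z_def)
    qed (use neg[OF z(1)] in simp)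
  qed
qed

lemma exp_rho_laplacian_large:
  obtains k where "k > 0" "\<And>x p. x \<in> Om \<Longrightarrow> - 1 / k < rho x \<Longrightarrow> \<bar>p\<bar> = k \<Longrightarrow> G \<le> exp_rho_laplacian p x"
proof -
  obtain b d where b: "b > 0" and d: "d > 0" and gr_ge: "\<And>x. x \<in> closure Om \<Longrightarrow> - d < rho x \<Longrightarrow> b \<le> gr x \<bullet> gr x"
    by (rule gr_bounded_below_near_frontier) (rule that)
  have "continuous_on (closure Om) (\<lambda>x. trace_op (Hr x))"
    unfolding trace_op_def
    by (intro continuous_on_sum continuous_on_subset[OF continuous_on_Hr closure_Om_subset_U])
  then obtain T where T: "\<And>x. x \<in> closure Om \<Longrightarrow> norm (trace_op (Hr x)) \<le> T"
    using continuous_on_compact_bound[OF compact_closure_Om] by blast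
  define k where "k = max (1 / d) (max 1 ((T + 3 * \<bar>G\<bar>) / b))"
  have k: "k > 0" "1 \<le> k" "1 / d \<le> k" "(T + 3 * \<bar>G\<bar>) / b \<le> k" by (simp_all add: k_def)
  show ?thesis
  proof (rule that[OF k(1)])
    fix x p
    assume x: "x \<in> Om" and rho: "- 1 / k < rho x" and p: "\<bar>p\<bar> = k"
    have "1 / k \<le> d" using k(1,3) d by (simp add: field_simps)
    then have "b \<le> gr x \<bullet> gr x" using gr_ge[OF Om_closure[OF x]] rho by simp
    then have "k * (k * b) \<le> k * (k * (gr x \<bullet> gr x))" using k(1) by (intro mult_left_mono) auto
    moreover have "k * (T + 3 * \<bar>G\<bar>) \<le> k * (k * b)"
      using k(1,4) b by (intro mult_left_mono) (simp_all add: field_simps)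
    moreover have "p\<^sup>2 = k * k" using p by (simp add: power2_eq_square abs_mult_self_eq flip: p)
    moreover have "\<bar>p * trace_op (Hr x)\<bar> \<le> k * T"
      unfolding abs_mult p using T[OF Om_closure[OF x]] k(1) by (simp add: mult_left_mono)
    then have "- (k * T) \<le> p * trace_op (Hr x)" by linarith
    moreover have "\<bar>G\<bar> \<le> k * \<bar>G\<bar>" using mult_right_mono[OF k(2), of "\<bar>G\<bar>"] by simp
    ultimately have lower: "3 * \<bar>G\<bar> \<le> p\<^sup>2 * (gr x \<bullet> gr x) + p * trace_op (Hr x)"
      by (simp add: algebra_simps)
    have "k * \<bar>rho x\<bar> \<le> 1" using rho rho_neg[OF x] k(1) by (simp add: field_simps abs_if)
    then have "- 1 \<le> p * rho x" using abs_ge_minus_self[of "p * rho x"] by (simp add: abs_mult p)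
    then have "exp (- 1) \<le> exp (p * rho x)" by simp
    moreover have "1 / 3 \<le> exp (- 1 :: real)" using exp_le by (simp add: exp_minus field_simps)
    ultimately have "1 / 3 \<le> exp (p * rho x)" by linarith
    then have "1 / 3 * (3 * \<bar>G\<bar>) \<le> exp_rho_laplacian p x"
      unfolding exp_rho_laplacian_def using lower by (intro mult_mono) auto
    then show "G \<le> exp_rho_laplacian p x" by simp
  qed
qed

lemma strip_maximum_principle:
  assumes q: "has_hessian_on Om q gq Hq" "continuous_on (closure Om) q"
    and frontier: "\<And>x. x \<in> frontier Om \<Longrightarrow> q x \<le> 0" and inner: "\<And>x. x \<in> Om \<Longrightarrow> rho x = - 1 / k \<Longrightarrow> q x \<le> 0"
    and trace: "\<And>x. x \<in> Om \<Longrightarrow> - 1 / k < rho x \<Longrightarrow> q x > 0 \<Longrightarrow> trace_op (Hq x) > 0"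
    and x: "x \<in> Om" "- 1 / k \<le> rho x"
  shows "q x \<le> 0"
proof (rule ccontr)
  assume pos: "\<not> q x \<le> 0"
  define Z where "Z = {x \<in> closure Om. - 1 / k \<le> rho x}"
  have "compact Z" unfolding Z_def by (rule compact_superlevel[OF compact_closure_Om continuous_on_rho])
  moreover have "x \<in> Z" using x Om_closure by (simp add: Z_def)
  moreover have "continuous_on Z q" by (rule continuous_on_subset[OF q(2)]) (auto simp: Z_def)
  ultimately obtain y where y: "y \<in> Z" "\<And>z. z \<in> Z \<Longrightarrow> q z \<le> q y" using continuous_attains_sup[of Z q] by blast
  have q_pos: "q y > 0" using y(2)[OF \<open>x \<in> Z\<close>] pos by simp
  have y_Om: "y \<in> Om" using closure_cases[of y] y(1) frontier[of y] q_pos by (auto simp: Z_def)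
  have rho: "- 1 / k < rho y" using y(1) inner[OF y_Om] q_pos by (cases "rho y = - 1 / k") (auto simp: Z_def)
  have "isCont rho y"
    using has_hessian_on_continuous_on(1)[OF has_hessian_on_rho] open_U Om_U[OF y_Om]
    by (simp add: continuous_on_eq_continuous_at)
  then have "\<forall>\<^sub>F z in nhds y. - 1 / k < rho z"
    using rho by (metis isCont_def order_tendstoD(1) tendsto_at_iff_tendsto_nhds)
  moreover have "\<forall>\<^sub>F z in nhds y. z \<in> Om" by (rule eventually_nhds_in_open[OF open_Om y_Om])
  ultimately have "\<forall>\<^sub>F z in nhds y. q z \<le> q y"
    by eventually_elim (use y(2) Om_closure in \<open>simp add: Z_def\<close>)
  from has_hessian_on_local_max(2)[OF q(1) open_Om y_Om this] trace[OF y_Om rho q_pos] show False by simp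
qed

lemma strip_upper_barrier:
  assumes k: "k > 0" and large: "\<And>x. x \<in> Om \<Longrightarrow> - 1 / k < rho x \<Longrightarrow> Q + 1 \<le> exp_rho_laplacian k x" and Q: "Q \<ge> 0"
    and w: "has_hessian_on Om w gw Hw" "continuous_on (closure Om) w" "\<And>x. x \<in> frontier Om \<Longrightarrow> w x = 0"
    and trace: "\<And>x. x \<in> Om \<Longrightarrow> - Q \<le> trace_op (Hw x)"
    and B: "\<And>x. x \<in> closure Om \<Longrightarrow> w x \<le> B" "B \<ge> 0" and x: "x \<in> Om" "- 1 / k \<le> rho x"
  shows "w x \<le> 2 * (B + 1) * (1 - exp (k * rho x))"
proof -
  define A where "A = 2 * (B + 1)"
  have A: "A \<ge> 1" using B(2) by (simp add: A_def)
  obtain gE HE where E: "has_hessian_on Om (\<lambda>x. exp (k * rho x)) gE HE" "\<And>x. trace_op (HE x) = exp_rho_laplacian k x"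
    by (rule has_hessian_on_exp_rho) (rule that)
  have "w x + (A * exp (k * rho x) + (- A)) \<le> 0"
  proof (rule strip_maximum_principle[OF has_hessian_on_add[OF w(1)
        has_hessian_on_add[OF has_hessian_on_cmult[OF E(1)] has_hessian_on_const]] _ _ _ _ x])
    show "continuous_on (closure Om) (\<lambda>x. w x + (A * exp (k * rho x) + - A))"
      by (intro continuous_intros w(2) continuous_on_rho)
    show "w z + (A * exp (k * rho z) + - A) \<le> 0" if "z \<in> frontier Om" for z
      using w(3)[OF that] rho_zero[OF that] by simp
    fix z
    assume z: "z \<in> Om"
    show "w z + (A * exp (k * rho z) + - A) \<le> 0" if "rho z = - 1 / k"
    proof -
      have "2 \<le> exp (1::real)" using exp_ge_add_one_self[of 1] by simp
      then have "exp (-1::real) \<le> 1 / 2" by (simp add: exp_minus field_simps)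
      then have "A * exp (k * rho z) \<le> A * (1 / 2)" using A that k by (intro mult_left_mono) auto
      then show ?thesis using B(1)[OF Om_closure[OF z]] by (simp add: A_def)
    qed
    assume "- 1 / k < rho z"
    then have "Q + 1 \<le> exp_rho_laplacian k z" by (rule large[OF z])
    then have "1 * (Q + 1) \<le> A * exp_rho_laplacian k z" using A Q by (intro mult_mono) auto
    then show "0 < trace_op (\<lambda>a. Hw z a + (A *\<^sub>R HE z a + 0))"
      unfolding trace_op_simps(1) trace_op_simps(2) trace_op_simps(5) using trace[OF z] E(2) by simp
  qed
  then show ?thesis by (simp add: A_def algebra_simps)
qed

end

locale ground_state = smooth_convex_domain Om rho gr Hr U
  for Om :: "'a::euclidean_space set" and rho gr Hr U +
  fixes V :: "'a \<Rightarrow> real" and M :: real and u :: "'a \<Rightarrow> real" and g :: "'a \<Rightarrow> 'a" and H :: "'a \<Rightarrow> 'a \<Rightarrow> 'a"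
    and lam :: real
  assumes V_bound: "\<And>x. x \<in> Om \<Longrightarrow> \<bar>V x\<bar> \<le> M"
    and has_hessian_on_u: "has_hessian_on Om u g H"
    and u_equation: "\<And>x. x \<in> Om \<Longrightarrow> trace_op (H x) = (V x - lam) * u x"
    and u_pos: "\<And>x. x \<in> Om \<Longrightarrow> u x > 0" and u_le_1: "\<And>x. x \<in> Om \<Longrightarrow> u x \<le> 1"
    and continuous_on_u: "continuous_on (closure Om) u" and u_zero: "\<And>x. x \<in> frontier Om \<Longrightarrow> u x = 0"
begin

definition log_u :: "'a \<Rightarrow> real" where
  "log_u x = ln (u x)"

definition grad_log_u :: "'a \<Rightarrow> 'a" where
  "grad_log_u x = inverse (u x) *\<^sub>R g x"

definition hess_log_u :: "'a \<Rightarrow> 'a \<Rightarrow> 'a" where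
  "hess_log_u x a = inverse (u x) *\<^sub>R H x a + (- (inverse (u x) * inverse (u x)) * (g x \<bullet> a)) *\<^sub>R g x"

lemma has_hessian_on_log_u: "has_hessian_on Om log_u grad_log_u hess_log_u"
  using has_hessian_on_ln[OF has_hessian_on_u u_pos]
  by (simp add: log_u_def[abs_def] grad_log_u_def[abs_def] hess_log_u_def[abs_def])

lemma trace_hess_log_u:
  assumes "x \<in> Om"
  shows "trace_op (hess_log_u x) + grad_log_u x \<bullet> grad_log_u x = V x - lam"
  unfolding hess_log_u_def[abs_def] grad_log_u_def trace_op_hessian_ln
  using u_equation[OF assms] u_pos[OF assms] by simp

lemma log_u_nonpos: "x \<in> Om \<Longrightarrow> log_u x \<le> 0"
  using u_pos u_le_1 by (simp add: log_u_def)

lemma u_pos_imp_Om: "x \<in> closure Om \<Longrightarrow> u x > 0 \<Longrightarrow> x \<in> Om"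
  using closure_cases[of x] u_zero[of x] by fastforce

lemma u_nonneg: "x \<in> closure Om \<Longrightarrow> u x \<ge> 0"
  using closure_cases[of x] u_pos[of x] u_zero[of x] by fastforce

lemma u_bounded_below_on_core:
  assumes "k > 0"
  obtains m where "m > 0" "\<And>x. x \<in> Om \<Longrightarrow> rho x \<le> - 1 / k \<Longrightarrow> m \<le> u x"
proof -
  define K where "K = {x \<in> closure Om. rho x \<le> - 1 / k}"
  have compact: "compact K"
    unfolding K_def by (rule compact_sublevel[OF compact_closure_Om continuous_on_rho])
  have K: "x \<in> Om" if "x \<in> K" for x
    using that closure_cases[of x] rho_zero[of x] assms by (auto simp: K_def divide_le_0_iff)
  show ?thesis
  proof (cases "K = {}")
    case True
    then show ?thesis using Om_closure by (intro that[of 1]) (auto simp: K_def)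
  next
    case False
    have "continuous_on K u" by (rule continuous_on_subset[OF continuous_on_u]) (auto simp: K_def)
    then obtain z where "z \<in> K" "\<And>x. x \<in> K \<Longrightarrow> u z \<le> u x"
      using continuous_attains_inf[OF compact False] by blast
    then show ?thesis using Om_closure by (intro that[of "u z"] u_pos K) (auto simp: K_def)
  qed
qed

lemma strip_lower_barrier:
  assumes k: "k > 0"
    and large: "\<And>x. x \<in> Om \<Longrightarrow> - 1 / k < rho x \<Longrightarrow> 2 * (M + \<bar>lam\<bar>) + 1 \<le> exp_rho_laplacian (- k) x"
    and m: "m > 0" "\<And>x. x \<in> Om \<Longrightarrow> rho x \<le> - 1 / k \<Longrightarrow> m \<le> u x" and x: "x \<in> Om" "- 1 / k \<le> rho x"
  shows "m / 2 * (exp (- k * rho x) - 1) \<le> u x"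
proof -
  define a where "a = m / 2"
  have a: "a > 0" using m by (simp add: a_def)
  obtain gE HE where E: "has_hessian_on Om (\<lambda>x. exp (- k * rho x)) gE HE" "\<And>x. trace_op (HE x) = exp_rho_laplacian (- k) x"
    by (rule has_hessian_on_exp_rho) (rule that)
  have exp_le_3: "a * exp (- k * rho z) \<le> a * 3" if "- 1 / k \<le> rho z" for z
  proof -
    have "- k * rho z \<le> 1" using that k by (simp add: field_simps)
    then have "exp (- k * rho z) \<le> exp 1" by simp
    then have "exp (- k * rho z) \<le> 3" using exp_le by linarith
    then show ?thesis using a by (intro mult_left_mono) auto
  qed
  have "(a * exp (- k * rho x) + (- a)) + (-1) * u x \<le> 0"
  proof (rule strip_maximum_principle[OF has_hessian_on_add[OF has_hessian_on_add[OF
        has_hessian_on_cmult[OF E(1)] has_hessian_on_const] has_hessian_on_cmult[OF has_hessian_on_u]] _ _ _ _ x])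
    show "continuous_on (closure Om) (\<lambda>x. (a * exp (- k * rho x) + - a) + (-1) * u x)"
      by (intro continuous_intros continuous_on_u continuous_on_rho)
    show "(a * exp (- k * rho z) + - a) + (-1) * u z \<le> 0" if "z \<in> frontier Om" for z
      using u_zero[OF that] rho_zero[OF that] by simp
    fix z
    assume z: "z \<in> Om"
    show "(a * exp (- k * rho z) + - a) + (-1) * u z \<le> 0" if "rho z = - 1 / k"
      using m(2)[OF z] exp_le_3[of z] that by (simp add: a_def)
    assume strip: "- 1 / k < rho z" and pos: "0 < (a * exp (- k * rho z) + - a) + (-1) * u z"
    have "u z < 2 * a" using exp_le_3[of z] strip pos by simp
    then have "\<bar>V z - lam\<bar> * u z \<le> (M + \<bar>lam\<bar>) * (2 * a)"
      using V_bound[OF z] u_pos[OF z] by (intro mult_mono) auto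
    moreover have "(V z - lam) * u z \<le> \<bar>V z - lam\<bar> * u z" using u_pos[OF z] by (intro mult_right_mono) auto
    moreover have "a * (2 * (M + \<bar>lam\<bar>) + 1) \<le> a * exp_rho_laplacian (- k) z"
      using large[OF z strip] a by simp
    ultimately have "0 < a * exp_rho_laplacian (- k) z - (V z - lam) * u z"
      using a by (simp add: algebra_simps)
    then show "0 < trace_op (\<lambda>b. (a *\<^sub>R HE z b + 0) + (-1) *\<^sub>R H z b)"
      unfolding trace_op_simps(1) trace_op_simps(2) trace_op_simps(5) using E(2) u_equation[OF z] by simp
  qed
  then show ?thesis by (simp add: a_def algebra_simps)
qed

lemma strip_upper_barrier_abs:
  assumes k: "k > 0" and large: "\<And>x. x \<in> Om \<Longrightarrow> - 1 / k < rho x \<Longrightarrow> Q + 1 \<le> exp_rho_laplacian k x" and Q: "Q \<ge> 0"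
    and w: "has_hessian_on Om w gw Hw" "continuous_on (closure Om) w" "\<And>x. x \<in> frontier Om \<Longrightarrow> w x = 0"
    and trace: "\<And>x. x \<in> Om \<Longrightarrow> \<bar>trace_op (Hw x)\<bar> \<le> Q"
    and W: "W \<ge> 0" "\<And>x. x \<in> closure Om \<Longrightarrow> norm (w x) \<le> W"
    and x: "x \<in> Om" "- 1 / k \<le> rho x"
  shows "\<bar>w x\<bar> \<le> 2 * (W + 1) * (1 - exp (k * rho x))"
proof -
  have "w x \<le> 2 * (W + 1) * (1 - exp (k * rho x))"
    by (rule strip_upper_barrier[OF k _ Q w(1,2) _ _ _ W(1) x])
      (use large w(3) trace W(2) in \<open>force simp: abs_le_iff\<close>)+
  moreover have "(-1) * w x \<le> 2 * (W + 1) * (1 - exp (k * rho x))"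
  proof (rule strip_upper_barrier[OF k _ Q has_hessian_on_cmult[OF w(1)] _ _ _ _ W(1) x])
    show "continuous_on (closure Om) (\<lambda>x. (-1) * w x)" by (intro continuous_intros w(2))
    show "- Q \<le> trace_op (\<lambda>a. (-1) *\<^sub>R Hw z a)" if "z \<in> Om" for z
      unfolding trace_op_simps(2) using trace[OF that] by (simp add: abs_le_iff)
  qed (use large w(3) W(2) in \<open>force simp: abs_le_iff\<close>)+
  ultimately show ?thesis by simp
qed

lemma quotient_bounded:
  assumes w: "has_hessian_on Om w gw Hw" "continuous_on (closure Om) w" "\<And>x. x \<in> frontier Om \<Longrightarrow> w x = 0"
    and trace: "\<And>x. x \<in> Om \<Longrightarrow> \<bar>trace_op (Hw x)\<bar> \<le> Q"
  obtains B where "B \<ge> 0" "\<And>x. x \<in> Om \<Longrightarrow> \<bar>w x\<bar> \<le> B * u x"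
proof -
  obtain k where k: "k > 0" and large: "\<And>x p. x \<in> Om \<Longrightarrow> - 1 / k < rho x \<Longrightarrow> \<bar>p\<bar> = k \<Longrightarrow>
    max (2 * (M + \<bar>lam\<bar>) + 1) (Q + 1) \<le> exp_rho_laplacian p x"
    by (rule exp_rho_laplacian_large) (rule that)
  obtain m where m: "m > 0" "\<And>x. x \<in> Om \<Longrightarrow> rho x \<le> - 1 / k \<Longrightarrow> m \<le> u x"
    by (rule u_bounded_below_on_core[OF k]) (rule that)
  obtain W where W: "W \<ge> 0" "\<And>x. x \<in> closure Om \<Longrightarrow> norm (w x) \<le> W"
    by (rule continuous_on_compact_bound[OF compact_closure_Om w(2)]) (rule that)
  obtain p where "p \<in> Om" using Om_ne by blast
  then have Q: "Q \<ge> 0" using trace[of p] by linarith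
  define A where "A = 2 * (W + 1)"
  have A: "A > 0" using W(1) by (simp add: A_def)
  have upper: "\<bar>w x\<bar> \<le> A * (1 - exp (k * rho x))" if "x \<in> Om" "- 1 / k \<le> rho x" for x
    unfolding A_def
    by (rule strip_upper_barrier_abs[OF k _ Q w trace W that]) (use large[of _ k] k in simp)
  define B where "B = A / (m / 2) + W / m"
  have B: "A / (m / 2) \<le> B" "W / m \<le> B" "0 \<le> B" using A W m by (auto simp: B_def)
  show ?thesis
  proof (rule that[OF B(3)])
    fix x
    assume x: "x \<in> Om"
    show "\<bar>w x\<bar> \<le> B * u x"
    proof (cases "- 1 / k \<le> rho x")
      case True
      define E where "E = exp (k * rho x)"
      have E: "E > 0" "exp (- k * rho x) = 1 / E" by (simp_all add: E_def exp_minus inverse_eq_divide)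
      have "0 \<le> (E - 1)\<^sup>2 / E" using E(1) by simp
      also have "(E - 1)\<^sup>2 / E = (1 / E - 1) - (1 - E)" using E(1) by (simp add: power2_eq_square field_simps)
      finally have "1 - E \<le> exp (- k * rho x) - 1" using E(2) by simp
      also have "\<dots> \<le> u x / (m / 2)"
        using strip_lower_barrier[OF k _ m x True] large k m(1) by (simp add: pos_le_divide_eq mult.commute)
      finally have "A * (1 - E) \<le> A * (u x / (m / 2))" using A by (intro mult_left_mono) auto
      also have "\<dots> = A / (m / 2) * u x" by simp
      also have "\<dots> \<le> B * u x" using B(1) u_pos[OF x] by (intro mult_right_mono) auto
      finally show ?thesis using upper[OF x True] by (simp add: E_def)
    next
      case False
      then have "W * m \<le> W * u x" using m(2)[OF x] W(1) by (intro mult_left_mono) auto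
      then have "W \<le> W / m * u x" using m(1) by (simp add: field_simps)
      also have "\<dots> \<le> B * u x" using B(2) u_pos[OF x] by (intro mult_right_mono) auto
      finally show ?thesis using W(2)[OF Om_closure[OF x]] by simp
    qed
  qed
qed

lemma quotient_operator:
  assumes w: "has_hessian_on Om w gw Hw"
  obtains gv Hv where "has_hessian_on Om (\<lambda>x. w x * inverse (u x)) gv Hv"
    "\<And>x. x \<in> Om \<Longrightarrow> trace_op (Hv x) + 2 * (grad_log_u x \<bullet> gv x) =
      trace_op (Hw x) * inverse (u x) - (V x - lam) * (w x * inverse (u x))"
proof -
  define i where "i = (\<lambda>x. inverse (u x))"
  have inverse_u: "inverse (u x) = i x" for x by (simp add: i_def)
  define Hi where "Hi = (\<lambda>x a. (- (i x * i x)) *\<^sub>R H x a + ((2 * i x * i x * i x) * (g x \<bullet> a)) *\<^sub>R g x)"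
  have "has_hessian_on Om i (\<lambda>x. (- (i x * i x)) *\<^sub>R g x) Hi"
    unfolding i_def Hi_def
    by (rule has_hessian_on_compose[OF has_hessian_on_u, of inverse "\<lambda>s. - (inverse s * inverse s)"
          "\<lambda>s. 2 * inverse s * inverse s * inverse s"])
      (use u_pos in \<open>auto intro!: derivative_eq_intros simp: less_imp_neq[symmetric]\<close>)
  note quotient = has_hessian_on_mult[OF w this]
  show ?thesis
  proof (rule that[unfolded inverse_u, OF quotient])
    fix x
    assume x: "x \<in> Om"
    have inverse: "i x * u x = 1" using u_pos[OF x] by (simp add: i_def)
    have "trace_op (\<lambda>a. w x *\<^sub>R Hi x a + (gw x \<bullet> a) *\<^sub>R ((- (i x * i x)) *\<^sub>R g x) +
        (i x *\<^sub>R Hw x a + ((- (i x * i x)) *\<^sub>R g x \<bullet> a) *\<^sub>R gw x)) +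
      2 * (grad_log_u x \<bullet> (w x *\<^sub>R ((- (i x * i x)) *\<^sub>R g x) + i x *\<^sub>R gw x)) =
      trace_op (Hw x) * i x - w x * (i x * i x) * trace_op (H x)"
      unfolding Hi_def trace_op_simps(1) trace_op_simps(2) trace_op_simps(3) trace_op_simps(4)
      by (simp add: grad_log_u_def i_def inner_add_right inner_commute[of "gw x"] algebra_simps)
    also have "w x * (i x * i x) * trace_op (H x) = (V x - lam) * (w x * i x) * (i x * u x)"
      unfolding u_equation[OF x] by (simp add: algebra_simps)
    finally show "trace_op (\<lambda>a. w x *\<^sub>R Hi x a + (gw x \<bullet> a) *\<^sub>R ((- (i x * i x)) *\<^sub>R g x) +
        (i x *\<^sub>R Hw x a + ((- (i x * i x)) *\<^sub>R g x \<bullet> a) *\<^sub>R gw x)) +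
      2 * (grad_log_u x \<bullet> (w x *\<^sub>R ((- (i x * i x)) *\<^sub>R g x) + i x *\<^sub>R gw x)) =
      trace_op (Hw x) * i x - (V x - lam) * (w x * i x)"
      unfolding inverse by simp
  qed
qed

text \<open>\<open>- ln u\<close> is a Lyapunov function: it blows up at the boundary, and the drift Laplacian
  with drift \<open>2 \<nabla> ln u\<close> maps it to \<open>\<lambda> - V - |\<nabla> ln u|\<^sup>2\<close>, which is bounded above.\<close>

lemma log_u_blowup:
  obtains K where "compact K" "K \<subseteq> Om" "\<And>x. x \<in> Om \<Longrightarrow> x \<notin> K \<Longrightarrow> log_u x < L"
proof -
  define K where "K = {x \<in> closure Om. exp L \<le> u x}"
  show ?thesis
  proof (rule that[of K])
    show "compact K" unfolding K_def by (rule compact_superlevel[OF compact_closure_Om continuous_on_u])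
    show "K \<subseteq> Om" unfolding K_def using u_pos_imp_Om less_le_trans[OF exp_gt_zero] by blast
    fix x
    assume x: "x \<in> Om" "x \<notin> K"
    then have "u x < exp L" using Om_closure by (auto simp: K_def)
    then have "ln (u x) < ln (exp L)" using u_pos[OF x(1)] by (subst ln_less_cancel_iff) auto
    then show "log_u x < L" by (simp add: log_u_def)
  qed
qed

lemma pair_penalized_max:
  fixes \<psi> :: "'a \<times> 'a \<Rightarrow> real"
  assumes cont: "continuous_on (Om \<times> Om) \<psi>" and bound: "\<And>x y. x \<in> Om \<Longrightarrow> y \<in> Om \<Longrightarrow> \<psi> (x, y) \<le> B" and e: "e > 0"
  obtains x0 y0 where "x0 \<in> Om" "y0 \<in> Om"
    "\<And>x y. x \<in> Om \<Longrightarrow> y \<in> Om \<Longrightarrow> \<psi> (x, y) + e * (log_u x + log_u y) \<le> \<psi> (x0, y0) + e * (log_u x0 + log_u y0)"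
proof -
  define F where "F = (\<lambda>p. \<psi> p + e * (log_u (fst p) + log_u (snd p)))"
  obtain p where p: "p \<in> Om" using Om_ne by blast
  obtain K where K: "compact K" "K \<subseteq> Om" and outside: "\<And>x. x \<in> Om \<Longrightarrow> x \<notin> K \<Longrightarrow> log_u x < (F (p, p) - B) / e"
    by (rule log_u_blowup) (rule that)
  have low: "F (x, y) < F (p, p)" if x: "x \<in> Om" "y \<in> Om" "x \<notin> K \<or> y \<notin> K" for x y
  proof -
    have "log_u x + log_u y < (F (p, p) - B) / e"
      using x(3) outside[OF x(1)] outside[OF x(2)] log_u_nonpos[OF x(1)] log_u_nonpos[OF x(2)] by linarith
    then have "e * (log_u x + log_u y) < F (p, p) - B" using e by (simp add: pos_less_divide_eq mult.commute)
    then show ?thesis using bound[OF x(1,2)] by (simp add: F_def)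
  qed
  have "p \<in> K" using low[OF p p] by blast
  have log: "continuous_on K log_u"
    by (rule continuous_on_subset[OF has_hessian_on_continuous_on(1)[OF has_hessian_on_log_u] K(2)])
  have "continuous_on (K \<times> K) (\<lambda>p. log_u (fst p))" "continuous_on (K \<times> K) (\<lambda>p. log_u (snd p))"
    by (rule continuous_on_compose2[OF log]; auto intro!: continuous_intros)+
  moreover have "continuous_on (K \<times> K) \<psi>" by (rule continuous_on_subset[OF cont]) (use K(2) in blast)
  ultimately have "continuous_on (K \<times> K) F"
    unfolding F_def by (intro continuous_on_add continuous_on_mult continuous_on_const)
  from continuous_attains_sup[OF compact_Times[OF K(1,1)] _ this] \<open>p \<in> K\<close>
  obtain q where q: "q \<in> K \<times> K" "\<forall>p\<in>K \<times> K. F p \<le> F q" by blast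
  obtain x0 y0 where "q = (x0, y0)" by (cases q)
  with q have max: "x0 \<in> K" "y0 \<in> K" "\<And>x y. x \<in> K \<Longrightarrow> y \<in> K \<Longrightarrow> F (x, y) \<le> F (x0, y0)" by auto
  show ?thesis
  proof (rule that[of x0 y0])
    show "x0 \<in> Om" "y0 \<in> Om" using max(1,2) K(2) by auto
    fix x y
    assume "x \<in> Om" "y \<in> Om"
    then have "F (x, y) \<le> F (x0, y0)"
      using low[of x y] max(3)[of x y] max(3)[OF \<open>p \<in> K\<close> \<open>p \<in> K\<close>] by (cases "x \<in> K \<and> y \<in> K") auto
    then show "\<psi> (x, y) + e * (log_u x + log_u y) \<le> \<psi> (x0, y0) + e * (log_u x0 + log_u y0)"
      by (simp add: F_def)
  qed
qed

lemma penalized_max: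
  assumes cont: "continuous_on Om \<psi>" and bound: "\<And>x. x \<in> Om \<Longrightarrow> \<psi> x \<le> B" and e: "e > 0"
  obtains y where "y \<in> Om" "\<And>x. x \<in> Om \<Longrightarrow> \<psi> x + e * log_u x \<le> \<psi> y + e * log_u y"
proof -
  have "continuous_on (Om \<times> Om) (\<lambda>p. \<psi> (fst p) + \<psi> (snd p))"
    by (intro continuous_on_add continuous_on_compose2[OF cont]) (auto intro!: continuous_intros)
  moreover have "\<psi> (fst (x, y)) + \<psi> (snd (x, y)) \<le> B + B" if "x \<in> Om" "y \<in> Om" for x y
    using bound[OF that(1)] bound[OF that(2)] by simp
  ultimately obtain y z where "y \<in> Om" "z \<in> Om" and max: "\<And>x x'. x \<in> Om \<Longrightarrow> x' \<in> Om \<Longrightarrow>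
    \<psi> (fst (x, x')) + \<psi> (snd (x, x')) + e * (log_u x + log_u x') \<le> \<psi> (fst (y, z)) + \<psi> (snd (y, z)) + e * (log_u y + log_u z)"
    using pair_penalized_max[of "\<lambda>p. \<psi> (fst p) + \<psi> (snd p)" "B + B", OF _ _ e] by blast
  show ?thesis
    by (rule that[OF \<open>y \<in> Om\<close>]) (use max \<open>z \<in> Om\<close> in \<open>force simp: distrib_left\<close>)
qed

lemma penalized_max_drift_laplacian:
  assumes v: "has_hessian_on Om v gv Hv" and bound: "\<And>x. x \<in> Om \<Longrightarrow> v x \<le> B" and e: "e > 0"
  obtains y where "y \<in> Om" "\<And>x. x \<in> Om \<Longrightarrow> v x + e * log_u x \<le> v y + e * log_u y"
    "trace_op (Hv y) + 2 * (grad_log_u y \<bullet> gv y) \<le> e * (M + \<bar>lam\<bar>)"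
proof -
  obtain y where y: "y \<in> Om" "\<And>x. x \<in> Om \<Longrightarrow> v x + e * log_u x \<le> v y + e * log_u y"
    using penalized_max[OF has_hessian_on_continuous_on(1)[OF v] bound e] by blast
  have "\<forall>\<^sub>F z in nhds y. v z + e * log_u z \<le> v y + e * log_u y"
    using eventually_nhds_in_open[OF open_Om y(1)] by (rule eventually_mono) (rule y(2))
  note at_max = has_hessian_on_local_max[OF has_hessian_on_add[OF v has_hessian_on_cmult[OF has_hessian_on_log_u, of e]] open_Om y(1) this]
  have gv: "gv y = - (e *\<^sub>R grad_log_u y)" using at_max(1) by (simp add: eq_neg_iff_add_eq_0)
  have "trace_op (Hv y) + e * trace_op (hess_log_u y) \<le> 0"
    using at_max(2) unfolding trace_op_simps(1) trace_op_simps(2) .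
  then have "trace_op (Hv y) + 2 * (grad_log_u y \<bullet> gv y) \<le>
    - e * (trace_op (hess_log_u y) + grad_log_u y \<bullet> grad_log_u y) - e * (grad_log_u y \<bullet> grad_log_u y)"
    unfolding gv by (simp add: algebra_simps)
  also have "\<dots> \<le> e * (- (V y - lam))"
    unfolding trace_hess_log_u[OF y(1)] using e by (simp add: algebra_simps)
  also have "\<dots> \<le> e * (M + \<bar>lam\<bar>)" using V_bound[OF y(1)] e by (intro mult_left_mono) auto
  finally show ?thesis using that[OF y] by blast
qed

lemma drift_subsolution_nonpos:
  assumes v: "has_hessian_on Om v gv Hv" and bound: "\<And>x. x \<in> Om \<Longrightarrow> v x \<le> B"
    and eq: "\<And>x. x \<in> Om \<Longrightarrow> trace_op (Hv x) + 2 * (grad_log_u x \<bullet> gv x) = a x * v x"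
    and a: "a0 > 0" "\<And>x. x \<in> Om \<Longrightarrow> a0 \<le> a x" and x: "x \<in> Om"
  shows "v x \<le> 0"
proof (rule ccontr)
  assume "\<not> v x \<le> 0"
  then have pos: "v x > 0" by simp
  define K where "K = M + \<bar>lam\<bar>"
  have K: "K \<ge> 0" using V_bound[OF x] by (simp add: K_def)
  have log: "log_u x \<le> 0" by (rule log_u_nonpos[OF x])
  define e where "e = min (v x / (2 * (1 - log_u x))) (a0 * v x / (4 * (K + 1)))"
  have e: "e > 0"
    unfolding e_def min_less_iff_conj using pos log a(1) K by (intro conjI divide_pos_pos mult_pos_pos) auto
  obtain y where y: "y \<in> Om" "\<And>x. x \<in> Om \<Longrightarrow> v x + e * log_u x \<le> v y + e * log_u y"
    "trace_op (Hv y) + 2 * (grad_log_u y \<bullet> gv y) \<le> e * (M + \<bar>lam\<bar>)"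
    using penalized_max_drift_laplacian[OF v bound e] by blast
  have "e * (1 - log_u x) \<le> v x / (2 * (1 - log_u x)) * (1 - log_u x)"
    using log by (intro mult_right_mono) (auto simp: e_def)
  also have "\<dots> = v x / 2" using log by (simp add: field_simps)
  finally have "v x / 2 \<le> v x + e * log_u x" using e by (simp add: algebra_simps)
  also have "\<dots> \<le> v y + e * log_u y" by (rule y(2)[OF x])
  also have "\<dots> \<le> v y" using log_u_nonpos[OF y(1)] e by (simp add: mult_nonneg_nonpos)
  finally have "a0 * (v x / 2) \<le> a y * v y" using a(1) a(2)[OF y(1)] pos by (intro mult_mono) auto
  also have "\<dots> \<le> e * K" using y(3) eq[OF y(1)] by (simp add: K_def)
  also have "\<dots> \<le> a0 * v x / (4 * (K + 1)) * (K + 1)"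
    using K e by (intro mult_mono) (auto simp: e_def)
  also have "\<dots> = a0 * v x / 4" using K by (simp add: field_simps)
  finally show False using a(1) pos by (simp add: field_simps)
qed

lemma drift_solution_not_bounded_below:
  assumes v: "has_hessian_on Om v gv Hv"
    and eq: "\<And>x. x \<in> Om \<Longrightarrow> trace_op (Hv x) + 2 * (grad_log_u x \<bullet> gv x) = a x * v x"
    and a: "a0 > 0" "\<And>x. x \<in> Om \<Longrightarrow> a x \<le> - a0" and c: "c > 0"
  shows "\<exists>x\<in>Om. v x < c"
proof (rule ccontr)
  assume "\<not> ?thesis"
  then have v_ge: "\<And>x. x \<in> Om \<Longrightarrow> c \<le> v x" by force
  define K where "K = M + \<bar>lam\<bar> + 1"
  have K: "K > 0" using V_bound Om_ne by (force simp: K_def)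
  define e where "e = a0 * c / (2 * K)"
  have e: "e > 0" using a c K by (simp add: e_def)
  have "(-1) * v x \<le> 0" if "x \<in> Om" for x using v_ge[OF that] c by simp
  then obtain y where y: "y \<in> Om"
    "trace_op (\<lambda>b. (-1) *\<^sub>R Hv y b) + 2 * (grad_log_u y \<bullet> ((-1) *\<^sub>R gv y)) \<le> e * (M + \<bar>lam\<bar>)"
    using penalized_max_drift_laplacian[OF has_hessian_on_cmult[OF v, of "-1"] _ e] by blast
  have "trace_op (\<lambda>b. (-1) *\<^sub>R Hv y b) + 2 * (grad_log_u y \<bullet> ((-1) *\<^sub>R gv y)) =
    - (trace_op (Hv y) + 2 * (grad_log_u y \<bullet> gv y))"
    unfolding trace_op_simps(2) by simp
  then have "- (a y * v y) \<le> e * (M + \<bar>lam\<bar>)" using y(2) eq[OF y(1)] by simp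
  moreover have "a0 * c \<le> (- a y) * v y" using a(1) a(2)[OF y(1)] v_ge[OF y(1)] c by (intro mult_mono) auto
  moreover have "e * (M + \<bar>lam\<bar>) \<le> e * K" using e by (simp add: K_def)
  moreover have "e * K = a0 * c / 2" using K by (simp add: e_def)
  ultimately show False using mult_pos_pos[OF a(1) c] by simp
qed

end

section \<open>The modulus of log-concavity\<close>

context smooth_convex_domain
begin

lemma open_segment_subset_Om:
  assumes p: "p \<in> closure Om" and r: "r \<in> closure Om" and w: "w \<in> open_segment p r" "w \<in> Om"
  shows "open_segment p r \<subseteq> Om"
proof -
  have "open_segment w p \<subseteq> Om" "open_segment w r \<subseteq> Om"
    using in_interior_closure_convex_segment[OF convex_Om, of w] w(2) p r open_Om
    by (simp_all add: interior_open)
  with w(2) show ?thesis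
    unfolding Un_open_segment[OF w(1), symmetric] by (auto simp: open_segment_commute)
qed

lemma strictly_convex:
  assumes p: "p \<in> closure Om" and r: "r \<in> closure Om" and "p \<noteq> r"
  shows "open_segment p r \<subseteq> Om"
proof (rule ccontr)
  assume not_subset: "\<not> open_segment p r \<subseteq> Om"
  have "open_segment p r \<subseteq> closure Om"
    using convex_closure[OF convex_Om] p r
    by (meson closed_segment_subset order_trans segment_open_subset_closed)
  then have frontier: "w \<in> frontier Om" if "w \<in> open_segment p r" for w
    using that open_segment_subset_Om[OF p r that] not_subset closure_cases[of w] by blast
  define v where "v = r - p"
  define x where "x = p + (1/2) *\<^sub>R v"
  have segment: "x + t *\<^sub>R v \<in> open_segment p r" if "\<bar>t\<bar> < 1/2" for t
  proof -
    have "x + t *\<^sub>R v = p + (1/2 + t) *\<^sub>R v" unfolding x_def scaleR_add_left by simp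
    also have "p + s *\<^sub>R v = (1 - s) *\<^sub>R p + s *\<^sub>R r" for s by (simp add: v_def algebra_simps)
    finally have "x + t *\<^sub>R v = (1 - (1/2 + t)) *\<^sub>R p + (1/2 + t) *\<^sub>R r" .
    moreover have "0 < 1/2 + t" "1/2 + t < 1" using that by linarith+
    ultimately show ?thesis using \<open>p \<noteq> r\<close> unfolding in_segment by blast
  qed
  have x: "x \<in> frontier Om" using frontier[OF segment[of 0]] by simp
  then have "x \<in> U" using closure_Om_subset_U by (auto simp: frontier_def)
  note jet = jet2_line[OF has_hessian_on_rho open_U this, of v]
  have "\<forall>\<^sub>F t in nhds (0::real). \<bar>t\<bar> < 1/2" unfolding eventually_nhds_metric by (intro exI[of _ "1/2"]) auto
  then have max: "\<forall>\<^sub>F t in nhds 0. rho (x + t *\<^sub>R v) \<le> rho (x + 0 *\<^sub>R v)"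
    by eventually_elim (use rho_zero[OF x] in \<open>simp add: rho_zero[OF frontier[OF segment]]\<close>)
  have "gr x \<bullet> v = 0" by (rule jet2_local_max(1)[OF jet max])
  then have "Hr x v \<bullet> v > 0" using positive_curvature[OF x, of v] \<open>p \<noteq> r\<close> by (simp add: v_def)
  then show False using jet2_local_max(2)[OF jet max] by simp
qed

end

lemma ln_add_ln_le_of_sqrt_le:
  assumes "a > 0" "b > 0" "sqrt (a * b) \<le> c"
  shows "ln a + ln b \<le> 2 * ln c"
proof -
  have "ln (sqrt (a * b)) \<le> ln c" using assms by (intro ln_mono) auto
  then show ?thesis using assms by (simp add: ln_sqrt ln_mult)
qed

lemma least_dominating_factor:
  fixes w v :: "'a::t2_space \<Rightarrow> real"
  assumes K: "compact K" and cont: "continuous_on K w" "continuous_on K v" and v: "\<And>z. z \<in> K \<Longrightarrow> v z > 0"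
  obtains t where "t \<ge> 1" "\<And>z. z \<in> K \<Longrightarrow> w z \<le> t * v z" "t > 1 \<Longrightarrow> \<exists>z\<in>K. w z = t * v z"
proof (cases "K = {}")
  case True
  then show ?thesis using that[of 1] by simp
next
  case False
  have "continuous_on K (\<lambda>z. w z / v z)" using cont v by (intro continuous_on_divide) force+
  then obtain z where z: "z \<in> K" "\<And>y. y \<in> K \<Longrightarrow> w y / v y \<le> w z / v z"
    using continuous_attains_sup[OF K False] by blast
  define T where "T = w z / v z"
  show ?thesis
  proof (rule that[of "max 1 T"])
    show "w y \<le> max 1 T * v y" if y: "y \<in> K" for y
    proof -
      have "w y \<le> T * v y" using z(2)[OF y] v[OF y] by (simp add: T_def pos_divide_le_eq)
      also have "\<dots> \<le> max 1 T * v y" using v[OF y] by (intro mult_right_mono) auto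
      finally show ?thesis .
    qed
    have "w z = T * v z" using v[OF z(1)] by (simp add: T_def)
    then show "\<exists>z\<in>K. w z = max 1 T * v z" if "1 < max 1 T"
      using that z(1) by (auto simp: max_def split: if_splits)
  qed simp
qed

context ground_state
begin

lemma midpoint_Om: "x \<in> Om \<Longrightarrow> y \<in> Om \<Longrightarrow> (1/2) *\<^sub>R (x + y) \<in> Om"
  using convexD[OF convex_Om, of x y "1/2" "1/2"] by (simp add: scaleR_add_right)

lemma midpoint_closure: "x \<in> closure Om \<Longrightarrow> y \<in> closure Om \<Longrightarrow> (1/2) *\<^sub>R (x + y) \<in> closure Om"
  using convexD[OF convex_closure[OF convex_Om], of x y "1/2" "1/2"] by (simp add: scaleR_add_right)

lemma korevaar_second_variation:
  assumes x: "x \<in> Om" and y: "y \<in> Om" and F: "has_hessian_on N F gF HF" "open N"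
    and m: "m = (1/2) *\<^sub>R (x + y)" "m \<in> N"
    and max: "\<And>a b. \<forall>\<^sub>F t in nhds 0. log_u (x + t *\<^sub>R a) + log_u (y + t *\<^sub>R b) - 2 * F (m + t *\<^sub>R ((1/2) *\<^sub>R (a + b))) \<le>
      log_u x + log_u y - 2 * F m"
  shows "V x + V y - 2 * lam \<le> 2 * (trace_op (HF m) + gF m \<bullet> gF m)"
proof -
  have jet: "grad_log_u x \<bullet> a + grad_log_u y \<bullet> b - 2 * (gF m \<bullet> ((1/2) *\<^sub>R (a + b))) = 0"
    "hess_log_u x a \<bullet> a + hess_log_u y b \<bullet> b - 2 * (HF m ((1/2) *\<^sub>R (a + b)) \<bullet> ((1/2) *\<^sub>R (a + b))) \<le> 0"
      for a b
  proof -
    have "\<forall>\<^sub>F t in nhds 0. log_u (x + t *\<^sub>R a) + log_u (y + t *\<^sub>R b) - 2 * F (m + t *\<^sub>R ((1/2) *\<^sub>R (a + b))) \<le>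
      log_u (x + 0 *\<^sub>R a) + log_u (y + 0 *\<^sub>R b) - 2 * F (m + 0 *\<^sub>R ((1/2) *\<^sub>R (a + b)))"
      using max[of a b] by simp
    note at_max = jet2_local_max[OF jet2_diff[OF jet2_add[OF jet2_line[OF has_hessian_on_log_u open_Om x]
      jet2_line[OF has_hessian_on_log_u open_Om y]] jet2_cmult[OF jet2_line[OF F m(2)]]] this]
    show "grad_log_u x \<bullet> a + grad_log_u y \<bullet> b - 2 * (gF m \<bullet> ((1/2) *\<^sub>R (a + b))) = 0"
      "hess_log_u x a \<bullet> a + hess_log_u y b \<bullet> b - 2 * (HF m ((1/2) *\<^sub>R (a + b)) \<bullet> ((1/2) *\<^sub>R (a + b))) \<le> 0"
      by (rule at_max)+
  qed
  have "grad_log_u x \<bullet> a = gF m \<bullet> a" "grad_log_u y \<bullet> a = gF m \<bullet> a" for a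
    using jet(1)[of a 0] jet(1)[of 0 a] by simp_all
  then have grad: "grad_log_u x = gF m" "grad_log_u y = gF m" by (metis inner_commute vector_eq_ldot)+
  have "hess_log_u x a \<bullet> a + hess_log_u y a \<bullet> a - 2 * (HF m a \<bullet> a) \<le> 0" for a
    using jet(2)[of a a] by (simp add: scaleR_2[symmetric])
  then have "(\<Sum>a\<in>Basis. hess_log_u x a \<bullet> a + hess_log_u y a \<bullet> a - 2 * (HF m a \<bullet> a)) \<le> 0" by (intro sum_nonpos)
  then have "trace_op (hess_log_u x) + trace_op (hess_log_u y) - 2 * trace_op (HF m) \<le> 0"
    unfolding trace_op_def by (simp add: sum.distrib sum_subtractf sum_distrib_left)
  then show ?thesis using trace_hess_log_u[OF x] trace_hess_log_u[OF y] unfolding grad distrib_left by argo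
qed

lemma korevaar_touching:
  assumes x: "x \<in> Om" and y: "y \<in> Om" and P: "has_hessian_on N P gP HP" "open N" "\<And>z. z \<in> N \<Longrightarrow> P z > 0"
    and m: "m = (1/2) *\<^sub>R (x + y)" "m \<in> N" and touch: "sqrt (u x * u y) = P m"
    and above: "\<And>x y. x \<in> Om \<Longrightarrow> y \<in> Om \<Longrightarrow> (1/2) *\<^sub>R (x + y) \<in> N \<Longrightarrow> sqrt (u x * u y) \<le> P ((1/2) *\<^sub>R (x + y))"
  shows "(V x + V y - 2 * lam) * P m \<le> 2 * trace_op (HP m)"
proof -
  define HF where "HF = (\<lambda>x a. inverse (P x) *\<^sub>R HP x a + (- (inverse (P x) * inverse (P x)) * (gP x \<bullet> a)) *\<^sub>R gP x)"
  have F: "has_hessian_on N (\<lambda>x. ln (P x)) (\<lambda>x. inverse (P x) *\<^sub>R gP x) HF"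
    unfolding HF_def by (rule has_hessian_on_ln[OF P(1,3)])
  have "V x + V y - 2 * lam \<le> 2 * (trace_op (HF m) + (inverse (P m) *\<^sub>R gP m) \<bullet> (inverse (P m) *\<^sub>R gP m))"
  proof (rule korevaar_second_variation[OF x y F P(2) m])
    fix a b
    have "ln (sqrt (u x * u y)) = ln (P m)" using touch by simp
    then have eq: "log_u x + log_u y = 2 * ln (P m)"
      using u_pos[OF x] u_pos[OF y] by (simp add: ln_sqrt ln_mult log_u_def)
    from eventually_on_line_in_open[OF open_Om x, of a] eventually_on_line_in_open[OF open_Om y, of b]
      eventually_on_line_in_open[OF P(2) m(2), of "(1/2) *\<^sub>R (a + b)"]
    show "\<forall>\<^sub>F t in nhds 0. log_u (x + t *\<^sub>R a) + log_u (y + t *\<^sub>R b) - 2 * ln (P (m + t *\<^sub>R ((1/2) *\<^sub>R (a + b)))) \<le>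
      log_u x + log_u y - 2 * ln (P m)"
    proof eventually_elim
      case (elim t)
      have mid: "(1/2) *\<^sub>R ((x + t *\<^sub>R a) + (y + t *\<^sub>R b)) = m + t *\<^sub>R ((1/2) *\<^sub>R (a + b))"
        by (simp add: m(1) algebra_simps)
      have "sqrt (u (x + t *\<^sub>R a) * u (y + t *\<^sub>R b)) \<le> P (m + t *\<^sub>R ((1/2) *\<^sub>R (a + b)))"
        using above[OF elim(1,2)] elim(3) unfolding mid by blast
      from ln_add_ln_le_of_sqrt_le[OF u_pos[OF elim(1)] u_pos[OF elim(2)] this] show ?case
        using eq by (simp add: log_u_def)
    qed
  qed
  also have "\<dots> = 2 * (trace_op (HP m) / P m)" unfolding HF_def trace_op_hessian_ln ..
  finally show ?thesis using P(3)[OF m(2)] by (simp add: field_simps)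
qed

lemma strip_supersolution:
  obtains k h gh Hh where "k > 0" "has_hessian_on Om h gh Hh" "continuous_on (closure Om) h"
    "\<And>x. x \<in> closure Om \<Longrightarrow> 1 \<le> h x" "\<And>x. x \<in> Om \<Longrightarrow> - 1 / k < rho x \<Longrightarrow> trace_op (Hh x) < (V x - lam) * h x"
proof -
  define Q where "Q = M + \<bar>lam\<bar>"
  obtain k where k: "k > 0"
    and large: "\<And>x p. x \<in> Om \<Longrightarrow> - 1 / k < rho x \<Longrightarrow> \<bar>p\<bar> = k \<Longrightarrow> 2 * Q + 1 \<le> exp_rho_laplacian p x"
    by (rule exp_rho_laplacian_large) (rule that)
  obtain gE HE where E: "has_hessian_on Om (\<lambda>x. exp (k * rho x)) gE HE" "\<And>x. trace_op (HE x) = exp_rho_laplacian k x"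
    by (rule has_hessian_on_exp_rho) (rule that)
  define h where "h = (\<lambda>x. (-1) * exp (k * rho x) + 2)"
  have h: "has_hessian_on Om h (\<lambda>x. (-1) *\<^sub>R gE x + 0) (\<lambda>x a. (-1) *\<^sub>R HE x a + 0)"
    unfolding h_def by (intro has_hessian_on_add has_hessian_on_cmult E(1) has_hessian_on_const)
  have bounds: "1 \<le> h x" "h x \<le> 2" if "x \<in> closure Om" for x
  proof -
    have "rho x \<le> 0" using closure_cases[OF that] rho_neg[of x] rho_zero[of x] by auto
    then have "exp (k * rho x) \<le> 1" using k by (simp add: mult_nonneg_nonpos)
    then show "1 \<le> h x" by (simp add: h_def)
    show "h x \<le> 2" by (simp add: h_def)
  qed
  show ?thesis
  proof (rule that[OF k h _ bounds(1)])
    show "continuous_on (closure Om) h" unfolding h_def by (intro continuous_intros continuous_on_rho)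
    fix x
    assume x: "x \<in> Om" "- 1 / k < rho x"
    note h_x = bounds[OF Om_closure[OF x(1)]]
    have "(- (V x - lam)) * h x \<le> \<bar>V x - lam\<bar> * h x" by (rule mult_right_mono) (use h_x in auto)
    also have "\<dots> \<le> Q * 2" using V_bound[OF x(1)] h_x by (intro mult_mono) (auto simp: Q_def)
    finally have "- (2 * Q + 1) < (V x - lam) * h x" by (simp add: algebra_simps)
    moreover have "2 * Q + 1 \<le> exp_rho_laplacian k x" using large[OF x, of k] k by simp
    ultimately show "trace_op (\<lambda>a. (-1) *\<^sub>R HE x a + 0) < (V x - lam) * h x"
      unfolding trace_op_simps(1) trace_op_simps(2) trace_op_simps(5) using E(2) by simp
  qed
qed

context
  assumes strictly_convex_V: "\<And>x y. x \<in> Om \<Longrightarrow> y \<in> Om \<Longrightarrow> x \<noteq> y \<Longrightarrow> 2 * V ((1/2) *\<^sub>R (x + y)) < V x + V y"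
begin

definition closure_pairs :: "('a \<times> 'a) set" where
  "closure_pairs = closure Om \<times> closure Om"

definition mid :: "'a \<times> 'a \<Rightarrow> 'a" where
  "mid z = (1/2) *\<^sub>R (fst z + snd z)"

definition geometric_mean :: "'a \<times> 'a \<Rightarrow> real" where
  "geometric_mean z = sqrt (u (fst z) * u (snd z))"

lemma compact_closure_pairs: "compact closure_pairs"
  unfolding closure_pairs_def by (intro compact_Times compact_closure_Om)

lemma mid_closure: "z \<in> closure_pairs \<Longrightarrow> mid z \<in> closure Om"
  unfolding mid_def closure_pairs_def by (auto intro: midpoint_closure)

lemma continuous_on_mid:
  fixes q :: "'a \<Rightarrow> real"
  assumes "continuous_on (closure Om) q"
  shows "continuous_on closure_pairs (\<lambda>z. q (mid z))"
proof (rule continuous_on_compose2[OF assms])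
  show "continuous_on closure_pairs mid" unfolding mid_def[abs_def] by (intro continuous_intros)
qed (use mid_closure in blast)

lemma continuous_on_geometric_mean: "continuous_on closure_pairs geometric_mean"
  unfolding geometric_mean_def[abs_def] closure_pairs_def
  by (intro continuous_intros continuous_on_compose2[OF continuous_on_u]) auto

lemma geometric_mean_pos_imp_Om:
  assumes "(x, y) \<in> closure_pairs" "geometric_mean (x, y) > 0"
  shows "x \<in> Om" "y \<in> Om"
proof -
  have closure: "x \<in> closure Om" "y \<in> closure Om" using assms(1) by (simp_all add: closure_pairs_def)
  have "u x * u y > 0" using assms(2) by (simp add: geometric_mean_def)
  then have "u x > 0" "u y > 0"
    using u_nonneg[OF closure(1)] u_nonneg[OF closure(2)] by (auto simp: zero_less_mult_iff)
  then show "x \<in> Om" "y \<in> Om" using closure u_pos_imp_Om by auto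
qed

lemma barrier_never_touches:
  assumes h: "has_hessian_on Om h gh Hh" "\<And>x. x \<in> closure Om \<Longrightarrow> 1 \<le> h x"
    and supersolution: "\<And>x. x \<in> Om \<Longrightarrow> - 1 / k < rho x \<Longrightarrow> trace_op (Hh x) < (V x - lam) * h x"
    and t: "t \<ge> 1" and a: "a > 0" and Om: "x \<in> Om" "y \<in> Om"
    and strip: "- 1 / k < rho ((1/2) *\<^sub>R (x + y))"
    and touch: "sqrt (u x * u y) = t * u ((1/2) *\<^sub>R (x + y)) + a * h ((1/2) *\<^sub>R (x + y))"
    and above: "\<And>x y. x \<in> Om \<Longrightarrow> y \<in> Om \<Longrightarrow> - 1 / k < rho ((1/2) *\<^sub>R (x + y)) \<Longrightarrow>
      sqrt (u x * u y) \<le> t * u ((1/2) *\<^sub>R (x + y)) + a * h ((1/2) *\<^sub>R (x + y))"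
  shows False
proof -
  define P where "P = (\<lambda>x. t * u x + a * h x)"
  define m where "m = (1/2) *\<^sub>R (x + y)"
  define N where "N = Om \<inter> rho -` {- 1 / k<..}"
  have m_Om: "m \<in> Om" unfolding m_def by (rule midpoint_Om[OF Om])
  have "open N"
    unfolding N_def
    by (intro continuous_open_preimage continuous_on_subset[OF continuous_on_rho closure_subset] open_Om open_greaterThan)
  have P: "has_hessian_on N P (\<lambda>x. t *\<^sub>R g x + a *\<^sub>R gh x) (\<lambda>x b. t *\<^sub>R H x b + a *\<^sub>R Hh x b)"
    unfolding P_def
    by (rule has_hessian_on_subset[OF has_hessian_on_add[OF has_hessian_on_cmult[OF has_hessian_on_u] has_hessian_on_cmult[OF h(1)]]])
      (simp add: N_def)
  have P_pos: "P x > 0" if "x \<in> Om" for x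
    unfolding P_def
    using t u_pos[OF that] a h(2)[OF Om_closure[OF that]] by (intro add_pos_pos mult_pos_pos) auto
  have "(V x + V y - 2 * lam) * P m \<le> 2 * trace_op (\<lambda>b. t *\<^sub>R H m b + a *\<^sub>R Hh m b)"
  proof (rule korevaar_touching[OF Om P \<open>open N\<close> _ m_def])
    show "m \<in> N" using m_Om strip by (simp add: N_def m_def)
    show "sqrt (u x * u y) = P m" using touch by (simp add: P_def m_def)
    show "sqrt (u x * u y) \<le> P ((1/2) *\<^sub>R (x + y))" if "x \<in> Om" "y \<in> Om" "(1/2) *\<^sub>R (x + y) \<in> N" for x y
      using above[of x y] that by (simp add: P_def N_def)
  qed (simp add: N_def P_pos)
  also have "\<dots> < 2 * ((V m - lam) * P m)"
    unfolding trace_op_simps(1) trace_op_simps(2) u_equation[OF m_Om]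
    using mult_strict_left_mono[OF supersolution[OF m_Om strip[folded m_def]] a]
    by (simp add: P_def algebra_simps)
  finally have "(V x + V y - 2 * lam) * P m < (2 * (V m - lam)) * P m" unfolding mult.assoc .
  then have "V x + V y < 2 * V m" using P_pos[OF m_Om] by simp
  then show False using strictly_convex_V[OF Om] by (cases "x = y") (auto simp: m_def scaleR_2[symmetric])
qed

lemma geometric_mean_le_of_core:
  assumes k: "k > 0"
    and h: "has_hessian_on Om h gh Hh" "continuous_on (closure Om) h" "\<And>x. x \<in> closure Om \<Longrightarrow> 1 \<le> h x"
    and supersolution: "\<And>x. x \<in> Om \<Longrightarrow> - 1 / k < rho x \<Longrightarrow> trace_op (Hh x) < (V x - lam) * h x"
    and t: "t \<ge> 1"
    and core: "\<And>z. z \<in> closure_pairs \<Longrightarrow> rho (mid z) \<le> - 1 / k \<Longrightarrow> geometric_mean z \<le> t * u (mid z)"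
    and z: "z \<in> closure_pairs"
  shows "geometric_mean z \<le> t * u (mid z)"
proof (rule ccontr)
  assume less: "\<not> geometric_mean z \<le> t * u (mid z)"
  define S where "S = {z \<in> closure_pairs. - 1 / k \<le> rho (mid z)}"
  define ratio where "ratio = (\<lambda>z. (geometric_mean z - t * u (mid z)) / h (mid z))"
  have h_pos: "h (mid z) > 0" if "z \<in> closure_pairs" for z using h(3)[OF mid_closure[OF that]] by simp
  have "continuous_on closure_pairs ratio"
    unfolding ratio_def using h_pos
    by (intro continuous_intros continuous_on_geometric_mean continuous_on_mid continuous_on_u h(2)) force
  then have "continuous_on S ratio" by (rule continuous_on_subset) (auto simp: S_def)
  moreover have "compact S"
    unfolding S_def
    by (rule compact_superlevel[OF compact_closure_pairs continuous_on_mid[OF continuous_on_rho]])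
  moreover have "z \<in> S" using z less core[of z] by (force simp: S_def)
  ultimately obtain p where p: "p \<in> S" "\<And>y. y \<in> S \<Longrightarrow> ratio y \<le> ratio p"
    using continuous_attains_sup[of S ratio] by blast
  have p_pairs: "p \<in> closure_pairs" using p(1) by (simp add: S_def)
  define a where "a = ratio p"
  have "0 < ratio z" using less h_pos[OF z] by (simp add: ratio_def)
  then have a: "a > 0" using p(2)[OF \<open>z \<in> S\<close>] by (simp add: a_def)
  define P where "P = (\<lambda>x. t * u x + a * h x)"
  have above: "geometric_mean y \<le> P (mid y)" if "y \<in> S" for y
  proof -
    have "y \<in> closure_pairs" using that by (simp add: S_def)
    have "ratio y \<le> a" unfolding a_def by (rule p(2)[OF that])
    then show ?thesis using h_pos[OF \<open>y \<in> closure_pairs\<close>] by (simp add: P_def ratio_def pos_divide_le_eq)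
  qed
  have touch: "geometric_mean p = P (mid p)" using h_pos[OF p_pairs] by (simp add: P_def a_def ratio_def)
  then have above_core: "geometric_mean p > t * u (mid p)" using a h_pos[OF p_pairs] by (simp add: P_def)
  moreover have "0 \<le> t * u (mid p)" using t u_nonneg[OF mid_closure[OF p_pairs]] by simp
  ultimately have pos: "geometric_mean p > 0" by linarith
  obtain x y where xy: "p = (x, y)" by (cases p)
  have Om: "x \<in> Om" "y \<in> Om" using geometric_mean_pos_imp_Om p_pairs pos by (simp_all add: xy)
  show False
  proof (rule barrier_never_touches[OF h(1,3) supersolution t a Om])
    show "- 1 / k < rho ((1/2) *\<^sub>R (x + y))"
      using core[OF p_pairs] above_core by (force simp: mid_def xy not_le)
    show "sqrt (u x * u y) = t * u ((1/2) *\<^sub>R (x + y)) + a * h ((1/2) *\<^sub>R (x + y))"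
      using touch by (simp add: P_def xy geometric_mean_def mid_def)
    show "sqrt (u x * u y) \<le> t * u ((1/2) *\<^sub>R (x + y)) + a * h ((1/2) *\<^sub>R (x + y))"
      if "x \<in> Om" "y \<in> Om" "- 1 / k < rho ((1/2) *\<^sub>R (x + y))" for x y
      using above[of "(x, y)"] that Om_closure
      by (simp add: P_def S_def closure_pairs_def mid_def geometric_mean_def)
  qed
qed

lemma geometric_mean_scaling_factor_le_1:
  assumes dominated: "\<And>z. z \<in> closure_pairs \<Longrightarrow> geometric_mean z \<le> t * u (mid z)"
    and touch: "p \<in> closure_pairs" "geometric_mean p = t * u (mid p)" "mid p \<in> Om"
  shows "t \<le> 1"
proof (rule ccontr)
  assume "\<not> t \<le> 1"
  then have t: "t > 1" by simp
  obtain x y where xy: "p = (x, y)" by (cases p)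
  have "geometric_mean p > 0" unfolding touch(2) using t u_pos[OF touch(3)] by simp
  then have Om: "x \<in> Om" "y \<in> Om" using geometric_mean_pos_imp_Om touch(1) by (simp_all add: xy)
  define m where "m = (1/2) *\<^sub>R (x + y)"
  have mid_p: "mid p = m" by (simp add: mid_def m_def xy)
  have m_Om: "m \<in> Om" unfolding m_def by (rule midpoint_Om[OF Om])
  have touch_m: "sqrt (u x * u y) = t * u m"
    using touch(2) by (simp add: xy geometric_mean_def mid_p[unfolded xy])
  have "x \<noteq> y"
  proof
    assume "x = y"
    then have "u x = t * u x" using touch_m u_pos[OF Om(1)] by (simp add: m_def scaleR_2[symmetric])
    then show False using t u_pos[OF Om(1)] by simp
  qed
  have "(V x + V y - 2 * lam) * (t * u m) \<le> 2 * trace_op (\<lambda>b. t *\<^sub>R H m b)"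
  proof (rule korevaar_touching[OF Om has_hessian_on_cmult[OF has_hessian_on_u] open_Om _ m_def m_Om touch_m])
    show "sqrt (u x * u y) \<le> t * u ((1/2) *\<^sub>R (x + y))" if "x \<in> Om" "y \<in> Om" for x y
      using dominated[of "(x, y)"] that Om_closure by (simp add: closure_pairs_def mid_def geometric_mean_def)
  qed (use t u_pos in simp)
  then have "(V x + V y - 2 * lam) * (t * u m) \<le> (2 * (V m - lam)) * (t * u m)"
    unfolding trace_op_simps(2) u_equation[OF m_Om] by (simp add: algebra_simps)
  then have "V x + V y \<le> 2 * V m" using mult_pos_pos[of t "u m"] t u_pos[OF m_Om] by simp
  then show False using strictly_convex_V[OF Om \<open>x \<noteq> y\<close>] by (simp add: m_def)
qed

lemma log_concave_midpoint:
  assumes x: "x \<in> Om" and y: "y \<in> Om"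
  shows "log_u x + log_u y \<le> 2 * log_u ((1/2) *\<^sub>R (x + y))"
proof -
  obtain k h gh Hh where k: "k > 0"
    and h: "has_hessian_on Om h gh Hh" "continuous_on (closure Om) h" "\<And>x. x \<in> closure Om \<Longrightarrow> 1 \<le> h x"
    and supersolution: "\<And>x. x \<in> Om \<Longrightarrow> - 1 / k < rho x \<Longrightarrow> trace_op (Hh x) < (V x - lam) * h x"
    by (rule strip_supersolution) (rule that)
  define K where "K = {z \<in> closure_pairs. rho (mid z) \<le> - 1 / k}"
  have K: "compact K" "K \<subseteq> closure_pairs"
    unfolding K_def
    by (rule compact_sublevel[OF compact_closure_pairs continuous_on_mid[OF continuous_on_rho]]) auto
  have K_Om: "mid z \<in> Om" if "z \<in> K" for z
    using that closure_cases[OF mid_closure, of z] rho_zero[of "mid z"] k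
    by (auto simp: K_def divide_le_0_iff)
  obtain t where t: "t \<ge> 1" "\<And>z. z \<in> K \<Longrightarrow> geometric_mean z \<le> t * u (mid z)" "t > 1 \<Longrightarrow> \<exists>z\<in>K. geometric_mean z = t * u (mid z)"
    by (rule least_dominating_factor[OF K(1) continuous_on_subset[OF continuous_on_geometric_mean K(2)]
      continuous_on_subset[OF continuous_on_mid[OF continuous_on_u] K(2)] u_pos[OF K_Om]]) (assumption, rule that)
  have dominated: "geometric_mean z \<le> t * u (mid z)" if "z \<in> closure_pairs" for z
    by (rule geometric_mean_le_of_core[OF k h supersolution t(1) _ that]) (use t(2) in \<open>auto simp: K_def\<close>)
  have "t = 1"
    using t(1,3) geometric_mean_scaling_factor_le_1[OF dominated] K(2) K_Om by force
  then have "sqrt (u x * u y) \<le> u ((1/2) *\<^sub>R (x + y))"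
    using dominated[of "(x, y)"] x y Om_closure by (simp add: closure_pairs_def geometric_mean_def mid_def)
  then show ?thesis unfolding log_u_def by (rule ln_add_ln_le_of_sqrt_le[OF u_pos[OF x] u_pos[OF y]])
qed

end

end

lemma convex_symmetric_segment:
  assumes "convex S" "m + z \<in> S" "m - z \<in> S" "\<bar>s\<bar> \<le> 1"
  shows "m + s *\<^sub>R z \<in> S" "m - s *\<^sub>R z \<in> S"
proof -
  have inside: "m + s *\<^sub>R z \<in> S" if "\<bar>s\<bar> \<le> 1" for s
  proof -
    have "((1 + s) / 2) *\<^sub>R (m + z) + ((1 - s) / 2) *\<^sub>R (m - z) \<in> S"
      by (rule convexD[OF assms(1-3)]) (use that in \<open>auto simp: add_divide_distrib diff_divide_distrib\<close>)
    moreover have "((1 + s) / 2) *\<^sub>R (m + z) + ((1 - s) / 2) *\<^sub>R (m - z) =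
      ((1 + s) / 2 + (1 - s) / 2) *\<^sub>R m + ((1 + s) / 2 - (1 - s) / 2) *\<^sub>R z"
      by (simp only: scaleR_add_left scaleR_diff_left scaleR_add_right scaleR_diff_right) simp
    moreover have "(1 + s) / 2 + (1 - s) / 2 = 1" "(1 + s) / 2 - (1 - s) / 2 = s"
      by (simp_all add: add_divide_distrib diff_divide_distrib)
    ultimately show ?thesis by simp
  qed
  show "m + s *\<^sub>R z \<in> S" "m - s *\<^sub>R z \<in> S" using inside[of s] inside[of "- s"] assms(4) by simp_all
qed

lemma maximizing_filter_converges:
  fixes f :: "'a::topological_space \<Rightarrow> real"
  assumes T: "compact T" "A \<subseteq> T" and A: "A \<noteq> {}" "bdd_above (f ` A)"
  obtains G l where "G \<noteq> bot" "\<forall>\<^sub>F c in G. c \<in> A" "(f \<longlongrightarrow> (SUP c\<in>A. f c)) G" "l \<in> T" "((\<lambda>c. c) \<longlongrightarrow> l) G"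
proof -
  let ?S = "SUP c\<in>A. f c"
  define G where "G = inf (filtercomap f (nhds ?S)) (principal A)"
  have "G \<noteq> bot"
  proof
    assume "G = bot"
    then have "\<forall>\<^sub>F c in G. False" by simp
    then obtain Q where Q: "eventually Q (nhds ?S)" "\<And>c. c \<in> A \<Longrightarrow> \<not> Q (f c)"
      unfolding G_def eventually_inf_principal eventually_filtercomap by auto
    then obtain e where e: "e > 0" "\<And>y. dist y ?S < e \<Longrightarrow> Q y" unfolding eventually_nhds_metric by blast
    have "?S - e < ?S" using e(1) by simp
    then obtain c where c: "c \<in> A" "?S - e < f c" using less_cSUP_iff[OF A] by blast
    then have "dist (f c) ?S < e" using cSUP_upper[OF c(1) A(2)] by (simp add: dist_real_def)
    with e(2) Q(2)[OF c(1)] show False by blast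
  qed
  moreover have A_G: "\<forall>\<^sub>F c in G. c \<in> A" unfolding G_def eventually_inf_principal by simp
  then have "\<forall>\<^sub>F c in G. c \<in> T" using T(2) by (auto elim: eventually_mono)
  ultimately obtain l G' where G': "l \<in> T" "G' \<le> G" "G' \<noteq> bot" "((\<lambda>c. c) \<longlongrightarrow> l) G'"
    by (rule compact_imp_convergent_finer_filter[OF T(1)])
  have "(f \<longlongrightarrow> ?S) G" unfolding G_def by (rule filterlim_mono[OF filterlim_filtercomap order_refl inf_le1])
  then show ?thesis
    by (rule that[OF G'(3) filter_leD[OF G'(2) A_G] filterlim_mono[OF _ order_refl G'(2)] G'(1,4)])
qed

lemma inner_square_difference_le:
  fixes a1 a2 b1 b2 e :: "'a::real_inner"
  assumes e: "norm e = 1" and sum: "a1 + a2 = b1 + b2"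
    and along: "(a1 - a2) \<bullet> e = 2 * \<alpha>" "(b1 - b2) \<bullet> e = 2 * \<beta>"
    and across: "\<And>x. e \<bullet> x = 0 \<Longrightarrow> (a1 - a2) \<bullet> x = s * ((b1 - b2) \<bullet> x)" and s: "0 \<le> s" "s \<le> 1"
  shows "a1 \<bullet> a1 + a2 \<bullet> a2 - b1 \<bullet> b1 - b2 \<bullet> b2 \<le> 2 * (\<alpha>\<^sup>2 - \<beta>\<^sup>2)"
proof -
  have unit: "e \<bullet> e = 1" using e by (simp add: norm_eq_1)
  define p q where "p = a1 - a2 - (2 * \<alpha>) *\<^sub>R e" and "q = b1 - b2 - (2 * \<beta>) *\<^sub>R e"
  have "p \<bullet> e = 0" "q \<bullet> e = 0" using along by (simp_all add: p_def q_def inner_diff_left unit)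
  then have orthogonal: "e \<bullet> p = 0" "e \<bullet> q = 0" by (simp_all add: inner_commute)
  have proj: "p \<bullet> x = s * (q \<bullet> x)" if "e \<bullet> x = 0" for x
    using across[OF that] that by (simp add: p_def q_def inner_diff_left)
  have "p \<bullet> p = s * (s * (q \<bullet> q))"
    using proj[OF orthogonal(1)] proj[OF orthogonal(2)] by (simp add: inner_commute)
  also have "\<dots> \<le> 1 * (1 * (q \<bullet> q))" using s by (intro mult_mono) auto
  finally have "p \<bullet> p \<le> q \<bullet> q" by simp
  moreover have "(a1 - a2) \<bullet> (a1 - a2) = p \<bullet> p + 4 * \<alpha>\<^sup>2" "(b1 - b2) \<bullet> (b1 - b2) = q \<bullet> q + 4 * \<beta>\<^sup>2"
  proof -
    have "(p + (2 * c) *\<^sub>R e) \<bullet> (p + (2 * c) *\<^sub>R e) = p \<bullet> p + 4 * c\<^sup>2" if "e \<bullet> p = 0" for p and c :: real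
      using that by (simp add: inner_add_left inner_add_right inner_commute[of p e] unit power2_eq_square)
    from this[OF orthogonal(1), of \<alpha>] this[OF orthogonal(2), of \<beta>]
    show "(a1 - a2) \<bullet> (a1 - a2) = p \<bullet> p + 4 * \<alpha>\<^sup>2" "(b1 - b2) \<bullet> (b1 - b2) = q \<bullet> q + 4 * \<beta>\<^sup>2"
      by (simp_all add: p_def q_def)
  qed
  moreover have parallelogram: "2 * (a \<bullet> a + b \<bullet> b) = (a + b) \<bullet> (a + b) + (a - b) \<bullet> (a - b)" for a b :: 'a
    by (simp add: inner_add_left inner_add_right inner_diff_left inner_diff_right)
  have "2 * (a1 \<bullet> a1 + a2 \<bullet> a2) - 2 * (b1 \<bullet> b1 + b2 \<bullet> b2) = (a1 - a2) \<bullet> (a1 - a2) - (b1 - b2) \<bullet> (b1 - b2)"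
    unfolding parallelogram by (simp add: sum)
  ultimately show ?thesis by argo
qed

context ground_state
begin

context
  assumes log_concave: "\<And>x y. x \<in> Om \<Longrightarrow> y \<in> Om \<Longrightarrow> log_u x + log_u y \<le> 2 * log_u ((1/2) *\<^sub>R (x + y))"
begin

lemma hess_log_u_minus: "x \<in> Om \<Longrightarrow> hess_log_u x (- v) = - hess_log_u x v"
  by (rule linear_neg[OF has_hessian_onD(3)[OF has_hessian_on_log_u]])

lemma hess_log_u_nonpos:
  assumes x: "x \<in> Om"
  shows "hess_log_u x v \<bullet> v \<le> 0"
proof -
  have "\<forall>\<^sub>F t in nhds 0. log_u (x + t *\<^sub>R v) + log_u (x + t *\<^sub>R - v) \<le> log_u (x + 0 *\<^sub>R v) + log_u (x + 0 *\<^sub>R - v)"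
    using eventually_on_line_in_open[OF open_Om x, of v] eventually_on_line_in_open[OF open_Om x, of "- v"]
  proof eventually_elim
    case (elim t)
    have "(1/2) *\<^sub>R ((x + t *\<^sub>R v) + (x + t *\<^sub>R - v)) = x" by (simp add: scaleR_2[symmetric])
    then show ?case using log_concave[OF elim] by simp
  qed
  from jet2_local_max(2)[OF jet2_add[OF jet2_line[OF has_hessian_on_log_u open_Om x]
    jet2_line[OF has_hessian_on_log_u open_Om x]] this] show ?thesis by (simp add: hess_log_u_minus[OF x])
qed

lemma has_real_derivative_log_u_pair:
  assumes "m + s *\<^sub>R z \<in> Om" "m - s *\<^sub>R z \<in> Om"
  shows "((\<lambda>s. log_u (m + s *\<^sub>R z) + log_u (m - s *\<^sub>R z)) has_real_derivative
    (grad_log_u (m + s *\<^sub>R z) - grad_log_u (m - s *\<^sub>R z)) \<bullet> z) (at s)"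
proof -
  have line: "((\<lambda>s. log_u (m + s *\<^sub>R a)) has_real_derivative grad_log_u (m + s *\<^sub>R a) \<bullet> a) (at s)"
    if "m + s *\<^sub>R a \<in> Om" for a
    by (rule has_derivative_line[OF has_hessian_onD(1)[OF has_hessian_on_log_u that]])
  show ?thesis using DERIV_add[OF line[of z] line[of "- z"]] assms by (simp add: inner_diff_left)
qed

lemma has_real_derivative_grad_log_u_pair:
  assumes "m + s *\<^sub>R z \<in> Om" "m - s *\<^sub>R z \<in> Om"
  shows "((\<lambda>s. (grad_log_u (m + s *\<^sub>R z) - grad_log_u (m - s *\<^sub>R z)) \<bullet> z) has_real_derivative
    hess_log_u (m + s *\<^sub>R z) z \<bullet> z + hess_log_u (m - s *\<^sub>R z) z \<bullet> z) (at s)"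
proof -
  have line: "((\<lambda>s. grad_log_u (m + s *\<^sub>R a) \<bullet> z) has_real_derivative hess_log_u (m + s *\<^sub>R a) a \<bullet> z) (at s)"
    if "m + s *\<^sub>R a \<in> Om" for a
    by (rule has_derivative_line_inner[OF has_hessian_onD(2)[OF has_hessian_on_log_u that]])
  show ?thesis
    using DERIV_diff[OF line[of z] line[of "- z"]] assms by (simp add: inner_diff_left hess_log_u_minus)
qed

lemma log_u_pair_decreasing:
  assumes z: "m + z \<in> Om" "m - z \<in> Om" and s: "0 \<le> s" "s \<le> 1"
  shows "log_u (m + z) + log_u (m - z) \<le> log_u (m + s *\<^sub>R z) + log_u (m - s *\<^sub>R z)"
proof -
  note in_Om = convex_symmetric_segment[OF convex_Om z]
  define slope where "slope = (\<lambda>t. (grad_log_u (m + t *\<^sub>R z) - grad_log_u (m - t *\<^sub>R z)) \<bullet> z)"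
  have slope_nonpos: "slope t \<le> 0" if t: "0 \<le> t" "t \<le> 1" for t
  proof -
    have "slope t \<le> slope 0"
    proof (rule DERIV_nonpos_imp_nonincreasing[OF t(1)])
      fix x
      assume "0 \<le> x" "x \<le> t"
      then have "\<bar>x\<bar> \<le> 1" using t by simp
      note x_Om = in_Om[OF this]
      have "hess_log_u (m + x *\<^sub>R z) z \<bullet> z + hess_log_u (m - x *\<^sub>R z) z \<bullet> z \<le> 0"
        using hess_log_u_nonpos[OF x_Om(1), of z] hess_log_u_nonpos[OF x_Om(2), of z] by simp
      then show "\<exists>y. DERIV slope x :> y \<and> y \<le> 0"
        using has_real_derivative_grad_log_u_pair[OF x_Om] unfolding slope_def by blast
    qed
    then show ?thesis by (simp add: slope_def)
  qed
  have "log_u (m + 1 *\<^sub>R z) + log_u (m - 1 *\<^sub>R z) \<le> log_u (m + s *\<^sub>R z) + log_u (m - s *\<^sub>R z)"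
  proof (rule DERIV_nonpos_imp_nonincreasing[OF s(2)])
    fix t
    assume "s \<le> t" "t \<le> 1"
    then have "0 \<le> t" "t \<le> 1" "\<bar>t\<bar> \<le> 1" using s by simp_all
    then show "\<exists>y. ((\<lambda>t. log_u (m + t *\<^sub>R z) + log_u (m - t *\<^sub>R z)) has_real_derivative y) (at t) \<and> y \<le> 0"
      using has_real_derivative_log_u_pair[OF in_Om] slope_nonpos[of t] unfolding slope_def by blast
  qed
  then show ?thesis by simp
qed

context
  fixes L L1 L2 :: "real \<Rightarrow> real" and D :: real
  assumes L: "\<And>s. \<bar>s\<bar> \<le> D \<Longrightarrow> (L has_real_derivative L1 s) (at s)" "\<And>s. \<bar>s\<bar> \<le> D \<Longrightarrow> (L1 has_real_derivative L2 s) (at s)"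
    and even: "\<And>s. L (- s) = L s"
    and diam: "\<And>x y. x \<in> Om \<Longrightarrow> y \<in> Om \<Longrightarrow> norm (y - x) < 2 * D"
begin

text \<open>The sharp modulus of log-concavity in integrated form. Compared with the two-point function
  built from \<open>\<nabla> ln u\<close>, the four-point function involves no third derivatives, and plain
  log-concavity controls it near the boundary.\<close>

definition four_point :: "'a \<times> 'a \<times> real \<Rightarrow> real" where
  "four_point = (\<lambda>(m, z, s). log_u (m + z) + log_u (m - z) - log_u (m + s *\<^sub>R z) - log_u (m - s *\<^sub>R z) -
    2 * L (norm z) + 2 * L (s * norm z))"

definition four_point_domain :: "('a \<times> 'a \<times> real) set" where
  "four_point_domain = {(m, z, s). m + z \<in> Om \<and> m - z \<in> Om \<and> 0 \<le> s \<and> s \<le> 1}"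

lemma norm_less_D:
  assumes "m + z \<in> Om" "m - z \<in> Om"
  shows "norm z < D"
proof -
  have "(m + z) - (m - z) = 2 *\<^sub>R z" by (simp add: scaleR_2)
  then have "norm (2 *\<^sub>R z) < 2 * D" using diam[OF assms(2,1)] by simp
  then show ?thesis by simp
qed

lemma abs_mult_norm_le_D:
  assumes "norm z \<le> D" "0 \<le> s" "s \<le> 1"
  shows "\<bar>s * norm z\<bar> \<le> D"
  using mult_right_mono[OF assms(3) norm_ge_zero[of z]] assms by (simp add: abs_mult)

lemma isCont_L: "\<bar>s\<bar> \<le> D \<Longrightarrow> isCont L s"
  by (rule DERIV_isCont[OF L(1)])

lemma four_point_le:
  assumes "(m, z, s) \<in> four_point_domain"
  shows "four_point (m, z, s) \<le> - 2 * L (norm z) + 2 * L (s * norm z)"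
  using log_u_pair_decreasing[of m z s] assms by (simp add: four_point_domain_def four_point_def)

lemma bdd_above_four_point: "bdd_above (four_point ` four_point_domain)"
proof -
  have "continuous_on {-D..D} L" by (intro continuous_at_imp_continuous_on ballI isCont_L) auto
  then obtain B where B: "\<And>s. s \<in> {-D..D} \<Longrightarrow> norm (L s) \<le> B"
    using continuous_on_compact_bound[OF compact_Icc] by metis
  show ?thesis
  proof (rule bdd_aboveI2, clarify)
    fix m z s
    assume dom: "(m, z, s) \<in> four_point_domain"
    then have "norm z \<le> D" "\<bar>s * norm z\<bar> \<le> D"
      using norm_less_D[of m z] abs_mult_norm_le_D[of z s] by (auto simp: four_point_domain_def)
    then show "four_point (m, z, s) \<le> 4 * B"
      using four_point_le[OF dom] B[of "norm z"] B[of "s * norm z"] norm_ge_zero[of z]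
      by (auto simp: abs_le_iff)
  qed
qed

lemma four_point_maximizing_limit:
  assumes c0: "c0 \<in> four_point_domain" "four_point c0 > 0"
  obtains G m z s where "G \<noteq> bot" "\<forall>\<^sub>F c in G. c \<in> four_point_domain"
    "(four_point \<longlongrightarrow> (SUP c\<in>four_point_domain. four_point c)) G" "((\<lambda>c. c) \<longlongrightarrow> (m, z, s)) G"
    "m + z \<in> closure Om" "m - z \<in> closure Om" "0 \<le> s" "s < 1" "z \<noteq> 0" "norm z \<le> D"
proof -
  let ?S = "SUP c\<in>four_point_domain. four_point c"
  define T where "T = (\<lambda>(p, q, s). ((1/2) *\<^sub>R (p + q), (1/2) *\<^sub>R (p - q), s)) ` (closure Om \<times> closure Om \<times> {0..1::real})"
  have "compact T"
    unfolding T_def case_prod_unfold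
    by (intro compact_continuous_image compact_Times compact_closure_Om compact_Icc continuous_intros)
  moreover have "four_point_domain \<subseteq> T"
  proof clarify
    fix m z s
    assume "(m, z, s) \<in> four_point_domain"
    then show "(m, z, s) \<in> T"
      using Om_closure unfolding T_def
      by (intro image_eqI[of _ _ "(m + z, m - z, s)"]) (auto simp: four_point_domain_def simp flip: scaleR_2)
  qed
  moreover have "four_point_domain \<noteq> {}" using c0(1) by blast
  ultimately obtain G l where G: "G \<noteq> bot" and dom: "\<forall>\<^sub>F c in G. c \<in> four_point_domain"
    and lim: "(four_point \<longlongrightarrow> ?S) G" and l: "l \<in> T" "((\<lambda>c. c) \<longlongrightarrow> l) G"
    by (rule maximizing_filter_converges[OF _ _ _ bdd_above_four_point])
  obtain m z s where l_eq: "l = (m, z, s)" by (cases l) auto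
  have closure: "m + z \<in> closure Om" "m - z \<in> closure Om" and s: "0 \<le> s" "s \<le> 1"
    using l(1) by (auto simp: l_eq T_def algebra_simps simp flip: scaleR_2)
  have coord: "((\<lambda>c. fst (snd c)) \<longlongrightarrow> z) G" "((\<lambda>c. snd (snd c)) \<longlongrightarrow> s) G"
    using tendsto_fst[OF tendsto_snd[OF l(2)]] tendsto_snd[OF tendsto_snd[OF l(2)]] by (simp_all add: l_eq)
  have norm_lim: "((\<lambda>c. norm (fst (snd c))) \<longlongrightarrow> norm z) G" "((\<lambda>c. snd (snd c) * norm (fst (snd c))) \<longlongrightarrow> s * norm z) G"
    by (intro tendsto_intros coord)+
  have "\<forall>\<^sub>F c in G. norm (fst (snd c)) \<le> D"
    using dom by eventually_elim (auto simp: four_point_domain_def dest: norm_less_D)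
  from tendsto_upperbound[OF norm_lim(1) this G] have z_le: "norm z \<le> D" .
  have "((\<lambda>c. - 2 * L (norm (fst (snd c))) + 2 * L (snd (snd c) * norm (fst (snd c)))) \<longlongrightarrow> - 2 * L (norm z) + 2 * L (s * norm z)) G"
    using isCont_tendsto_compose[OF isCont_L norm_lim(1)] isCont_tendsto_compose[OF isCont_L norm_lim(2)]
      z_le abs_mult_norm_le_D[OF z_le s] by (intro tendsto_intros) simp_all
  moreover have "\<forall>\<^sub>F c in G. four_point c \<le> - 2 * L (norm (fst (snd c))) + 2 * L (snd (snd c) * norm (fst (snd c)))"
    using dom by eventually_elim (auto dest: four_point_le)
  ultimately have "?S \<le> - 2 * L (norm z) + 2 * L (s * norm z)" using lim by (intro tendsto_le[OF G])
  moreover have "0 < ?S" using c0(2) cSUP_upper[OF c0(1) bdd_above_four_point] by linarith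
  ultimately have gap: "L (norm z) < L (s * norm z)" by simp
  show ?thesis
  proof (rule that[OF G dom lim l(2)[unfolded l_eq] closure s(1) _ _ z_le])
    show "s < 1" using gap s(2) by (cases "s = 1") auto
    show "z \<noteq> 0" using gap by auto
  qed
qed

lemma four_point_limit_end_in_Om:
  assumes G: "G \<noteq> bot" and pos: "\<forall>\<^sub>F c in G. 0 < (F c :: real)"
    and w: "w \<in> closure Om" "(W \<longlongrightarrow> w) G" "\<forall>\<^sub>F c in G. W c \<in> Om"
    and above: "\<forall>\<^sub>F c in G. F c \<le> log_u (W c) + R c" and R: "(R \<longlongrightarrow> r) G"
  shows "w \<in> Om"
proof (rule ccontr)
  assume "w \<notin> Om"
  then have "u w = 0" using closure_cases[OF w(1)] u_zero by blast
  moreover have "((\<lambda>c. u (W c)) \<longlongrightarrow> u w) G"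
    by (rule continuous_on_tendsto_compose[OF continuous_on_u w(2,1)]) (use w(3) Om_closure in \<open>auto elim: eventually_mono\<close>)
  ultimately have "\<forall>\<^sub>F c in G. u (W c) < exp (- r - 1)" by (intro order_tendstoD(2)) auto
  moreover have "\<forall>\<^sub>F c in G. R c < r + 1" by (rule order_tendstoD(2)[OF R]) simp
  ultimately have "\<forall>\<^sub>F c in G. False"
    using pos w(3) above
  proof eventually_elim
    case (elim c)
    have "ln (u (W c)) < ln (exp (- r - 1))"
      using elim(1) u_pos[OF elim(4)] by (subst ln_less_cancel_iff) auto
    then show False using elim(2,3,5) by (simp add: log_u_def)
  qed
  then show False using G by simp
qed

lemma open_symmetric_segment_subset_Om:
  assumes closure: "m + z \<in> closure Om" "m - z \<in> closure Om" and "z \<noteq> 0" "\<bar>t\<bar> < 1"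
  shows "m + t *\<^sub>R z \<in> Om"
proof -
  have "(1 - a) *\<^sub>R (m + z) + a *\<^sub>R (m - z) = m + (1 - a - a) *\<^sub>R z" for a
    by (simp add: algebra_simps scaleR_2[symmetric] mult.commute)
  then have "m + t *\<^sub>R z = (1 - (1 - t) / 2) *\<^sub>R (m + z) + ((1 - t) / 2) *\<^sub>R (m - z)"
    by (simp only:) (simp add: field_simps)
  moreover have "m + z \<noteq> m - z" using assms(3) by (auto simp: algebra_simps simp flip: scaleR_2)
  ultimately have "m + t *\<^sub>R z \<in> open_segment (m + z) (m - z)"
    using assms(4) unfolding in_segment by (auto intro!: exI[of _ "(1 - t) / 2"])
  then show ?thesis using strictly_convex[OF closure \<open>m + z \<noteq> m - z\<close>] by blast
qed

lemma isCont_log_u: "x \<in> Om \<Longrightarrow> isCont log_u x"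
  using has_hessian_on_continuous_on(1)[OF has_hessian_on_log_u] open_Om
  by (simp add: continuous_on_eq_continuous_at)

lemma four_point_abs: "four_point (m, z, s) = four_point (m, z, \<bar>s\<bar>)"
  using even[of "s * norm z"] by (cases "s \<ge> 0") (simp_all add: four_point_def abs_if)

lemma four_point_attains_max:
  assumes c0: "c0 \<in> four_point_domain" "four_point c0 > 0"
  obtains m z s where "m + z \<in> Om" "m - z \<in> Om" "0 \<le> s" "s < 1" "z \<noteq> 0"
    "\<And>m' z' s'. m' + z' \<in> Om \<Longrightarrow> m' - z' \<in> Om \<Longrightarrow> \<bar>s'\<bar> \<le> 1 \<Longrightarrow> four_point (m', z', s') \<le> four_point (m, z, s)"
proof -
  let ?S = "SUP c\<in>four_point_domain. four_point c"
  obtain G m z s where G: "G \<noteq> bot" and dom: "\<forall>\<^sub>F c in G. c \<in> four_point_domain"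
    and lim: "(four_point \<longlongrightarrow> ?S) G"
    and c_lim: "((\<lambda>c. c) \<longlongrightarrow> (m, z, s)) G" and closure: "m + z \<in> closure Om" "m - z \<in> closure Om"
    and s: "0 \<le> s" "s < 1" and z: "z \<noteq> 0" "norm z \<le> D"
    by (rule four_point_maximizing_limit[OF c0]) (rule that)
  define mc zc sc where "mc = (\<lambda>c::'a \<times> 'a \<times> real. fst c)" and "zc = (\<lambda>c::'a \<times> 'a \<times> real. fst (snd c))"
    and "sc = (\<lambda>c::'a \<times> 'a \<times> real. snd (snd c))"
  have coord: "(mc \<longlongrightarrow> m) G" "(zc \<longlongrightarrow> z) G" "(sc \<longlongrightarrow> s) G"
    using tendsto_fst[OF c_lim] tendsto_fst[OF tendsto_snd[OF c_lim]] tendsto_snd[OF tendsto_snd[OF c_lim]]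
    by (simp_all add: mc_def zc_def sc_def)
  have ends: "\<forall>\<^sub>F c in G. mc c + zc c \<in> Om" "\<forall>\<^sub>F c in G. mc c - zc c \<in> Om"
    using dom by (auto simp: four_point_domain_def mc_def zc_def elim!: eventually_mono)
  have inner: "m + s *\<^sub>R z \<in> Om" "m - s *\<^sub>R z \<in> Om"
    using open_symmetric_segment_subset_Om[OF closure z(1), of s] open_symmetric_segment_subset_Om[OF closure z(1), of "- s"] s by simp_all
  define R where "R = (\<lambda>c. - log_u (mc c + sc c *\<^sub>R zc c) - log_u (mc c - sc c *\<^sub>R zc c) - 2 * L (norm (zc c)) + 2 * L (sc c * norm (zc c)))"
  have four_point_eq: "four_point c = log_u (mc c + zc c) + log_u (mc c - zc c) + R c" for c
    by (simp add: four_point_def R_def mc_def zc_def sc_def case_prod_unfold)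
  have R: "(R \<longlongrightarrow> - log_u (m + s *\<^sub>R z) - log_u (m - s *\<^sub>R z) - 2 * L (norm z) + 2 * L (s * norm z)) G"
    unfolding R_def
    by (intro tendsto_intros isCont_tendsto_compose[OF isCont_log_u] isCont_tendsto_compose[OF isCont_L] coord inner)
      (use z(2) s abs_mult_norm_le_D[OF z(2), of s] in auto)
  have "0 < ?S" using c0(2) cSUP_upper[OF c0(1) bdd_above_four_point] by linarith
  then have pos: "\<forall>\<^sub>F c in G. 0 < four_point c" by (rule order_tendstoD(1)[OF lim])
  have above: "\<forall>\<^sub>F c in G. four_point c \<le> log_u (mc c + zc c) + R c" "\<forall>\<^sub>F c in G. four_point c \<le> log_u (mc c - zc c) + R c"
    using ends by (eventually_elim, simp add: four_point_eq log_u_nonpos)+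
  have Om: "m + z \<in> Om" "m - z \<in> Om"
    by (rule four_point_limit_end_in_Om[OF G pos closure(1) tendsto_add[OF coord(1,2)] ends(1) above(1) R],
        rule four_point_limit_end_in_Om[OF G pos closure(2) tendsto_diff[OF coord(1,2)] ends(2) above(2) R])
  have "four_point = (\<lambda>c. log_u (mc c + zc c) + log_u (mc c - zc c) + R c)" by (rule ext) (rule four_point_eq)
  then have "(four_point \<longlongrightarrow> log_u (m + z) + log_u (m - z) +
    (- log_u (m + s *\<^sub>R z) - log_u (m - s *\<^sub>R z) - 2 * L (norm z) + 2 * L (s * norm z))) G"
    by (simp only:) (intro tendsto_add R isCont_tendsto_compose[OF isCont_log_u] tendsto_diff coord Om)
  also have "log_u (m + z) + log_u (m - z) +
    (- log_u (m + s *\<^sub>R z) - log_u (m - s *\<^sub>R z) - 2 * L (norm z) + 2 * L (s * norm z)) = four_point (m, z, s)"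
    by (simp add: four_point_def)
  finally have "(four_point \<longlongrightarrow> four_point (m, z, s)) G" .
  then have max: "four_point (m, z, s) = ?S" using lim by (rule tendsto_unique[OF G])
  have upper: "four_point c \<le> four_point (m, z, s)" if "c \<in> four_point_domain" for c
    unfolding max by (rule cSUP_upper[OF that bdd_above_four_point])
  show ?thesis
  proof (rule that[OF Om s z(1)])
    fix m' z' :: 'a and s' :: real
    assume in_Om: "m' + z' \<in> Om" "m' - z' \<in> Om" and abs_s': "\<bar>s'\<bar> \<le> 1"
    have "four_point (m', z', s') = four_point (m', z', \<bar>s'\<bar>)" by (rule four_point_abs)
    also have "\<dots> \<le> four_point (m, z, s)" using in_Om abs_s' by (intro upper) (simp add: four_point_domain_def)
    finally show "four_point (m', z', s') \<le> four_point (m, z, s)" .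
  qed
qed

context
  fixes m z :: 'a and s :: real
  assumes ends: "m + z \<in> Om" "m - z \<in> Om" and s: "0 \<le> s" "s < 1" and z: "z \<noteq> 0"
    and max: "\<And>m' z' s'. m' + z' \<in> Om \<Longrightarrow> m' - z' \<in> Om \<Longrightarrow> \<bar>s'\<bar> \<le> 1 \<Longrightarrow> four_point (m', z', s') \<le> four_point (m, z, s)"
begin

lemma inner_points: "m + s *\<^sub>R z \<in> Om" "m - s *\<^sub>R z \<in> Om"
  using convex_symmetric_segment[OF convex_Om ends, of s] s by simp_all

lemma norm_pos: "0 < norm z" "norm z < D" "s * norm z < norm z"
  using z norm_less_D[OF ends] s by simp_all

lemma abs_mult_norm_less_D: "\<bar>s * norm z\<bar> < D"
proof -
  have "s * norm z < D" using norm_pos(2,3) by linarith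
  then show ?thesis using s by (simp add: abs_mult)
qed

lemma norm_sgn_z: "norm (sgn z) = 1" "z = norm z *\<^sub>R sgn z"
  using z by (simp_all add: norm_sgn sgn_div_norm)

lemma near_ends:
  "\<forall>\<^sub>F t in nhds (0::real). m + z + t *\<^sub>R a \<in> Om" "\<forall>\<^sub>F t in nhds (0::real). m - z + t *\<^sub>R b \<in> Om"
  by (rule eventually_on_line_in_open[OF open_Om ends(1)], rule eventually_on_line_in_open[OF open_Om ends(2)])

lemma four_point_scaleR_sgn:
  assumes "r > 0"
  shows "four_point (m', r *\<^sub>R sgn z, k / r) = log_u (m' + r *\<^sub>R sgn z) + log_u (m' - r *\<^sub>R sgn z) -
    log_u (m' + k *\<^sub>R sgn z) - log_u (m' - k *\<^sub>R sgn z) - 2 * L r + 2 * L k"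
  using assms norm_sgn_z(1) by (simp add: four_point_def)

lemma jet2_L: "jet2 (\<lambda>t. L (norm z + t)) (L1 (norm z)) (L2 (norm z))"
  "jet2 (\<lambda>t. L (s * norm z + t)) (L1 (s * norm z)) (L2 (s * norm z))"
proof -
  have "jet2 (\<lambda>t. L (r + t)) (L1 r) (L2 r)" if "\<bar>r\<bar> < D" for r
    by (rule jet2_shift[of "{-D<..<D}"]) (use L that in auto)
  then show "jet2 (\<lambda>t. L (norm z + t)) (L1 (norm z)) (L2 (norm z))"
    "jet2 (\<lambda>t. L (s * norm z + t)) (L1 (s * norm z)) (L2 (s * norm z))"
    using norm_pos(2) abs_mult_norm_less_D by simp_all
qed

lemmas jet2_log_u = jet2_line[OF has_hessian_on_log_u open_Om]

lemma translation_variation: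
  "grad_log_u (m + z) \<bullet> a + grad_log_u (m - z) \<bullet> a - grad_log_u (m + s *\<^sub>R z) \<bullet> a - grad_log_u (m - s *\<^sub>R z) \<bullet> a = 0"
  "hess_log_u (m + z) a \<bullet> a + hess_log_u (m - z) a \<bullet> a - hess_log_u (m + s *\<^sub>R z) a \<bullet> a - hess_log_u (m - s *\<^sub>R z) a \<bullet> a \<le> 0"
proof -
  have "\<forall>\<^sub>F t in nhds 0.
    log_u (m + z + t *\<^sub>R a) + log_u (m - z + t *\<^sub>R a) - log_u (m + s *\<^sub>R z + t *\<^sub>R a) - log_u (m - s *\<^sub>R z + t *\<^sub>R a) \<le>
    log_u (m + z + 0 *\<^sub>R a) + log_u (m - z + 0 *\<^sub>R a) - log_u (m + s *\<^sub>R z + 0 *\<^sub>R a) - log_u (m - s *\<^sub>R z + 0 *\<^sub>R a)"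
    using near_ends(1)[of a] near_ends(2)[of a]
  proof eventually_elim
    case (elim t)
    have "four_point (m + t *\<^sub>R a, z, s) \<le> four_point (m, z, s)"
      by (rule max) (use elim s in \<open>simp_all add: algebra_simps\<close>)
    then show ?case by (simp add: four_point_def algebra_simps)
  qed
  note at_max = jet2_local_max[OF jet2_diff[OF jet2_diff[OF jet2_add[OF jet2_log_u[OF ends(1)] jet2_log_u[OF ends(2)]]
    jet2_log_u[OF inner_points(1)]] jet2_log_u[OF inner_points(2)]] this]
  show "grad_log_u (m + z) \<bullet> a + grad_log_u (m - z) \<bullet> a - grad_log_u (m + s *\<^sub>R z) \<bullet> a - grad_log_u (m - s *\<^sub>R z) \<bullet> a = 0"
    "hess_log_u (m + z) a \<bullet> a + hess_log_u (m - z) a \<bullet> a - hess_log_u (m + s *\<^sub>R z) a \<bullet> a - hess_log_u (m - s *\<^sub>R z) a \<bullet> a \<le> 0"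
    by (rule at_max)+
qed

lemma dilation_variation:
  "(grad_log_u (m + z) - grad_log_u (m - z)) \<bullet> sgn z - (grad_log_u (m + s *\<^sub>R z) - grad_log_u (m - s *\<^sub>R z)) \<bullet> sgn z =
    2 * L1 (norm z) - 2 * L1 (s * norm z)"
  "hess_log_u (m + z) (sgn z) \<bullet> sgn z + hess_log_u (m - z) (sgn z) \<bullet> sgn z -
    hess_log_u (m + s *\<^sub>R z) (sgn z) \<bullet> sgn z - hess_log_u (m - s *\<^sub>R z) (sgn z) \<bullet> sgn z \<le> 2 * L2 (norm z) - 2 * L2 (s * norm z)"
proof -
  define N k e where "N = norm z" and "k = s * norm z" and "e = sgn z"
  have scale: "z = N *\<^sub>R e" "s *\<^sub>R z = k *\<^sub>R e"
    using norm_sgn_z(2) unfolding N_def e_def k_def scaleR_scaleR[symmetric] by simp_all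
  have N: "0 < N" "0 \<le> k" "k < N" using norm_pos s by (simp_all add: N_def k_def)
  define F where "F = (\<lambda>t. log_u (m + z + t *\<^sub>R e) + log_u (m - z + t *\<^sub>R - e) - log_u (m + s *\<^sub>R z + t *\<^sub>R e) -
    log_u (m - s *\<^sub>R z + t *\<^sub>R - e) - 2 * L (N + t) + 2 * L (k + t))"
  have F: "F t = four_point (m, (N + t) *\<^sub>R e, (k + t) / (N + t))" if "N + t > 0" for t
    unfolding e_def four_point_scaleR_sgn[OF that]
    unfolding F_def e_def[symmetric] scale(2) unfolding scale(1)
    by (simp add: algebra_simps)
  have "\<forall>\<^sub>F t in nhds (0::real). \<bar>t\<bar> < (N - k) / 2"
    unfolding eventually_nhds_metric using N by (intro exI[of _ "(N - k) / 2"]) auto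
  then have "\<forall>\<^sub>F t in nhds 0. F t \<le> F 0"
    using near_ends(1)[of e] near_ends(2)[of "- e"]
  proof eventually_elim
    case (elim t)
    have t: "N + t > 0" "\<bar>k + t\<bar> \<le> N + t" using elim(1) N by auto
    have "four_point (m, (N + t) *\<^sub>R e, (k + t) / (N + t)) \<le> four_point (m, z, s)"
      by (rule max) (use elim(2,3) t in \<open>simp_all add: scale algebra_simps abs_divide\<close>)
    moreover have "four_point (m, z, s) = four_point (m, (N + 0) *\<^sub>R e, (k + 0) / (N + 0))"
      using N(1) by (simp add: k_def N_def[symmetric] scale(1)[symmetric])
    ultimately show ?case using F[OF t(1)] F[of 0] N(1) by simp
  qed
  note at_max = jet2_local_max[OF jet2_add[OF jet2_diff[OF jet2_diff[OF jet2_diff[OF jet2_add[OF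
    jet2_log_u[OF ends(1)] jet2_log_u[OF ends(2)]] jet2_log_u[OF inner_points(1)]] jet2_log_u[OF inner_points(2)]]
    jet2_cmult[OF jet2_L(1)]] jet2_cmult[OF jet2_L(2)]] this[unfolded F_def N_def k_def]]
  show "(grad_log_u (m + z) - grad_log_u (m - z)) \<bullet> sgn z - (grad_log_u (m + s *\<^sub>R z) - grad_log_u (m - s *\<^sub>R z)) \<bullet> sgn z =
      2 * L1 (norm z) - 2 * L1 (s * norm z)"
    using at_max(1) by (simp add: e_def inner_diff_left)
  show "hess_log_u (m + z) (sgn z) \<bullet> sgn z + hess_log_u (m - z) (sgn z) \<bullet> sgn z -
      hess_log_u (m + s *\<^sub>R z) (sgn z) \<bullet> sgn z - hess_log_u (m - s *\<^sub>R z) (sgn z) \<bullet> sgn z \<le> 2 * L2 (norm z) - 2 * L2 (s * norm z)"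
    using at_max(2) by (simp add: e_def hess_log_u_minus ends(2) inner_points(2))
qed

lemma inner_dilation_variation:
  "(grad_log_u (m + s *\<^sub>R z) - grad_log_u (m - s *\<^sub>R z)) \<bullet> sgn z = 2 * L1 (s * norm z)"
proof -
  define N k e where "N = norm z" and "k = s * norm z" and "e = sgn z"
  have scale: "z = N *\<^sub>R e" "s *\<^sub>R z = k *\<^sub>R e"
    using norm_sgn_z(2) unfolding N_def e_def k_def scaleR_scaleR[symmetric] by simp_all
  have N: "0 < N" "0 \<le> k" "k < N" using norm_pos s by (simp_all add: N_def k_def)
  have "\<forall>\<^sub>F t in nhds (0::real). \<bar>t\<bar> < N - k"
    unfolding eventually_nhds_metric using N by (intro exI[of _ "N - k"]) auto
  then have "\<forall>\<^sub>F t in nhds 0. - log_u (m + s *\<^sub>R z + t *\<^sub>R e) - log_u (m - s *\<^sub>R z + t *\<^sub>R - e) + 2 * L (k + t) \<le>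
    - log_u (m + s *\<^sub>R z + 0 *\<^sub>R e) - log_u (m - s *\<^sub>R z + 0 *\<^sub>R - e) + 2 * L (k + 0)"
  proof eventually_elim
    case (elim t)
    have "\<bar>k + t\<bar> \<le> N" using elim N by auto
    then have "four_point (m, z, (k + t) / N) \<le> four_point (m, z, s)"
      by (intro max ends) (use N in \<open>simp add: abs_divide\<close>)
    moreover have "s = (k + 0) / N" using N(1) by (simp add: k_def N_def)
    ultimately have "four_point (m, N *\<^sub>R e, (k + t) / N) \<le> four_point (m, N *\<^sub>R e, (k + 0) / N)"
      using scale(1) by simp
    then show ?case
      unfolding e_def four_point_scaleR_sgn[OF N(1)]
      unfolding e_def[symmetric] scale(2) by (simp add: algebra_simps)
  qed
  from jet2_local_max(1)[OF jet2_add[OF jet2_diff[OF jet2_minus[OF jet2_log_u[OF inner_points(1)]]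
    jet2_log_u[OF inner_points(2)]] jet2_cmult[OF jet2_L(2)]] this[unfolded k_def]]
  show ?thesis by (simp add: e_def inner_diff_left)
qed

lemma rotation_variation:
  assumes x: "sgn z \<bullet> x = 0"
  shows "(grad_log_u (m + z) - grad_log_u (m - z)) \<bullet> x = s * ((grad_log_u (m + s *\<^sub>R z) - grad_log_u (m - s *\<^sub>R z)) \<bullet> x)"
proof -
  define F where "F = (\<lambda>t. log_u (m + z + t *\<^sub>R x) + log_u (m - z + t *\<^sub>R - x) - log_u (m + s *\<^sub>R z + t *\<^sub>R (s *\<^sub>R x)) -
    log_u (m - s *\<^sub>R z + t *\<^sub>R - (s *\<^sub>R x)) - 2 * L (norm (z + t *\<^sub>R x)) + 2 * L (s * norm (z + t *\<^sub>R x)))"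
  have norm_deriv: "((\<lambda>t. norm (z + t *\<^sub>R x)) has_real_derivative 0) (at 0)"
    using has_real_derivative_norm_line[OF z, of x] x by (simp add: inner_commute)
  have line: "((\<lambda>t. log_u (w + t *\<^sub>R a)) has_real_derivative grad_log_u w \<bullet> a) (at 0)" if "w \<in> Om" for w a
    using has_derivative_line[of log_u "grad_log_u w" w 0 a] has_hessian_onD(1)[OF has_hessian_on_log_u that]
    by simp
  have L_deriv: "((\<lambda>t. L (norm (z + t *\<^sub>R x))) has_real_derivative L1 (norm z) * 0) (at 0)"
    "((\<lambda>t. L (s * norm (z + t *\<^sub>R x))) has_real_derivative L1 (s * norm z) * (s * 0)) (at 0)"
    by (rule DERIV_chain2[OF _ norm_deriv], use L(1) norm_pos in simp)
      (rule DERIV_chain2[OF _ DERIV_cmult[OF norm_deriv]], use L(1) abs_mult_norm_less_D in simp)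
  have F: "(F has_real_derivative (grad_log_u (m + z) \<bullet> x + grad_log_u (m - z) \<bullet> - x - grad_log_u (m + s *\<^sub>R z) \<bullet> (s *\<^sub>R x) -
    grad_log_u (m - s *\<^sub>R z) \<bullet> - (s *\<^sub>R x) - 2 * (L1 (norm z) * 0) + 2 * (L1 (s * norm z) * (s * 0)))) (at 0)"
    unfolding F_def by (intro DERIV_add DERIV_diff DERIV_cmult line ends inner_points L_deriv)
  have "\<forall>\<^sub>F t in nhds 0. F t \<le> F 0"
    using near_ends(1)[of x] near_ends(2)[of "- x"]
  proof eventually_elim
    case (elim t)
    have "four_point (m, z + t *\<^sub>R x, s) \<le> four_point (m, z, s)"
      by (rule max) (use elim s in \<open>simp_all add: algebra_simps\<close>)
    then show ?case unfolding F_def by (simp add: four_point_def algebra_simps)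
  qed
  then obtain d where d: "d > 0" "\<And>t. \<bar>0 - t\<bar> < d \<Longrightarrow> F t \<le> F 0"
    unfolding eventually_nhds_metric by (auto simp: dist_real_def)
  from DERIV_local_max[OF F d(1)] d(2) show ?thesis by (simp add: inner_diff_left algebra_simps)
qed

lemma trace_hess_log_u_four_point_le:
  "trace_op (hess_log_u (m + z)) + trace_op (hess_log_u (m - z)) - trace_op (hess_log_u (m + s *\<^sub>R z)) -
    trace_op (hess_log_u (m - s *\<^sub>R z)) \<le> 2 * L2 (norm z) - 2 * L2 (s * norm z)"
proof -
  obtain B where B: "finite B" "sgn z \<in> B" "\<And>A. linear A \<Longrightarrow> trace_op A = (\<Sum>b\<in>B. A b \<bullet> b)"
    by (rule trace_op_orthonormal[OF norm_sgn_z(1)]) (rule that; assumption)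
  have trace: "trace_op (hess_log_u w) = (\<Sum>b\<in>B. hess_log_u w b \<bullet> b)" if "w \<in> Om" for w
    by (rule B(3)[OF has_hessian_onD(3)[OF has_hessian_on_log_u that]])
  define Hsum where "Hsum = (\<lambda>b. hess_log_u (m + z) b \<bullet> b + hess_log_u (m - z) b \<bullet> b - hess_log_u (m + s *\<^sub>R z) b \<bullet> b -
    hess_log_u (m - s *\<^sub>R z) b \<bullet> b)"
  have "trace_op (hess_log_u (m + z)) + trace_op (hess_log_u (m - z)) - trace_op (hess_log_u (m + s *\<^sub>R z)) -
    trace_op (hess_log_u (m - s *\<^sub>R z)) = (\<Sum>b\<in>B. Hsum b)"
    by (simp add: Hsum_def trace ends inner_points sum.distrib sum_subtractf)
  also have "\<dots> = Hsum (sgn z) + (\<Sum>b\<in>B - {sgn z}. Hsum b)" by (rule sum.remove[OF B(1,2)])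
  also have "\<dots> \<le> (2 * L2 (norm z) - 2 * L2 (s * norm z)) + 0"
    unfolding Hsum_def by (intro add_mono dilation_variation(2) sum_nonpos translation_variation(2))
  finally show ?thesis by simp
qed

lemma V_four_point_le:
  "V (m + z) + V (m - z) - V (m + s *\<^sub>R z) - V (m - s *\<^sub>R z) \<le>
    2 * ((L2 (norm z) + (L1 (norm z))\<^sup>2) - (L2 (s * norm z) + (L1 (s * norm z))\<^sup>2))"
proof -
  let ?g = grad_log_u
  have "(?g (m + z) + ?g (m - z)) \<bullet> a = (?g (m + s *\<^sub>R z) + ?g (m - s *\<^sub>R z)) \<bullet> a" for a
    using translation_variation(1)[of a] by (simp add: inner_add_left)
  then have "?g (m + z) + ?g (m - z) = ?g (m + s *\<^sub>R z) + ?g (m - s *\<^sub>R z)"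
    by (metis inner_commute vector_eq_ldot)
  moreover have "(?g (m + z) - ?g (m - z)) \<bullet> sgn z = 2 * L1 (norm z)"
    using dilation_variation(1) inner_dilation_variation by simp
  ultimately have "?g (m + z) \<bullet> ?g (m + z) + ?g (m - z) \<bullet> ?g (m - z) - ?g (m + s *\<^sub>R z) \<bullet> ?g (m + s *\<^sub>R z) -
    ?g (m - s *\<^sub>R z) \<bullet> ?g (m - s *\<^sub>R z) \<le> 2 * ((L1 (norm z))\<^sup>2 - (L1 (s * norm z))\<^sup>2)"
    using s rotation_variation inner_dilation_variation
    by (intro inner_square_difference_le[OF norm_sgn_z(1), of _ _ _ _ _ _ s]) auto
  with trace_hess_log_u_four_point_le show ?thesis
    using trace_hess_log_u[OF ends(1)] trace_hess_log_u[OF ends(2)] trace_hess_log_u[OF inner_points(1)]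
      trace_hess_log_u[OF inner_points(2)] by (simp add: algebra_simps)
qed

end

context
  assumes strict: "\<And>m z s. m + z \<in> Om \<Longrightarrow> m - z \<in> Om \<Longrightarrow> z \<noteq> 0 \<Longrightarrow> 0 \<le> s \<Longrightarrow> s < 1 \<Longrightarrow>
      2 * ((L2 (norm z) + (L1 (norm z))\<^sup>2) - (L2 (s * norm z) + (L1 (s * norm z))\<^sup>2))
        < V (m + z) + V (m - z) - V (m + s *\<^sub>R z) - V (m - s *\<^sub>R z)"
begin

lemma four_point_nonpos:
  assumes "m + z \<in> Om" "m - z \<in> Om" "0 \<le> s" "s \<le> 1"
  shows "four_point (m, z, s) \<le> 0"
proof (rule ccontr)
  assume "\<not> four_point (m, z, s) \<le> 0"
  then have pos: "four_point (m, z, s) > 0" by simp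
  have dom: "(m, z, s) \<in> four_point_domain" using assms by (simp add: four_point_domain_def)
  obtain m z s where max: "m + z \<in> Om" "m - z \<in> Om" "0 \<le> s" "s < 1" "z \<noteq> 0"
    "\<And>m' z' s'. m' + z' \<in> Om \<Longrightarrow> m' - z' \<in> Om \<Longrightarrow> \<bar>s'\<bar> \<le> 1 \<Longrightarrow> four_point (m', z', s') \<le> four_point (m, z, s)"
    by (rule four_point_attains_max[OF dom pos]) (rule that)
  from V_four_point_le[OF max] strict[OF max(1,2,5,3,4)] show False by simp
qed

lemma grad_log_u_modulus:
  assumes xy: "x \<in> Om" "y \<in> Om"
  shows "(grad_log_u y - grad_log_u x) \<bullet> (y - x) \<le> 2 * L1 (norm (y - x) / 2) * norm (y - x)"
proof -
  define m z where "m = (1/2) *\<^sub>R (x + y)" and "z = (1/2) *\<^sub>R (y - x)"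
  have ends_eq: "m + z = y" "m - z = x"
    unfolding m_def z_def by (simp_all add: algebra_simps flip: scaleR_add_left)
  have norm_z: "norm z = norm (y - x) / 2" by (simp add: z_def)
  have "norm z \<le> D" using diam[OF xy] by (simp add: norm_z)
  define k where "k = (\<lambda>s. (log_u (m + s *\<^sub>R z) + log_u (m - s *\<^sub>R z)) - 2 * L (s * norm z))"
  have "((\<lambda>s. L (s * norm z)) has_real_derivative L1 (norm z) * norm z) (at 1)"
    by (rule DERIV_chain2[of L]) (use L(1)[of "norm z"] \<open>norm z \<le> D\<close> in \<open>auto intro!: derivative_eq_intros\<close>)
  moreover have "((\<lambda>s. log_u (m + s *\<^sub>R z) + log_u (m - s *\<^sub>R z)) has_real_derivative (grad_log_u y - grad_log_u x) \<bullet> z) (at 1)"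
    using has_real_derivative_log_u_pair[of m 1 z] xy by (simp add: ends_eq)
  ultimately have k_deriv: "(k has_real_derivative (grad_log_u y - grad_log_u x) \<bullet> z - 2 * (L1 (norm z) * norm z)) (at 1)"
    unfolding k_def by (intro DERIV_diff DERIV_cmult)
  have "(grad_log_u y - grad_log_u x) \<bullet> z - 2 * (L1 (norm z) * norm z) \<le> 0"
  proof (rule ccontr)
    assume "\<not> ?thesis"
    then obtain r where r: "r > 0" "\<And>h. 0 < h \<Longrightarrow> h < r \<Longrightarrow> k (1 - h) < k 1"
      using DERIV_pos_inc_left[OF k_deriv] by auto
    define h where "h = min (r / 2) 1"
    have h: "0 < h" "h < r" "h \<le> 1" using r(1) by (auto simp: h_def)
    have "k 1 \<le> k (1 - h)"
      using four_point_nonpos[of m z "1 - h"] xy h by (simp add: k_def ends_eq four_point_def)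
    then show False using r(2)[OF h(1,2)] by simp
  qed
  moreover have "(grad_log_u y - grad_log_u x) \<bullet> z = ((grad_log_u y - grad_log_u x) \<bullet> (y - x)) / 2"
    by (simp add: z_def)
  ultimately show ?thesis unfolding norm_z by simp
qed

end

end

end

end

section \<open>Two-point comparison of oscillations\<close>

lemma DERIV_eventually_local_max:
  fixes F :: "real \<Rightarrow> real"
  assumes F: "(F has_real_derivative d) (at x)" and max: "\<forall>\<^sub>F t in nhds x. F t \<le> F x"
  shows "d = 0"
proof -
  obtain r where "r > 0" "\<And>t. \<bar>x - t\<bar> < r \<Longrightarrow> F t \<le> F x"
    using max unfolding eventually_nhds_metric by (auto simp: dist_real_def abs_minus_commute)
  then show ?thesis by (intro DERIV_local_max[OF F]) auto
qed

context ground_state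
begin

context
  fixes L1 w w1 w2 :: "real \<Rightarrow> real" and v :: "'a \<Rightarrow> real" and gv Hv and c :: "'a \<Rightarrow> real" and D \<gamma> \<mu> \<delta> B :: real
  assumes modulus: "\<And>x y. x \<in> Om \<Longrightarrow> y \<in> Om \<Longrightarrow> (grad_log_u y - grad_log_u x) \<bullet> (y - x) \<le> 2 * L1 (norm (y - x) / 2) * norm (y - x)"
    and diam: "\<And>x y. x \<in> Om \<Longrightarrow> y \<in> Om \<Longrightarrow> norm (y - x) < 2 * D"
    and w: "\<And>s. \<bar>s\<bar> \<le> D \<Longrightarrow> (w has_real_derivative w1 s) (at s)" "\<And>s. \<bar>s\<bar> \<le> D \<Longrightarrow> (w1 has_real_derivative w2 s) (at s)"
    and w1_nonneg: "\<And>s. 0 \<le> s \<Longrightarrow> s < D \<Longrightarrow> w1 s \<ge> 0"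
    and w_inequality: "\<And>s. 0 \<le> s \<Longrightarrow> s < D \<Longrightarrow> w2 s + 2 * L1 s * w1 s \<le> - \<gamma> * w s"
    and v: "has_hessian_on Om v gv Hv" and v_bound: "\<And>x. x \<in> Om \<Longrightarrow> \<bar>v x\<bar> \<le> B"
    and v_equation: "\<And>x. x \<in> Om \<Longrightarrow> trace_op (Hv x) + 2 * (grad_log_u x \<bullet> gv x) = - (\<mu> + c x) * v x"
    and c_bound: "\<And>x. x \<in> Om \<Longrightarrow> \<bar>c x\<bar> \<le> \<delta>"
begin

definition two_point :: "real \<Rightarrow> 'a \<times> 'a \<Rightarrow> real" where
  "two_point C = (\<lambda>(x, y). v y - v x - C * w (norm (y - x) / 2))"

lemma half_distance_less_D: "x \<in> Om \<Longrightarrow> y \<in> Om \<Longrightarrow> norm (y - x) / 2 < D"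
  using diam by fastforce

lemma continuous_on_w: "continuous_on {-D..D} w"
proof (rule continuous_at_imp_continuous_on, rule ballI)
  fix s
  assume "s \<in> {-D..D}"
  then have "\<bar>s\<bar> \<le> D" by auto
  from w(1)[OF this] show "isCont w s" by (rule DERIV_isCont)
qed

lemma continuous_on_two_point: "continuous_on (Om \<times> Om) (two_point C)"
proof -
  have "continuous_on (Om \<times> Om) (\<lambda>p. v (snd p))" "continuous_on (Om \<times> Om) (\<lambda>p. v (fst p))"
    by (rule continuous_on_compose2[OF has_hessian_on_continuous_on(1)[OF v]]; auto intro!: continuous_intros)+
  moreover have "continuous_on (Om \<times> Om) (\<lambda>p. w (norm (snd p - fst p) / 2))"
  proof (rule continuous_on_compose2[OF continuous_on_w])
    show "continuous_on (Om \<times> Om) (\<lambda>p. norm (snd p - fst p) / 2)" by (intro continuous_intros) auto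
    show "(\<lambda>p. norm (snd p - fst p) / 2) ` (Om \<times> Om) \<subseteq> {-D..D}"
    proof clarify
      fix x y
      assume "x \<in> Om" "y \<in> Om"
      from half_distance_less_D[OF this] norm_ge_zero[of "y - x"]
      show "norm (snd (x, y) - fst (x, y)) / 2 \<in> {-D..D}"
        unfolding atLeastAtMost_iff fst_conv snd_conv by linarith
    qed
  qed
  ultimately show ?thesis
    unfolding two_point_def case_prod_unfold
    by (intro continuous_on_diff continuous_on_mult continuous_on_const)
qed

lemma two_point_bounded:
  assumes "C > 0"
  obtains K where "\<And>x y. x \<in> Om \<Longrightarrow> y \<in> Om \<Longrightarrow> two_point C (x, y) \<le> K"
proof -
  obtain W where w_bound: "\<And>s. s \<in> {-D..D} \<Longrightarrow> norm (w s) \<le> W"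
    by (rule continuous_on_compact_bound[OF compact_Icc continuous_on_w]) (rule that)
  show ?thesis
  proof (rule that[of "2 * B + C * W"])
    fix x y
    assume xy: "x \<in> Om" "y \<in> Om"
    have "- w (norm (y - x) / 2) \<le> W"
      using w_bound[of "norm (y - x) / 2"] half_distance_less_D[OF xy] norm_ge_zero[of "y - x"] by simp
    then have "C * (- w (norm (y - x) / 2)) \<le> C * W" using assms by (intro mult_left_mono) auto
    then show "two_point C (x, y) \<le> 2 * B + C * W"
      using v_bound[OF xy(1)] v_bound[OF xy(2)] by (simp add: two_point_def abs_le_iff)
  qed
qed

context
  fixes C e :: real and x y :: 'a
  assumes C: "C > 0" and e: "e > 0" and xy: "x \<in> Om" "y \<in> Om" "x \<noteq> y"
    and max: "\<And>a b. a \<in> Om \<Longrightarrow> b \<in> Om \<Longrightarrow>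
      two_point C (a, b) + e * (log_u a + log_u b) \<le> two_point C (x, y) + e * (log_u x + log_u y)"
begin

abbreviation (input) half_dist where "half_dist \<equiv> norm (y - x) / 2"

abbreviation (input) unit_dir where "unit_dir \<equiv> sgn (y - x)"

lemma half_dist_bounds: "0 < half_dist" "half_dist < D"
  using xy half_distance_less_D by simp_all

lemma norm_dir: "norm unit_dir = 1"
  using xy(3) by (simp add: norm_sgn)

lemma diff_eq_dir: "y - x = (2 * half_dist) *\<^sub>R unit_dir"
  using xy(3) by (simp add: sgn_div_norm)

lemma near: "\<forall>\<^sub>F t in nhds (0::real). x + t *\<^sub>R a \<in> Om" "\<forall>\<^sub>F t in nhds (0::real). y + t *\<^sub>R b \<in> Om"
  by (rule eventually_on_line_in_open[OF open_Om xy(1)], rule eventually_on_line_in_open[OF open_Om xy(2)])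

lemma max_unfolded:
  assumes "a \<in> Om" "b \<in> Om"
  shows "v b - v a - C * w (norm (b - a) / 2) + e * (log_u a + log_u b) \<le>
    v y - v x - C * w half_dist + e * (log_u x + log_u y)"
  using max[OF assms] by (simp add: two_point_def)

lemma line_derivatives:
  "((\<lambda>t. w (norm (y - x + t *\<^sub>R a) / 2)) has_real_derivative w1 half_dist * ((a \<bullet> unit_dir) / 2)) (at 0)"
  "p \<in> Om \<Longrightarrow> ((\<lambda>t. log_u (p + t *\<^sub>R a)) has_real_derivative grad_log_u p \<bullet> a) (at 0)"
  "p \<in> Om \<Longrightarrow> ((\<lambda>t. v (p + t *\<^sub>R a)) has_real_derivative gv p \<bullet> a) (at 0)"
proof -
  show "((\<lambda>t. w (norm (y - x + t *\<^sub>R a) / 2)) has_real_derivative w1 half_dist * ((a \<bullet> unit_dir) / 2)) (at 0)"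
    by (rule DERIV_chain2[of w])
      (use w(1)[of half_dist] half_dist_bounds has_real_derivative_norm_line[of "y - x" a] xy(3) in \<open>auto intro!: derivative_eq_intros\<close>)
qed (use has_derivative_line[of log_u "grad_log_u p" p 0 a] has_derivative_line[of v "gv p" p 0 a]
  has_hessian_onD(1)[OF has_hessian_on_log_u] has_hessian_onD(1)[OF v] in simp_all)

lemma gradient_at_max:
  "gv y = (C * w1 half_dist / 2) *\<^sub>R unit_dir - e *\<^sub>R grad_log_u y"
  "gv x = (C * w1 half_dist / 2) *\<^sub>R unit_dir + e *\<^sub>R grad_log_u x"
proof -
  have "gv y \<bullet> a - C * (w1 half_dist * ((a \<bullet> unit_dir) / 2)) + e * (grad_log_u y \<bullet> a) = 0" for a
  proof (rule DERIV_eventually_local_max)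
    show "((\<lambda>t. v (y + t *\<^sub>R a) - C * w (norm (y - x + t *\<^sub>R a) / 2) + e * log_u (y + t *\<^sub>R a)) has_real_derivative
      gv y \<bullet> a - C * (w1 half_dist * ((a \<bullet> unit_dir) / 2)) + e * (grad_log_u y \<bullet> a)) (at 0)"
      by (intro DERIV_add DERIV_diff DERIV_cmult line_derivatives xy)
    show "\<forall>\<^sub>F t in nhds 0. v (y + t *\<^sub>R a) - C * w (norm (y - x + t *\<^sub>R a) / 2) + e * log_u (y + t *\<^sub>R a) \<le>
      v (y + 0 *\<^sub>R a) - C * w (norm (y - x + 0 *\<^sub>R a) / 2) + e * log_u (y + 0 *\<^sub>R a)"
      using near(2)[of a]
    proof eventually_elim
      case (elim t)
      have "y + t *\<^sub>R a - x = y - x + t *\<^sub>R a" by simp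
      from max_unfolded[OF xy(1) elim, unfolded this] show ?case by (simp add: distrib_left)
    qed
  qed
  then have "(gv y - ((C * w1 half_dist / 2) *\<^sub>R unit_dir - e *\<^sub>R grad_log_u y)) \<bullet> a = 0" for a
    by (simp add: inner_diff_left inner_add_left inner_commute[of unit_dir a] algebra_simps)
  from this[of "gv y - ((C * w1 half_dist / 2) *\<^sub>R unit_dir - e *\<^sub>R grad_log_u y)"]
  show "gv y = (C * w1 half_dist / 2) *\<^sub>R unit_dir - e *\<^sub>R grad_log_u y" by simp
  have "- (gv x \<bullet> a) - C * (w1 half_dist * ((- a \<bullet> unit_dir) / 2)) + e * (grad_log_u x \<bullet> a) = 0" for a
  proof (rule DERIV_eventually_local_max)
    show "((\<lambda>t. - v (x + t *\<^sub>R a) - C * w (norm (y - x + t *\<^sub>R (- a)) / 2) + e * log_u (x + t *\<^sub>R a)) has_real_derivative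
      - (gv x \<bullet> a) - C * (w1 half_dist * ((- a \<bullet> unit_dir) / 2)) + e * (grad_log_u x \<bullet> a)) (at 0)"
      by (intro DERIV_add DERIV_diff DERIV_cmult DERIV_minus line_derivatives xy)
    show "\<forall>\<^sub>F t in nhds 0. - v (x + t *\<^sub>R a) - C * w (norm (y - x + t *\<^sub>R (- a)) / 2) + e * log_u (x + t *\<^sub>R a) \<le>
      - v (x + 0 *\<^sub>R a) - C * w (norm (y - x + 0 *\<^sub>R (- a)) / 2) + e * log_u (x + 0 *\<^sub>R a)"
      using near(1)[of a]
    proof eventually_elim
      case (elim t)
      have "y - (x + t *\<^sub>R a) = y - x + t *\<^sub>R (- a)" by simp
      from max_unfolded[OF elim xy(2), unfolded this] show ?case by (simp add: distrib_left)
    qed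
  qed
  then have "(gv x - ((C * w1 half_dist / 2) *\<^sub>R unit_dir + e *\<^sub>R grad_log_u x)) \<bullet> a = 0" for a
    by (simp add: inner_diff_left inner_add_left inner_commute[of unit_dir a] algebra_simps)
  from this[of "gv x - ((C * w1 half_dist / 2) *\<^sub>R unit_dir + e *\<^sub>R grad_log_u x)"]
  show "gv x = (C * w1 half_dist / 2) *\<^sub>R unit_dir + e *\<^sub>R grad_log_u x" by simp
qed

lemma parallel_second_variation:
  "Hv y a \<bullet> a - Hv x a \<bullet> a + e * (hess_log_u x a \<bullet> a + hess_log_u y a \<bullet> a) \<le> 0"
proof -
  have "\<forall>\<^sub>F t in nhds 0. v (y + t *\<^sub>R a) - v (x + t *\<^sub>R a) + e * (log_u (x + t *\<^sub>R a) + log_u (y + t *\<^sub>R a)) \<le>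
    v (y + 0 *\<^sub>R a) - v (x + 0 *\<^sub>R a) + e * (log_u (x + 0 *\<^sub>R a) + log_u (y + 0 *\<^sub>R a))"
    using near(1)[of a] near(2)[of a]
  proof eventually_elim
    case (elim t)
    have "y + t *\<^sub>R a - (x + t *\<^sub>R a) = y - x" by simp
    then show ?case using max_unfolded[OF elim] by simp
  qed
  from jet2_local_max(2)[OF jet2_add[OF jet2_diff[OF jet2_line[OF v open_Om xy(2)] jet2_line[OF v open_Om xy(1)]]
    jet2_cmult[OF jet2_add[OF jet2_line[OF has_hessian_on_log_u open_Om xy(1)] jet2_line[OF has_hessian_on_log_u open_Om xy(2)]]]] this]
  show ?thesis .
qed

lemma opposite_second_variation:
  "Hv y unit_dir \<bullet> unit_dir - Hv x unit_dir \<bullet> unit_dir + e * (hess_log_u x unit_dir \<bullet> unit_dir + hess_log_u y unit_dir \<bullet> unit_dir) \<le> C * w2 half_dist"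
proof -
  have "half_dist \<in> {-D<..<D}" "\<bar>half_dist\<bar> \<le> D"
    using half_dist_bounds unfolding greaterThanLessThan_iff by linarith+
  then have w_jet: "jet2 (\<lambda>t. w (half_dist + t)) (w1 half_dist) (w2 half_dist)"
    by (intro jet2_shift[of "{-D<..<D}"] w) auto
  have "\<forall>\<^sub>F t in nhds (0::real). \<bar>t\<bar> < half_dist"
    unfolding eventually_nhds_metric using half_dist_bounds by (intro exI[of _ half_dist]) auto
  then have "\<forall>\<^sub>F t in nhds 0.
    v (y + t *\<^sub>R unit_dir) - v (x + t *\<^sub>R - unit_dir) - C * w (half_dist + t) + e * (log_u (x + t *\<^sub>R - unit_dir) + log_u (y + t *\<^sub>R unit_dir)) \<le>
    v (y + 0 *\<^sub>R unit_dir) - v (x + 0 *\<^sub>R - unit_dir) - C * w (half_dist + 0) + e * (log_u (x + 0 *\<^sub>R - unit_dir) + log_u (y + 0 *\<^sub>R unit_dir))"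
    using near(1)[of "- unit_dir"] near(2)[of unit_dir]
  proof eventually_elim
    case (elim t)
    have "(2 * t) *\<^sub>R unit_dir = t *\<^sub>R unit_dir + t *\<^sub>R unit_dir" by (simp only: mult_2 scaleR_add_left)
    then have "y + t *\<^sub>R unit_dir - (x + t *\<^sub>R - unit_dir) = (y - x) + (2 * t) *\<^sub>R unit_dir" by simp
    also have "\<dots> = (2 * (half_dist + t)) *\<^sub>R unit_dir"
      by (subst diff_eq_dir) (simp add: distrib_left scaleR_add_left)
    finally have "norm (y + t *\<^sub>R unit_dir - (x + t *\<^sub>R - unit_dir)) = \<bar>2 * (half_dist + t)\<bar> * norm unit_dir"
      by (simp only: norm_scaleR)
    then have "norm (y + t *\<^sub>R unit_dir - (x + t *\<^sub>R - unit_dir)) / 2 = half_dist + t"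
      using elim(1) norm_dir by simp
    from max_unfolded[OF elim(2,3), unfolded this] show ?case by simp
  qed
  note at_max = jet2_local_max(2)[OF jet2_add[OF jet2_diff[OF jet2_diff[OF jet2_line[OF v open_Om xy(2)] jet2_line[OF v open_Om xy(1)]]
    jet2_cmult[OF w_jet]] jet2_cmult[OF jet2_add[OF jet2_line[OF has_hessian_on_log_u open_Om xy(1)]
    jet2_line[OF has_hessian_on_log_u open_Om xy(2)]]]] this]
  have "hess_log_u x (- unit_dir) = - hess_log_u x unit_dir" "Hv x (- unit_dir) = - Hv x unit_dir"
    by (rule linear_neg[OF has_hessian_onD(3)[OF has_hessian_on_log_u xy(1)]], rule linear_neg[OF has_hessian_onD(3)[OF v xy(1)]])
  with at_max show ?thesis by simp
qed

lemma trace_at_max: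
  "trace_op (Hv y) - trace_op (Hv x) + e * (trace_op (hess_log_u x) + trace_op (hess_log_u y)) \<le> C * w2 half_dist"
proof -
  obtain E where E: "finite E" "unit_dir \<in> E" "\<And>A. linear A \<Longrightarrow> trace_op A = (\<Sum>b\<in>E. A b \<bullet> b)"
    by (rule trace_op_orthonormal[OF norm_dir]) (rule that; assumption)
  have trace: "trace_op (hess_log_u p) = (\<Sum>b\<in>E. hess_log_u p b \<bullet> b)" "trace_op (Hv p) = (\<Sum>b\<in>E. Hv p b \<bullet> b)"
    if "p \<in> Om" for p
    by (rule E(3)[OF has_hessian_onD(3)[OF has_hessian_on_log_u that]], rule E(3)[OF has_hessian_onD(3)[OF v that]])
  define Q where "Q = (\<lambda>b. Hv y b \<bullet> b - Hv x b \<bullet> b + e * (hess_log_u x b \<bullet> b + hess_log_u y b \<bullet> b))"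
  have "trace_op (Hv y) - trace_op (Hv x) + e * (trace_op (hess_log_u x) + trace_op (hess_log_u y)) = (\<Sum>b\<in>E. Q b)"
    by (simp add: Q_def trace xy sum.distrib sum_subtractf sum_distrib_left[symmetric])
  also have "\<dots> = Q unit_dir + (\<Sum>b\<in>E - {unit_dir}. Q b)" by (rule sum.remove[OF E(1,2)])
  also have "\<dots> \<le> C * w2 half_dist + 0"
    unfolding Q_def by (intro add_mono opposite_second_variation sum_nonpos parallel_second_variation)
  finally show ?thesis by simp
qed

lemma drift_difference_at_max:
  "2 * (grad_log_u y \<bullet> gv y) - 2 * (grad_log_u x \<bullet> gv x) \<le>
    C * (2 * L1 half_dist * w1 half_dist) - 2 * e * (grad_log_u y \<bullet> grad_log_u y + grad_log_u x \<bullet> grad_log_u x)"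
proof -
  define P where "P = (grad_log_u y - grad_log_u x) \<bullet> unit_dir"
  have "P * (2 * half_dist) = (grad_log_u y - grad_log_u x) \<bullet> ((2 * half_dist) *\<^sub>R unit_dir)"
    by (simp add: P_def)
  also have "\<dots> \<le> 2 * L1 half_dist * (2 * half_dist)"
    unfolding diff_eq_dir[symmetric] using modulus[OF xy(1,2)] by simp
  finally have "P \<le> 2 * L1 half_dist" using half_dist_bounds(1) by simp
  moreover have "0 \<le> C * w1 half_dist" using C w1_nonneg[of half_dist] half_dist_bounds by simp
  ultimately have "C * w1 half_dist * P \<le> C * w1 half_dist * (2 * L1 half_dist)" by (rule mult_left_mono)
  moreover have "2 * (grad_log_u y \<bullet> gv y) - 2 * (grad_log_u x \<bullet> gv x) =
    C * w1 half_dist * P - 2 * e * (grad_log_u y \<bullet> grad_log_u y + grad_log_u x \<bullet> grad_log_u x)"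
    unfolding gradient_at_max P_def
    by (simp add: inner_diff_left inner_diff_right inner_add_right algebra_simps)
  ultimately show ?thesis by (simp add: mult_ac)
qed

lemma penalized_two_point_inequality:
  "C * \<gamma> * w half_dist \<le> \<mu> * (v y - v x) + \<delta> * (\<bar>v x\<bar> + \<bar>v y\<bar>) - e * (V x + V y - 2 * lam)"
proof -
  define G where "G = grad_log_u y \<bullet> grad_log_u y + grad_log_u x \<bullet> grad_log_u x"
  have "trace_op (hess_log_u x) + trace_op (hess_log_u y) = V x + V y - 2 * lam - G"
    using trace_hess_log_u[OF xy(1)] trace_hess_log_u[OF xy(2)] by (simp add: G_def)
  with trace_at_max have "trace_op (Hv y) - trace_op (Hv x) + e * (V x + V y - 2 * lam) - e * G \<le> C * w2 half_dist"
    by (simp add: right_diff_distrib)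
  moreover have "2 * (grad_log_u y \<bullet> gv y) - 2 * (grad_log_u x \<bullet> gv x) \<le> C * (2 * L1 half_dist * w1 half_dist) - 2 * (e * G)"
    using drift_difference_at_max by (simp add: G_def)
  moreover have "0 \<le> e * G" using e by (simp add: G_def)
  moreover have "C * (w2 half_dist + 2 * L1 half_dist * w1 half_dist) \<le> C * (- \<gamma> * w half_dist)"
    using w_inequality[of half_dist] half_dist_bounds C by (intro mult_left_mono) auto
  moreover have "c p * v p \<le> \<delta> * \<bar>v p\<bar>" "- (c p * v p) \<le> \<delta> * \<bar>v p\<bar>" if "p \<in> Om" for p
    using mult_right_mono[OF c_bound[OF that], of "\<bar>v p\<bar>"] abs_ge_self[of "c p * v p"] abs_ge_minus_self[of "c p * v p"]
    by (simp_all add: abs_mult)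
  note this(1)[OF xy(2)] this(2)[OF xy(1)]
  ultimately show ?thesis using v_equation[OF xy(1)] v_equation[OF xy(2)] by (simp add: algebra_simps)
qed

end

lemma two_point_estimate:
  assumes C: "C > 0" and xy: "x \<in> Om" "y \<in> Om" "v y - v x > C * w (norm (y - x) / 2)" and w_pos: "w 0 > 0"
    and k: "k > 0"
  obtains x' y' where "x' \<in> Om" "y' \<in> Om"
    "C * \<gamma> * w (norm (y' - x') / 2) \<le> \<mu> * (v y' - v x') + \<delta> * (\<bar>v x'\<bar> + \<bar>v y'\<bar>) + k"
proof -
  define K where "K = M + \<bar>lam\<bar>"
  have K: "K \<ge> 0" using V_bound[OF xy(1)] by (simp add: K_def)
  define m where "m = two_point C (x, y)"
  have m: "m > 0" using xy by (simp add: m_def two_point_def)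
  define F where "F = log_u x + log_u y"
  have F: "F \<le> 0" using log_u_nonpos xy by (simp add: F_def add_nonpos_nonpos)
  define e where "e = min (m / (2 * (1 - F))) (k / (2 * (K + 1)))"
  have e: "e > 0"
    unfolding e_def min_less_iff_conj using m F K k by (intro conjI divide_pos_pos mult_pos_pos) auto
  obtain T where T: "\<And>x y. x \<in> Om \<Longrightarrow> y \<in> Om \<Longrightarrow> two_point C (x, y) \<le> T"
    by (rule two_point_bounded[OF C]) (rule that)
  obtain x' y' where xy': "x' \<in> Om" "y' \<in> Om"
    and max: "\<And>a b. a \<in> Om \<Longrightarrow> b \<in> Om \<Longrightarrow> two_point C (a, b) + e * (log_u a + log_u b) \<le> two_point C (x', y') + e * (log_u x' + log_u y')"
    using pair_penalized_max[OF continuous_on_two_point T e] by blast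
  have "e * (1 - F) \<le> m / (2 * (1 - F)) * (1 - F)" using F by (intro mult_right_mono) (auto simp: e_def)
  also have "\<dots> = m / 2" using F by (simp add: field_simps)
  finally have "0 < m + e * F" using e m by (simp add: algebra_simps)
  moreover have "m + e * F \<le> two_point C (x', y') + e * (log_u x' + log_u y')"
    using max[OF xy(1,2)] by (simp add: m_def F_def)
  moreover have "e * (log_u x' + log_u y') \<le> 0"
    using log_u_nonpos[OF xy'(1)] log_u_nonpos[OF xy'(2)] e by (simp add: mult_nonneg_nonpos)
  ultimately have "0 < two_point C (x', y')" by linarith
  then have "x' \<noteq> y'" using mult_pos_pos[OF C w_pos] by (auto simp: two_point_def)
  have "e * (- (V x' + V y' - 2 * lam)) \<le> e * (2 * (K + 1))"
    using V_bound[OF xy'(1)] V_bound[OF xy'(2)] e by (intro mult_left_mono) (auto simp: K_def abs_le_iff)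
  also have "\<dots> \<le> k / (2 * (K + 1)) * (2 * (K + 1))" using K by (intro mult_right_mono) (auto simp: e_def)
  also have "\<dots> = k" using K by simp
  finally have "- (e * (V x' + V y' - 2 * lam)) \<le> k" unfolding mult_minus_right .
  then show ?thesis
    using penalized_two_point_inequality[OF C e xy' \<open>x' \<noteq> y'\<close> max] by (intro that[OF xy']) linarith
qed

context
  fixes w_min w_max :: real and p :: 'a
  assumes w_bounds: "\<And>s. 0 \<le> s \<Longrightarrow> s < D \<Longrightarrow> w_min \<le> w s" "\<And>s. 0 \<le> s \<Longrightarrow> s < D \<Longrightarrow> w s \<le> w_max" "w_min > 0"
    and \<mu>_nonneg: "\<mu> \<ge> 0"
    and v_below: "\<And>r. r > 0 \<Longrightarrow> \<exists>x\<in>Om. v x < r" and v_above: "\<And>r. r > 0 \<Longrightarrow> \<exists>x\<in>Om. v x > - r"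
    and p: "p \<in> Om" "v p \<noteq> 0"
begin

definition oscillation_quotient :: "'a \<times> 'a \<Rightarrow> real" where
  "oscillation_quotient = (\<lambda>(x, y). (v y - v x) / w (norm (y - x) / 2))"

definition oscillation :: real where
  "oscillation = (SUP p\<in>Om \<times> Om. oscillation_quotient p)"

lemma D_pos: "D > 0"
  using half_distance_less_D[OF p(1,1)] by simp

lemma w_pos: "0 \<le> s \<Longrightarrow> s < D \<Longrightarrow> w s > 0"
  using w_bounds(1)[of s] w_bounds(3) by linarith

lemma w_half_distance:
  assumes "x \<in> Om" "y \<in> Om"
  shows "0 < w (norm (y - x) / 2)" "w_min \<le> w (norm (y - x) / 2)" "w (norm (y - x) / 2) \<le> w_max"
  using w_pos w_bounds half_distance_less_D[OF assms] by simp_all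

lemma bdd_above_oscillation_quotient: "bdd_above (oscillation_quotient ` (Om \<times> Om))"
proof (rule bdd_aboveI2, clarify)
  fix x y
  assume xy: "x \<in> Om" "y \<in> Om"
  have "B \<ge> 0" using v_bound[OF p(1)] by linarith
  have "v y - v x \<le> 2 * B" using v_bound[OF xy(1)] v_bound[OF xy(2)] by (simp add: abs_le_iff)
  then have "oscillation_quotient (x, y) \<le> 2 * B / w (norm (y - x) / 2)"
    unfolding oscillation_quotient_def using w_half_distance(1)[OF xy] by (simp add: divide_right_mono)
  also have "\<dots> \<le> 2 * B / w_min"
    using w_half_distance[OF xy] w_bounds(3) \<open>B \<ge> 0\<close> by (intro divide_left_mono) auto
  finally show "oscillation_quotient (x, y) \<le> 2 * B / w_min" .
qed

lemma v_diff_le_oscillation: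
  assumes "x \<in> Om" "y \<in> Om"
  shows "v y - v x \<le> oscillation * w (norm (y - x) / 2)"
proof -
  have "oscillation_quotient (x, y) \<le> oscillation"
    unfolding oscillation_def by (rule cSUP_upper[OF _ bdd_above_oscillation_quotient]) (use assms in simp)
  then show ?thesis
    using w_half_distance(1)[OF assms] by (simp add: oscillation_quotient_def pos_divide_le_eq)
qed

lemma oscillation_pos: "oscillation > 0"
proof -
  have "\<exists>x\<in>Om. \<exists>y\<in>Om. 0 < v y - v x"
  proof (cases "v p > 0")
    case True
    from v_below[OF this] p(1) show ?thesis by force
  next
    case False
    then have "- v p > 0" using p(2) by simp
    from v_above[OF this] p(1) show ?thesis by force
  qed
  then obtain x y where xy: "x \<in> Om" "y \<in> Om" "0 < v y - v x" by blast
  then have "0 < oscillation * w (norm (y - x) / 2)" using v_diff_le_oscillation[OF xy(1,2)] by linarith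
  then show ?thesis using w_half_distance(1)[OF xy(1,2)] by (simp add: zero_less_mult_iff)
qed

lemma abs_v_le_oscillation:
  assumes x: "x \<in> Om"
  shows "\<bar>v x\<bar> \<le> oscillation * w_max"
proof -
  have diff: "v y - v x \<le> oscillation * w_max" if "x \<in> Om" "y \<in> Om" for x y
    using v_diff_le_oscillation[OF that] mult_left_mono[OF w_half_distance(3)[OF that] less_imp_le[OF oscillation_pos]] by linarith
  have "v x \<le> oscillation * w_max + r" "- v x \<le> oscillation * w_max + r" if "r > 0" for r
    using v_below[OF that] v_above[OF that] diff[OF _ x] diff[OF x] by force+
  then have "v x \<le> oscillation * w_max" "- v x \<le> oscillation * w_max" by (auto intro: field_le_epsilon)
  then show ?thesis by (simp add: abs_le_iff)
qed

lemma scaled_gap_le: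
  assumes C: "0 < C" "C < oscillation"
  shows "C * \<gamma> \<le> oscillation * (\<mu> + 2 * \<delta> * w_max / w_min)"
proof (rule field_le_epsilon)
  fix k :: real
  assume k: "k > 0"
  obtain x y where xy: "x \<in> Om" "y \<in> Om" "C < oscillation_quotient (x, y)"
    using less_cSUP_iff[OF _ bdd_above_oscillation_quotient, of C] C(2) p(1) unfolding oscillation_def by auto
  then have "v y - v x > C * w (norm (y - x) / 2)"
    using w_half_distance(1)[OF xy(1,2)] by (simp add: oscillation_quotient_def pos_less_divide_eq)
  then obtain x y where xy: "x \<in> Om" "y \<in> Om"
    "C * \<gamma> * w (norm (y - x) / 2) \<le> \<mu> * (v y - v x) + \<delta> * (\<bar>v x\<bar> + \<bar>v y\<bar>) + k * w_min"
    using two_point_estimate[OF C(1) xy(1,2) _ w_pos[OF order_refl D_pos] mult_pos_pos[OF k w_bounds(3)]]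
    by blast
  define W where "W = w (norm (y - x) / 2)"
  have W: "W > 0" "w_min \<le> W" using w_half_distance[OF xy(1,2)] by (simp_all add: W_def)
  have \<delta>: "\<delta> \<ge> 0" using c_bound[OF p(1)] by linarith
  have w_max: "w_max > 0" using w_half_distance[OF p(1,1)] by linarith
  have "\<mu> * (v y - v x) \<le> \<mu> * (oscillation * W)"
    unfolding W_def by (rule mult_left_mono[OF v_diff_le_oscillation[OF xy(1,2)] \<mu>_nonneg])
  moreover have "\<delta> * (\<bar>v x\<bar> + \<bar>v y\<bar>) \<le> \<delta> * (oscillation * w_max + oscillation * w_max)"
    by (intro mult_left_mono add_mono abs_v_le_oscillation xy \<delta>)
  moreover have "\<delta> * (oscillation * w_max + oscillation * w_max) = (2 * \<delta> * w_max / w_min * oscillation) * w_min"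
    using w_bounds(3) by (simp add: algebra_simps)
  moreover have "(2 * \<delta> * w_max / w_min * oscillation) * w_min \<le> (2 * \<delta> * w_max / w_min * oscillation) * W"
    using W \<delta> w_max oscillation_pos w_bounds(3) by (intro mult_left_mono) auto
  moreover have "k * w_min \<le> k * W" using W k by simp
  ultimately have "C * \<gamma> * W \<le> \<mu> * (oscillation * W) + (2 * \<delta> * w_max / w_min * oscillation) * W + k * W"
    using xy(3) unfolding W_def[symmetric] by linarith
  also have "\<dots> = (oscillation * (\<mu> + 2 * \<delta> * w_max / w_min) + k) * W" by (simp add: algebra_simps)
  finally show "C * \<gamma> \<le> oscillation * (\<mu> + 2 * \<delta> * w_max / w_min) + k" using W(1) by simp
qed

lemma gap_comparison: "\<gamma> \<le> \<mu> + 2 * \<delta> * w_max / w_min"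
proof -
  have "oscillation * \<gamma> \<le> oscillation * (\<mu> + 2 * \<delta> * w_max / w_min)"
  proof (rule field_le_mult_one_interval)
    fix r :: real
    assume "0 < r" "r < 1"
    then have "0 < r * oscillation" "r * oscillation < oscillation" using oscillation_pos by simp_all
    from scaled_gap_le[OF this] show "r * (oscillation * \<gamma>) \<le> oscillation * (\<mu> + 2 * \<delta> * w_max / w_min)"
      by (simp add: mult.assoc)
  qed
  then show ?thesis using oscillation_pos by simp
qed

end

end

end

section \<open>The one-dimensional problem\<close>

definition primitive :: "(real \<Rightarrow> real) \<Rightarrow> real \<Rightarrow> real" where
  "primitive h = (SOME F. (\<forall>x. (F has_real_derivative h x) (at x)) \<and> F 0 = 0)"

lemma
  assumes "continuous_on UNIV h"
  shows has_real_derivative_primitive: "(primitive h has_real_derivative h x) (at x)"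
    and primitive_zero: "primitive h 0 = 0"
    and continuous_on_primitive: "continuous_on UNIV (primitive h)"
proof -
  obtain F where "\<And>x. (F has_vector_derivative h x) (at x)"
    using einterval_antiderivative[of "-\<infinity>" \<infinity> h] assms by (auto simp: continuous_on_eq_continuous_at)
  then have "(\<forall>x. ((\<lambda>x. F x - F 0) has_real_derivative h x) (at x)) \<and> F 0 - F 0 = 0"
    by (auto intro!: derivative_eq_intros simp: has_real_derivative_iff_has_vector_derivative)
  then have *: "(\<forall>x. (primitive h has_real_derivative h x) (at x)) \<and> primitive h 0 = 0"
    unfolding primitive_def by (rule someI[of "\<lambda>F. (\<forall>x. (F has_real_derivative h x) (at x)) \<and> F 0 = 0"])
  then show "(primitive h has_real_derivative h x) (at x)" "primitive h 0 = 0" by blast+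
  show "continuous_on UNIV (primitive h)"
    using * by (auto simp: continuous_on_eq_continuous_at intro: DERIV_isCont)
qed

lemma primitive_le_power:
  assumes h: "continuous_on UNIV h" "\<And>x. \<bar>x\<bar> \<le> R \<Longrightarrow> \<bar>h x\<bar> \<le> C * \<bar>x\<bar> ^ n" and x: "\<bar>x\<bar> \<le> R"
  shows "\<bar>primitive h x\<bar> \<le> C * \<bar>x\<bar> ^ Suc n / real (Suc n)"
proof -
  define majorant where "majorant = (\<lambda>t. C * \<bar>x\<bar> ^ Suc n * t ^ Suc n / real (Suc n))"
  have "((\<lambda>t. primitive h (t * x)) has_real_derivative h (t * x) * x) (at t)" for t
    by (rule DERIV_chain2[OF has_real_derivative_primitive[OF h(1)]]) (auto intro!: derivative_eq_intros)
  then have deriv: "((\<lambda>t. primitive h (t * x)) has_vector_derivative h (t * x) * x) (at t)" for t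
    by (simp add: has_real_derivative_iff_has_vector_derivative)
  have majorant_deriv: "(majorant has_vector_derivative C * \<bar>x\<bar> ^ Suc n * t ^ n) (at t)" for t
    unfolding has_real_derivative_iff_has_vector_derivative[symmetric] majorant_def
    by (auto intro!: derivative_eq_intros simp del: power_Suc of_nat_Suc)
  have "norm (primitive h (1 * x) - primitive h (0 * x)) \<le> majorant 1 - majorant 0"
  proof (rule differentiable_bound_general[OF zero_less_one _ _ deriv majorant_deriv])
    show "continuous_on {0..1} (\<lambda>t. primitive h (t * x))" "continuous_on {0..1} majorant"
      using deriv majorant_deriv
      by (auto intro!: continuous_at_imp_continuous_on has_vector_derivative_continuous)
    fix t :: real
    assume "0 < t" "t < 1"
    then have "\<bar>t * x\<bar> \<le> R" using x mult_left_le_one_le[of "\<bar>x\<bar>" t] by (simp add: abs_mult)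
    then have "\<bar>h (t * x)\<bar> * \<bar>x\<bar> \<le> C * \<bar>t * x\<bar> ^ n * \<bar>x\<bar>" by (intro mult_right_mono h(2)) auto
    then show "norm (h (t * x) * x) \<le> C * \<bar>x\<bar> ^ Suc n * t ^ n"
      using \<open>0 < t\<close> by (simp add: abs_mult power_mult_distrib mult_ac)
  qed
  then show ?thesis by (simp add: majorant_def primitive_zero[OF h(1)])
qed

lemma continuous_on_real_bound:
  fixes h :: "real \<Rightarrow> real"
  assumes "continuous_on UNIV h"
  obtains K where "K \<ge> 1" "\<And>s. \<bar>s\<bar> \<le> R \<Longrightarrow> \<bar>h s\<bar> \<le> K"
proof -
  obtain K where "K \<ge> 0" "\<And>s. s \<in> {-R..R} \<Longrightarrow> norm (h s) \<le> K"
    by (rule continuous_on_compact_bound[OF compact_Icc continuous_on_subset[OF assms subset_UNIV]]) (rule that)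
  then have "\<bar>h s\<bar> \<le> K + 1" if "\<bar>s\<bar> \<le> R" for s
    using that by (simp add: add_increasing2 abs_le_iff)
  then show ?thesis using that[of "K + 1"] \<open>K \<ge> 0\<close> by simp
qed

context
  fixes p :: "real \<Rightarrow> real" and c0 c1 :: real
  assumes continuous_on_p: "continuous_on UNIV p"
begin

primrec picard :: "nat \<Rightarrow> real \<Rightarrow> real" where
  "picard 0 = (\<lambda>s. c0 + c1 * s)"
| "picard (Suc n) = primitive (primitive (\<lambda>s. p s * picard n s))"

definition picard1 :: "nat \<Rightarrow> real \<Rightarrow> real" where
  "picard1 n = (case n of 0 \<Rightarrow> (\<lambda>s. c1) | Suc k \<Rightarrow> primitive (\<lambda>s. p s * picard k s))"

definition picard2 :: "nat \<Rightarrow> real \<Rightarrow> real" where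
  "picard2 n = (case n of 0 \<Rightarrow> (\<lambda>s. 0) | Suc k \<Rightarrow> (\<lambda>s. p s * picard k s))"

lemma continuous_on_picard: "continuous_on UNIV (picard n)"
proof (induction n)
  case (Suc n)
  then show ?case by (auto intro!: continuous_on_primitive continuous_on_mult continuous_on_p)
qed (auto intro!: continuous_intros)

lemma continuous_on_picard2: "continuous_on UNIV (picard2 n)"
  by (cases n) (auto simp: picard2_def intro!: continuous_on_mult continuous_on_p continuous_on_picard)

lemma continuous_on_picard1: "continuous_on UNIV (picard1 n)"
  using continuous_on_picard2[of n]
  by (cases n) (auto simp: picard1_def picard2_def intro: continuous_on_primitive)

lemma picard_Suc: "picard (Suc n) = primitive (picard1 (Suc n))" "picard1 (Suc n) = primitive (picard2 (Suc n))"
  by (simp_all add: picard1_def picard2_def)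

lemma picard_deriv:
  "(picard n has_real_derivative picard1 n s) (at s)" "(picard1 n has_real_derivative picard2 n s) (at s)"
proof -
  show "(picard n has_real_derivative picard1 n s) (at s)"
  proof (cases n)
    case 0 then show ?thesis by (auto simp: picard1_def intro!: derivative_eq_intros)
  next
    case (Suc k)
    show ?thesis unfolding Suc picard_Suc(1) by (rule has_real_derivative_primitive[OF continuous_on_picard1])
  qed
  show "(picard1 n has_real_derivative picard2 n s) (at s)"
  proof (cases n)
    case 0 then show ?thesis by (auto simp: picard1_def picard2_def intro!: derivative_eq_intros)
  next
    case (Suc k)
    show ?thesis unfolding Suc picard_Suc(2) by (rule has_real_derivative_primitive[OF continuous_on_picard2])
  qed
qed

context
  fixes R K :: real
  assumes R: "R \<ge> 1" and K: "K \<ge> 1" "\<And>s. \<bar>s\<bar> \<le> R \<Longrightarrow> \<bar>p s\<bar> \<le> K"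
begin

definition picard_bound :: "nat \<Rightarrow> real" where
  "picard_bound n = (\<bar>c0\<bar> + \<bar>c1\<bar> * R) * ((R * K * R) ^ n / fact n)"

lemma picard_bound_nonneg: "picard_bound n \<ge> 0"
  using R K(1) by (simp add: picard_bound_def)

lemma summable_picard_bound: "summable picard_bound" "summable (\<lambda>n. picard_bound (n - 1))"
proof -
  show "summable picard_bound" unfolding picard_bound_def
    using summable_exp[of "R * K * R"] by (intro summable_mult) (simp add: divide_inverse mult.commute)
  then show "summable (\<lambda>n. picard_bound (n - 1))" by (subst summable_Suc_iff[symmetric]) simp
qed

lemma picard_le_power:
  assumes "\<bar>s\<bar> \<le> R"
  shows "\<bar>picard n s\<bar> \<le> (\<bar>c0\<bar> + \<bar>c1\<bar> * R) * (R * K) ^ n / fact n * \<bar>s\<bar> ^ n"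
  using assms
proof (induction n arbitrary: s)
  case 0
  then have "\<bar>c1 * s\<bar> \<le> \<bar>c1\<bar> * R" by (simp add: abs_mult mult_left_mono)
  then show ?case using abs_triangle_ineq[of c0 "c1 * s"] by simp
next
  case (Suc n)
  define E where "E = (\<bar>c0\<bar> + \<bar>c1\<bar> * R) * (R * K) ^ n / fact n"
  have E: "E \<ge> 0" using R K(1) by (simp add: E_def)
  have picard2: "\<bar>picard2 (Suc n) t\<bar> \<le> (K * E) * \<bar>t\<bar> ^ n" if "\<bar>t\<bar> \<le> R" for t
  proof -
    have "\<bar>p t\<bar> * \<bar>picard n t\<bar> \<le> K * (E * \<bar>t\<bar> ^ n)"
      using K(2)[OF that] Suc.IH[OF that] K(1) unfolding E_def by (intro mult_mono) auto
    then show ?thesis by (simp add: picard2_def abs_mult)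
  qed
  have picard1: "\<bar>picard1 (Suc n) t\<bar> \<le> (R * (K * E)) * \<bar>t\<bar> ^ n" if t: "\<bar>t\<bar> \<le> R" for t
  proof -
    have "\<bar>picard1 (Suc n) t\<bar> \<le> (K * E) * \<bar>t\<bar> ^ Suc n / real (Suc n)"
      unfolding picard_Suc(2) by (rule primitive_le_power[OF continuous_on_picard2 picard2 t])
    also have "\<dots> \<le> (K * E) * \<bar>t\<bar> ^ Suc n / 1" using K(1) E by (intro divide_left_mono) auto
    also have "\<dots> = (K * E * \<bar>t\<bar> ^ n) * \<bar>t\<bar>" by simp
    also have "\<dots> \<le> (K * E * \<bar>t\<bar> ^ n) * R" using t K(1) E by (intro mult_left_mono) auto
    finally show ?thesis by (simp add: mult_ac)
  qed
  have "\<bar>picard (Suc n) s\<bar> \<le> (R * (K * E)) * \<bar>s\<bar> ^ Suc n / real (Suc n)"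
    unfolding picard_Suc(1) by (rule primitive_le_power[OF continuous_on_picard1 picard1 Suc.prems])
  also have "\<dots> = (\<bar>c0\<bar> + \<bar>c1\<bar> * R) * (R * K) ^ Suc n / fact (Suc n) * \<bar>s\<bar> ^ Suc n"
    unfolding E_def by (simp add: field_simps del: of_nat_Suc)
  finally show ?case .
qed

lemma picard_dominated: "\<bar>s\<bar> \<le> R \<Longrightarrow> \<bar>picard n s\<bar> \<le> picard_bound n"
proof -
  assume s: "\<bar>s\<bar> \<le> R"
  have "\<bar>picard n s\<bar> \<le> (\<bar>c0\<bar> + \<bar>c1\<bar> * R) * (R * K) ^ n / fact n * \<bar>s\<bar> ^ n" by (rule picard_le_power[OF s])
  also have "\<dots> \<le> (\<bar>c0\<bar> + \<bar>c1\<bar> * R) * (R * K) ^ n / fact n * R ^ n"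
    using R K(1) s by (intro mult_left_mono power_mono) auto
  finally show ?thesis by (simp add: picard_bound_def power_mult_distrib)
qed

lemma picard2_dominated: "\<bar>s\<bar> \<le> R \<Longrightarrow> \<bar>picard2 n s\<bar> \<le> K * picard_bound (n - 1)"
  using K picard_dominated picard_bound_nonneg[of "n - 1"]
  by (cases n) (auto simp: picard2_def abs_mult intro!: mult_mono)

lemma picard1_dominated:
  assumes s: "\<bar>s\<bar> \<le> R"
  shows "\<bar>picard1 n s\<bar> \<le> R * (K * picard_bound (n - 1))"
proof (cases n)
  case 0
  have "\<bar>c1\<bar> * 1 \<le> \<bar>c1\<bar> * R" using R by (intro mult_left_mono) auto
  then have "1 * \<bar>c1\<bar> \<le> (R * K) * (\<bar>c0\<bar> + \<bar>c1\<bar> * R)"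
    using R K(1) mult_mono[of 1 R 1 K] by (intro mult_mono) auto
  then show ?thesis by (simp add: 0 picard1_def picard_bound_def)
next
  case (Suc k)
  have "\<bar>picard1 (Suc k) s\<bar> \<le> (K * picard_bound k) * \<bar>s\<bar> ^ Suc 0 / real (Suc 0)"
    unfolding picard_Suc(2)
    by (rule primitive_le_power[OF continuous_on_picard2 _ s]) (use picard2_dominated[of _ "Suc k"] in simp)
  also have "\<dots> \<le> (K * picard_bound k) * R"
    using s K(1) picard_bound_nonneg[of k] by (simp add: mult_left_mono)
  finally show ?thesis by (simp add: Suc mult.commute)
qed

lemma picard_series_deriv:
  assumes "\<bar>x\<bar> < R"
  shows "summable (\<lambda>n. picard n x)"
    and "((\<lambda>x. \<Sum>n. picard n x) has_real_derivative (\<Sum>n. picard1 n x)) (at x)"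
    and "((\<lambda>x. \<Sum>n. picard1 n x) has_real_derivative (\<Sum>n. picard2 n x)) (at x)"
proof -
  note bounds = picard_dominated[of 0] picard1_dominated[of 0]
  note deriv_within = has_field_derivative_at_within[OF picard_deriv(1)] has_field_derivative_at_within[OF picard_deriv(2)]
  have interval: "convex {-R..R}" "0 \<in> {-R..R}" "x \<in> interior {-R..R}" using assms R by auto
  have uniform1: "uniformly_convergent_on {-R..R} (\<lambda>n s. \<Sum>i<n. picard1 i s)"
    by (rule Weierstrass_m_test'[OF _ summable_mult[OF summable_mult[OF summable_picard_bound(2)], of R K]])
      (use picard1_dominated in auto)
  have uniform2: "uniformly_convergent_on {-R..R} (\<lambda>n s. \<Sum>i<n. picard2 i s)"
    by (rule Weierstrass_m_test'[OF _ summable_mult[OF summable_picard_bound(2), of K]]) (use picard2_dominated in auto)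
  have "summable (\<lambda>n. picard n 0)"
    by (rule summable_comparison_test'[OF summable_picard_bound(1)]) (use bounds(1) R in simp)
  note series = has_field_derivative_series'[OF interval(1) deriv_within(1) uniform1 interval(2) this interval(3)]
  show "summable (\<lambda>n. picard n x)" "((\<lambda>x. \<Sum>n. picard n x) has_real_derivative (\<Sum>n. picard1 n x)) (at x)"
    by (rule series)+
  have "summable (\<lambda>n. picard1 n 0)"
    by (rule summable_comparison_test'[OF summable_mult[OF summable_mult[OF summable_picard_bound(2)], of R K]])
      (use bounds(2) R in simp)
  from has_field_derivative_series'(2)[OF interval(1) deriv_within(2) uniform2 interval(2) this interval(3)]
  show "((\<lambda>x. \<Sum>n. picard1 n x) has_real_derivative (\<Sum>n. picard2 n x)) (at x)" .
qed

end

lemma linear_ode_exists: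
  obtains y y1 where "\<And>s. (y has_real_derivative y1 s) (at s)"
    "\<And>s. (y1 has_real_derivative p s * y s) (at s)" "y 0 = c0" "y1 0 = c1"
proof -
  define y y1 where "y = (\<lambda>s. \<Sum>n. picard n s)" and "y1 = (\<lambda>s. \<Sum>n. picard1 n s)"
  have series: "summable (\<lambda>n. picard n s)" "(y has_real_derivative y1 s) (at s)"
      "(y1 has_real_derivative (\<Sum>n. picard2 n s)) (at s)" for s
  proof -
    obtain K where K: "K \<ge> 1" "\<And>t. \<bar>t\<bar> \<le> \<bar>s\<bar> + 1 \<Longrightarrow> \<bar>p t\<bar> \<le> K"
      by (rule continuous_on_real_bound[OF continuous_on_p]) (rule that)
    have R: "\<bar>s\<bar> + 1 \<ge> 1" by simp
    show "summable (\<lambda>n. picard n s)" "(y has_real_derivative y1 s) (at s)"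
      "(y1 has_real_derivative (\<Sum>n. picard2 n s)) (at s)"
      unfolding y_def y1_def using picard_series_deriv[OF R K, of s] by auto
  qed
  show ?thesis
  proof (rule that[of y y1])
    fix s
    have "(\<lambda>n. picard2 (Suc n) s) sums (p s * y s)"
      using sums_mult[OF summable_sums[OF series(1)], of "p s" s] by (simp add: picard2_def y_def)
    then have "(\<lambda>n. picard2 n s) sums (p s * y s + picard2 0 s)" by (rule sums_Suc)
    then show "(y1 has_real_derivative p s * y s) (at s)"
      using series(3)[of s] by (simp add: picard2_def sums_unique[symmetric])
  next
    have "picard (Suc n) 0 = 0" "picard1 (Suc n) 0 = 0" for n
      using primitive_zero[OF continuous_on_picard1[of "Suc n"]] primitive_zero[OF continuous_on_picard2[of "Suc n"]]
      by (simp_all only: picard_Suc)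
    then have "(\<lambda>n. picard (Suc n) 0) sums 0" "(\<lambda>n. picard1 (Suc n) 0) sums 0" by simp_all
    from sums_Suc[OF this(1)] sums_Suc[OF this(2)] show "y 0 = c0" "y1 0 = c1"
      by (auto simp: y_def y1_def picard1_def sums_unique[symmetric])
  qed (rule series(2))
qed

end

lemma energy_rate_le:
  fixes y y1 :: real
  assumes "\<bar>p\<bar> \<le> K" "\<bar>r\<bar> \<le> e"
  shows "2 * y * y1 + 2 * y1 * (p * y + r) \<le> (2 + K) * (y\<^sup>2 + y1\<^sup>2 + e\<^sup>2)"
proof -
  have "2 * y1 * y * p \<le> \<bar>2 * y1 * y\<bar> * \<bar>p\<bar>" by (metis abs_ge_self abs_mult)
  also have "\<dots> \<le> (y\<^sup>2 + y1\<^sup>2) * K"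
    using sum_squares_bound[of y1 y] sum_squares_bound[of "- y1" y] assms(1)
    by (intro mult_mono) (auto simp: abs_le_iff)
  finally have "2 * y1 * y * p \<le> (y\<^sup>2 + y1\<^sup>2) * K" .
  moreover have "r\<^sup>2 \<le> e\<^sup>2" using power_mono[OF assms(2), of 2] by simp
  then have "2 * y1 * r \<le> y1\<^sup>2 + e\<^sup>2" using sum_squares_bound[of y1 r] by simp
  moreover have "2 * y * y1 \<le> y\<^sup>2 + y1\<^sup>2" using sum_squares_bound[of y y1] by simp
  moreover have "0 \<le> K * e\<^sup>2" "0 \<le> y\<^sup>2" "0 \<le> e\<^sup>2" using assms(1) by auto
  moreover have "2 * y * y1 + 2 * y1 * (p * y + r) = 2 * y * y1 + 2 * y1 * y * p + 2 * y1 * r"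
    "(2 + K) * (y\<^sup>2 + y1\<^sup>2 + e\<^sup>2) = 2 * y\<^sup>2 + 2 * y1\<^sup>2 + 2 * e\<^sup>2 + (y\<^sup>2 + y1\<^sup>2) * K + K * e\<^sup>2"
    by (simp_all add: algebra_simps)
  ultimately show ?thesis by linarith
qed

lemma energy_estimate:
  fixes y y1 :: "real \<Rightarrow> real"
  assumes y: "\<And>s. 0 \<le> s \<Longrightarrow> s < R \<Longrightarrow> (y has_real_derivative y1 s) (at s)"
      "\<And>s. 0 \<le> s \<Longrightarrow> s < R \<Longrightarrow> (y1 has_real_derivative p s * y s + r s) (at s)"
    and p: "\<And>s. 0 \<le> s \<Longrightarrow> s < R \<Longrightarrow> \<bar>p s\<bar> \<le> K" and r: "\<And>s. 0 \<le> s \<Longrightarrow> s < R \<Longrightarrow> \<bar>r s\<bar> \<le> e"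
    and s: "0 \<le> s" "s < R"
  shows "(y s)\<^sup>2 + (y1 s)\<^sup>2 \<le> ((y 0)\<^sup>2 + (y1 0)\<^sup>2 + e\<^sup>2) * exp ((2 + K) * s)"
proof -
  define c where "c = 2 + K"
  define energy where "energy = (\<lambda>s. (y s)\<^sup>2 + (y1 s)\<^sup>2 + e\<^sup>2)"
  have "energy s * exp (- c * s) \<le> energy 0 * exp (- c * 0)"
  proof (rule DERIV_nonpos_imp_nonincreasing[OF s(1)])
    fix t
    assume "0 \<le> t" "t \<le> s"
    then have t: "0 \<le> t" "t < R" using s by auto
    define rate where "rate = 2 * y t * y1 t + 2 * y1 t * (p t * y t + r t)"
    have "(energy has_real_derivative rate) (at t)"
      unfolding energy_def rate_def using y(1)[OF t] y(2)[OF t] by (auto intro!: derivative_eq_intros)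
    then have "((\<lambda>s. energy s * exp (- c * s)) has_real_derivative (rate - c * energy t) * exp (- c * t)) (at t)"
      by (auto intro!: derivative_eq_intros simp: algebra_simps)
    moreover have "(rate - c * energy t) * exp (- c * t) \<le> 0"
      using energy_rate_le[OF p[OF t] r[OF t]]
      by (intro mult_nonpos_nonneg) (simp_all add: rate_def c_def energy_def)
    ultimately show "\<exists>z. ((\<lambda>s. energy s * exp (- c * s)) has_real_derivative z) (at t) \<and> z \<le> 0" by blast
  qed
  then have "energy s \<le> energy 0 * exp (c * s)" by (simp add: exp_minus field_simps)
  then show ?thesis using zero_le_power2[of e] unfolding c_def energy_def by linarith
qed

lemma linear_ode_unique:
  fixes y y1 :: "real \<Rightarrow> real"
  assumes y: "\<And>s. 0 \<le> s \<Longrightarrow> s < R \<Longrightarrow> (y has_real_derivative y1 s) (at s)"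
      "\<And>s. 0 \<le> s \<Longrightarrow> s < R \<Longrightarrow> (y1 has_real_derivative p s * y s) (at s)"
    and p: "\<And>s. 0 \<le> s \<Longrightarrow> s < R \<Longrightarrow> \<bar>p s\<bar> \<le> K" and zero: "y 0 = 0" "y1 0 = 0" and s: "0 \<le> s" "s < R"
  shows "y s = 0"
proof -
  have "(y s)\<^sup>2 + (y1 s)\<^sup>2 \<le> ((y 0)\<^sup>2 + (y1 0)\<^sup>2 + 0\<^sup>2) * exp ((2 + K) * s)"
    by (rule energy_estimate[where r = "\<lambda>s. 0", OF y(1) _ p _ s]) (use y(2) in auto)
  then show ?thesis using zero sum_power2_le_zero_iff[of "y s" "y1 s"] by simp
qed

lemma DERIV_reflect:
  fixes f :: "real \<Rightarrow> real"
  shows "(f has_real_derivative c) (at (- t)) \<Longrightarrow> ((\<lambda>t. f (- t)) has_real_derivative - c) (at t)"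
  using DERIV_mirror[of f c t] by simp

lemma linear_ode_unique_symmetric:
  fixes y y1 :: "real \<Rightarrow> real"
  assumes y: "\<And>s. \<bar>s\<bar> < R \<Longrightarrow> (y has_real_derivative y1 s) (at s)"
      "\<And>s. \<bar>s\<bar> < R \<Longrightarrow> (y1 has_real_derivative p s * y s) (at s)"
    and p: "\<And>s. \<bar>s\<bar> < R \<Longrightarrow> \<bar>p s\<bar> \<le> K" and zero: "y 0 = 0" "y1 0 = 0" and s: "\<bar>s\<bar> < R"
  shows "y s = 0"
proof (cases "s \<ge> 0")
  case True
  show ?thesis by (rule linear_ode_unique[of R y y1 p K]) (use y p zero s True in auto)
next
  case False
  have "y (- (- s)) = 0"
  proof (rule linear_ode_unique[of R "\<lambda>t. y (- t)" "\<lambda>t. - y1 (- t)" "\<lambda>t. p (- t)" K])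
    fix t :: real
    assume "0 \<le> t" "t < R"
    then have t: "\<bar>- t\<bar> < R" by simp
    show "((\<lambda>t. y (- t)) has_real_derivative - y1 (- t)) (at t)" by (rule DERIV_reflect[OF y(1)[OF t]])
    show "((\<lambda>t. - y1 (- t)) has_real_derivative p (- t) * y (- t)) (at t)"
      using DERIV_minus[OF DERIV_reflect[OF y(2)[OF t]]] by simp
    show "\<bar>p (- t)\<bar> \<le> K" by (rule p[OF t])
  qed (use zero s False in auto)
  then show ?thesis by simp
qed

lemma uniform_limit_of_lipschitz_parameter:
  fixes F :: "real \<Rightarrow> 'b \<Rightarrow> real"
  assumes "\<And>m s. \<bar>m - n\<bar> \<le> 1 \<Longrightarrow> s \<in> S \<Longrightarrow> \<bar>F m s - F n s\<bar> \<le> C * \<bar>m - n\<bar>"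
  shows "uniform_limit S F (F n) (nhds n)"
proof (rule uniform_limitI)
  fix e :: real
  assume "e > 0"
  have limit: "((\<lambda>m. m) \<longlongrightarrow> n) (nhds n)" by (rule filterlim_ident)
  then have "((\<lambda>m. C * \<bar>m - n\<bar>) \<longlongrightarrow> C * \<bar>n - n\<bar>) (nhds n)" by (intro tendsto_intros)
  then have "\<forall>\<^sub>F m in nhds n. C * \<bar>m - n\<bar> < e" by (rule order_tendstoD(2)) (use \<open>e > 0\<close> in simp)
  moreover have "((\<lambda>m. \<bar>m - n\<bar>) \<longlongrightarrow> \<bar>n - n\<bar>) (nhds n)" using limit by (intro tendsto_intros)
  then have "\<forall>\<^sub>F m in nhds n. \<bar>m - n\<bar> < 1" by (rule order_tendstoD(2)) simp
  ultimately
  show "\<forall>\<^sub>F m in nhds n. \<forall>s\<in>S. dist (F m s) (F n s) < e"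
  proof eventually_elim
    case (elim m)
    then show ?case using assms[of m] by (force simp: dist_real_def)
  qed
qed

lemma positive_near_zero:
  fixes F :: "real \<Rightarrow> real \<Rightarrow> real"
  assumes "D > 0" "uniform_limit {0..D} F (F n) (nhds n)" "isCont (F n) 0" "F n 0 > 0"
  shows "\<exists>r>0. \<forall>\<^sub>F m in nhds n. \<forall>s\<in>{0..r}. F m s > 0"
proof -
  define a where "a = F n 0 / 2"
  have "a > 0" using assms(4) by (simp add: a_def)
  then obtain d where d: "d > 0" "\<And>s. dist s 0 < d \<Longrightarrow> dist (F n s) (F n 0) < a"
    using assms(3) unfolding continuous_at_eps_delta by blast
  define r where "r = min (d / 2) D"
  have r: "r > 0" "r < d" "r \<le> D" using d assms(1) by (auto simp: r_def)
  have "\<forall>\<^sub>F m in nhds n. \<forall>s\<in>{0..r}. F m s > 0"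
    using uniform_limitD[OF assms(2) \<open>a > 0\<close>]
  proof eventually_elim
    case (elim m)
    show ?case
    proof
      fix s
      assume s: "s \<in> {0..r}"
      then have "\<bar>F m s - F n s\<bar> < a" "\<bar>F n s - F n 0\<bar> < a"
        using elim d(2)[of s] r by (auto simp: dist_real_def)
      then show "F m s > 0" unfolding a_def by linarith
    qed
  qed
  then show ?thesis using r(1) by blast
qed

context
  fixes Y Y1 :: "real \<Rightarrow> real \<Rightarrow> real" and D :: real
  assumes D_pos: "D > 0"
    and deriv: "\<And>m s. (Y m has_real_derivative Y1 m s) (at s)"
    and simple_zeros: "\<And>m s. Y m s = 0 \<Longrightarrow> Y1 m s \<noteq> 0"
    and uniform: "\<And>n. uniform_limit {0..D} Y (Y n) (nhds n)"
    and initially_positive: "\<And>n. \<exists>r>0. \<forall>\<^sub>F m in nhds n. \<forall>s\<in>{0<..r}. Y m s > 0"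
begin

lemma eventually_positive_parameter:
  assumes "\<forall>s\<in>{0<..D}. Y n s > 0"
  shows "\<forall>\<^sub>F m in nhds n. \<forall>s\<in>{0<..D}. Y m s > 0"
proof -
  obtain r where r: "r > 0" and near: "\<forall>\<^sub>F m in nhds n. \<forall>s\<in>{0<..r}. Y m s > 0"
    using initially_positive by blast
  have "continuous_on {min r D..D} (Y n)"
    using deriv by (auto intro!: continuous_at_imp_continuous_on DERIV_isCont)
  then obtain t where t: "t \<in> {min r D..D}" "\<forall>s\<in>{min r D..D}. Y n t \<le> Y n s"
    using continuous_attains_inf[OF compact_Icc, of "min r D" D "Y n"] by auto
  then have "Y n t > 0" using assms r D_pos by auto
  from near uniform_limitD[OF uniform this] show ?thesis
  proof eventually_elim
    case (elim m)
    show ?case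
    proof
      fix s
      assume s: "s \<in> {0<..D}"
      show "Y m s > 0"
      proof (cases "s \<le> r")
        case True then show ?thesis using elim(1) s by auto
      next
        case False
        then have "Y n t \<le> Y n s" "dist (Y m s) (Y n s) < Y n t" using t(2) elim(2) s by auto
        then show ?thesis by (simp add: dist_real_def)
      qed
    qed
  qed
qed

lemma closed_nonpositive_parameters: "closed {m. \<exists>s\<in>{0<..D}. Y m s \<le> 0}" (is "closed ?Z")
  unfolding closed_def open_subopen[of "- ?Z"]
proof
  fix n
  assume "n \<in> - ?Z"
  then have "\<forall>\<^sub>F m in nhds n. m \<in> - ?Z"
    using eventually_positive_parameter[of n] by (simp add: not_le)
  then show "\<exists>T. open T \<and> n \<in> T \<and> T \<subseteq> - ?Z" by (auto simp: eventually_nhds)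
qed

lemma first_zero_parameter:
  assumes low: "\<And>m s. m \<le> b \<Longrightarrow> s \<in> {0<..D} \<Longrightarrow> Y m s > 0"
    and s1: "s1 \<in> {0<..D}" "Y m1 s1 \<le> 0"
  obtains m where "m \<le> m1" "Y m D = 0" "\<And>s. 0 < s \<Longrightarrow> s < D \<Longrightarrow> Y m s > 0"
proof -
  define Z where "Z = {m. \<exists>s\<in>{0<..D}. Y m s \<le> 0}"
  define m where "m = Inf Z"
  have "m1 \<in> Z" using s1 by (auto simp: Z_def)
  have "bdd_below Z"
  proof (rule bdd_belowI[of _ b])
    fix m
    assume "m \<in> Z"
    then obtain s where "s \<in> {0<..D}" "Y m s \<le> 0" by (auto simp: Z_def)
    then show "b \<le> m" using low[of m s] by linarith
  qed
  have below: "Y n s > 0" if "n < m" "s \<in> {0<..D}" for n s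
  proof (rule ccontr)
    assume "\<not> Y n s > 0"
    then have "n \<in> Z" using that(2) by (auto simp: Z_def not_less intro!: bexI[of _ s])
    from cInf_lower[OF this \<open>bdd_below Z\<close>] show False using that(1) by (simp add: m_def)
  qed
  have nonneg: "Y m s \<ge> 0" if "s \<in> {0<..D}" for s
  proof (rule tendsto_lowerbound)
    show "((\<lambda>n. Y n s) \<longlongrightarrow> Y m s) (at_left m)"
      using that by (intro tendsto_mono[OF _ tendsto_uniform_limitI[OF uniform]]) (auto simp: at_within_def)
    show "\<forall>\<^sub>F n in at_left m. 0 \<le> Y n s" using below that by (auto simp: eventually_at_filter less_imp_le)
  qed simp
  have pos: "Y m s > 0" if "0 < s" "s < D" for s
  proof (rule ccontr)
    assume "\<not> Y m s > 0"
    then have "Y m s = 0" using nonneg[of s] that by simp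
    moreover have "Y1 m s = 0"
    proof (rule DERIV_local_min[OF deriv])
      show "0 < min s (D - s)" using that by simp
      show "\<forall>y. \<bar>s - y\<bar> < min s (D - s) \<longrightarrow> Y m s \<le> Y m y" using nonneg \<open>Y m s = 0\<close> by (simp add: abs_less_iff)
    qed
    ultimately show False using simple_zeros by blast
  qed
  have "m \<in> Z"
    unfolding m_def
    using \<open>m1 \<in> Z\<close> \<open>bdd_below Z\<close> closed_nonpositive_parameters
    by (intro closed_contains_Inf) (auto simp: Z_def)
  then obtain s where "s \<in> {0<..D}" "Y m s \<le> 0" by (auto simp: Z_def)
  then have "Y m D = 0" using pos[of s] nonneg[of s] by (cases "s = D") auto
  moreover have "m \<le> m1" unfolding m_def by (rule cInf_lower) fact+
  ultimately show ?thesis using pos by (intro that)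
qed

end

locale even_potential =
  fixes q :: "real \<Rightarrow> real" and D :: real
  assumes continuous_on_q: "continuous_on UNIV q" and q_even: "\<And>s. q (- s) = q s" and D_pos: "D > 0"
begin

definition solves_ivp :: "real \<Rightarrow> real \<Rightarrow> real \<Rightarrow> (real \<Rightarrow> real) \<Rightarrow> (real \<Rightarrow> real) \<Rightarrow> bool" where
  "solves_ivp c0 c1 m y y1 \<longleftrightarrow> (\<forall>s. (y has_real_derivative y1 s) (at s)) \<and>
    (\<forall>s. (y1 has_real_derivative (q s - m) * y s) (at s)) \<and> y 0 = c0 \<and> y1 0 = c1"

definition ivp :: "real \<Rightarrow> real \<Rightarrow> real \<Rightarrow> (real \<Rightarrow> real) \<times> (real \<Rightarrow> real)" where
  "ivp c0 c1 m = (SOME y. solves_ivp c0 c1 m (fst y) (snd y))"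

definition sol :: "real \<Rightarrow> real \<Rightarrow> real \<Rightarrow> real \<Rightarrow> real" where
  "sol c0 c1 m = fst (ivp c0 c1 m)"

definition sol1 :: "real \<Rightarrow> real \<Rightarrow> real \<Rightarrow> real \<Rightarrow> real" where
  "sol1 c0 c1 m = snd (ivp c0 c1 m)"

lemma solves_ivp_sol: "solves_ivp c0 c1 m (sol c0 c1 m) (sol1 c0 c1 m)"
proof -
  have "continuous_on UNIV (\<lambda>s. q s - m)" by (intro continuous_intros continuous_on_q)
  then obtain y y1 where "\<And>s. (y has_real_derivative y1 s) (at s)"
    "\<And>s. (y1 has_real_derivative (q s - m) * y s) (at s)" "y 0 = c0" "y1 0 = c1"
    by (rule linear_ode_exists) (rule that)
  then have "solves_ivp c0 c1 m (fst (y, y1)) (snd (y, y1))" by (simp add: solves_ivp_def)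
  then show ?thesis unfolding sol_def sol1_def ivp_def by (rule someI)
qed

lemma sol_deriv: "(sol c0 c1 m has_real_derivative sol1 c0 c1 m s) (at s)"
  and sol1_deriv: "(sol1 c0 c1 m has_real_derivative (q s - m) * sol c0 c1 m s) (at s)"
  and sol_zero: "sol c0 c1 m 0 = c0"
  and sol1_zero: "sol1 c0 c1 m 0 = c1"
  using solves_ivp_sol[of c0 c1 m] by (simp_all add: solves_ivp_def)

lemma continuous_on_sol: "continuous_on S (sol c0 c1 m)"
  by (auto intro!: continuous_at_imp_continuous_on DERIV_isCont[OF sol_deriv])

lemma sol_unique:
  assumes y: "\<And>s. \<bar>s\<bar> < R \<Longrightarrow> (y has_real_derivative y1 s) (at s)"
      "\<And>s. \<bar>s\<bar> < R \<Longrightarrow> (y1 has_real_derivative (q s - m) * y s) (at s)"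
    and s: "\<bar>s\<bar> < R"
  shows "y s = sol (y 0) (y1 0) m s"
proof -
  have "continuous_on UNIV (\<lambda>s. q s - m)" by (intro continuous_intros continuous_on_q)
  then obtain K where K: "\<And>s. \<bar>s\<bar> \<le> R \<Longrightarrow> \<bar>q s - m\<bar> \<le> K"
    by (rule continuous_on_real_bound) (rule that)
  have "y s - sol (y 0) (y1 0) m s = 0"
  proof (rule linear_ode_unique_symmetric[of R "\<lambda>s. y s - sol (y 0) (y1 0) m s"
        "\<lambda>s. y1 s - sol1 (y 0) (y1 0) m s" "\<lambda>s. q s - m" K])
    fix t
    assume t: "\<bar>t\<bar> < R"
    show "((\<lambda>s. y s - sol (y 0) (y1 0) m s) has_real_derivative y1 t - sol1 (y 0) (y1 0) m t) (at t)"
      by (rule DERIV_diff[OF y(1)[OF t] sol_deriv])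
    show "((\<lambda>s. y1 s - sol1 (y 0) (y1 0) m s) has_real_derivative
        (q t - m) * (y t - sol (y 0) (y1 0) m t)) (at t)"
      using DERIV_diff[OF y(2)[OF t] sol1_deriv] by (simp add: right_diff_distrib)
    show "\<bar>q t - m\<bar> \<le> K" using K[of t] t by simp
  qed (use s sol_zero sol1_zero in auto)
  then show ?thesis by simp
qed

lemma sol_combine: "sol a b m s = a * sol 1 0 m s + b * sol 0 1 m s"
proof -
  define y y1 where "y = (\<lambda>s. a * sol 1 0 m s + b * sol 0 1 m s)"
    and "y1 = (\<lambda>s. a * sol1 1 0 m s + b * sol1 0 1 m s)"
  have "y s = sol (y 0) (y1 0) m s"
  proof (rule sol_unique)
    fix t
    show "(y has_real_derivative y1 t) (at t)"
      unfolding y_def y1_def by (intro DERIV_add DERIV_cmult sol_deriv)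
    have "(y1 has_real_derivative a * ((q t - m) * sol 1 0 m t) + b * ((q t - m) * sol 0 1 m t)) (at t)"
      unfolding y1_def by (intro DERIV_add DERIV_cmult sol1_deriv)
    then show "(y1 has_real_derivative (q t - m) * y t) (at t)" by (simp add: y_def algebra_simps)
  qed (rule less_add_one)
  then show ?thesis by (simp add: y_def y1_def sol_zero sol1_zero)
qed

lemma sol_reflect: "sol a b m (- s) = sol a (- b) m s"
proof -
  have deriv: "((\<lambda>s. sol a b m (- s)) has_real_derivative - sol1 a b m (- t)) (at t)"
    "((\<lambda>s. - sol1 a b m (- s)) has_real_derivative (q t - m) * sol a b m (- t)) (at t)" for t
    using DERIV_reflect[OF sol_deriv[of a b m "- t"]]
      DERIV_minus[OF DERIV_reflect[OF sol1_deriv[of a b m "- t"]]] by (simp_all add: q_even)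
  have "sol a b m (- s) = sol (sol a b m (- 0)) (- sol1 a b m (- 0)) m s"
    by (rule sol_unique[OF deriv less_add_one])
  then show ?thesis by (simp add: sol_zero sol1_zero)
qed

lemma sol_parity: "sol 1 0 m (- s) = sol 1 0 m s" "sol 0 1 m (- s) = - sol 0 1 m s"
  using sol_reflect[of 1 0 m s] sol_reflect[of 0 1 m s] sol_combine[of 0 "- 1" m s] by simp_all

lemma wronskian_eq_1: "sol 1 0 m s * sol1 0 1 m s - sol1 1 0 m s * sol 0 1 m s = 1"
proof -
  define W where "W = (\<lambda>s. sol 1 0 m s * sol1 0 1 m s - sol1 1 0 m s * sol 0 1 m s)"
  have "(W has_real_derivative 0) (at t)" for t
    unfolding W_def
    by (rule DERIV_cong[OF DERIV_diff[OF DERIV_mult[OF sol_deriv sol1_deriv] DERIV_mult[OF sol1_deriv sol_deriv]]]) simp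
  then have "W s = W 0" by (intro DERIV_isconst_all allI)
  then show ?thesis by (simp add: W_def sol_zero sol1_zero)
qed

lemma sol_lipschitz_parameter:
  obtains C where "C \<ge> 0" "\<And>m s. \<bar>m - n\<bar> \<le> 1 \<Longrightarrow> s \<in> {0..D} \<Longrightarrow>
    (sol c0 c1 m s - sol c0 c1 n s)\<^sup>2 + (sol1 c0 c1 m s - sol1 c0 c1 n s)\<^sup>2 \<le> (C * \<bar>m - n\<bar>)\<^sup>2"
proof -
  obtain K where K: "K \<ge> 1" "\<And>s. \<bar>s\<bar> \<le> D + 1 \<Longrightarrow> \<bar>q s\<bar> \<le> K"
    by (rule continuous_on_real_bound[OF continuous_on_q]) (rule that)
  obtain B where B: "B \<ge> 1" "\<And>s. \<bar>s\<bar> \<le> D + 1 \<Longrightarrow> \<bar>sol c0 c1 n s\<bar> \<le> B"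
    by (rule continuous_on_real_bound[OF continuous_on_sol]) (rule that)
  define L where "L = 2 + (K + \<bar>n\<bar> + 1)"
  have L: "L \<ge> 0" using K by (simp add: L_def)
  show ?thesis
  proof (rule that)
    show "B * exp (L * D) \<ge> 0" using B by simp
    fix m s
    assume m: "\<bar>m - n\<bar> \<le> 1" and s: "s \<in> {0..D}"
    define e where "e = \<bar>m - n\<bar> * B"
    have "(sol c0 c1 m s - sol c0 c1 n s)\<^sup>2 + (sol1 c0 c1 m s - sol1 c0 c1 n s)\<^sup>2
        \<le> ((sol c0 c1 m 0 - sol c0 c1 n 0)\<^sup>2 + (sol1 c0 c1 m 0 - sol1 c0 c1 n 0)\<^sup>2 + e\<^sup>2) * exp (L * s)"
      unfolding L_def
    proof (rule energy_estimate[where R = "D + 1" and p = "\<lambda>s. q s - m"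
      and r = "\<lambda>s. (n - m) * sol c0 c1 n s"])
      fix t :: real
      assume t: "0 \<le> t" "t < D + 1"
      show "((\<lambda>a. sol c0 c1 m a - sol c0 c1 n a) has_real_derivative sol1 c0 c1 m t - sol1 c0 c1 n t) (at t)"
        by (intro DERIV_diff sol_deriv)
      show "((\<lambda>a. sol1 c0 c1 m a - sol1 c0 c1 n a) has_real_derivative
          (q t - m) * (sol c0 c1 m t - sol c0 c1 n t) + (n - m) * sol c0 c1 n t) (at t)"
        using DERIV_diff[OF sol1_deriv[of c0 c1 m t] sol1_deriv[of c0 c1 n t]] by (simp add: algebra_simps)
      show "\<bar>q t - m\<bar> \<le> K + \<bar>n\<bar> + 1" using K(2)[of t] t m by simp
      show "\<bar>(n - m) * sol c0 c1 n t\<bar> \<le> e"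
        unfolding e_def abs_mult abs_minus_commute[of n m] using B(2)[of t] t by (intro mult_left_mono) auto
    qed (use s in auto)
    also have "\<dots> = e\<^sup>2 * exp (L * s)" by (simp add: sol_zero sol1_zero)
    also have "\<dots> \<le> e\<^sup>2 * (exp (L * D))\<^sup>2"
    proof (rule mult_left_mono)
      have "exp (L * s) * 1 \<le> exp (L * D) * exp (L * D)"
        using s L D_pos by (intro mult_mono) (auto simp: mult_left_mono)
      then show "exp (L * s) \<le> (exp (L * D))\<^sup>2" by (simp add: power2_eq_square)
    qed simp
    also have "\<dots> = (B * exp (L * D) * \<bar>m - n\<bar>)\<^sup>2" by (simp add: e_def power_mult_distrib)
    finally show "(sol c0 c1 m s - sol c0 c1 n s)\<^sup>2 + (sol1 c0 c1 m s - sol1 c0 c1 n s)\<^sup>2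
        \<le> (B * exp (L * D) * \<bar>m - n\<bar>)\<^sup>2" .
  qed
qed

lemma
  shows uniform_limit_sol: "uniform_limit {0..D} (sol c0 c1) (sol c0 c1 n) (nhds n)"
    and uniform_limit_sol1: "uniform_limit {0..D} (sol1 c0 c1) (sol1 c0 c1 n) (nhds n)"
proof -
  obtain C where C: "C \<ge> 0" "\<And>m s. \<bar>m - n\<bar> \<le> 1 \<Longrightarrow> s \<in> {0..D} \<Longrightarrow>
    (sol c0 c1 m s - sol c0 c1 n s)\<^sup>2 + (sol1 c0 c1 m s - sol1 c0 c1 n s)\<^sup>2 \<le> (C * \<bar>m - n\<bar>)\<^sup>2"
    by (rule sol_lipschitz_parameter) (rule that)
  have root: "\<bar>x\<bar> \<le> C * \<bar>t\<bar>" "\<bar>y\<bar> \<le> C * \<bar>t\<bar>" if "x\<^sup>2 + y\<^sup>2 \<le> (C * \<bar>t\<bar>)\<^sup>2" for x y t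
  proof -
    have "\<bar>x\<bar>\<^sup>2 \<le> (C * \<bar>t\<bar>)\<^sup>2" "\<bar>y\<bar>\<^sup>2 \<le> (C * \<bar>t\<bar>)\<^sup>2"
      using that zero_le_power2[of x] zero_le_power2[of y] unfolding power2_abs by linarith+
    then show "\<bar>x\<bar> \<le> C * \<bar>t\<bar>" "\<bar>y\<bar> \<le> C * \<bar>t\<bar>" using C(1) by (auto intro: power2_le_imp_le)
  qed
  show "uniform_limit {0..D} (sol c0 c1) (sol c0 c1 n) (nhds n)"
    by (rule uniform_limit_of_lipschitz_parameter) (rule root(1)[OF C(2)])
  show "uniform_limit {0..D} (sol1 c0 c1) (sol1 c0 c1 n) (nhds n)"
    by (rule uniform_limit_of_lipschitz_parameter) (rule root(2)[OF C(2)])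
qed

lemma initially_positive:
  assumes "(c0, c1) = (1, 0) \<or> (c0, c1) = (0, 1)"
  shows "\<exists>r>0. \<forall>\<^sub>F m in nhds n. \<forall>s\<in>{0<..r}. sol c0 c1 m s > 0"
  using assms
proof
  assume "(c0, c1) = (1, 0)"
  then obtain r where "r > 0" "\<forall>\<^sub>F m in nhds n. \<forall>s\<in>{0..r}. sol c0 c1 m s > 0"
    using positive_near_zero[OF D_pos uniform_limit_sol DERIV_isCont[OF sol_deriv], of c0 c1 n]
    by (auto simp: sol_zero)
  then show ?thesis by (auto elim!: eventually_mono intro!: exI[of _ r])
next
  assume c: "(c0, c1) = (0, 1)"
  then obtain r where r: "r > 0" "\<forall>\<^sub>F m in nhds n. \<forall>s\<in>{0..r}. sol1 c0 c1 m s > 0"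
    using positive_near_zero[OF D_pos uniform_limit_sol1 DERIV_isCont[OF sol1_deriv], of c0 c1 n]
    by (auto simp: sol1_zero)
  from r(2) have "\<forall>\<^sub>F m in nhds n. \<forall>s\<in>{0<..r}. sol c0 c1 m s > 0"
  proof eventually_elim
    case (elim m)
    have "sol c0 c1 m 0 < sol c0 c1 m s" if s: "s \<in> {0<..r}" for s
    proof (rule DERIV_pos_imp_increasing[of 0 s])
      show "\<exists>d. (sol c0 c1 m has_real_derivative d) (at t) \<and> d > 0" if "0 \<le> t" "t \<le> s" for t
        using sol_deriv elim that s by (intro exI[of _ "sol1 c0 c1 m t"]) auto
    qed (use s in simp)
    then show ?case using c by (simp add: sol_zero)
  qed
  then show ?thesis using r(1) by blast
qed

lemma sol_positive_of_low_parameter: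
  assumes c: "(c0, c1) = (1, 0) \<or> (c0, c1) = (0, 1)"
    and m: "\<And>t. 0 \<le> t \<Longrightarrow> t \<le> D \<Longrightarrow> m \<le> q t" and s: "s \<in> {0<..D}"
  shows "sol c0 c1 m s > 0"
proof (rule ccontr)
  assume neg: "\<not> sol c0 c1 m s > 0"
  let ?y = "sol c0 c1 m" and ?y1 = "sol1 c0 c1 m"
  have product_nonneg: "0 \<le> ?y t * ?y1 t" if t: "0 \<le> t" "t \<le> D" for t
  proof -
    have "?y 0 * ?y1 0 \<le> ?y t * ?y1 t"
    proof (rule DERIV_nonneg_imp_nondecreasing[OF t(1)])
      fix x
      assume x: "0 \<le> x" "x \<le> t"
      have "((\<lambda>t. ?y t * ?y1 t) has_real_derivative ?y1 x * ?y1 x + (q x - m) * ?y x * ?y x) (at x)"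
        by (rule DERIV_mult[OF sol_deriv sol1_deriv])
      moreover have "0 \<le> ?y1 x * ?y1 x + (q x - m) * ?y x * ?y x"
        using m[of x] x t
        unfolding mult.assoc by (intro add_nonneg_nonneg mult_nonneg_nonneg[of "q x - m"]) auto
      ultimately show "\<exists>d. ((\<lambda>t. ?y t * ?y1 t) has_real_derivative d) (at x) \<and> 0 \<le> d" by blast
    qed
    then show ?thesis using c by (auto simp: sol_zero sol1_zero)
  qed
  obtain r where r: "r > 0" "\<forall>s\<in>{0<..r}. ?y s > 0"
    using initially_positive[OF c, of m] by (auto dest: eventually_nhds_x_imp_x)
  define a where "a = min r s"
  have a: "0 < a" "a \<le> s" "?y a > 0" using r s by (auto simp: a_def)
  obtain t where t: "a \<le> t" "t \<le> s" "?y t = 0"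
    using IVT2'[of ?y s 0 a, OF _ _ a(2) continuous_on_sol] a neg by auto
  have "?y a * ?y a \<le> ?y t * ?y t"
  proof (rule DERIV_nonneg_imp_nondecreasing[OF t(1)])
    fix x
    assume "a \<le> x" "x \<le> t"
    then have "0 \<le> ?y1 x * ?y x + ?y1 x * ?y x" using product_nonneg[of x] a t s by (simp add: mult.commute)
    then show "\<exists>d. ((\<lambda>t. ?y t * ?y t) has_real_derivative d) (at x) \<and> 0 \<le> d"
      using DERIV_mult[OF sol_deriv sol_deriv] by blast
  qed
  then show False using a(3) t(3) mult_pos_pos[OF a(3) a(3)] by simp
qed

lemma first_zero_sol:
  assumes c: "(c0, c1) = (1, 0) \<or> (c0, c1) = (0, 1)" and s1: "s1 \<in> {0<..D}" "sol c0 c1 m1 s1 \<le> 0"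
  obtains m where "m \<le> m1" "sol c0 c1 m D = 0" "\<And>s. 0 < s \<Longrightarrow> s < D \<Longrightarrow> sol c0 c1 m s > 0"
proof -
  obtain K where K: "\<And>s. \<bar>s\<bar> \<le> D \<Longrightarrow> \<bar>q s\<bar> \<le> K"
    by (rule continuous_on_real_bound[OF continuous_on_q]) (rule that)
  show ?thesis
  proof (rule first_zero_parameter[of D "sol c0 c1" "sol1 c0 c1" "- K" s1 m1])
    show "sol1 c0 c1 m s \<noteq> 0" if "sol c0 c1 m s = 0" for m s
      using wronskian_eq_1[of m s] c that by auto
    show "sol c0 c1 m s > 0" if "m \<le> - K" "s \<in> {0<..D}" for m s
    proof (rule sol_positive_of_low_parameter[OF c _ that(2)])
      show "m \<le> q t" if "0 \<le> t" "t \<le> D" for t using K[of t] that \<open>m \<le> - K\<close> by (simp add: abs_le_iff)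
    qed
  qed (use D_pos sol_deriv uniform_limit_sol initially_positive[OF c] s1 that in auto)
qed

lemma dirichlet_eigenvalue_of_sol_zero:
  assumes zero: "sol c0 c1 m D = 0" "sol c0 c1 m (- D) = 0" and c: "c0 \<noteq> 0 \<or> c1 \<noteq> 0"
  shows "dirichlet_eigenvalue {-D<..<D} q m"
proof -
  let ?y = "sol c0 c1 m" and ?S = "{-D<..<D}"
  have hessian: "has_hessian_on ?S ?y (sol1 c0 c1 m) (\<lambda>x a. ((q x - m) * ?y x) * a)"
    unfolding has_hessian_on_def using sol_deriv[of c0 c1 m] sol1_deriv[of c0 c1 m]
    by (auto simp: has_field_derivative_def)
  have boundary: "frontier ?S = {-D, D}" using D_pos by (auto simp: frontier_def)
  show ?thesis
    unfolding dirichlet_eigenvalue_def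
  proof (intro exI[of _ ?y] conjI ballI)
    show "Ck_on 2 ?S ?y"
    proof (rule Ck2_of_has_hessian_on[OF open_greaterThanLessThan hessian])
      show "continuous_on ?S (\<lambda>x. ((q x - m) * ?y x * b) \<bullet> c)" for b c :: real
        unfolding inner_real_def
        by (intro continuous_intros continuous_on_subset[OF continuous_on_q] continuous_on_sol) auto
    qed
    show "?y x = 0" if "x \<in> frontier ?S" for x using that zero by (auto simp: boundary)
    show "- laplacian ?y x + q x * ?y x = m * ?y x" if "x \<in> ?S" for x
      using laplacian_has_hessian_on[OF open_greaterThanLessThan hessian that]
      by (simp add: trace_op_def algebra_simps)
    show "\<exists>x\<in>?S. ?y x \<noteq> 0"
    proof (rule ccontr)
      assume "\<not> ?thesis"
      then have vanishes: "?y x = 0" if "x \<in> ?S" for x using that by blast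
      have zero_in: "0 \<in> ?S" using D_pos by simp
      have "((\<lambda>x. 0) has_real_derivative sol1 c0 c1 m 0) (at 0)"
        by (rule has_field_derivative_transform_within_open[OF sol_deriv open_greaterThanLessThan zero_in vanishes])
      then have "sol1 c0 c1 m 0 = 0" using DERIV_unique[OF _ DERIV_const] by blast
      then show False using c vanishes[OF zero_in] by (simp add: sol_zero sol1_zero)
    qed
  qed (rule continuous_on_sol)
qed

lemma sol_zero_of_dirichlet_eigenvalue:
  assumes "dirichlet_eigenvalue {-D<..<D} q m"
  shows "sol 1 0 m D = 0 \<or> sol 0 1 m D = 0"
proof -
  let ?S = "{-D<..<D}"
  have boundary: "frontier ?S = {-D, D}" "closure ?S = {-D..D}" using D_pos by (auto simp: frontier_def)
  obtain u where u: "Ck_on 2 ?S u" "continuous_on (closure ?S) u" "\<forall>x\<in>frontier ?S. u x = 0" "\<exists>x\<in>?S. u x \<noteq> 0"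
      "\<forall>x\<in>?S. - laplacian u x + q x * u x = m * u x"
    using assms unfolding dirichlet_eigenvalue_def by blast
  note hessian = Ck2_has_hessian_on[OF u(1)]
  define u1 where "u1 = grad u"
  have in_S: "s \<in> ?S" if "\<bar>s\<bar> < D" for s using that by auto
  have deriv: "(u has_real_derivative u1 s) (at s)" if "\<bar>s\<bar> < D" for s
    using has_hessian_onD(1)[OF hessian in_S[OF that]]
    by (simp add: u1_def has_field_derivative_def inner_real_def)
  have deriv1: "(u1 has_real_derivative (q s - m) * u s) (at s)" if s: "\<bar>s\<bar> < D" for s
  proof -
    have "hess u s v = hess u s 1 * v" for v
      using linear_scale[OF has_hessian_onD(3)[OF hessian in_S[OF s]], of v 1] by (simp add: mult.commute)
    moreover have "hess u s 1 = (q s - m) * u s"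
      using laplacian_has_hessian_on[OF open_greaterThanLessThan hessian in_S[OF s]] u(5) in_S[OF s]
      by (simp add: trace_op_def algebra_simps)
    ultimately have "hess u s = (*) ((q s - m) * u s)" by (simp add: fun_eq_iff)
    then show ?thesis
      using has_hessian_onD(2)[OF hessian in_S[OF s]] by (simp add: u1_def has_field_derivative_def)
  qed
  have expansion: "u s = u 0 * sol 1 0 m s + u1 0 * sol 0 1 m s" if "s \<in> ?S" for s
    using sol_unique[of D u u1 m s, OF deriv deriv1] that sol_combine[of "u 0" "u1 0" m s]
    by (simp add: abs_less_iff)
  have "continuous_on (closure ?S) (\<lambda>s. u s - (u 0 * sol 1 0 m s + u1 0 * sol 0 1 m s))"
    by (intro continuous_intros u(2) continuous_on_sol)
  from continuous_constant_on_closure[OF this right_minus_eq[THEN iffD2, OF expansion]]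
  have "u s - (u 0 * sol 1 0 m s + u1 0 * sol 0 1 m s) = 0" if "s \<in> closure ?S" for s
    using that by blast
  from this[of D] this[of "- D"]
  have "u 0 * sol 1 0 m D + u1 0 * sol 0 1 m D = 0" "u 0 * sol 1 0 m D - u1 0 * sol 0 1 m D = 0"
    using u(3) D_pos by (simp_all add: boundary sol_parity)
  then have "u 0 * sol 1 0 m D = 0" "u1 0 * sol 0 1 m D = 0" by linarith+
  moreover obtain x where "x \<in> ?S" "u x \<noteq> 0" using u(4) by blast
  then have "u 0 \<noteq> 0 \<or> u1 0 \<noteq> 0" using expansion[of x] by auto
  ultimately show ?thesis by auto
qed

end

locale one_dim_comparison =
  fixes D :: real and q :: "real \<Rightarrow> real" and m \<gamma> :: real
    and L L1 L2 w w1 w2 :: "real \<Rightarrow> real" and w_min w_max :: real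
  assumes L_deriv: "\<And>s. \<bar>s\<bar> \<le> D \<Longrightarrow> (L has_real_derivative L1 s) (at s)"
    and L1_deriv: "\<And>s. \<bar>s\<bar> \<le> D \<Longrightarrow> (L1 has_real_derivative L2 s) (at s)"
    and L_even: "\<And>s. L (- s) = L s" and L_riccati: "\<And>s. L2 s + (L1 s)\<^sup>2 = q s - m"
    and w_deriv: "\<And>s. \<bar>s\<bar> \<le> D \<Longrightarrow> (w has_real_derivative w1 s) (at s)"
    and w1_deriv: "\<And>s. \<bar>s\<bar> \<le> D \<Longrightarrow> (w1 has_real_derivative w2 s) (at s)"
    and w1_nonneg: "\<And>s. 0 \<le> s \<Longrightarrow> s < D \<Longrightarrow> w1 s \<ge> 0"
    and w_inequality: "\<And>s. 0 \<le> s \<Longrightarrow> s < D \<Longrightarrow> w2 s + 2 * L1 s * w1 s \<le> - \<gamma> * w s"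
    and w_ge_min: "\<And>s. 0 \<le> s \<Longrightarrow> s < D \<Longrightarrow> w_min \<le> w s"
    and w_le_max: "\<And>s. 0 \<le> s \<Longrightarrow> s < D \<Longrightarrow> w s \<le> w_max"
    and w_min_pos: "w_min > 0"

context even_potential
begin

context
  fixes m n h :: real
  assumes m_less_n: "m < n"
    and ground_pos: "\<And>s. 0 \<le> s \<Longrightarrow> s \<le> D \<Longrightarrow> sol 1 0 m s > 0"
    and excited_pos: "\<And>s. 0 \<le> s \<Longrightarrow> s \<le> D \<Longrightarrow> sol h 1 n s > 0"
    and flux_pos_at_D: "sol1 h 1 n D * sol 1 0 m D - sol h 1 n D * sol1 1 0 m D > 0"
begin

definition flux :: "real \<Rightarrow> real" where
  "flux s = sol1 h 1 n s * sol 1 0 m s - sol h 1 n s * sol1 1 0 m s"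

lemma flux_deriv: "(flux has_real_derivative (m - n) * (sol h 1 n s * sol 1 0 m s)) (at s)"
  unfolding flux_def
  by (rule DERIV_cong[OF DERIV_diff[OF DERIV_mult[OF sol1_deriv sol_deriv] DERIV_mult[OF sol_deriv sol1_deriv]]])
    (simp add: algebra_simps)

lemma flux_nonneg:
  assumes s: "0 \<le> s" "s \<le> D"
  shows "flux s \<ge> 0"
proof -
  have "flux D \<le> flux s"
  proof (rule DERIV_nonpos_imp_nonincreasing[OF s(2)])
    fix t
    assume "s \<le> t" "t \<le> D"
    then have "sol h 1 n t * sol 1 0 m t > 0" using s by (intro mult_pos_pos excited_pos ground_pos) auto
    then have "(m - n) * (sol h 1 n t * sol 1 0 m t) \<le> 0" using m_less_n by (intro mult_nonpos_nonneg) auto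
    then show "\<exists>d. (flux has_real_derivative d) (at t) \<and> d \<le> 0" using flux_deriv by blast
  qed
  then show ?thesis using flux_pos_at_D by (simp add: flux_def)
qed

lemma ground_pos_symmetric: "\<bar>s\<bar> \<le> D \<Longrightarrow> sol 1 0 m s > 0"
  using ground_pos[of "\<bar>s\<bar>"] sol_parity(1)[of m s] by (cases "s \<ge> 0") auto

lemma quotient_deriv:
  "\<bar>s\<bar> \<le> D \<Longrightarrow> ((\<lambda>s. sol h 1 n s / sol 1 0 m s) has_real_derivative flux s / (sol 1 0 m s)\<^sup>2) (at s)"
  using ground_pos_symmetric[of s] unfolding flux_def
  by (intro DERIV_cong[OF DERIV_divide[OF sol_deriv sol_deriv]]) (auto simp: power2_eq_square)

lemma quotient_flux_deriv:
  assumes "\<bar>s\<bar> \<le> D"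
  shows "((\<lambda>s. flux s / (sol 1 0 m s)\<^sup>2) has_real_derivative
    - (n - m) * (sol h 1 n s / sol 1 0 m s) - 2 * (sol1 1 0 m s / sol 1 0 m s) * (flux s / (sol 1 0 m s)\<^sup>2)) (at s)"
proof -
  have "((\<lambda>s. (sol 1 0 m s)\<^sup>2) has_real_derivative 2 * sol 1 0 m s * sol1 1 0 m s) (at s)"
    using DERIV_power[OF sol_deriv, of 1 0 m 2 s] by (simp add: mult_ac)
  then show ?thesis
    by (rule DERIV_cong[OF DERIV_divide[OF flux_deriv]])
      (use ground_pos_symmetric[OF assms] in \<open>simp_all add: power2_eq_square field_simps\<close>)
qed

lemma log_ground_deriv:
  assumes "\<bar>s\<bar> \<le> D"
  shows "((\<lambda>s. ln (sol 1 0 m s)) has_real_derivative sol1 1 0 m s / sol 1 0 m s) (at s)"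
    and "((\<lambda>s. sol1 1 0 m s / sol 1 0 m s) has_real_derivative (q s - m) - (sol1 1 0 m s / sol 1 0 m s)\<^sup>2) (at s)"
proof -
  note pos = ground_pos_symmetric[OF assms]
  show "((\<lambda>s. ln (sol 1 0 m s)) has_real_derivative sol1 1 0 m s / sol 1 0 m s) (at s)"
    using DERIV_chain2[OF DERIV_ln[OF pos] sol_deriv] by (simp add: field_simps)
  show "((\<lambda>s. sol1 1 0 m s / sol 1 0 m s) has_real_derivative (q s - m) - (sol1 1 0 m s / sol 1 0 m s)\<^sup>2) (at s)"
    by (rule DERIV_cong[OF DERIV_divide[OF sol1_deriv sol_deriv]])
      (use pos in \<open>auto simp: power2_eq_square field_simps\<close>)
qed

lemma one_dim_comparison_of_flux:
  obtains L L1 L2 w w1 w2 w_min w_max where "one_dim_comparison D q m (n - m) L L1 L2 w w1 w2 w_min w_max"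
proof -
  let ?w = "\<lambda>s. sol h 1 n s / sol 1 0 m s"
  have "continuous_on {0..D} ?w"
    by (intro continuous_at_imp_continuous_on ballI DERIV_isCont[OF quotient_deriv]) auto
  then obtain a b where a: "a \<in> {0..D}" "\<forall>s\<in>{0..D}. ?w a \<le> ?w s" and b: "\<forall>s\<in>{0..D}. ?w s \<le> ?w b"
    using continuous_attains_inf[OF compact_Icc, of 0 D ?w] continuous_attains_sup[OF compact_Icc, of 0 D ?w]
      D_pos by auto
  have "?w a > 0" using a(1) by (intro divide_pos_pos excited_pos ground_pos) auto
  have "one_dim_comparison D q m (n - m) (\<lambda>s. ln (sol 1 0 m s)) (\<lambda>s. sol1 1 0 m s / sol 1 0 m s)
    (\<lambda>s. (q s - m) - (sol1 1 0 m s / sol 1 0 m s)\<^sup>2) ?w (\<lambda>s. flux s / (sol 1 0 m s)\<^sup>2)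
    (\<lambda>s. - (n - m) * ?w s - 2 * (sol1 1 0 m s / sol 1 0 m s) * (flux s / (sol 1 0 m s)\<^sup>2)) (?w a) (?w b)"
    by unfold_locales
      (use log_ground_deriv quotient_deriv quotient_flux_deriv flux_nonneg a b \<open>?w a > 0\<close> in \<open>simp_all add: sol_parity\<close>)
  then show ?thesis by (rule that)
qed

end

context
  fixes l1 l2 :: real
  assumes eigenvalues: "first_two_dirichlet_eigenvalues {-D<..<D} q l1 l2"
begin

lemma eigenvalue_unfolded:
  "dirichlet_eigenvalue {-D<..<D} q l1" "dirichlet_eigenvalue {-D<..<D} q k \<Longrightarrow> l1 \<le> k" "l1 < l2"
  "dirichlet_eigenvalue {-D<..<D} q k \<Longrightarrow> l1 < k \<Longrightarrow> l2 \<le> k"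
  using eigenvalues unfolding first_two_dirichlet_eigenvalues_def by blast+

lemma even_sol_pos_below:
  assumes m: "m < l1" and s: "0 \<le> s" "s \<le> D"
  shows "sol 1 0 m s > 0"
proof (rule ccontr)
  assume "\<not> ?thesis"
  moreover from this have "s \<noteq> 0" using sol_zero[of 1 0 m] by auto
  ultimately obtain k where k: "k \<le> m" "sol 1 0 k D = 0"
    using first_zero_sol[of 1 0 s m] s by (auto simp: not_less)
  then have "l1 \<le> k"
    by (intro eigenvalue_unfolded(2) dirichlet_eigenvalue_of_sol_zero[of 1 0]) (auto simp: sol_parity)
  then show False using k m by simp
qed

lemma sol_tendsto:
  "s \<in> {0..D} \<Longrightarrow> ((\<lambda>m. sol c0 c1 m s) \<longlongrightarrow> sol c0 c1 n s) (at_left n)"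
  "s \<in> {0..D} \<Longrightarrow> ((\<lambda>m. sol1 c0 c1 m s) \<longlongrightarrow> sol1 c0 c1 n s) (at_left n)"
  by (rule tendsto_mono[OF _ tendsto_uniform_limitI[OF uniform_limit_sol]], simp_all add: at_within_def)
    (rule tendsto_mono[OF _ tendsto_uniform_limitI[OF uniform_limit_sol1]], simp_all add: at_within_def)

lemma even_sol_end_nonneg: "sol 1 0 l1 D \<ge> 0"
proof (rule tendsto_lowerbound[OF sol_tendsto(1)])
  show "\<forall>\<^sub>F m in at_left l1. 0 \<le> sol 1 0 m D"
    using even_sol_pos_below D_pos by (auto simp: eventually_at_filter less_imp_le)
qed (use D_pos in auto)

lemma odd_sol_pos_below:
  assumes n: "n < l2" and s: "s \<in> {0<..D}"
  shows "sol 0 1 n s > 0"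
proof (rule ccontr)
  assume "\<not> ?thesis"
  then obtain k where k: "k \<le> n" "sol 0 1 k D = 0" "\<And>s. 0 < s \<Longrightarrow> s < D \<Longrightarrow> sol 0 1 k s > 0"
    using first_zero_sol[of 0 1 s n] s by (auto simp: not_less)
  have "dirichlet_eigenvalue {-D<..<D} q k"
    using k(2) by (intro dirichlet_eigenvalue_of_sol_zero[of 0 1]) (auto simp: sol_parity)
  then have "k = l1" using eigenvalue_unfolded(2,4)[of k] k(1) n by linarith
  have "sol1 0 1 k D \<le> 0"
  proof (rule ccontr)
    assume "\<not> ?thesis"
    then obtain d where d: "d > 0" "\<And>h. 0 < h \<Longrightarrow> h < d \<Longrightarrow> sol 0 1 k (D - h) < sol 0 1 k D"
      using DERIV_pos_inc_left[OF sol_deriv[of 0 1 k D]] by auto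
    define h where "h = min (d / 2) (D / 2)"
    have "0 < h" "h < d" "h < D" using d D_pos by (auto simp: h_def)
    then show False using d(2)[of h] k(3)[of "D - h"] k(2) by auto
  qed
  moreover have "sol 1 0 k D * sol1 0 1 k D = 1" using wronskian_eq_1[of k D] k(2) by simp
  ultimately show False
    using even_sol_end_nonneg \<open>k = l1\<close> mult_nonneg_nonpos[of "sol 1 0 k D" "sol1 0 1 k D"] by simp
qed

lemma even_sol_end: "sol 1 0 l1 D = 0" "sol1 1 0 l1 D < 0"
proof -
  have odd: "sol 0 1 l1 D > 0" using odd_sol_pos_below eigenvalue_unfolded(3) D_pos by simp
  then show zero: "sol 1 0 l1 D = 0" using sol_zero_of_dirichlet_eigenvalue[OF eigenvalue_unfolded(1)] by simp
  have "sol1 1 0 l1 D * sol 0 1 l1 D < 0" using wronskian_eq_1[of l1 D] zero by simp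
  then show "sol1 1 0 l1 D < 0" using odd by (simp add: mult_less_0_iff)
qed

lemma positive_combination_exists:
  assumes n: "n < l2"
  obtains h where "\<And>s. 0 \<le> s \<Longrightarrow> s \<le> D \<Longrightarrow> sol h 1 n s > 0"
proof -
  obtain r where r: "r > 0" "\<forall>s\<in>{0<..r}. sol 1 0 n s > 0"
    using initially_positive[of 1 0 n] by (auto dest: eventually_nhds_x_imp_x)
  have "min r D \<le> D" by simp
  then obtain t where t: "t \<in> {min r D..D}" "\<forall>s\<in>{min r D..D}. sol 0 1 n t \<le> sol 0 1 n s"
    using continuous_attains_inf[OF compact_Icc _ continuous_on_sol, of "min r D" D 0 1 n] by auto
  define c where "c = sol 0 1 n t"
  have "c > 0" unfolding c_def by (rule odd_sol_pos_below[OF n]) (use t r D_pos in auto)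
  obtain B where B: "B \<ge> 1" "\<And>s. \<bar>s\<bar> \<le> D \<Longrightarrow> \<bar>sol 1 0 n s\<bar> \<le> B"
    by (rule continuous_on_real_bound[OF continuous_on_sol]) (rule that)
  define h where "h = c / (B + 1)"
  have h: "h > 0" "h * B < c" using \<open>c > 0\<close> B(1) by (simp_all add: h_def field_simps)
  show ?thesis
  proof (rule that)
    fix s
    assume s: "0 \<le> s" "s \<le> D"
    have "h * sol 1 0 n s + sol 0 1 n s > 0"
    proof (cases "s \<le> r")
      case True
      have "sol 1 0 n s > 0" using r(2) s True sol_zero[of 1 0 n] by (cases "s = 0") auto
      moreover have "sol 0 1 n s \<ge> 0"
        using odd_sol_pos_below[OF n, of s] s sol_zero[of 0 1 n] by (cases "s = 0") auto
      ultimately show ?thesis using h(1) by (simp add: add_pos_nonneg)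
    next
      case False
      have "h * - sol 1 0 n s \<le> h * B" using B(2)[of s] s h(1) by (intro mult_left_mono) auto
      moreover have "c \<le> sol 0 1 n s" using t(2) s False by (auto simp: c_def)
      ultimately show ?thesis using h(2) by simp
    qed
    then show "sol h 1 n s > 0" using sol_combine[of h 1 n s] by simp
  qed
qed

lemma one_dim_comparison_exists:
  assumes e: "e > 0"
  obtains m n L L1 L2 w w1 w2 w_min w_max
  where "one_dim_comparison D q m (n - m) L L1 L2 w w1 w2 w_min w_max" "n - m \<ge> l2 - l1 - e"
proof -
  define n where "n = max ((l1 + l2) / 2) (l2 - e)"
  have n: "l1 < n" "n < l2" "n \<ge> l2 - e"
    using eigenvalue_unfolded(3) e by (auto simp: n_def less_max_iff_disj)
  obtain h where h: "\<And>s. 0 \<le> s \<Longrightarrow> s \<le> D \<Longrightarrow> sol h 1 n s > 0"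
    by (rule positive_combination_exists[OF n(2)]) (rule that)
  let ?flux_D = "\<lambda>m. sol1 h 1 n D * sol 1 0 m D - sol h 1 n D * sol1 1 0 m D"
  have "(?flux_D \<longlongrightarrow> ?flux_D l1) (at_left l1)"
    using D_pos by (intro tendsto_intros sol_tendsto) auto
  moreover have "?flux_D l1 > 0"
    using mult_pos_neg[OF h[of D] even_sol_end(2)] even_sol_end(1) D_pos by simp
  ultimately have "\<forall>\<^sub>F m in at_left l1. ?flux_D m > 0" by (rule order_tendstoD(1))
  moreover have "\<forall>\<^sub>F m in at_left l1. m < l1" by (simp add: eventually_at_filter)
  ultimately have "\<forall>\<^sub>F m in at_left l1. ?flux_D m > 0 \<and> m < l1" by eventually_elim simp
  then obtain m where m: "?flux_D m > 0" "m < l1"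
    using eventually_happens'[OF trivial_limit_at_left_real] by blast
  then have "m < n" using n(1) by simp
  then obtain L L1 L2 w w1 w2 w_min w_max where "one_dim_comparison D q m (n - m) L L1 L2 w w1 w2 w_min w_max"
    by (rule one_dim_comparison_of_flux[OF _ even_sol_pos_below[OF m(2)] h m(1)])
  then show ?thesis by (rule that) (use n(3) m(2) in simp)
qed

end

end

section \<open>The fundamental gap\<close>

lemma norm_le_of_entries:
  fixes A :: "'a::euclidean_space \<Rightarrow> 'a"
  assumes A: "linear A" and K: "\<And>b c. b \<in> Basis \<Longrightarrow> c \<in> Basis \<Longrightarrow> \<bar>A b \<bullet> c\<bar> \<le> K"
  shows "norm (A v) \<le> (real DIM('a) * (real DIM('a) * K)) * norm v"
proof -
  have entry: "\<bar>A v \<bullet> c\<bar> \<le> real DIM('a) * K * norm v" if c: "c \<in> Basis" for c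
  proof -
    have "A v = A (\<Sum>b\<in>Basis. (v \<bullet> b) *\<^sub>R b)" by (simp add: euclidean_representation)
    also have "\<dots> = (\<Sum>b\<in>Basis. (v \<bullet> b) *\<^sub>R A b)" by (simp add: linear_sum[OF A] linear_scale[OF A])
    finally have "A v \<bullet> c = (\<Sum>b\<in>Basis. (v \<bullet> b) * (A b \<bullet> c))" by (simp add: inner_sum_left)
    also have "\<bar>\<dots>\<bar> \<le> (\<Sum>b\<in>Basis. \<bar>(v \<bullet> b) * (A b \<bullet> c)\<bar>)" by (rule sum_abs)
    also have "\<dots> \<le> (\<Sum>b\<in>(Basis::'a set). norm v * K)"
      unfolding abs_mult using c by (intro sum_mono mult_mono Basis_le_norm K) auto
    finally show ?thesis by (simp add: mult_ac)
  qed
  have "norm (A v) \<le> (\<Sum>c\<in>Basis. \<bar>A v \<bullet> c\<bar>)" by (rule norm_le_l1)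
  also have "\<dots> \<le> (\<Sum>c\<in>(Basis::'a set). real DIM('a) * K * norm v)" by (intro sum_mono entry)
  finally show ?thesis by (simp add: mult_ac)
qed

lemma hess_bounded_on_compact:
  fixes V :: "'a::euclidean_space \<Rightarrow> real"
  assumes V: "Ck_on 2 U V" and K: "compact K" "K \<subseteq> U"
  obtains B where "\<And>x v. x \<in> K \<Longrightarrow> norm (hess V x v) \<le> B * norm v"
proof -
  have "\<exists>B. \<forall>x\<in>K. \<bar>hess V x b \<bullet> c\<bar> \<le> B" for b c
    using continuous_on_compact_bound[OF K(1) continuous_on_subset[OF Ck2_continuous_on_hess[OF V] K(2)]]
    by (metis real_norm_def)
  then obtain k where k: "\<And>b c x. x \<in> K \<Longrightarrow> \<bar>hess V x b \<bullet> c\<bar> \<le> k b c" by metis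
  define C where "C = (\<Sum>b\<in>(Basis::'a set). \<Sum>c\<in>(Basis::'a set). \<bar>k b c\<bar>)"
  have C: "\<bar>hess V x b \<bullet> c\<bar> \<le> C" if "x \<in> K" "b \<in> Basis" "c \<in> Basis" for x b c
  proof -
    have "\<bar>hess V x b \<bullet> c\<bar> \<le> \<bar>k b c\<bar>" using k[OF that(1), of b c] by linarith
    also have "\<dots> \<le> (\<Sum>c\<in>(Basis::'a set). \<bar>k b c\<bar>)" by (rule member_le_sum[OF that(3)]) auto
    also have "\<dots> \<le> C"
      unfolding C_def
      by (rule member_le_sum[OF that(2), of "\<lambda>b. \<Sum>c\<in>(Basis::'a set). \<bar>k b c\<bar>"]) (auto intro: sum_nonneg)
    finally show ?thesis .
  qed
  have "linear (hess V x)" if "x \<in> K" for x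
    by (rule has_hessian_onD(3)[OF Ck2_has_hessian_on[OF V]]) (use that K(2) in blast)
  then show ?thesis using that norm_le_of_entries C by blast
qed

lemma schroedinger_domain_of_smooth_on_closed:
  fixes Om :: "'a::euclidean_space set"
  assumes Om: "open Om" "convex Om" "bounded Om" "Om \<noteq> {}" and V: "smooth_on_closed (closure Om) V"
  obtains M where "schroedinger_domain Om V (grad V) M"
proof -
  obtain U where U: "closure Om \<subseteq> U" "Ck_on 2 U V" using V by (auto simp: smooth_on_closed_def C_inf_on_def)
  note hessian = Ck2_has_hessian_on[OF U(2)]
  have compact: "compact (closure Om)" using Om(3) by simp
  have Om_closure: "x \<in> closure Om" and Om_U: "x \<in> U" if "x \<in> Om" for x
    using that closure_subset U(1) by blast+
  obtain K1 where K1: "K1 \<ge> 0" "\<And>x. x \<in> closure Om \<Longrightarrow> norm (V x) \<le> K1"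
    by (rule continuous_on_compact_bound[OF compact continuous_on_subset[OF has_hessian_on_continuous_on(1)[OF hessian] U(1)]])
      (rule that)
  obtain K2 where K2: "K2 \<ge> 0" "\<And>x. x \<in> closure Om \<Longrightarrow> norm (grad V x) \<le> K2"
    by (rule continuous_on_compact_bound[OF compact continuous_on_subset[OF has_hessian_on_continuous_on(2)[OF hessian] U(1)]])
      (rule that)
  obtain B where B: "\<And>x v. x \<in> closure Om \<Longrightarrow> norm (hess V x v) \<le> B * norm v"
    by (rule hess_bounded_on_compact[OF U(2) compact U(1)]) (rule that)
  have lipschitz: "norm (grad V x - grad V y) \<le> B * norm (x - y)" if "x \<in> Om" "y \<in> Om" for x y
  proof (rule differentiable_bound[OF Om(2) _ _ that])
    fix x
    assume x: "x \<in> Om"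
    show "(grad V has_derivative hess V x) (at x within Om)"
      by (rule has_derivative_at_withinI[OF has_hessian_onD(2)[OF hessian Om_U[OF x]]])
    show "onorm (hess V x) \<le> B" by (rule onorm_le[OF B[OF Om_closure[OF x]]])
  qed
  have "schroedinger_domain Om V (grad V) (K1 + K2 + \<bar>B\<bar>)"
  proof
    fix x
    assume x: "x \<in> Om"
    show "(V has_derivative (\<bullet>) (grad V x)) (at x)" by (rule has_hessian_onD(1)[OF hessian Om_U[OF x]])
    show "\<bar>V x\<bar> \<le> K1 + K2 + \<bar>B\<bar>" "norm (grad V x) \<le> K1 + K2 + \<bar>B\<bar>"
      using K1(1) K1(2)[OF Om_closure[OF x]] K2(1) K2(2)[OF Om_closure[OF x]] by simp_all
    fix y
    assume y: "y \<in> Om"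
    have "B * norm (x - y) \<le> (K1 + K2 + \<bar>B\<bar>) * norm (x - y)" using K1(1) K2(1) by (intro mult_right_mono) auto
    then show "norm (grad V x - grad V y) \<le> (K1 + K2 + \<bar>B\<bar>) * norm (x - y)"
      using lipschitz[OF x y] by linarith
  qed (use Om in auto)
  then show ?thesis by (rule that)
qed

lemma (in schroedinger_domain) schroedinger_domain_add_square:
  assumes R: "\<And>x. x \<in> Om \<Longrightarrow> norm x \<le> R" and \<delta>: "\<delta> \<ge> 0"
  obtains M' where "schroedinger_domain Om (\<lambda>x. V x + \<delta> * (x \<bullet> x)) (\<lambda>x. gV x + (2 * \<delta>) *\<^sub>R x) M'"
proof -
  define M' where "M' = M + \<delta> * R\<^sup>2 + 2 * \<delta> * R + 2 * \<delta>"
  have "R \<ge> 0" using R Om_ne norm_ge_zero by (metis ex_in_conv order_trans)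
  then have nonneg: "\<delta> * R\<^sup>2 \<ge> 0" "2 * \<delta> * R \<ge> 0" using \<delta> by auto
  have "schroedinger_domain Om (\<lambda>x. V x + \<delta> * (x \<bullet> x)) (\<lambda>x. gV x + (2 * \<delta>) *\<^sub>R x) M'"
  proof
    fix x
    assume x: "x \<in> Om"
    have "((\<lambda>x. V x + \<delta> * (x \<bullet> x)) has_derivative (\<lambda>v. gV x \<bullet> v + \<delta> * (x \<bullet> v + v \<bullet> x))) (at x)"
      by (intro has_derivative_add V_deriv[OF x] has_derivative_mult_right has_derivative_inner has_derivative_ident)
    then show "((\<lambda>x. V x + \<delta> * (x \<bullet> x)) has_derivative (\<bullet>) (gV x + (2 * \<delta>) *\<^sub>R x)) (at x)"
      by (rule has_derivative_eq_rhs) (auto simp: fun_eq_iff inner_add_left inner_commute algebra_simps)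
    have "x \<bullet> x \<le> R\<^sup>2" using power_mono[OF R[OF x] norm_ge_zero, of 2] by (simp add: power2_norm_eq_inner)
    then have "\<delta> * (x \<bullet> x) \<le> \<delta> * R\<^sup>2" by (rule mult_left_mono[OF _ \<delta>])
    moreover have "0 \<le> \<delta> * (x \<bullet> x)" using \<delta> by simp
    ultimately show "\<bar>V x + \<delta> * (x \<bullet> x)\<bar> \<le> M'" using V_bound[OF x] nonneg \<delta> unfolding M'_def by linarith
    have "norm (gV x + (2 * \<delta>) *\<^sub>R x) \<le> norm (gV x) + 2 * \<delta> * norm x"
      using norm_triangle_ineq[of "gV x" "(2 * \<delta>) *\<^sub>R x"] \<delta> by simp
    moreover have "2 * \<delta> * norm x \<le> 2 * \<delta> * R" using R[OF x] \<delta> by (intro mult_left_mono) auto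
    ultimately show "norm (gV x + (2 * \<delta>) *\<^sub>R x) \<le> M'"
      using gV_bound[OF x] nonneg \<delta> unfolding M'_def by linarith
    fix y
    assume y: "y \<in> Om"
    have difference: "gV x + (2 * \<delta>) *\<^sub>R x - (gV y + (2 * \<delta>) *\<^sub>R y) = (gV x - gV y) + (2 * \<delta>) *\<^sub>R (x - y)"
      by (simp add: algebra_simps)
    have "norm (gV x + (2 * \<delta>) *\<^sub>R x - (gV y + (2 * \<delta>) *\<^sub>R y)) \<le> norm (gV x - gV y) + 2 * \<delta> * norm (x - y)"
      unfolding difference using norm_triangle_ineq[of "gV x - gV y" "(2 * \<delta>) *\<^sub>R (x - y)"] \<delta> by simp
    also have "\<dots> \<le> (M + 2 * \<delta>) * norm (x - y)" using gV_lipschitz[OF x y] by (simp add: distrib_right)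
    also have "\<dots> \<le> M' * norm (x - y)" using nonneg by (intro mult_right_mono) (auto simp: M'_def)
    finally show "norm (gV x + (2 * \<delta>) *\<^sub>R x - (gV y + (2 * \<delta>) *\<^sub>R y)) \<le> M' * norm (x - y)" .
  qed (rule open_Om convex_Om bounded_Om Om_ne)+
  then show ?thesis by (rule that)
qed

lemma ground_state_of_schroedinger_domain:
  assumes convex: "smooth_convex_domain Om rho gr Hr U" and domain: "schroedinger_domain Om V gV M"
  obtains u g H lam where "ground_state Om rho gr Hr U V M u g H lam" "\<And>b c. continuous_on Om (\<lambda>x. H x b \<bullet> c)"
proof -
  interpret smooth_convex_domain Om rho gr Hr U by (rule convex)
  interpret potential: schroedinger_domain Om V gV M by (rule domain)
  obtain u g H lam where u: "has_hessian_on Om u g H" "\<And>b c. continuous_on Om (\<lambda>x. H x b \<bullet> c)"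
    "\<And>x. x \<in> Om \<Longrightarrow> trace_op (H x) = (V x - lam) * u x"
    "\<And>x. x \<in> Om \<Longrightarrow> 0 \<le> u x" "\<And>x. x \<in> Om \<Longrightarrow> u x \<le> 1" "\<exists>x\<in>Om. u x = 1"
    "continuous_on (closure Om) u" "\<And>x. x \<in> frontier Om \<Longrightarrow> u x = 0"
    by (rule potential.ground_state_exists) (rule that)
  have pos: "u x > 0" if x: "x \<in> Om" for x
  proof (rule positive_of_nonneg_supersolution[OF open_Om u(1) _ _ u(4) convex_connected[OF convex_Om] _ x])
    show "0 \<le> M + \<bar>lam\<bar>" using potential.M_nonneg by simp
    show "trace_op (H y) \<le> (M + \<bar>lam\<bar>) * u y" if "y \<in> Om" for y
      unfolding u(3)[OF that]
      using potential.V_bound[OF that] u(4)[OF that] by (intro mult_right_mono) (auto simp: abs_le_iff)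
    show "\<exists>x\<in>Om. 0 < u x" using u(6) by force
  qed
  have "ground_state Om rho gr Hr U V M u g H lam"
    by (intro ground_state.intro convex ground_state_axioms.intro) (use potential.V_bound u pos in auto)
  then show ?thesis by (rule that) (rule u(2))
qed

context ground_state
begin

lemma dirichlet_eigenvalue_ground:
  assumes "\<And>b c. continuous_on Om (\<lambda>x. H x b \<bullet> c)"
  shows "dirichlet_eigenvalue Om V lam"
  unfolding dirichlet_eigenvalue_def
proof (intro exI[of _ u] conjI ballI)
  show "Ck_on 2 Om u" by (rule Ck2_of_has_hessian_on[OF open_Om has_hessian_on_u assms])
  show "\<exists>x\<in>Om. u x \<noteq> 0" using Om_ne u_pos by fastforce
  show "- laplacian u x + V x * u x = lam * u x" if "x \<in> Om" for x
    unfolding laplacian_has_hessian_on[OF open_Om has_hessian_on_u that] u_equation[OF that]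
    by (simp add: algebra_simps)
qed (use continuous_on_u u_zero in auto)

lemma eigenfunction_quotient:
  assumes eigenvalue: "dirichlet_eigenvalue Om V' \<mu>" and V': "\<And>x. x \<in> Om \<Longrightarrow> \<bar>V' x\<bar> \<le> M'"
  obtains v gv Hv B p where "has_hessian_on Om v gv Hv" "\<And>x. x \<in> Om \<Longrightarrow> \<bar>v x\<bar> \<le> B" "p \<in> Om" "v p \<noteq> 0"
    "\<And>x. x \<in> Om \<Longrightarrow> trace_op (Hv x) + 2 * (grad_log_u x \<bullet> gv x) = (V' x - V x + lam - \<mu>) * v x"
proof -
  obtain w p where w: "Ck_on 2 Om w" "continuous_on (closure Om) w" "\<And>x. x \<in> frontier Om \<Longrightarrow> w x = 0"
      "\<And>x. x \<in> Om \<Longrightarrow> - laplacian w x + V' x * w x = \<mu> * w x" and p: "p \<in> Om" "w p \<noteq> 0"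
    using eigenvalue unfolding dirichlet_eigenvalue_def by blast
  note hessian = Ck2_has_hessian_on[OF w(1)]
  have trace: "trace_op (hess w x) = (V' x - \<mu>) * w x" if "x \<in> Om" for x
    using w(4)[OF that] laplacian_has_hessian_on[OF open_Om hessian that] by (simp add: algebra_simps)
  obtain K where K: "K \<ge> 0" "\<And>x. x \<in> closure Om \<Longrightarrow> norm (w x) \<le> K"
    by (rule continuous_on_compact_bound[OF compact_closure_Om w(2)]) (rule that)
  have "\<bar>trace_op (hess w x)\<bar> \<le> (M' + \<bar>\<mu>\<bar>) * K" if x: "x \<in> Om" for x
  proof -
    have "\<bar>V' x - \<mu>\<bar> \<le> M' + \<bar>\<mu>\<bar>" using V'[OF x] by linarith
    then show ?thesis unfolding trace[OF x] abs_mult using K(2)[OF Om_closure[OF x]] by (intro mult_mono) auto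
  qed
  then obtain B where B: "\<And>x. x \<in> Om \<Longrightarrow> \<bar>w x\<bar> \<le> B * u x"
    using quotient_bounded[OF hessian w(2,3)] by blast
  obtain gv Hv where v: "has_hessian_on Om (\<lambda>x. w x * inverse (u x)) gv Hv"
    "\<And>x. x \<in> Om \<Longrightarrow> trace_op (Hv x) + 2 * (grad_log_u x \<bullet> gv x) = trace_op (hess w x) * inverse (u x) - (V x - lam) * (w x * inverse (u x))"
    by (rule quotient_operator[OF hessian]) (rule that)
  show ?thesis
  proof (rule that[OF v(1) _ p(1)])
    show "w p * inverse (u p) \<noteq> 0" using p u_pos[OF p(1)] by simp
    fix x
    assume x: "x \<in> Om"
    show "\<bar>w x * inverse (u x)\<bar> \<le> B"
      using B[OF x] u_pos[OF x] by (simp add: abs_mult divide_inverse[symmetric] pos_divide_le_eq)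
    show "trace_op (Hv x) + 2 * (grad_log_u x \<bullet> gv x) = (V' x - V x + lam - \<mu>) * (w x * inverse (u x))"
      unfolding v(2)[OF x] trace[OF x] by (simp add: algebra_simps)
  qed
qed

lemma drift_equation_minus:
  assumes "\<And>x. x \<in> Om \<Longrightarrow> trace_op (Hv x) + 2 * (grad_log_u x \<bullet> gv x) = a x * v x" and "x \<in> Om"
  shows "trace_op (\<lambda>b. (- 1) *\<^sub>R Hv x b) + 2 * (grad_log_u x \<bullet> ((- 1) *\<^sub>R gv x)) = a x * ((- 1) * v x)"
  using assms(1)[OF assms(2)] unfolding trace_op_simps(2) by (simp add: algebra_simps)

lemma ground_eigenvalue_le:
  assumes eigenvalue: "dirichlet_eigenvalue Om V' \<mu>" and V': "\<And>x. x \<in> Om \<Longrightarrow> \<bar>V' x\<bar> \<le> M'"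
    and perturbation: "\<And>x. x \<in> Om \<Longrightarrow> V x \<le> V' x + \<delta>"
  shows "lam \<le> \<mu> + \<delta>"
proof (rule ccontr)
  assume "\<not> lam \<le> \<mu> + \<delta>"
  then have rate_pos: "lam - \<mu> - \<delta> > 0" by simp
  have rate: "lam - \<mu> - \<delta> \<le> V' x - V x + lam - \<mu>" if "x \<in> Om" for x using perturbation[OF that] by simp
  obtain v gv Hv B p where v: "has_hessian_on Om v gv Hv" and B: "\<And>x. x \<in> Om \<Longrightarrow> \<bar>v x\<bar> \<le> B"
    and p: "p \<in> Om" "v p \<noteq> 0"
    and equation: "\<And>x. x \<in> Om \<Longrightarrow> trace_op (Hv x) + 2 * (grad_log_u x \<bullet> gv x) = (V' x - V x + lam - \<mu>) * v x"
    by (rule eigenfunction_quotient[OF eigenvalue V']) (assumption | rule that)+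
  have "v p \<le> 0"
    by (rule drift_subsolution_nonpos[OF v _ equation rate_pos rate p(1), of B]) (use B in \<open>auto simp: abs_le_iff\<close>)
  moreover have "(- 1) * v p \<le> 0"
    by (rule drift_subsolution_nonpos[OF has_hessian_on_cmult[OF v] _ drift_equation_minus[OF equation] rate_pos rate p(1), of B])
      (use B in \<open>auto simp: abs_le_iff\<close>)
  ultimately show False using p(2) by simp
qed

lemma gap_le_of_dirichlet_eigenvalue:
  assumes modulus: "\<And>x y. x \<in> Om \<Longrightarrow> y \<in> Om \<Longrightarrow> (grad_log_u y - grad_log_u x) \<bullet> (y - x) \<le> 2 * L1 (norm (y - x) / 2) * norm (y - x)"
    and diam: "\<And>x y. x \<in> Om \<Longrightarrow> y \<in> Om \<Longrightarrow> norm (y - x) < 2 * D"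
    and comparison: "one_dim_comparison D q m \<gamma> L L1 L2 w w1 w2 w_min w_max"
    and eigenvalue: "dirichlet_eigenvalue Om V' \<mu>" and V': "\<And>x. x \<in> Om \<Longrightarrow> \<bar>V' x\<bar> \<le> M'"
    and perturbation: "\<And>x. x \<in> Om \<Longrightarrow> V' x \<le> V x" "\<And>x. x \<in> Om \<Longrightarrow> V x \<le> V' x + \<delta>" and gap: "lam < \<mu>"
  shows "\<gamma> \<le> \<mu> - lam + 2 * \<delta> * w_max / w_min"
proof -
  interpret one_dim_comparison D q m \<gamma> L L1 L2 w w1 w2 w_min w_max by (rule comparison)
  obtain v gv Hv B p where v: "has_hessian_on Om v gv Hv" and B: "\<And>x. x \<in> Om \<Longrightarrow> \<bar>v x\<bar> \<le> B"
    and p: "p \<in> Om" "v p \<noteq> 0"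
    and equation: "\<And>x. x \<in> Om \<Longrightarrow> trace_op (Hv x) + 2 * (grad_log_u x \<bullet> gv x) = (V' x - V x + lam - \<mu>) * v x"
    by (rule eigenfunction_quotient[OF eigenvalue V']) (assumption | rule that)+
  have rate_pos: "\<mu> - lam > 0" using gap by simp
  have rate: "V' x - V x + lam - \<mu> \<le> - (\<mu> - lam)" if "x \<in> Om" for x using perturbation(1)[OF that] by simp
  have below: "\<exists>x\<in>Om. v x < r" if "r > 0" for r
    by (rule drift_solution_not_bounded_below[OF v equation rate_pos rate that])
  have above: "\<exists>x\<in>Om. v x > - r" if "r > 0" for r
    using drift_solution_not_bounded_below[OF has_hessian_on_cmult[OF v] drift_equation_minus[OF equation] rate_pos rate that]
    by force
  show ?thesis
  proof (rule gap_comparison[OF modulus diam w_deriv w1_deriv w1_nonneg w_inequality v B _ _ w_ge_min w_le_max w_min_pos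
        less_imp_le[OF rate_pos] below above p])
    show "trace_op (Hv x) + 2 * (grad_log_u x \<bullet> gv x) = - (\<mu> - lam + (V x - V' x)) * v x" if "x \<in> Om" for x
      unfolding equation[OF that] by (simp add: algebra_simps)
    show "\<bar>V x - V' x\<bar> \<le> \<delta>" if "x \<in> Om" for x using perturbation[OF that] by simp
  qed
qed

end

lemma convex_add_square_strict:
  fixes x y :: "'a::real_inner"
  assumes V: "convex_on S V" and xy: "x \<in> S" "y \<in> S" "x \<noteq> y" and \<delta>: "\<delta> > 0"
  shows "2 * (V ((1/2) *\<^sub>R (x + y)) + \<delta> * (((1/2) *\<^sub>R (x + y)) \<bullet> ((1/2) *\<^sub>R (x + y)))) <
    V x + \<delta> * (x \<bullet> x) + (V y + \<delta> * (y \<bullet> y))"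
proof -
  have "V ((1 - 1/2) *\<^sub>R x + (1/2) *\<^sub>R y) \<le> (1 - 1/2) * V x + (1/2) * V y"
    by (rule convex_onD[OF V]) (use xy in auto)
  then have "2 * V ((1/2) *\<^sub>R (x + y)) \<le> V x + V y" by (simp add: scaleR_add_right)
  moreover have "(x - y) \<bullet> (x - y) > 0" using xy(3) by simp
  then have "2 * (((1/2) *\<^sub>R (x + y)) \<bullet> ((1/2) *\<^sub>R (x + y))) < x \<bullet> x + y \<bullet> y"
    by (simp add: inner_add_left inner_add_right inner_diff_left inner_diff_right inner_commute[of y x] field_simps)
  then have "\<delta> * (2 * (((1/2) *\<^sub>R (x + y)) \<bullet> ((1/2) *\<^sub>R (x + y)))) < \<delta> * (x \<bullet> x + y \<bullet> y)"
    by (rule mult_strict_left_mono[OF _ \<delta>])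
  ultimately show ?thesis unfolding distrib_left by linarith
qed

lemma four_point_square:
  fixes a z :: "'a::real_inner"
  shows "(a + z) \<bullet> (a + z) + (a - z) \<bullet> (a - z) - (a + s *\<^sub>R z) \<bullet> (a + s *\<^sub>R z) - (a - s *\<^sub>R z) \<bullet> (a - s *\<^sub>R z)
    = 2 * ((1 - s\<^sup>2) * (z \<bullet> z))"
  by (simp add: inner_add_left inner_add_right inner_diff_left inner_diff_right algebra_simps power2_eq_square)

definition four_point_modulus :: "'a::real_normed_vector set \<Rightarrow> ('a \<Rightarrow> real) \<Rightarrow> (real \<Rightarrow> real) \<Rightarrow> bool" where
  "four_point_modulus S V q \<longleftrightarrow> (\<forall>a z s. a + z \<in> S \<longrightarrow> a - z \<in> S \<longrightarrow> z \<noteq> 0 \<longrightarrow> 0 \<le> s \<longrightarrow> s < 1 \<longrightarrow>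
    2 * (q (norm z) - q (s * norm z)) \<le> V (a + z) + V (a - z) - V (a + s *\<^sub>R z) - V (a - s *\<^sub>R z))"

lemma four_point_modulus_add_square_strict:
  fixes V :: "'a::real_inner \<Rightarrow> real"
  assumes V: "four_point_modulus S V q" and z: "a + z \<in> S" "a - z \<in> S" "z \<noteq> 0" "0 \<le> s" "s < 1" and \<delta>: "\<delta> > 0"
  shows "2 * (q (norm z) - q (s * norm z)) < V (a + z) + \<delta> * ((a + z) \<bullet> (a + z)) + (V (a - z) + \<delta> * ((a - z) \<bullet> (a - z)))
    - (V (a + s *\<^sub>R z) + \<delta> * ((a + s *\<^sub>R z) \<bullet> (a + s *\<^sub>R z))) - (V (a - s *\<^sub>R z) + \<delta> * ((a - s *\<^sub>R z) \<bullet> (a - s *\<^sub>R z)))"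
proof -
  have "s\<^sup>2 < 1" using z(4,5) by (simp add: abs_square_less_1)
  then have "0 < \<delta> * (2 * ((1 - s\<^sup>2) * (z \<bullet> z)))" using z(3) \<delta> by simp
  then have "0 < \<delta> * ((a + z) \<bullet> (a + z) + (a - z) \<bullet> (a - z) - (a + s *\<^sub>R z) \<bullet> (a + s *\<^sub>R z) - (a - s *\<^sub>R z) \<bullet> (a - s *\<^sub>R z))"
    unfolding four_point_square .
  moreover have "2 * (q (norm z) - q (s * norm z)) \<le> V (a + z) + V (a - z) - V (a + s *\<^sub>R z) - V (a - s *\<^sub>R z)"
    using V z unfolding four_point_modulus_def by blast
  ultimately show ?thesis unfolding right_diff_distrib distrib_left by linarith
qed

lemma open_norm_less_diameter:
  fixes S :: "'a::euclidean_space set"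
  assumes S: "open S" "bounded S" and xy: "x \<in> S" "y \<in> S"
  shows "norm (y - x) < diameter S"
proof -
  obtain b :: 'a where b: "b \<in> Basis" using nonempty_Basis by blast
  define e where "e = (if x = y then b else sgn (y - x))"
  have extend: "norm (y - x + t *\<^sub>R e) = norm (y - x) + t" if "t > 0" for t
  proof (cases "x = y")
    case True then show ?thesis using b that by (simp add: e_def)
  next
    case False
    then have n: "norm (y - x) > 0" by simp
    have "norm (y - x) *\<^sub>R sgn (y - x) = y - x" using False by (simp add: sgn_div_norm)
    then have "y - x + t *\<^sub>R e = (norm (y - x) + t) *\<^sub>R sgn (y - x)"
      using False by (simp add: e_def scaleR_add_left)
    then show ?thesis using n that False by (simp add: norm_sgn)
  qed
  have norm_e: "norm e = 1" using b by (simp add: e_def norm_sgn)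
  obtain r where r: "r > 0" "ball y r \<subseteq> S" using S(1) xy(2) open_contains_ball by blast
  have "y + (r / 2) *\<^sub>R e \<in> S" using r norm_e by (intro subsetD[OF r(2)]) (simp add: dist_norm)
  from diameter_bounded_bound[OF S(2) this xy(1)] have "norm (y + (r / 2) *\<^sub>R e - x) \<le> diameter S"
    by (simp add: dist_norm)
  moreover have "y + (r / 2) *\<^sub>R e - x = y - x + (r / 2) *\<^sub>R e" by simp
  ultimately show ?thesis using extend[of "r / 2"] r by simp
qed

lemma four_point_modulus_of_gradient_modulus:
  fixes Om :: "'a::euclidean_space set" and V :: "'a \<Rightarrow> real" and q q' :: "real \<Rightarrow> real"
  assumes convex: "convex Om" and V_deriv: "\<And>x. x \<in> Om \<Longrightarrow> (V has_derivative (\<lambda>v. gV x \<bullet> v)) (at x)"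
    and q: "continuous_on UNIV q" "\<And>s. 0 < s \<Longrightarrow> s < D \<Longrightarrow> (q has_real_derivative q' s) (at s)"
    and diam: "\<And>x y. x \<in> Om \<Longrightarrow> y \<in> Om \<Longrightarrow> norm (y - x) < 2 * D"
    and modulus: "\<And>x y. x \<in> Om \<Longrightarrow> y \<in> Om \<Longrightarrow> x \<noteq> y \<Longrightarrow>
      (gV y - gV x) \<bullet> ((1 / norm (y - x)) *\<^sub>R (y - x)) \<ge> 2 * q' (norm (y - x) / 2)"
  shows "four_point_modulus Om V q"
  unfolding four_point_modulus_def
proof (intro allI impI)
  fix a z s
  assume z: "a + z \<in> Om" "a - z \<in> Om" "z \<noteq> (0::'a)" "0 \<le> s" "s < (1::real)"
  note in_Om = convex_symmetric_segment[OF convex z(1,2)]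
  define excess where "excess = (\<lambda>t. V (a + t *\<^sub>R z) + V (a - t *\<^sub>R z) - 2 * q (t * norm z))"
  have "((\<lambda>t. V (a + t *\<^sub>R z) + V (a + t *\<^sub>R (- z))) has_real_derivative
      gV (a + t *\<^sub>R z) \<bullet> z + gV (a + t *\<^sub>R (- z)) \<bullet> (- z)) (at t)" if "\<bar>t\<bar> \<le> 1" for t
    by (intro DERIV_add has_derivative_line V_deriv) (use in_Om[OF that] in simp_all)
  then have V_pair_deriv: "((\<lambda>t. V (a + t *\<^sub>R z) + V (a - t *\<^sub>R z)) has_real_derivative
      (gV (a + t *\<^sub>R z) - gV (a - t *\<^sub>R z)) \<bullet> z) (at t)" if "\<bar>t\<bar> \<le> 1" for t
    using that by (simp add: inner_diff_left)
  have "norm ((a + z) - (a - z)) = 2 * norm z" by (simp add: scaleR_2[symmetric])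
  then have norm_z: "norm z < D" using diam[OF z(2,1)] by linarith
  have "excess s \<le> excess 1"
  proof (rule DERIV_nonneg_imp_increasing_open[OF less_imp_le[OF z(5)]])
    fix t
    assume "s < t" "t < 1"
    then have t: "0 < t" "\<bar>t\<bar> \<le> 1" using z(4) by auto
    define T where "T = t * norm z"
    have "T \<le> 1 * norm z" unfolding T_def using t by (intro mult_right_mono) auto
    then have T: "0 < T" "T < D" using t z(3) norm_z by (simp add: T_def, linarith)
    have q_deriv: "((\<lambda>t. q (t * norm z)) has_real_derivative q' T * norm z) (at t)"
      by (rule DERIV_chain2[of q]) (use q(2)[OF T] in \<open>auto simp: T_def intro!: derivative_eq_intros\<close>)
    define x y where "x = a - t *\<^sub>R z" and "y = a + t *\<^sub>R z"
    have difference: "y - x = (2 * t) *\<^sub>R z" by (simp add: x_def y_def scaleR_2[symmetric])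
    have distance: "norm (y - x) = 2 * T" using t by (simp add: difference T_def)
    have "x \<in> Om" "y \<in> Om" using in_Om[OF t(2)] by (simp_all add: x_def y_def)
    moreover have "x \<noteq> y" using distance T(1) by auto
    ultimately have "2 * q' T \<le> (gV y - gV x) \<bullet> ((1 / (2 * T)) *\<^sub>R ((2 * t) *\<^sub>R z))"
      using modulus[of x y] unfolding distance unfolding difference by simp
    also have "\<dots> = ((gV y - gV x) \<bullet> z) / norm z" using t z(3) by (simp add: T_def)
    finally have "0 \<le> (gV y - gV x) \<bullet> z - 2 * (q' T * norm z)" using z(3) by (simp add: pos_le_divide_eq)
    moreover have "(excess has_real_derivative (gV y - gV x) \<bullet> z - 2 * (q' T * norm z)) (at t)"
      unfolding excess_def x_def y_def by (rule DERIV_diff[OF V_pair_deriv[OF t(2)] DERIV_cmult[OF q_deriv]])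
    ultimately show "\<exists>d. (excess has_real_derivative d) (at t) \<and> d \<ge> 0" by blast
  next
    have "continuous_on {s..1} (\<lambda>t. V (a + t *\<^sub>R z) + V (a - t *\<^sub>R z))"
      by (intro continuous_at_imp_continuous_on ballI DERIV_isCont[OF V_pair_deriv]) (use z(4) in auto)
    moreover have "continuous_on {s..1} (\<lambda>t. q (t * norm z))"
      by (rule continuous_on_compose2[OF q(1)]) (auto intro!: continuous_intros)
    ultimately show "continuous_on {s..1} excess"
      unfolding excess_def by (intro continuous_on_diff continuous_on_mult continuous_on_const)
  qed
  then show "2 * (q (norm z) - q (s * norm z)) \<le> V (a + z) + V (a - z) - V (a + s *\<^sub>R z) - V (a - s *\<^sub>R z)"
    by (simp add: excess_def)
qed

context
  fixes Om :: "'a::euclidean_space set" and rho gr Hr U V gV and q :: "real \<Rightarrow> real" and M D l1 l2 :: real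
  assumes convex: "smooth_convex_domain Om rho gr Hr U" and domain: "schroedinger_domain Om V gV M"
    and V_convex: "convex_on Om V" and V_modulus: "four_point_modulus Om V q"
    and diam: "\<And>x y. x \<in> Om \<Longrightarrow> y \<in> Om \<Longrightarrow> norm (y - x) < 2 * D"
    and eigenvalues: "first_two_dirichlet_eigenvalues Om V l1 l2"
begin

lemma gap_le_perturbed:
  assumes comparison: "one_dim_comparison D q m \<gamma> L L1 L2 w w1 w2 w_min w_max"
    and R: "\<And>x. x \<in> Om \<Longrightarrow> norm x \<le> R" and \<delta>: "\<delta> > 0" "\<delta> * R\<^sup>2 < l2 - l1"
  shows "\<gamma> \<le> l2 - l1 + 2 * (\<delta> * R\<^sup>2) * w_max / w_min"
proof -
  interpret one_dim_comparison D q m \<gamma> L L1 L2 w w1 w2 w_min w_max by (rule comparison)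
  interpret potential: schroedinger_domain Om V gV M by (rule domain)
  define V\<delta> where "V\<delta> = (\<lambda>x. V x + \<delta> * (x \<bullet> x))"
  have perturbation: "V x \<le> V\<delta> x" "V\<delta> x \<le> V x + \<delta> * R\<^sup>2" if "x \<in> Om" for x
    using \<delta>(1) power_mono[OF R[OF that] norm_ge_zero, of 2] by (auto simp: V\<delta>_def power2_norm_eq_inner)
  obtain M\<delta> where domain_\<delta>: "schroedinger_domain Om V\<delta> (\<lambda>x. gV x + (2 * \<delta>) *\<^sub>R x) M\<delta>"
    unfolding V\<delta>_def
    by (rule potential.schroedinger_domain_add_square[OF R less_imp_le[OF \<delta>(1)]]) (assumption | rule that)+
  obtain u g H lam where ground: "ground_state Om rho gr Hr U V M u g H lam"
    and H: "\<And>b c. continuous_on Om (\<lambda>x. H x b \<bullet> c)"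
    by (rule ground_state_of_schroedinger_domain[OF convex domain]) (rule that)
  obtain u\<delta> g\<delta> H\<delta> lam\<delta> where ground_\<delta>: "ground_state Om rho gr Hr U V\<delta> M\<delta> u\<delta> g\<delta> H\<delta> lam\<delta>"
    and H\<delta>: "\<And>b c. continuous_on Om (\<lambda>x. H\<delta> x b \<bullet> c)"
    by (rule ground_state_of_schroedinger_domain[OF convex domain_\<delta>]) (rule that)
  interpret G: ground_state Om rho gr Hr U V M u g H lam by (rule ground)
  interpret G\<delta>: ground_state Om rho gr Hr U V\<delta> M\<delta> u\<delta> g\<delta> H\<delta> lam\<delta> by (rule ground_\<delta>)
  have eigenvalue: "dirichlet_eigenvalue Om V l1" "dirichlet_eigenvalue Om V l2" and "l1 \<le> lam"
    using eigenvalues G.dirichlet_eigenvalue_ground[OF H]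
    unfolding first_two_dirichlet_eigenvalues_def by blast+
  have "lam \<le> lam\<delta> + 0"
    by (rule G.ground_eigenvalue_le[OF G\<delta>.dirichlet_eigenvalue_ground[OF H\<delta>] G\<delta>.V_bound]) (use perturbation(1) in auto)
  have "lam\<delta> \<le> l1 + \<delta> * R\<^sup>2"
    by (rule G\<delta>.ground_eigenvalue_le[OF eigenvalue(1) potential.V_bound perturbation(2)])
  have log_concave: "G\<delta>.log_u x + G\<delta>.log_u y \<le> 2 * G\<delta>.log_u ((1/2) *\<^sub>R (x + y))" if "x \<in> Om" "y \<in> Om" for x y
    by (rule G\<delta>.log_concave_midpoint[OF _ that])
      (unfold V\<delta>_def, rule convex_add_square_strict[OF V_convex _ _ _ \<delta>(1)])
  have "2 * ((L2 (norm z) + (L1 (norm z))\<^sup>2) - (L2 (s * norm z) + (L1 (s * norm z))\<^sup>2))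
      < V\<delta> (a + z) + V\<delta> (a - z) - V\<delta> (a + s *\<^sub>R z) - V\<delta> (a - s *\<^sub>R z)"
    if "a + z \<in> Om" "a - z \<in> Om" "z \<noteq> 0" "0 \<le> s" "s < 1" for a z s
    using four_point_modulus_add_square_strict[OF V_modulus that \<delta>(1)] by (simp add: V\<delta>_def L_riccati)
  note modulus = G\<delta>.grad_log_u_modulus[OF log_concave L_deriv L1_deriv L_even diam this]
  have "\<gamma> \<le> l2 - lam\<delta> + 2 * (\<delta> * R\<^sup>2) * w_max / w_min"
    by (rule G\<delta>.gap_le_of_dirichlet_eigenvalue[OF modulus diam comparison eigenvalue(2) potential.V_bound perturbation])
      (use \<open>lam\<delta> \<le> _\<close> \<delta>(2) in simp_all)
  then show ?thesis using \<open>l1 \<le> lam\<close> \<open>lam \<le> _\<close> by linarith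
qed

lemma gap_le_of_one_dim_comparison:
  assumes comparison: "one_dim_comparison D q m \<gamma> L L1 L2 w w1 w2 w_min w_max"
  shows "\<gamma> \<le> l2 - l1"
proof -
  interpret one_dim_comparison D q m \<gamma> L L1 L2 w w1 w2 w_min w_max by (rule comparison)
  obtain R where R: "\<And>x. x \<in> Om \<Longrightarrow> norm x \<le> R"
    using smooth_convex_domain.bounded_Om[OF convex] unfolding bounded_iff by blast
  have "((\<lambda>\<delta>. \<delta> * R\<^sup>2) \<longlongrightarrow> 0 * R\<^sup>2) (at_right 0)" by (intro tendsto_intros)
  then have "\<forall>\<^sub>F \<delta> in at_right 0. \<delta> * R\<^sup>2 < l2 - l1"
    by (rule order_tendstoD(2)) (use eigenvalues in \<open>simp add: first_two_dirichlet_eigenvalues_def\<close>)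
  moreover have "\<forall>\<^sub>F \<delta> in at_right (0::real). \<delta> > 0" by (rule eventually_at_right_less)
  ultimately have "\<forall>\<^sub>F \<delta> in at_right 0. \<gamma> \<le> l2 - l1 + 2 * (\<delta> * R\<^sup>2) * w_max / w_min"
    by eventually_elim (rule gap_le_perturbed[OF comparison R])
  moreover have "((\<lambda>\<delta>. l2 - l1 + 2 * (\<delta> * R\<^sup>2) * w_max / w_min) \<longlongrightarrow> l2 - l1 + 2 * (0 * R\<^sup>2) * w_max / w_min) (at_right 0)"
    using w_min_pos by (intro tendsto_intros) auto
  ultimately have "\<gamma> \<le> l2 - l1 + 2 * (0 * R\<^sup>2) * w_max / w_min"
    by (intro tendsto_lowerbound[of _ _ "at_right (0::real)"]) auto
  then show ?thesis by simp
qed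

lemma one_dim_gap_le:
  assumes q: "even_potential q D" and eigenvalues_q: "first_two_dirichlet_eigenvalues {-D<..<D} q k1 k2"
  shows "k2 - k1 \<le> l2 - l1"
proof (rule field_le_epsilon)
  fix e :: real
  assume "e > 0"
  then obtain m n L L1 L2 w w1 w2 w_min w_max
    where "one_dim_comparison D q m (n - m) L L1 L2 w w1 w2 w_min w_max" "n - m \<ge> k2 - k1 - e"
    by (rule even_potential.one_dim_comparison_exists[OF q eigenvalues_q]) (rule that)
  then show "k2 - k1 \<le> l2 - l1 + e" using gap_le_of_one_dim_comparison by fastforce
qed

end

lemma first_two_dirichlet_eigenvalues_cong:
  assumes "\<And>x. x \<in> S \<Longrightarrow> V x = W x"
  shows "first_two_dirichlet_eigenvalues S V l1 l2 \<longleftrightarrow> first_two_dirichlet_eigenvalues S W l1 l2"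
proof -
  have "dirichlet_eigenvalue S V = dirichlet_eigenvalue S W"
    using assms by (simp add: fun_eq_iff dirichlet_eigenvalue_def)
  then show ?thesis by (simp add: first_two_dirichlet_eigenvalues_def)
qed

lemma even_potential_extension:
  assumes D: "D > 0" and Vt_deriv: "\<forall>t\<in>{-D..D}. (Vt has_real_derivative Vt' t) (at t within {-D..D})"
    and Vt_even: "\<forall>t\<in>{-D..D}. Vt (- t) = Vt t"
  obtains q where "even_potential q D" "\<And>s. s \<in> {-D<..<D} \<Longrightarrow> q s = Vt s"
    "\<And>s. 0 < s \<Longrightarrow> s < D \<Longrightarrow> (q has_real_derivative Vt' s) (at s)"
proof -
  define q where "q = (\<lambda>s. Vt (max (- D) (min D s)))"
  have q_eq: "q s = Vt s" if "s \<in> {-D<..<D}" for s using that by (simp add: q_def)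
  have "continuous_on {-D..D} Vt" using Vt_deriv by (auto intro!: DERIV_continuous_on)
  then have "continuous_on UNIV q"
    unfolding q_def by (rule continuous_on_compose2) (use D in \<open>auto intro!: continuous_intros\<close>)
  moreover have "q (- s) = q s" for s
  proof -
    have "max (- D) (min D (- s)) = - max (- D) (min D s)" using D by (simp add: max_def min_def)
    moreover have "max (- D) (min D s) \<in> {- D..D}" using D by simp
    ultimately show ?thesis using Vt_even by (simp add: q_def)
  qed
  ultimately have "even_potential q D" using D by unfold_locales
  moreover have "(q has_real_derivative Vt' s) (at s)" if s: "0 < s" "s < D" for s
  proof -
    have "at s within {- D..D} = at s"
      by (rule at_within_interior) (use s in \<open>simp add: interior_atLeastAtMost_real\<close>)
    then have "(Vt has_real_derivative Vt' s) (at s)" using Vt_deriv[rule_format, of s] s by simp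
    then show ?thesis
      by (rule has_field_derivative_transform_within_open[of _ _ _ "{- D<..<D}"]) (use s in \<open>auto simp: q_eq\<close>)
  qed
  ultimately show ?thesis using q_eq by (intro that)
qed

theorem mainTheorem2:
  fixes \<Omega> :: "'a::euclidean_space set"
    and V :: "'a \<Rightarrow> real"
    and Vt Vt' :: "real \<Rightarrow> real"
    and d l1 l2 lt1 lt2 :: real
  assumes dom: "smooth_uniformly_convex_domain \<Omega>"
    and d_def: "d = diameter \<Omega>"
    and V_smooth: "smooth_on_closed (closure \<Omega>) V"
    and V_convex: "convex_on (closure \<Omega>) V"
    and Vt_deriv: "\<forall>t\<in>{-d/2..d/2}. (Vt has_real_derivative Vt' t) (at t within {-d/2..d/2})"
    and Vt'_cont: "continuous_on {-d/2..d/2} Vt'"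
    and Vt_even: "\<forall>t\<in>{-d/2..d/2}. Vt (-t) = Vt t"
    and modulus: "\<forall>x\<in>\<Omega>. \<forall>y\<in>\<Omega>. x \<noteq> y \<longrightarrow>
        (grad V y - grad V x) \<bullet> ((1 / norm (y - x)) *\<^sub>R (y - x)) \<ge> 2 * Vt' (norm (y - x) / 2)"
    and eig: "first_two_dirichlet_eigenvalues \<Omega> V l1 l2"
    and eig1d: "first_two_dirichlet_eigenvalues {-d/2<..<d/2} Vt lt1 lt2"
  shows "l2 - l1 \<ge> lt2 - lt1"
proof -
  define D where "D = d / 2"
  have half_d: "- d / 2 = - D" "d / 2 = D" by (simp_all add: D_def)
  obtain rho U where convex: "smooth_convex_domain \<Omega> rho (grad rho) (hess rho) U"
    by (rule smooth_convex_domain_of_smooth_uniformly_convex_domain[OF dom]) (rule that)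
  interpret smooth_convex_domain \<Omega> rho "grad rho" "hess rho" U by (rule convex)
  obtain M where domain: "schroedinger_domain \<Omega> V (grad V) M"
    by (rule schroedinger_domain_of_smooth_on_closed[OF open_Om convex_Om bounded_Om Om_ne V_smooth]) (rule that)
  have diam: "norm (y - x) < 2 * D" if "x \<in> \<Omega>" "y \<in> \<Omega>" for x y
    using open_norm_less_diameter[OF open_Om bounded_Om that] by (simp add: D_def d_def)
  then have "D > 0" using Om_ne by force
  then obtain q where q: "even_potential q D" "\<And>s. s \<in> {-D<..<D} \<Longrightarrow> q s = Vt s"
    "\<And>s. 0 < s \<Longrightarrow> s < D \<Longrightarrow> (q has_real_derivative Vt' s) (at s)"
    by (rule even_potential_extension[OF _ Vt_deriv[unfolded half_d] Vt_even[unfolded half_d]]) (rule that)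
  have "four_point_modulus \<Omega> V q"
    by (rule four_point_modulus_of_gradient_modulus[OF convex_Om schroedinger_domain.V_deriv[OF domain]
        even_potential.continuous_on_q[OF q(1)] q(3) diam]) (use modulus in auto)
  moreover have "first_two_dirichlet_eigenvalues {-D<..<D} q lt1 lt2"
    using eig1d first_two_dirichlet_eigenvalues_cong[of "{-D<..<D}" q Vt] q(2) by (simp add: half_d)
  ultimately show ?thesis
    by (intro one_dim_gap_le[OF convex domain _ _ diam eig q(1)]
        convex_on_subset[OF V_convex closure_subset convex_Om])
qed

end
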